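(* Let $-1<\alpha<0$, $\Omega=\mathbb H^d_n(a)$, and $\delta(x)=|a+x\cdot n|$. Let $u\in H^1_{loc}(\Omega;\mathbb R^m)$ be a weak solution of $\mathcal L(u)=\mathrm{div}(f)+h$ in $\Omega$, $u=0$ on $\partial\Omega$. Assume that for some $x_0\in\partial\Omega$, $R^\alpha\int_{B(x_0,R)\cap\Omega}|\nabla u|^2\to0$ as $R\to\infty$. Then $$\int_\Omega|\nabla u(x)|^2[\delta(x)]^\alpha dx\le C\int_\Omega|f(x)|^2[\delta(x)]^\alpha dx+C\int_\Omega|h(x)|^2[\delta(x)]^{\alpha+2}dx,$$ where $C$ depends only on $d,m,\mu,\alpha$ and $\|A\|_{C^\sigma(\mathbb T^d)}$.
   Context: $A=(a_{ij}^{\alpha\beta}(x))$ satisfies $\mu|\xi|^2\le a_{ij}^{\alpha\beta}\xi_i^\alpha\xi_j^\beta\le\mu^{-1}|\xi|^2$ for $\xi\in\mathbb R^{m\times d}$, is $\mathbb Z^d$-periodic, and $A\in C^\sigma(\mathbb T^d)$ for some $\sigma\in(0,1)$. $\mathcal L=-\mathrm{div}(A(x)\nabla)$. $\mathbb H^d_n(a)=\{x:x\cdot n<-a\}$, $n\in\mathbb S^{d-1}$, $a\in\mathbb R$; $\delta(x)$ is the distance to $\partial\Omega$. *)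

theory Defs
  imports "HOL-Analysis.Analysis"
begin

text \<open>Points of R^d are vectors real^'d; R^m-valued functions take values in real^'m.
  Gradients / matrix fields R^(m x d) are real^'d^'m, entry (G x)$beta$i = partial_i u^beta.\<close>

definition pd :: "'d::finite \<Rightarrow> (real^'d \<Rightarrow> real) \<Rightarrow> real^'d \<Rightarrow> real" where
  "pd i \<phi> x = frechet_derivative \<phi> (at x) (axis i 1)"

definition smooth_fun :: "(real^'d::finite \<Rightarrow> real) \<Rightarrow> bool" where
  "smooth_fun \<phi> \<longleftrightarrow> (\<forall>is::'d list. \<forall>x. (foldr pd is \<phi>) differentiable (at x))"

definition test_fun :: "(real^'d::finite) set \<Rightarrow> (real^'d \<Rightarrow> real) \<Rightarrow> bool" where
  "test_fun \<Omega> \<phi> \<longleftrightarrow> smooth_fun \<phi> \<and> compact (closure {x. \<phi> x \<noteq> 0})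
      \<and> closure {x. \<phi> x \<noteq> 0} \<subseteq> \<Omega>"

definition L1loc :: "(real^'d::finite) set \<Rightarrow> (real^'d \<Rightarrow> 'b::euclidean_space) \<Rightarrow> bool" where
  "L1loc \<Omega> g \<longleftrightarrow> (\<forall>K. compact K \<and> K \<subseteq> \<Omega> \<longrightarrow> set_integrable lebesgue K g)"

definition L2loc :: "(real^'d::finite) set \<Rightarrow> (real^'d \<Rightarrow> 'b::euclidean_space) \<Rightarrow> bool" where
  "L2loc \<Omega> g \<longleftrightarrow> (\<forall>K. compact K \<and> K \<subseteq> \<Omega> \<longrightarrow>
      set_borel_measurable lebesgue K g \<and> set_integrable lebesgue K (\<lambda>x. (norm (g x))\<^sup>2))"

definition weak_gradient :: "(real^'d::finite) set \<Rightarrow> (real^'d \<Rightarrow> real^'m::finite)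
    \<Rightarrow> (real^'d \<Rightarrow> real^'d^'m) \<Rightarrow> bool" where
  "weak_gradient \<Omega> u G \<longleftrightarrow> (\<forall>\<phi>. test_fun \<Omega> \<phi> \<longrightarrow> (\<forall>\<beta> i.
      (\<integral>x. u x $ \<beta> * pd i \<phi> x \<partial>lebesgue) = - (\<integral>x. G x $ \<beta> $ i * \<phi> x \<partial>lebesgue)))"

definition H1loc :: "(real^'d::finite) set \<Rightarrow> (real^'d \<Rightarrow> real^'m::finite)
    \<Rightarrow> (real^'d \<Rightarrow> real^'d^'m) \<Rightarrow> bool" where
  "H1loc \<Omega> u G \<longleftrightarrow> L2loc \<Omega> u \<and> L2loc \<Omega> G \<and> weak_gradient \<Omega> u G"

definition zero_bdry :: "(real^'d::finite) set \<Rightarrow> (real^'d \<Rightarrow> real^'m::finite)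
    \<Rightarrow> (real^'d \<Rightarrow> real^'d^'m) \<Rightarrow> bool" where
  "zero_bdry \<Omega> u G \<longleftrightarrow> H1loc UNIV (\<lambda>x. if x \<in> \<Omega> then u x else 0) (\<lambda>x. if x \<in> \<Omega> then G x else 0)"

text \<open>Coefficients: A x i j \<alpha> \<beta> = a_{ij}^{\<alpha>\<beta>}(x).\<close>
type_synonym ('d, 'm) coeff = "real^'d \<Rightarrow> 'd \<Rightarrow> 'd \<Rightarrow> 'm \<Rightarrow> 'm \<Rightarrow> real"

definition elliptic :: "real \<Rightarrow> ('d::finite, 'm::finite) coeff \<Rightarrow> bool" where
  "elliptic \<mu> A \<longleftrightarrow> (\<forall>x (\<xi>::real^'d^'m).
      \<mu> * (norm \<xi>)\<^sup>2 \<le> (\<Sum>i\<in>UNIV. \<Sum>j\<in>UNIV. \<Sum>\<alpha>\<in>UNIV. \<Sum>\<beta>\<in>UNIV. A x i j \<alpha> \<beta> * \<xi> $ \<alpha> $ i * \<xi> $ \<beta> $ j)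
    \<and> (\<Sum>i\<in>UNIV. \<Sum>j\<in>UNIV. \<Sum>\<alpha>\<in>UNIV. \<Sum>\<beta>\<in>UNIV. A x i j \<alpha> \<beta> * \<xi> $ \<alpha> $ i * \<xi> $ \<beta> $ j) \<le> (norm \<xi>)\<^sup>2 / \<mu>)"

definition periodic_coeff :: "('d::finite, 'm::finite) coeff \<Rightarrow> bool" where
  "periodic_coeff A \<longleftrightarrow> (\<forall>x z. (\<forall>k. z $ k \<in> \<int>) \<longrightarrow> A (x + z) = A x)"

definition holder_bound :: "real \<Rightarrow> real \<Rightarrow> ('d::finite, 'm::finite) coeff \<Rightarrow> bool" where
  "holder_bound \<sigma> M A \<longleftrightarrow> (\<forall>x i j \<alpha> \<beta>. \<bar>A x i j \<alpha> \<beta>\<bar> \<le> M) \<and>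
     (\<forall>x y i j \<alpha> \<beta>. \<bar>A x i j \<alpha> \<beta> - A y i j \<alpha> \<beta>\<bar> \<le> M * dist x y powr \<sigma>)"

text \<open>Weak solution of -div(A grad u) = div f + h in \<Omega>, with u \<in> H^1_loc and gradient G.\<close>
definition weak_solution :: "(real^'d::finite) set \<Rightarrow> ('d, 'm::finite) coeff \<Rightarrow> (real^'d \<Rightarrow> real^'m)
    \<Rightarrow> (real^'d \<Rightarrow> real^'d^'m) \<Rightarrow> (real^'d \<Rightarrow> real^'d^'m) \<Rightarrow> (real^'d \<Rightarrow> real^'m) \<Rightarrow> bool" where
  "weak_solution \<Omega> A u G f h \<longleftrightarrow> H1loc \<Omega> u G \<and> L1loc \<Omega> f \<and> L1loc \<Omega> h \<and>
    (\<forall>\<phi>::real^'d \<Rightarrow> real^'m. (\<forall>\<beta>. test_fun \<Omega> (\<lambda>y. \<phi> y $ \<beta>)) \<longrightarrow>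
       (\<integral>x. (\<Sum>i\<in>UNIV. \<Sum>j\<in>UNIV. \<Sum>\<alpha>\<in>UNIV. \<Sum>\<beta>\<in>UNIV.
              A x i j \<alpha> \<beta> * G x $ \<beta> $ j * pd i (\<lambda>y. \<phi> y $ \<alpha>) x) \<partial>lebesgue)
     = - (\<integral>x. (\<Sum>i\<in>UNIV. \<Sum>\<alpha>\<in>UNIV. f x $ \<alpha> $ i * pd i (\<lambda>y. \<phi> y $ \<alpha>) x) \<partial>lebesgue)
       + (\<integral>x. (\<Sum>\<alpha>\<in>UNIV. h x $ \<alpha> * \<phi> x $ \<alpha>) \<partial>lebesgue))"

definition half_space :: "real^'d::finite \<Rightarrow> real \<Rightarrow> (real^'d) set" where
  "half_space n a = {x. x \<bullet> n < - a}"

end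

theory Submission
  imports Defs "HOL-Real_Asymp.Real_Asymp"
begin

text \<open>
  Let \<open>t\<close> be the distance to the boundary and \<open>E(\<rho>)\<close> the energy of the solution, cut off at a large radius, in the
  strip \<open>t < \<rho>\<close>. Testing the equation with the solution times a cut-off in \<open>t\<close> bounds \<open>E(\<rho>)\<close> by the normal flux
  through the layer \<open>\<rho> < t < 2\<rho>\<close>. At large scales the coefficients are invariant under lattice translations, at
  small scales they are almost invariant by Hoelder continuity; in both cases differences of the solution along a
  nearly tangential vector \<open>z\<close> almost solve the equation, so by Caccioppoli their energy in a strip of width \<open>r\<close> is
  small like \<open>\<bar>z\<bar> / r\<close>. A test function averaged over such translations moves the flux from the layer at height \<open>\<rho>\<close>
  to height \<open>r\<close>, at the price of tangential differences only. The outcome is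
  \<open>E(\<rho>) \<le> E(3\<rho>) / 12 + C (\<rho> / r) E(r) + data\<close> with \<open>\<rho> = r / 3^N\<close>, for all \<open>r\<close> outside a bounded range of scales.
  Since \<open>\<alpha> > -1\<close>, the factor \<open>\<rho> / r\<close> beats the weight: multiplying by \<open>\<rho>^\<alpha>\<close> and summing over \<open>\<rho> = 3^k\<close> absorbs both
  energies. The growth hypothesis removes the error of the cut-off at infinity.
\<close>

text \<open>The normal may be irrational, so in general no lattice vector is tangential: rounding a
  long tangential vector leaves a normal component of bounded size. A difference along such a vector
  does not vanish on the boundary, and the cut-off needed there costs the energy in a strip of width
  comparable to that component. Hole filling makes this energy a small multiple of E(r), up to data,
  once the strip is thin compared with r; this is why the periodic argument needs large r. The
  factor \<rho> / r is a square: a normal primitive over length r of a function living in a layer of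
  thickness \<rho> gains sqrt(\<rho> / r) in L2, by Cauchy-Schwarz on the part of each line inside
  the layer, and Young's inequality squares the gain. The excluded range of scales contains a number
  of powers of 3 that depends on the constants only; there E is compared by monotonicity with its
  value at the first scale above the range. The weak form is given only for smooth test functions
  supported inside the half space; mollification and Hardy's inequality extend it to Sobolev
  functions with zero trace.\<close>

notation scaleR (infixr "*R" 75)

abbreviation bm :: "('a::topological_space => 'b::topological_space) => bool" where
  "bm f == f \<in> borel_measurable borel"

abbreviation nnl :: "('a::euclidean_space => ennreal) => ennreal" (binder "NNI " 10) where
  "nnl g == integral\<^sup>N lborel g"

lemmas lebesgue_cong = Bochner_Integration.integral_cong and lebesgue_sum = Bochner_Integration.integrable_sum

section \<open>Test functions\<close>

text \<open>The recursion peels off the innermost derivative, so that sum, product and chain rules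
  are applied to \<open>f\<close> before the induction hypothesis is applied to
  \<open>pd i f\<close>. Level 0 already asks for differentiability; level \<open>n\<close> covers
  all partial derivatives of order at most \<open>n\<close>, each of them differentiable.\<close>

primrec sm :: "nat => (real^'d::finite => real) => bool" where
  "sm 0 f \<longleftrightarrow> (ALL x. f differentiable (at x))"
| "sm (Suc n) f \<longleftrightarrow> (ALL x. f differentiable (at x)) & (ALL i. sm n (pd i f))"

lemma sm_differentiable: "sm n f ==> f differentiable (at x)"
  by (cases n) auto

lemma sm_SucD: "sm (Suc n) f ==> sm n f"
  by (induction n arbitrary: f) auto

text \<open>\<open>foldr\<close> applies the last index of the list first; hence lists are split at
  their end, as \<open>is @ [i]\<close>, to match the recursion of \<open>sm\<close>.\<close>

lemma sm_iff_foldr: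
  "sm n f \<longleftrightarrow> (ALL is. length is <= n --> (ALL x. foldr pd is f differentiable (at x)))"
proof (induction n arbitrary: f)
  case (Suc n)
  show ?case
  proof
    assume L: "sm (Suc n) f"
    show "ALL is. length is <= Suc n --> (ALL x. foldr pd is f differentiable at x)"
    proof (intro allI impI)
      fix "is" :: "'a list" and x
      assume "length is <= Suc n"
      then show "foldr pd is f differentiable at x"
        using L Suc[of "pd (last is) f"]
        by (cases "is" rule: rev_cases) auto
    qed
  next
    assume R: "ALL is. length is <= Suc n --> (ALL x. foldr pd is f differentiable at x)"
    have "sm n (pd i f)" for i
      unfolding Suc
    proof (intro allI impI)
      fix "is" :: "'a list" and x
      assume "length is <= n"
      then show "foldr pd is (pd i f) differentiable at x"
        using R[rule_format, of "is @ [i]" x] by simp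
    qed
    moreover have "f differentiable at x" for x
      using R[rule_format, of "[]" x] by simp
    ultimately show "sm (Suc n) f" by simp
  qed
qed auto

lemma smooth_fun_iff_sm: "smooth_fun f \<longleftrightarrow> (ALL n. sm n f)"
  unfolding smooth_fun_def sm_iff_foldr by auto

lemma pd_eq: "(f has_derivative f') (at x) ==> pd i f x = f' (axis i 1)"
  unfolding pd_def using frechet_derivative_at by metis

lemma differentiable_has_derivative:
  "f differentiable (at x) ==> (f has_derivative frechet_derivative f (at x)) (at x)"
  using frechet_derivative_works by blast

lemma pd_add:
  assumes "f differentiable (at x)" "g differentiable (at x)"
  shows "pd i (%x. f x + g x) x = pd i f x + pd i g x"
proof -
  note d = assms[THEN differentiable_has_derivative]
  show ?thesis using pd_eq[OF has_derivative_add[OF d]] by (simp add: pd_def)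
qed

lemma pd_mult:
  assumes "f differentiable (at x)" "g differentiable (at x)"
  shows "pd i (%x. f x * g x) x = f x * pd i g x + pd i f x * g x"
proof -
  note d = assms[THEN differentiable_has_derivative]
  show ?thesis using pd_eq[OF has_derivative_mult[OF d]] by (simp add: pd_def)
qed

lemma pd_const [simp]: "pd i (%x. c) = (%x. 0)"
  by (intro ext pd_eq[OF has_derivative_const])

lemma sm_const [simp, intro]: "sm n (%x. c)"
  by (induction n arbitrary: c) auto

lemma sm_add: "sm n f ==> sm n g ==> sm n (%x. f x + g x)"
proof (induction n arbitrary: f g)
  case (Suc n)
  have "pd i (%x. f x + g x) = (%x. pd i f x + pd i g x)" for i
    using Suc.prems by (auto simp: pd_add)
  with Suc show ?case by auto
qed auto

lemma sm_mult: "sm n f ==> sm n g ==> sm n (%x. f x * g x)"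
proof (induction n arbitrary: f g)
  case (Suc n)
  have "pd i (%x. f x * g x) = (%x. f x * pd i g x + pd i f x * g x)" for i
    using Suc.prems by (auto simp: pd_mult)
  moreover have "sm n (%x. f x * pd i g x + pd i f x * g x)" for i
    using Suc.prems sm_SucD[OF Suc.prems(1)] sm_SucD[OF Suc.prems(2)]
    by (intro sm_add Suc.IH) auto
  ultimately show ?case using Suc.prems by auto
qed auto

lemma sm_linear:
  assumes "bounded_linear f" shows "sm n f"
proof (cases n)
  case 0 then show ?thesis using bounded_linear_imp_differentiable[OF assms] by auto
next
  case (Suc k)
  have d: "(f has_derivative f) (at x)" for x
    using assms by (rule bounded_linear_imp_has_derivative)
  have "pd i f = (%x. f (axis i 1))" for i
    using pd_eq[OF d] by auto
  then show ?thesis using Suc bounded_linear_imp_differentiable[OF assms] by simp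
qed

lemma sm_inner_const: "sm n (%x. x \<bullet> p)"
  by (intro sm_linear bounded_linear_inner_left)

lemma sm_inner_self: "sm n (%x::real^'d::finite. x \<bullet> x)"
proof -
  have eq: "(%x::real^'d. x \<bullet> x) = (%x. \<Sum>i\<in>UNIV. (x \<bullet> axis i 1) * (x \<bullet> axis i 1))"
    unfolding inner_axis by (simp add: inner_vec_def)
  have "finite I ==> sm n (%x::real^'d. \<Sum>i\<in>I. (x \<bullet> axis i 1) * (x \<bullet> axis i 1))" for I
    by (induction I rule: finite_induct) (auto intro!: sm_add sm_mult sm_inner_const)
  then show ?thesis unfolding eq by simp
qed

section \<open>Smooth functions of one variable, the flat bump and the smooth step\<close>

primrec dn :: "nat => (real => real) => bool" where
  "dn 0 g \<longleftrightarrow> True"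
| "dn (Suc n) g \<longleftrightarrow> (EX g'. (ALL x. (g has_real_derivative g' x) (at x)) & dn n g')"

lemma dn_SucD: "dn (Suc n) g ==> dn n g"
proof (induction n arbitrary: g)
  case (Suc n)
  then show ?case by (metis dn.simps(2))
qed auto

lemma dn_const [simp, intro]: "dn n (%x. c)"
proof (induction n arbitrary: c)
  case (Suc n)
  then show ?case by (auto intro!: exI[of _ "%x. 0"])
qed auto

lemma dn_add: "dn n f ==> dn n g ==> dn n (%x. f x + g x)"
proof (induction n arbitrary: f g)
  case (Suc n)
  from Suc.prems obtain f' g' where
    "!!x. (f has_real_derivative f' x) (at x)" "dn n f'"
    "!!x. (g has_real_derivative g' x) (at x)" "dn n g'" by auto
  then show ?case
    by (auto intro!: exI[of _ "%x. f' x + g' x"] Suc.IH derivative_intros)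
qed auto

lemma dn_mult: "dn n f ==> dn n g ==> dn n (%x. f x * g x)"
proof (induction n arbitrary: f g)
  case (Suc n)
  from Suc.prems obtain f' g' where d:
    "!!x. (f has_real_derivative f' x) (at x)" "dn n f'"
    "!!x. (g has_real_derivative g' x) (at x)" "dn n g'" by auto
  have "dn n (%x. f' x * g x + g' x * f x)"
    using Suc.prems[THEN dn_SucD] d by (intro dn_add Suc.IH)
  then show ?case
    using d by (auto intro!: exI[of _ "%x. f' x * g x + g' x * f x"] DERIV_mult)
qed auto

lemma dn_affine: "dn n g ==> dn n (%x. g (c * x + d))"
proof (induction n arbitrary: g)
  case (Suc n)
  then obtain g' where d: "!!x. (g has_real_derivative g' x) (at x)" "dn n g'" by auto
  have "((%x. g (c * x + d)) has_real_derivative (g' (c * x + d) * c)) (at x)" for x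
    by (rule DERIV_chain2[OF d(1)]) (auto intro!: derivative_eq_intros)
  moreover have "dn n (%x. g' (c * x + d) * c)"
    using Suc.IH[OF d(2)] by (intro dn_mult) auto
  ultimately show ?case
    unfolding dn.simps by (intro exI[of _ "%x. g' (c * x + d) * c"]) auto
qed auto

text \<open>One order more is asked of \<open>g\<close> than of \<open>s\<close>, because
  \<open>dn 0\<close> is empty while \<open>sm 0\<close> already means differentiable. The induction
  generalises over \<open>g\<close>, since the chain rule replaces it by its derivative and keeps
  \<open>s\<close>.\<close>

lemma sm_comp:
  assumes "dn (Suc n) g" "sm n s" shows "sm n (%x. g (s x))"
  using assms
proof (induction n arbitrary: g)
  case 0
  then obtain g' where d: "!!x. (g has_real_derivative g' x) (at x)" by auto
  have "(%x. g (s x)) differentiable at x" for x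
  proof -
    have "s differentiable at x" "g differentiable at (s x)"
      using 0 d real_differentiable_def by auto
    from differentiable_chain_at[OF this] show ?thesis by (simp add: o_def)
  qed
  then show ?case by simp
next
  case (Suc n)
  from Suc.prems obtain g' where d: "!!x. (g has_real_derivative g' x) (at x)" "dn (Suc n) g'" by auto
  have der: "((%x. g (s x)) has_derivative (%h. g' (s x) * frechet_derivative s (at x) h)) (at x)" for x
  proof -
    have "(s has_derivative frechet_derivative s (at x)) (at x)"
      using Suc.prems(2) by (intro differentiable_has_derivative) auto
    from has_derivative_compose[OF this d(1)[unfolded has_field_derivative_def]]
    show ?thesis by simp
  qed
  have "pd i (%x. g (s x)) = (%x. g' (s x) * pd i s x)" for i
    using pd_eq[OF der] by (auto simp: pd_def)
  moreover have "sm n (%x. g' (s x) * pd i s x)" for i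
    using Suc.prems(2) by (intro sm_mult Suc.IH[OF d(2) sm_SucD[OF Suc.prems(2)]]) simp
  ultimately show ?case using der by (auto simp: differentiable_def)
qed

text \<open>The functions p(1/x) exp(-1/x), continued by 0, form a class closed under
  differentiation. Smoothness of the standard flat function then needs no formula for higher
  derivatives.\<close>

definition bmp :: "real poly => real => real" where
  "bmp p x = (if x > 0 then poly p (1/x) * exp (-(1/x)) else 0)"

lemma poly_exp_decay: "((%y. y ^ k * poly p y * exp (- y)) \<longlongrightarrow> 0) at_top" for p :: "real poly"
proof (induction p arbitrary: k)
  case (pCons a p)
  have "((%y::real. a * (y ^ k / exp y) + y ^ (Suc k) * poly p y * exp (- y)) \<longlongrightarrow> a * 0 + 0) at_top"
    by (intro tendsto_add tendsto_mult tendsto_const pCons.IH tendsto_power_div_exp_0)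
  moreover have "(%y. y ^ k * poly (pCons a p) y * exp (- y))
      = (%y::real. a * (y ^ k / exp y) + y ^ (Suc k) * poly p y * exp (- y))"
    by (auto simp: field_simps exp_minus)
  ultimately show ?case by simp
qed auto

text \<open>The polynomial y^2 (p - p') is what the product and chain rules give in the variable y =
  1/x. At 0 the difference quotient from the right is y p(y) exp(-y) with y tending to infinity, so
  its limit is 0 and matches the zero branch.\<close>

lemma bmp_deriv: "(bmp p has_real_derivative bmp ([:0,0,1:] * (p - pderiv p)) x) (at x)"
proof -
  consider "x > 0" | "x < 0" | "x = 0" by linarith
  then show ?thesis
  proof cases
    case 1
    have *: "((%x. poly p (1/x) * exp (-(1/x))) has_real_derivative
       poly ([:0,0,1:] * (p - pderiv p)) (1/x) * exp (-(1/x))) (at x)"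
      using 1 by (auto intro!: derivative_eq_intros DERIV_chain2[OF poly_DERIV]
          simp: power2_eq_square field_simps)
    have "\<forall>\<^sub>F y in nhds x. poly p (1/y) * exp (-(1/y)) = bmp p y"
      using eventually_nhds_in_open[of "{0<..}" x] 1
      by (auto elim!: eventually_mono simp: bmp_def)
    from DERIV_cong_ev[OF refl this refl] *
    have "(bmp p has_real_derivative poly ([:0,0,1:] * (p - pderiv p)) (1/x) * exp (-(1/x))) (at x)"
      by blast
    moreover have "bmp ([:0,0,1:] * (p - pderiv p)) x = poly ([:0,0,1:] * (p - pderiv p)) (1/x) * exp (-(1/x))"
      using 1 by (simp only: bmp_def if_True)
    ultimately show ?thesis by simp
  next
    case 2
    have "\<forall>\<^sub>F y in nhds x. 0 = bmp p y"
      using eventually_nhds_in_open[of "{..<0}" x] 2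
      by (auto elim!: eventually_mono simp: bmp_def)
    from DERIV_cong_ev[OF refl this refl, of 0]
    have "(bmp p has_real_derivative 0) (at x)" by simp
    then show ?thesis using 2 by (simp add: bmp_def[of _ x])
  next
    case 3
    have "((%h. bmp p h / h) \<longlongrightarrow> 0) (at_right 0)"
    proof -
      have "((%h. (1/h) ^ 1 * poly p (1/h) * exp (- (1/h))) \<longlongrightarrow> 0) (at_right (0::real))"
        by (rule filterlim_compose[OF poly_exp_decay[where k=1]])
           (use filterlim_inverse_at_top_right in \<open>simp add: inverse_eq_divide\<close>)
      then show ?thesis
        by (rule Lim_transform_eventually) (auto simp: bmp_def eventually_at_filter field_simps)
    qed
    moreover have "((%h. bmp p h / h) \<longlongrightarrow> 0) (at_left 0)"
      by (rule tendsto_eventually) (auto simp: bmp_def eventually_at_filter)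
    ultimately have "((%h. bmp p h / h) \<longlongrightarrow> 0) (at 0)"
      by (simp add: filterlim_split_at)
    then show ?thesis
      unfolding 3 DERIV_def by (simp add: bmp_def)
  qed
qed

lemma dn_bmp: "dn n (bmp p)"
proof (induction n arbitrary: p)
  case (Suc n)
  then show ?case using bmp_deriv by auto
qed auto

lemma bmp1: "bmp 1 x = (if x > 0 then exp (-(1/x)) else 0)"
  by (simp add: bmp_def)

text \<open>The bound \<open>c0\<close> on the derivatives of the step is the only trace of its choice in the final constant.\<close>

locale smooth_step =
  fixes c0 :: real and s s1 s2 :: "real => real"
  assumes c0: "1 <= c0"
    and s_dn: "dn n s" and s_der: "(s has_real_derivative s1 x) (at x)" and s1_dn: "dn n s1"
    and s1_der: "(s1 has_real_derivative s2 x) (at x)"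
    and s_0: "x <= 0 ==> s x = 0" and s_1: "x >= 1 ==> s x = 1" and s_nn: "0 <= s x" and s_le: "s x <= 1"
    and s1_le: "\<bar>s1 x\<bar> <= c0" and s2_le: "\<bar>s2 x\<bar> <= c0"
    and s1_0: "x <= 0 | x >= 1 ==> s1 x = 0" and s2_0: "x <= 0 | x >= 1 ==> s2 x = 0" and s2_dn: "dn n s2"

lemma (in smooth_step) s_cont: "continuous_on UNIV s" and s1_cont: "continuous_on UNIV s1"
  using s_der s1_der by (auto intro!: continuous_at_imp_continuous_on DERIV_isCont)

lemma (in smooth_step) s_measurable [measurable]: "bm s" and s1_measurable [measurable]: "bm s1"
  using s_cont s1_cont by (auto intro: borel_measurable_continuous_onI)

text \<open>The step is the normalised primitive of a bump that lives on [0,1]; compactness of this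
  interval bounds the first two derivatives of the step.\<close>

lemma smooth_step_exists: obtains c0 s s1 s2 where "smooth_step c0 s s1 s2"
proof -
  define b where "b x = bmp 1 x * bmp 1 (1 - x)" for x
  have dnb: "dn n b" for n
    using dn_mult[OF dn_bmp[of n 1] dn_affine[OF dn_bmp[of n 1], of "-1" 1]] by (simp add: b_def[abs_def] add.commute)
  from dnb[of "Suc n" for n] have exb': "EX b'. (ALL x. (b has_real_derivative b' x) (at x)) & dn n b'" for n
    by simp
  obtain b' where b': "!!x. (b has_real_derivative b' x) (at x)" using exb'[of 0] by auto
  \<comment> \<open>Each order \<open>n\<close> comes with its own first derivative; uniqueness of
    derivatives identifies them all with the single \<open>b'\<close>.\<close>
  have dnb': "dn n b'" for n
  proof -
    obtain b'' where "!!x. (b has_real_derivative b'' x) (at x)" "dn n b''" using exb'[of n] by auto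
    moreover have "b'' = b'" using calculation(1) b' DERIV_unique by blast
    ultimately show ?thesis by simp
  qed
  have b0: "b x = 0" if "x <= 0 | x >= 1" for x using that by (auto simp: b_def bmp1)
  have bpos: "b x > 0" if "0 < x" "x < 1" for x using that by (auto simp: b_def bmp1)
  have bnn: "b x >= 0" for x by (auto simp: b_def bmp1)
  have contb: "continuous_on S b" for S
    by (intro continuous_at_imp_continuous_on ballI DERIV_isCont[OF b'])
  have contb': "continuous_on S b'" for S
  proof -
    obtain b'' where "!!x. (b' has_real_derivative b'' x) (at x)" using dnb'[of 1] by auto
    then show ?thesis by (intro continuous_at_imp_continuous_on ballI DERIV_isCont)
  qed
  \<comment> \<open>At these points \<open>b\<close> takes its minimum 0, so its derivative vanishes
    without any formula for it.\<close>
  have b'0: "b' x = 0" if "x <= 0 | x >= 1" for x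
  proof -
    have mini: "b x <= b y" for y using b0[OF that] bnn by simp
    show ?thesis using DERIV_local_min[OF b'[of x], of 1] mini by simp
  qed
  \<comment> \<open>Starting at -1 instead of 0 makes each x > -1 an interior point of an interval
    of integration, so the derivative is two-sided at 0 as well.\<close>
  define I where "I s = integral {-1..s} b" for s
  have Ider: "(I has_real_derivative b x) (at x)" for x
  proof (cases "x > -1")
    case True
    have "(I has_real_derivative b x) (at x within {-1..x+1})"
      unfolding I_def[abs_def] using True by (intro integral_has_real_derivative contb) auto
    moreover have "x \<in> interior {-1..x+1}" using True by simp
    ultimately show ?thesis using at_within_interior[of x "{-1..x+1}"] by metis
  next
    case False
    have "I y = 0" if "y < 0" for y
    proof -
      have "I y = integral {-1..y} (%x. 0)" unfolding I_def using that
        by (intro integral_cong) (auto intro!: b0)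
      then show ?thesis by simp
    qed
    then have "\<forall>\<^sub>F y in nhds x. 0 = I y"
      using eventually_nhds_in_open[of "{..<0}" x] False
      by (auto elim!: eventually_mono)
    from DERIV_cong_ev[OF refl this refl, of 0] show ?thesis using False b0[of x] by simp
  qed
  have I0: "I x = 0" if "x <= 0" for x
  proof -
    have "I x = integral {-1..x} (%x. 0)" unfolding I_def using that
      by (intro integral_cong) (auto intro!: b0)
    then show ?thesis by simp
  qed
  have mono: "I x <= I y" if "x <= y" for x y
    using that Ider bnn by (meson DERIV_nonneg_imp_nondecreasing)
  have I1: "I x = I 1" if "x >= 1" for x
  proof (cases "x = 1")
    case False
    show ?thesis
    proof (rule DERIV_isconst_end[where f=I and a=1 and b=x])
      show "1 < x" using that False by simp
      show "continuous_on {1..x} I"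
        by (intro continuous_at_imp_continuous_on ballI DERIV_isCont[OF Ider])
      show "(I has_real_derivative 0) (at y)" if "1 < y" for y
        using Ider[of y] b0[of y] that by simp
    qed
  qed simp
  have I1pos: "I 1 > 0"
  proof -
    have "I 0 < I 1"
    proof (rule DERIV_pos_imp_increasing_open[of 0 1 I])
      show "EX y. (I has_real_derivative y) (at x) & 0 < y" if "0 < x" "x < 1" for x
        using Ider[of x] bpos[OF that] by blast
      show "continuous_on {0..1} I"
        by (intro continuous_at_imp_continuous_on ballI DERIV_isCont[OF Ider])
    qed simp
    then show ?thesis using I0[of 0] by simp
  qed
  define k where "k = inverse (I 1)"
  have kpos: "k > 0" using I1pos by (simp add: k_def)
  have "bounded (b ` {0..1})" "bounded (b' ` {0..1})"
    by (intro compact_imp_bounded compact_continuous_image contb contb' compact_Icc)+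
  then obtain c1 c2 where "\<forall>y\<in>b ` {0..1}. norm y <= c1" "\<forall>y\<in>b' ` {0..1}. norm y <= c2"
    unfolding bounded_iff by auto
  then have c: "!!x. x \<in> {0..1} ==> \<bar>b x\<bar> <= c1" "!!x. x \<in> {0..1} ==> \<bar>b' x\<bar> <= c2"
    by auto
  define C where "C = max (max c1 0) (max c2 0)"
  \<comment> \<open>The lower bound 1 allows later estimates to replace \<open>c0\<close> by
    \<open>c0^2\<close> and to absorb absolute constants.\<close>
  define c where "c = max 1 (k * C)"
  have kc: "\<bar>k * y\<bar> <= c" if "\<bar>y\<bar> <= C" for y
  proof -
    have "\<bar>k * y\<bar> = k * \<bar>y\<bar>" using kpos by (simp add: abs_mult)
    also have "... <= k * C" using kpos that by (intro mult_left_mono) auto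
    also have "... <= c" by (simp add: c_def)
    finally show ?thesis .
  qed
  have C: "0 <= C" "c1 <= C" "c2 <= C" by (simp_all add: C_def)
  have cb1: "\<bar>k * b x\<bar> <= c" for x
  proof (rule kc, cases "x \<in> {0..1}")
    case True from c(1)[OF this] C(2) show "\<bar>b x\<bar> <= C" by linarith
  next
    case False then have "b x = 0" by (intro b0) auto
    then show "\<bar>b x\<bar> <= C" using C(1) by simp
  qed
  have cb2: "\<bar>k * b' x\<bar> <= c" for x
  proof (rule kc, cases "x \<in> {0..1}")
    case True from c(2)[OF this] C(3) show "\<bar>b' x\<bar> <= C" by linarith
  next
    case False then have "b' x = 0" by (intro b'0) auto
    then show "\<bar>b' x\<bar> <= C" using C(1) by simp
  qed
  have d1: "((%x. k * I x) has_real_derivative (k * b x)) (at x)" for x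
    using DERIV_cmult[OF Ider] by simp
  have d2: "((%x. k * b x) has_real_derivative (k * b' x)) (at x)" for x
    using DERIV_cmult[OF b'] by simp
  have dnkb: "dn n (%x. k * b x)" for n by (intro dn_mult dnb) auto
  show ?thesis
  proof (rule that[of c "%x. k * I x" "%x. k * b x" "%x. k * b' x"], unfold_locales)
    have "dn (Suc n) (%x. k * I x)" for n
      unfolding dn.simps by (intro exI[of _ "%x. k * b x"] conjI allI d1 dnkb)
    then show "dn n (%x. k * I x)" for n by (rule dn_SucD)
    show "dn n (%x. k * b x)" for n by (rule dnkb)
    show "dn n (%x. k * b' x)" for n by (intro dn_mult dnb') auto
    show "k * I x = 0" if "x <= 0" for x using I0[OF that] by simp
    show "k * I x = 1" if "x >= 1" for x using I1[OF that] I1pos by (simp add: k_def)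
    show "0 <= k * I x" for x
    proof -
      have "0 <= I x" using mono[of 0 x] I0[of x] I0[of 0] by linarith
      then show ?thesis using kpos by simp
    qed
    show "k * I x <= 1" for x
    proof -
      have "I x <= I 1" using mono[of x 1] I1[of x] by linarith
      then have "k * I x <= k * I 1" using kpos by simp
      then show ?thesis using I1pos by (simp add: k_def)
    qed
    show "((%x. k * I x) has_real_derivative k * b x) (at x)" for x by (rule d1)
    show "((%x. k * b x) has_real_derivative k * b' x) (at x)" for x by (rule d2)
    show "\<bar>k * b x\<bar> <= c" for x by (rule cb1)
    show "\<bar>k * b' x\<bar> <= c" for x by (rule cb2)
    show "k * b x = 0" if "x <= 0 | x >= 1" for x using b0[OF that] by simp
    show "k * b' x = 0" if "x <= 0 | x >= 1" for x using b'0[OF that] by simp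
    show "1 <= c" by (simp add: c_def)
  qed
qed

section \<open>Test functions and their Taylor remainders\<close>

lemma quadratic_remainder_has_derivative:
  assumes "bounded_linear D" "!!h. norm (f (x + h) - f x - D h) <= K * (norm h)^2"
  shows "(f has_derivative D) (at x)"
  unfolding has_derivative_at
proof
  show "(%h. norm (f (x + h) - f x - D h) / norm h) \<midarrow>0\<rightarrow> 0"
  proof (rule tendsto_sandwich[of "%_. 0" _ _ "%h. K * norm h"])
    show "\<forall>\<^sub>F h in at 0. norm (f (x + h) - f x - D h) / norm h <= K * norm h"
      unfolding eventually_at_filter
      using assms(2) by (intro always_eventually) (auto simp: divide_simps power2_eq_square mult.assoc)
    show "((%h. K * norm h) \<longlongrightarrow> 0) (at 0)"
      by (auto intro!: tendsto_eq_intros)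
  qed auto
qed (rule assms)

lemma frechet_eq_sum_pd:
  fixes f :: "real^'d::finite => real"
  assumes "f differentiable (at x)"
  shows "frechet_derivative f (at x) h = (\<Sum>i\<in>UNIV. h $ i * pd i f x)"
proof -
  have lin: "linear (frechet_derivative f (at x))"
    using assms linear_frechet_derivative by blast
  have "h = (\<Sum>i\<in>UNIV. h $ i *R axis i 1)"
    using basis_expansion[of h] by (simp add: scalar_mult_eq_scaleR)
  then have "frechet_derivative f (at x) h = frechet_derivative f (at x) (\<Sum>i\<in>UNIV. h $ i *R axis i 1)"
    by (rule arg_cong)
  also have "... = (\<Sum>i\<in>UNIV. h $ i * pd i f x)"
    by (simp add: linear_sum[OF lin] linear_scale[OF lin] pd_def)
  finally show ?thesis .
qed

lemma has_derivative_sum_pd: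
  assumes "f differentiable (at (x::real^'d::finite))"
  shows "(f has_derivative (%h. \<Sum>i\<in>UNIV. h $ i * pd i f x)) (at x)"
proof -
  have "frechet_derivative f (at x) = (%h. \<Sum>i\<in>UNIV. h $ i * pd i f x)"
    using frechet_eq_sum_pd[OF assms] by (intro ext)
  then show ?thesis using differentiable_has_derivative[OF assms] by simp
qed

lemma smooth_fun_pd: "smooth_fun f ==> smooth_fun (pd i f)"
  unfolding smooth_fun_iff_sm by (meson sm.simps(2))

lemma smooth_fun_differentiable: "smooth_fun f ==> f differentiable (at x)"
  unfolding smooth_fun_iff_sm by (meson sm_differentiable)

lemma smooth_fun_mult: "smooth_fun f ==> smooth_fun g ==> smooth_fun (%x. f x * g x)"
  unfolding smooth_fun_iff_sm by (intro allI sm_mult) auto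

lemma smooth_fun_const: "smooth_fun (%x. c)"
  unfolding smooth_fun_iff_sm by auto

lemma smooth_fun_continuous: "smooth_fun f ==> continuous_on S f"
  by (meson continuous_at_imp_continuous_on differentiable_imp_continuous_within smooth_fun_differentiable)

lemma smooth_fun_measurable: "smooth_fun f ==> bm f"
  by (intro borel_measurable_continuous_onI smooth_fun_continuous)

lemma test_fun_iff: "test_fun \<Omega> \<phi> \<longleftrightarrow> smooth_fun \<phi> & bounded {x. \<phi> x ~= 0} & closure {x. \<phi> x ~= 0} <= \<Omega>"
  unfolding test_fun_def by (simp add: compact_closure)

lemma pd_eq_0_outside:
  assumes "x \<notin> closure {x. f x ~= 0}" shows "pd i f x = 0"
proof -
  have opn: "open (- closure {x. f x ~= 0})" by auto
  have mem: "x \<in> - closure {x. f x ~= 0}" using assms by simp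
  have z: "0 = f y" if "y \<in> - closure {x. f x ~= 0}" for y
    using that closure_subset[of "{x. f x ~= 0}"] by (metis (mono_tags, lifting) ComplD mem_Collect_eq subsetD)
  have "(f has_derivative (%h. 0)) (at x)"
    by (rule has_derivative_transform_within_open[OF has_derivative_const opn mem z])
  from pd_eq[OF this] show ?thesis by simp
qed

lemma closure_support_pd: "closure {x. pd i f x ~= 0} <= closure {x. f x ~= 0}"
  by (rule closure_minimal) (use pd_eq_0_outside in auto)

lemma test_fun_pd: "test_fun \<Omega> \<phi> ==> test_fun \<Omega> (pd i \<phi>)"
  unfolding test_fun_iff using closure_support_pd[of i \<phi>] 
  by (meson bounded_closure bounded_subset closure_subset dual_order.trans smooth_fun_pd)

lemma test_fun_mult:
  assumes "smooth_fun \<zeta>" "test_fun \<Omega> \<phi>" shows "test_fun \<Omega> (%x. \<zeta> x * \<phi> x)"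
proof -
  have "{x. \<zeta> x * \<phi> x ~= 0} <= {x. \<phi> x ~= 0}" by auto
  then show ?thesis using assms unfolding test_fun_iff
    using bounded_subset closure_mono[of "{x. \<zeta> x * \<phi> x ~= 0}" "{x. \<phi> x ~= 0}"] smooth_fun_mult by blast
qed

lemma sm_affine:
  assumes "sm n f" shows "sm n (%y. f (a + c *R y))"
    and "f differentiable (at (a + c *R y)) ==> pd i (%y. f (a + c *R y)) y = c * pd i f (a + c *R y)"
proof -
  have der: "((%y. f (a + c *R y)) has_derivative (%h. frechet_derivative f (at (a + c *R y)) (c *R h))) (at y)"
    if "f differentiable (at (a + c *R y))" for f :: "real^'a => real" and y
  proof -
    have "((%y. a + c *R y) has_derivative (%h. c *R h)) (at y)"
      by (auto intro!: derivative_eq_intros)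
    from has_derivative_compose[OF this differentiable_has_derivative[OF that]] show ?thesis .
  qed
  have pdd: "pd i (%y. f (a + c *R y)) y = c * pd i f (a + c *R y)"
    if "f differentiable (at (a + c *R y))" for f :: "real^'a => real" and y i
    using pd_eq[OF der[OF that]] that
    by (simp add: pd_def linear_scale[OF linear_frechet_derivative])
  show "f differentiable (at (a + c *R y)) ==> pd i (%y. f (a + c *R y)) y = c * pd i f (a + c *R y)"
    by (rule pdd)
  show "sm n (%y. f (a + c *R y))" using assms
  proof (induction n arbitrary: f)
    case 0 show ?case unfolding sm.simps
      by (intro allI differentiableI[OF der] sm_differentiable[OF 0])
  next
    case (Suc n)
    have "pd i (%y. f (a + c *R y)) = (%y. c * pd i f (a + c *R y))" for i
      using Suc.prems pdd by auto
    then show ?case unfolding sm.simps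
      using Suc by (auto intro!: sm_mult differentiableI[OF der])
  qed
qed

lemma test_fun_affine:
  assumes "test_fun UNIV f" "c ~= 0"
  shows "test_fun UNIV (%y. f (a + c *R y))"
    and "pd i (%y. f (a + c *R y)) = (%y. c * pd i f (a + c *R y))"
proof -
  from assms have s: "smooth_fun f" and b: "bounded {x. f x ~= 0}" by (auto simp: test_fun_iff)
  obtain B where B: "!!x. f x ~= 0 ==> norm x <= B" using b unfolding bounded_iff by auto
  have "bounded {y. f (a + c *R y) ~= 0}"
  proof (rule boundedI)
    fix y assume "y \<in> {y. f (a + c *R y) ~= 0}"
    then have "norm (a + c *R y) <= B" using B by simp
    then have "\<bar>c\<bar> * norm y <= B + norm a"
      using norm_triangle_ineq4[of "a + c *R y" a] by simp
    then show "norm y <= (B + norm a) / \<bar>c\<bar>" using assms(2) by (simp add: field_simps)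
  qed
  moreover have "smooth_fun (%y. f (a + c *R y))"
    using s sm_affine(1) unfolding smooth_fun_iff_sm by blast
  ultimately show "test_fun UNIV (%y. f (a + c *R y))"
    unfolding test_fun_iff by simp
  show "pd i (%y. f (a + c *R y)) = (%y. c * pd i f (a + c *R y))"
    using s by (intro ext sm_affine(2)[where n=0] smooth_fun_differentiable) (auto simp: smooth_fun_iff_sm)
qed

lemma test_fun_bounded:
  assumes "test_fun \<Omega> f" obtains B where "B >= 0" "!!x. \<bar>f x\<bar> <= B"
proof -
  have "compact (closure {x. f x ~= 0})" "continuous_on (closure {x. f x ~= 0}) f"
    using assms by (auto simp: test_fun_def intro: smooth_fun_continuous)
  then have "bounded (f ` closure {x. f x ~= 0})"
    by (intro compact_imp_bounded compact_continuous_image)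
  then obtain B where B: "!!x. x \<in> closure {x. f x ~= 0} ==> \<bar>f x\<bar> <= B"
    unfolding bounded_iff by auto
  have "\<bar>f x\<bar> <= max B 0" for x
    using B[of x] closure_subset[of "{x. f x ~= 0}"] by (cases "f x = 0") auto
  then show ?thesis using that[of "max B 0"] by simp
qed

lemma test_fun_integrable:
  assumes "test_fun \<Omega> f" shows "integrable lborel f"
proof -
  obtain B where B: "B >= 0" "!!x. \<bar>f x\<bar> <= B" using test_fun_bounded[OF assms] by blast
  have "integrable lborel (%x. indicator (closure {x. f x ~= 0}) x *R f x)"
    by (intro borel_integrable_compact) (use assms in \<open>auto simp: test_fun_def intro: smooth_fun_continuous\<close>)
  moreover have "(%x. indicator (closure {x. f x ~= 0}) x *R f x) = f"
    using closure_subset[of "{x. f x ~= 0}"] by (auto simp: indicator_def fun_eq_iff)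
  ultimately show ?thesis by simp
qed

lemma test_fun_measurable [measurable_dest]: "test_fun \<Omega> f ==> bm f"
  by (auto simp: test_fun_iff intro: smooth_fun_measurable)

lemma abs_sum_component_le:
  fixes h :: "real^'d::finite"
  assumes "!!i. \<bar>c i\<bar> <= b i"
  shows "\<bar>\<Sum>i\<in>UNIV. h $ i * c i\<bar> <= (\<Sum>i\<in>UNIV. b i) * norm h"
proof -
  have "\<bar>\<Sum>i\<in>UNIV. h $ i * c i\<bar> <= (\<Sum>i\<in>UNIV. \<bar>h $ i\<bar> * \<bar>c i\<bar>)"
    by (metis (no_types, lifting) abs_mult sum.cong sum_abs)
  also have "... <= (\<Sum>i\<in>UNIV. norm h * b i)"
    by (intro sum_mono mult_mono component_le_norm_cart assms) auto
  finally show ?thesis by (simp add: sum_distrib_left mult.commute)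
qed

lemma test_fun_Lipschitz:
  assumes "test_fun \<Omega> f" obtains L where "L >= 0" "!!x y. \<bar>f x - f y\<bar> <= L * norm (x - y)"
proof -
  have "ALL i. EX B. 0 <= B & (ALL x. \<bar>pd i f x\<bar> <= B)"
  proof
    fix i
    obtain B where "0 <= B" "!!x. \<bar>pd i f x\<bar> <= B" using test_fun_bounded[OF test_fun_pd[OF assms]] by blast
    then show "EX B. 0 <= B & (ALL x. \<bar>pd i f x\<bar> <= B)" by blast
  qed
  then obtain B where B: "!!i. 0 <= B i" "!!i x. \<bar>pd i f x\<bar> <= B i" by metis
  have "norm (f x - f y) <= (\<Sum>i\<in>UNIV. B i) * norm (x - y)" for x y
  proof (rule differentiable_bound[of UNIV])
    show "(f has_derivative (%h. \<Sum>i\<in>UNIV. h $ i * pd i f x)) (at x within UNIV)" for x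
      using assms has_derivative_sum_pd smooth_fun_differentiable by (auto simp: test_fun_iff)
    show "onorm (%h. \<Sum>i\<in>UNIV. h $ i * pd i f x) <= (\<Sum>i\<in>UNIV. B i)" for x
      by (rule onorm_le) (use abs_sum_component_le[OF B(2)] in auto)
  qed auto
  then show ?thesis using that[of "\<Sum>i\<in>UNIV. B i"] B by (auto intro: sum_nonneg)
qed

text \<open>Mean value inequality on the ball of radius |h|, applied to the remainder itself: its
  derivative is a difference of partial derivatives, which are Lipschitz because they are test
  functions again. The constant is uniform in the base point, and that is what differentiation of a
  convolution needs.\<close>

lemma test_fun_remainder:
  assumes "test_fun \<Omega> f"
  obtains K where "K >= 0" "!!y h. \<bar>f (y + h) - f y - (\<Sum>i\<in>UNIV. h $ i * pd i f y)\<bar> <= K * (norm h)^2"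
proof -
  have "ALL i. EX B. 0 <= B & (ALL x y. \<bar>pd i f x - pd i f y\<bar> <= B * norm (x - y))"
  proof
    fix i
    obtain B where "0 <= B" "!!x y. \<bar>pd i f x - pd i f y\<bar> <= B * norm (x - y)"
      using test_fun_Lipschitz[OF test_fun_pd[OF assms]] by blast
    then show "EX B. 0 <= B & (ALL x y. \<bar>pd i f x - pd i f y\<bar> <= B * norm (x - y))" by blast
  qed
  then obtain B where B: "!!i. 0 <= B i" "!!i x y. \<bar>pd i f x - pd i f y\<bar> <= B i * norm (x - y)" by metis
  define K where "K = (\<Sum>i\<in>UNIV. B i)"
  have K0: "K >= 0" using B by (auto simp: K_def intro: sum_nonneg)
  have "norm ((f (y + h) - (\<Sum>i\<in>UNIV. h $ i * pd i f y)) - (f (y + 0) - (\<Sum>i\<in>UNIV. 0 $ i * pd i f y)))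
      <= (K * norm h) * norm (h - 0)" for y h :: "real^'a"
  proof (rule differentiable_bound[of "cball 0 (norm h)" "%u. f (y + u) - (\<Sum>i\<in>UNIV. u $ i * pd i f y)"])
    fix u :: "real^'a" assume u: "u \<in> cball 0 (norm h)"
    have "((%u. f (y + u)) has_derivative (%h. \<Sum>i\<in>UNIV. h $ i * pd i f (y + u))) (at u)"
    proof (rule has_derivative_compose[of "%u. y + u" "%h. h"])
      show "((+) y has_derivative (%h. h)) (at u)" by (auto intro!: derivative_eq_intros)
      show "(f has_derivative (%h. \<Sum>i\<in>UNIV. h $ i * pd i f (y + u))) (at (y + u))"
        using assms has_derivative_sum_pd smooth_fun_differentiable by (auto simp: test_fun_iff)
    qed
    moreover have "((%u. \<Sum>i\<in>UNIV. u $ i * pd i f y) has_derivative (%u. \<Sum>i\<in>UNIV. u $ i * pd i f y)) (at u)"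
      by (intro bounded_linear_imp_has_derivative bounded_linear_sum bounded_linear_mult_const bounded_linear_vec_nth)
    ultimately have "((%u. f (y + u) - (\<Sum>i\<in>UNIV. u $ i * pd i f y)) has_derivative
       (%h. (\<Sum>i\<in>UNIV. h $ i * pd i f (y + u)) - (\<Sum>i\<in>UNIV. h $ i * pd i f y))) (at u)"
      by (rule has_derivative_diff)
    then have "((%u. f (y + u) - (\<Sum>i\<in>UNIV. u $ i * pd i f y)) has_derivative
       (%h. (\<Sum>i\<in>UNIV. h $ i * (pd i f (y + u) - pd i f y)))) (at u)"
      by (simp add: algebra_simps sum_subtractf)
    then show "((%u. f (y + u) - (\<Sum>i\<in>UNIV. u $ i * pd i f y)) has_derivative
       (%h. (\<Sum>i\<in>UNIV. h $ i * (pd i f (y + u) - pd i f y)))) (at u within cball 0 (norm h))"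
      by (rule has_derivative_at_withinI)
    have "\<bar>pd i f (y + u) - pd i f y\<bar> <= B i * norm h" for i
      using B(2)[of i "y + u" y] u mult_left_mono[of "norm u" "norm h" "B i"] B(1)[of i] by auto
    from abs_sum_component_le[OF this]
    show "onorm (%h. (\<Sum>i\<in>UNIV. h $ i * (pd i f (y + u) - pd i f y))) <= K * norm h"
      by (intro onorm_le) (auto simp: K_def sum_distrib_right)
  qed auto
  then show ?thesis using that[of K] K0 by (auto simp: power2_eq_square mult.assoc algebra_simps)
qed

section \<open>Convolution with a test function\<close>

definition conv :: "(real^'d::finite => real) => (real^'d => real) => real^'d => real" where
  "conv v \<phi> x = (LBINT y. v y * \<phi> (x - y))"

lemma conv_integrable:
  assumes "integrable lborel v" "test_fun UNIV \<phi>"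
  shows "integrable lborel (%y. v y * \<phi> (x - y))"
proof -
  obtain B where B: "B >= 0" "!!x. \<bar>\<phi> x\<bar> <= B" using test_fun_bounded[OF assms(2)] by blast
  have [measurable]: "bm \<phi>" "bm v" using assms by auto
  show ?thesis
    by (rule Bochner_Integration.integrable_bound[of _ "%y. B * v y"])
       (use assms B in \<open>auto simp: abs_mult mult.commute[of B] intro!: mult_left_mono\<close>)
qed

text \<open>The uniform quadratic remainder of \<phi> is integrated against \<open>v\<close>, so
  differentiation under the integral sign asks no more of \<open>v\<close> than
  integrability.\<close>

lemma conv_has_derivative:
  assumes v: "integrable lborel v" and \<phi>: "test_fun UNIV \<phi>"
  shows "(conv v \<phi> has_derivative (%h. \<Sum>i\<in>UNIV. h $ i * conv v (pd i \<phi>) x)) (at x)"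
proof -
  obtain K where K: "K >= 0" "!!y h. \<bar>\<phi> (y + h) - \<phi> y - (\<Sum>i\<in>UNIV. h $ i * pd i \<phi> y)\<bar> <= K * (norm h)^2"
    using test_fun_remainder[OF \<phi>] by blast
  note int = conv_integrable[OF v \<phi>] conv_integrable[OF v test_fun_pd[OF \<phi>]]
  show ?thesis
  proof (rule quadratic_remainder_has_derivative[where K="K * (LBINT y. \<bar>v y\<bar>)"])
    show "bounded_linear (%h. \<Sum>i\<in>UNIV. h $ i * conv v (pd i \<phi>) x)"
      by (intro bounded_linear_sum bounded_linear_mult_const bounded_linear_vec_nth)
    fix h
    have "conv v \<phi> (x + h) - conv v \<phi> x - (\<Sum>i\<in>UNIV. h $ i * conv v (pd i \<phi>) x)
      = (LBINT y. v y * (\<phi> ((x - y) + h) - \<phi> (x - y) - (\<Sum>i\<in>UNIV. h $ i * pd i \<phi> (x - y))))"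
    proof -
      have "conv v \<phi> (x + h) - conv v \<phi> x - (\<Sum>i\<in>UNIV. h $ i * conv v (pd i \<phi>) x)
        = (LBINT y. v y * \<phi> ((x + h) - y)) - (LBINT y. v y * \<phi> (x - y))
          - (\<Sum>i\<in>UNIV. (LBINT y. h $ i * (v y * pd i \<phi> (x - y))))"
        by (simp add: conv_def)
      also have "... = (LBINT y. (v y * \<phi> ((x + h) - y) - v y * \<phi> (x - y))
          - (\<Sum>i\<in>UNIV. h $ i * (v y * pd i \<phi> (x - y))))"
        using int by (subst Bochner_Integration.integral_diff)
          (auto intro!: Bochner_Integration.integrable_diff lebesgue_sum)
      also have "... = (LBINT y. v y * (\<phi> ((x - y) + h) - \<phi> (x - y) - (\<Sum>i\<in>UNIV. h $ i * pd i \<phi> (x - y))))"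
        by (simp add: right_diff_distrib sum_distrib_left algebra_simps)
      finally show ?thesis .
    qed
    also have "norm ... <= (LBINT y. K * (norm h)^2 * \<bar>v y\<bar>)"
    proof (rule Bochner_Integration.integral_norm_bound_integral)
      have "integrable lborel (%y. v y * \<phi> ((x + h) - y) - v y * \<phi> (x - y) - (\<Sum>i\<in>UNIV. h $ i * (v y * pd i \<phi> (x - y))))"
        using int by (intro Bochner_Integration.integrable_diff lebesgue_sum integrable_mult_right) auto
      then show "integrable lborel (%y. v y * (\<phi> ((x - y) + h) - \<phi> (x - y) - (\<Sum>i\<in>UNIV. h $ i * pd i \<phi> (x - y))))"
        by (simp add: right_diff_distrib sum_distrib_left algebra_simps)
      show "integrable lborel (%y. K * (norm h)^2 * \<bar>v y\<bar>)" using v by auto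
      show "norm (v y * (\<phi> ((x - y) + h) - \<phi> (x - y) - (\<Sum>i\<in>UNIV. h $ i * pd i \<phi> (x - y)))) <= K * (norm h)^2 * \<bar>v y\<bar>" for y
        using mult_left_mono[OF K(2)[of "x - y" h], of "\<bar>v y\<bar>"] by (simp add: abs_mult mult_ac)
    qed
    finally show "norm (conv v \<phi> (x + h) - conv v \<phi> x - (\<Sum>i\<in>UNIV. h $ i * conv v (pd i \<phi>) x))
      <= K * (LBINT y. \<bar>v y\<bar>) * (norm h)^2" by (simp add: mult_ac)
  qed
qed

lemma pd_conv:
  assumes "integrable lborel v" "test_fun UNIV \<phi>"
  shows "pd i (conv v \<phi>) = conv v (pd i \<phi>)"
  using pd_eq[OF conv_has_derivative[OF assms]] by (auto simp: axis_def if_distrib if_distribR cong: if_cong)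

lemma smooth_conv:
  assumes "integrable lborel v" "test_fun UNIV \<phi>" shows "smooth_fun (conv v \<phi>)"
proof -
  have d: "conv v \<phi> differentiable (at x)" if "test_fun UNIV \<phi>" for \<phi> x
    using conv_has_derivative[OF assms(1) that] by (auto simp: differentiable_def)
  have "sm n (conv v \<phi>)" for n using assms(2)
  proof (induction n arbitrary: \<phi>)
    case 0
    then show ?case using d by auto
  next
    case (Suc n)
    then show ?case using d Suc.IH[OF test_fun_pd[OF Suc.prems]] by (auto simp: pd_conv[OF assms(1)])
  qed
  then show ?thesis unfolding smooth_fun_iff_sm by auto
qed

text \<open>The flat function of \<epsilon>^2 - |x|^2, normalised. Its integral is positive:
  otherwise the nonnegative function would vanish almost everywhere, but it is positive on a ball,
  which is not a null set.\<close>

lemma mollifier_exists: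
  assumes "\<epsilon> > 0"
  obtains \<phi> :: "real^'d::finite => real" where "test_fun UNIV \<phi>" "!!x. \<phi> x >= 0"
    "!!x. norm x >= \<epsilon> ==> \<phi> x = 0" "(LBINT x. \<phi> x) = 1"
proof -
  define g :: "real^'d => real" where "g x = bmp 1 (\<epsilon>^2 + (-1) * (x \<bullet> x))" for x
  have s: "smooth_fun g"
    unfolding smooth_fun_iff_sm
  proof
    fix n
    have "sm n (%x::real^'d. \<epsilon>\<^sup>2 + (-1) * (x \<bullet> x))"
      by (rule sm_add[OF sm_const sm_mult[OF sm_const sm_inner_self]])
    from sm_comp[OF dn_bmp this] show "sm n g" unfolding g_def[abs_def] .
  qed
  have z: "g x = 0" if "norm x >= \<epsilon>" for x
  proof -
    have "\<epsilon>^2 <= (norm x)^2" using that assms by (intro power_mono) auto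
    then show ?thesis by (simp add: g_def bmp1 power2_norm_eq_inner)
  qed
  have sub: "{x. g x ~= 0} <= cball 0 \<epsilon>" using z by force
  have t: "test_fun UNIV g" unfolding test_fun_iff
    using s sub bounded_subset[OF bounded_cball] by auto
  have nn: "g x >= 0" for x by (simp add: g_def bmp1)
  have pos: "(LBINT x. g x) > 0"
  proof -
    have "(LBINT x. g x) ~= 0"
    proof
      assume "(LBINT x. g x) = 0"
      then have "AE x in lborel. g x = 0"
        using integral_nonneg_eq_0_iff_AE[OF test_fun_integrable[OF t]] nn by auto
      then have "AE x in lborel. ~ x \<in> ball (0::real^'d) \<epsilon>"
      proof eventually_elim
        fix x :: "real^'d" assume "g x = 0"
        then have "~ \<epsilon>\<^sup>2 > (norm x)\<^sup>2" by (auto simp: g_def bmp1 power2_norm_eq_inner split: if_splits)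
        then show "~ x \<in> ball 0 \<epsilon>" using assms by (auto simp: power_strict_mono)
      qed
      from emeasure_eq_0_AE[OF this] have "emeasure lborel (ball (0::real^'d) \<epsilon>) = 0" by (simp add: ball_def)
      moreover have "emeasure lborel (ball (0::real^'d) \<epsilon>) ~= 0"
      proof
        assume "emeasure lborel (ball (0::real^'d) \<epsilon>) = 0"
        then have "ball (0::real^'d) \<epsilon> \<in> null_sets lebesgue"
          by (intro null_sets_completionI null_setsI) auto
        then have "negligible (ball (0::real^'d) \<epsilon>)" by (simp add: negligible_iff_null_sets)
        then show False using open_not_negligible[of "ball (0::real^'d) \<epsilon>"] assms by simp
      qed
      ultimately show False by simp
    qed
    then show ?thesis using integral_nonneg_AE[of g lborel] nn by (simp add: less_le)
  qed
  show ?thesis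
  proof (rule that[of "%x. inverse (LBINT x. g x) * g x"])
    show "test_fun UNIV (%x. inverse (LBINT x. g x) * g x)"
      by (intro test_fun_mult smooth_fun_const t)
  qed (use nn z pos in auto)
qed

section \<open>Square integrable functions\<close>

text \<open>Borel rather than Lebesgue measurable: translations and Fubini on products of
  \<open>lborel\<close> then preserve measurability without any completion. Borel representatives of
  the data are chosen once, when the weak solution is translated into this setting.\<close>

definition l2 :: "('a::euclidean_space => 'b::euclidean_space) => bool" where
  "l2 g \<longleftrightarrow> bm g & integrable lborel (%x. (norm (g x))\<^sup>2)"

definition n2 :: "('a::euclidean_space => 'b::euclidean_space) => real" where
  "n2 g = sqrt (LBINT x. (norm (g x))\<^sup>2)"

lemma l2_measurable [measurable_dest]: "l2 g ==> bm g"
  by (simp add: l2_def)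

lemma n2_nonneg [simp]: "0 <= n2 g"
  by (simp add: n2_def)

lemma n2_power2: "(n2 g)^2 = (LBINT x. (norm (g x))\<^sup>2)"
  by (simp add: n2_def)

lemma nn_integral_l2: "l2 g ==> (NNI x. ennreal ((norm (g x))^2)) = ennreal ((n2 g)^2)"
  unfolding l2_def n2_power2 by (intro nn_integral_eq_integral) auto

lemma l2I_nn:
  assumes [measurable]: "bm g"
    and "(NNI x. ennreal ((norm (g x))^2)) <= ennreal (c^2)" "0 <= c"
  shows "l2 g" "n2 g <= c"
proof -
  have "(NNI x. ennreal (norm ((norm (g x))^2))) < \<infinity>"
    using assms(2) by (simp add: le_less_trans)
  then show l: "l2 g" unfolding l2_def by (auto intro!: integrableI_bounded)
  have "ennreal ((n2 g)^2) <= ennreal (c^2)" using nn_integral_l2[OF l] assms(2) by simp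
  then show "n2 g <= c" using assms(3) by (simp add: power2_le_iff_abs_le)
qed

lemma l2_cmp:
  assumes q: "l2 q" and [measurable]: "bm p"
    and le: "AE x in lborel. norm (p x) <= C * norm (q x)" and C: "0 <= C"
  shows "l2 p" "n2 p <= C * n2 q"
proof -
  have "(NNI x. ennreal ((norm (p x))^2)) <= (NNI x. ennreal (C^2) * ennreal ((norm (q x))^2))"
  proof (intro nn_integral_mono_AE, use le in eventually_elim)
    fix x assume "norm (p x) <= C * norm (q x)"
    then have "(norm (p x))^2 <= (C * norm (q x))^2" by (intro power_mono) auto
    then show "ennreal ((norm (p x))^2) <= ennreal (C^2) * ennreal ((norm (q x))^2)"
      by (simp add: power_mult_distrib flip: ennreal_mult)
  qed
  also have "... = ennreal (C^2) * (NNI x. ennreal ((norm (q x))^2))"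
    using q by (intro nn_integral_cmult) (auto simp: l2_def)
  also have "... = ennreal ((C * n2 q)^2)"
    by (simp add: nn_integral_l2[OF q] power_mult_distrib flip: ennreal_mult)
  finally have *: "(NNI x. ennreal ((norm (p x))^2)) <= ennreal ((C * n2 q)^2)" .
  show "l2 p" "n2 p <= C * n2 q" by (rule l2I_nn[OF _ *]; use C in simp)+
qed

text \<open>The Cauchy-Schwarz inequality for nonnegative integrals presupposes no integrability, so
  it yields the integrability of \<open>F\<close> together with the bound.\<close>

lemma l2_cs:
  assumes p: "l2 p" and q: "l2 q" and [measurable]: "bm F"
    and le: "AE x in lborel. \<bar>F x\<bar> <= norm (p x) * norm (q x)"
  shows "integrable lborel F" "\<bar>LBINT x. F x\<bar> <= n2 p * n2 q"
proof -
  have [measurable]: "bm p" "bm q" using p q by auto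
  let ?I = "(NNI x. ennreal (norm (p x)) * ennreal (norm (q x)))"
  have "?I\<^sup>2 <= (NNI x. (ennreal (norm (p x)))\<^sup>2) * (NNI x. (ennreal (norm (q x)))\<^sup>2)"
    by (rule Cauchy_Schwarz_nn_integral) auto
  also have "... = ennreal ((n2 p * n2 q)^2)"
    using nn_integral_l2[OF p] nn_integral_l2[OF q]
    by (simp add: ennreal_power power_mult_distrib flip: ennreal_mult)
  finally have I2: "?I\<^sup>2 <= ennreal ((n2 p * n2 q)^2)" .
  have I: "?I <= ennreal (n2 p * n2 q)"
  proof (cases ?I)
    case (real r)
    with I2 have "r^2 <= (n2 p * n2 q)^2" by (simp add: ennreal_power)
    then have "r <= n2 p * n2 q" by (rule power2_le_imp_le) simp
    then show ?thesis using real by (simp add: ennreal_leI)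
  next
    case top
    with I2 show ?thesis by (simp add: top_unique)
  qed
  have F: "(NNI x. ennreal (norm (F x))) <= ?I"
  proof (rule nn_integral_mono_AE, use le in eventually_elim)
    fix x assume "\<bar>F x\<bar> <= norm (p x) * norm (q x)"
    then show "ennreal (norm (F x)) <= ennreal (norm (p x)) * ennreal (norm (q x))"
      by (simp add: ennreal_leI flip: ennreal_mult)
  qed
  then show int: "integrable lborel F"
    using le_less_trans[OF order_trans[OF F I] ennreal_less_top] by (intro integrableI_bounded) simp_all
  have "ennreal \<bar>LBINT x. F x\<bar> <= (NNI x. ennreal (norm (F x)))"
    using integral_norm_bound_ennreal[OF int] by simp
  with order_trans[OF F I] have "ennreal \<bar>LBINT x. F x\<bar> <= ennreal (n2 p * n2 q)" by (rule order_trans[rotated])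
  then show "\<bar>LBINT x. F x\<bar> <= n2 p * n2 q" by (simp add: ennreal_le_iff)
qed

lemma l2_inner:
  assumes "l2 p" "l2 q"
  shows "integrable lborel (%x. p x \<bullet> q x)" "\<bar>LBINT x. p x \<bullet> q x\<bar> <= n2 p * n2 q"
  by (rule l2_cs[OF assms]; use assms in \<open>auto simp: Cauchy_Schwarz_ineq2\<close>)+

lemma l2_zero [simp]: "l2 (%x. 0)" and n2_zero [simp]: "n2 (%x. 0) = 0"
  by (auto simp: l2_def n2_def)

lemma l2_scaleR:
  assumes "l2 p" shows "l2 (%x. c *R p x)" "n2 (%x. c *R p x) = \<bar>c\<bar> * n2 p"
  using assms by (auto simp: l2_def n2_def power_mult_distrib real_sqrt_mult)

lemma l2_add:
  assumes p: "l2 p" and q: "l2 q"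
  shows "l2 (%x. p x + q x)" "n2 (%x. p x + q x) <= n2 p + n2 q"
proof -
  have [measurable]: "bm p" "bm q" using p q by auto
  have eq: "(norm (p x + q x))^2 = (norm (p x))^2 + (norm (q x))^2 + 2 * (p x \<bullet> q x)" for x
    by (simp add: power2_norm_eq_inner inner_add_left inner_add_right inner_commute)
  have int: "integrable lborel (%x. (norm (p x))\<^sup>2)" "integrable lborel (%x. (norm (q x))\<^sup>2)"
    using p q by (auto simp: l2_def)
  show "l2 (%x. p x + q x)"
    unfolding l2_def eq using int l2_inner(1)[OF p q] by auto
  have "(n2 (%x. p x + q x))^2 = (n2 p)^2 + (n2 q)^2 + 2 * (LBINT x. p x \<bullet> q x)"
    unfolding n2_power2 eq using int l2_inner(1)[OF p q] by simp
  also have "... <= (n2 p + n2 q)^2"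
    using l2_inner(2)[OF p q] by (simp add: power2_sum)
  finally show "n2 (%x. p x + q x) <= n2 p + n2 q"
    by (rule power2_le_imp_le) simp
qed

lemma l2_uminus: "l2 p ==> l2 (%x. - p x)" "n2 (%x. - p x) = n2 p"
  by (auto simp: l2_def n2_def)

lemma l2_diff:
  assumes p: "l2 p" and q: "l2 q"
  shows "l2 (%x. p x - q x)" "n2 (%x. p x - q x) <= n2 p + n2 q"
  using l2_add[OF p l2_uminus(1)[OF q]] l2_uminus(2)[of q] by auto

lemma l2_sum:
  assumes "!!i. i \<in> I ==> l2 (p i)" "finite I"
  shows "l2 (%x. \<Sum>i\<in>I. p i x)"
  using assms(2,1) by (induction I rule: finite_induct) (auto intro!: l2_add(1))

lemma n2_cong_AE:
  assumes "AE x in lborel. p x = q x" "bm p" "bm q"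
  shows "n2 p = n2 q"
  unfolding n2_def using assms by (intro arg_cong[where f=sqrt] integral_cong_AE) auto

lemma n2_eq_0_AE:
  assumes "l2 p" "n2 p = 0" shows "AE x in lborel. p x = 0"
proof -
  have "(LBINT x. (norm (p x))\<^sup>2) = 0" using assms(2) by (simp add: n2_def)
  then have "AE x in lborel. (norm (p x))\<^sup>2 = 0"
    using assms(1) by (subst (asm) integral_nonneg_eq_0_iff_AE) (auto simp: l2_def)
  then show ?thesis by simp
qed

section \<open>Translations in L2 and their continuity\<close>

lemma nn_integral_shift:
  fixes F :: "'a::euclidean_space => ennreal"
  assumes [measurable]: "bm F"
  shows "(NNI x. F (x + z)) = (NNI x. F x)"
proof -
  have "(NNI x. F x) = (\<integral>\<^sup>+x. F x \<partial>distr lborel borel ((+) z))"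
    by (simp add: lborel_distr_plus)
  also have "... = (NNI x. F (z + x))" by (subst nn_integral_distr) auto
  finally show ?thesis by (simp add: add.commute)
qed

lemma integral_shift:
  fixes F :: "'a::euclidean_space => 'b::{banach,second_countable_topology}"
  assumes [measurable]: "bm F"
  shows "(LBINT x. F (x + z)) = (LBINT x. F x)"
proof -
  have "(LBINT x. F x) = (\<integral>x. F x \<partial>distr lborel borel ((+) z))"
    by (simp add: lborel_distr_plus)
  also have "... = (LBINT x. F (z + x))" by (subst integral_distr) auto
  finally show ?thesis by (simp add: add.commute)
qed

lemma l2_shift:
  assumes "l2 g" shows "l2 (%x. g (x + z))" "n2 (%x. g (x + z)) = n2 g"
proof -
  have [measurable]: "bm g" using assms by auto
  have "(NNI x. ennreal ((norm (g (x + z)))^2)) = ennreal ((n2 g)^2)"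
    using nn_integral_shift[of "%x. ennreal ((norm (g x))^2)" z] nn_integral_l2[OF assms] by simp
  then show "l2 (%x. g (x + z))" by (intro l2I_nn(1)[where c="n2 g"]) auto
  show "n2 (%x. g (x + z)) = n2 g"
    unfolding n2_def using integral_shift[of "%x. (norm (g x))\<^sup>2" z] by simp
qed

definition tcont :: "('a::euclidean_space => real) => bool" where
  "tcont g \<longleftrightarrow> (ALL e>0. EX d>0. ALL y. norm y < d --> n2 (%x. g (x + y) - g x) <= e)"

lemma tcont_add:
  assumes "l2 f" "l2 g" "tcont f" "tcont g" shows "tcont (%x. f x + g x)"
  unfolding tcont_def
proof (intro allI impI)
  fix e :: real assume "e > 0"
  then obtain d1 d2 where d: "d1 > 0" "d2 > 0" "!!y. norm y < d1 ==> n2 (%x. f (x + y) - f x) <= e/2"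
    "!!y. norm y < d2 ==> n2 (%x. g (x + y) - g x) <= e/2"
    using assms(3)[unfolded tcont_def, rule_format, of "e/2"] assms(4)[unfolded tcont_def, rule_format, of "e/2"]
    by auto
  have "n2 (%x. f (x + y) + g (x + y) - (f x + g x)) <= e" if "norm y < min d1 d2" for y
    using l2_add(2)[OF l2_diff(1)[OF l2_shift(1)[OF assms(1)] assms(1), of y] l2_diff(1)[OF l2_shift(1)[OF assms(2)] assms(2), of y]]
      d(3)[of y] d(4)[of y] that by (simp add: algebra_simps)
  then show "EX d>0. ALL y. norm y < d --> n2 (%x. f (x + y) + g (x + y) - (f x + g x)) <= e"
    using d by (intro exI[of _ "min d1 d2"]) auto
qed

lemma tcont_lim:
  assumes "l2 g" "!!e. e > 0 ==> EX f. l2 f & tcont f & n2 (%x. f x - g x) <= e"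
  shows "tcont g"
  unfolding tcont_def
proof (intro allI impI)
  fix e :: real assume "e > 0"
  then obtain f where f: "l2 f" "tcont f" "n2 (%x. f x - g x) <= e/3" using assms(2)[of "e/3"] by auto
  then obtain d where d: "d > 0" "!!y. norm y < d ==> n2 (%x. f (x + y) - f x) <= e/3"
    using f(2)[unfolded tcont_def, rule_format, of "e/3"] \<open>e > 0\<close> by auto
  have "n2 (%x. g (x + y) - g x) <= e" if "norm y < d" for y
  proof -
    note l = l2_diff(1)[OF f(1) assms(1)]
    have "n2 (%x. (f (x + y) - f x + (f x - g x)) - (f (x + y) - g (x + y)))
      <= n2 (%x. f (x + y) - f x) + n2 (%x. f x - g x) + n2 (%x. f (x + y) - g (x + y))"
      using l2_diff(2)[OF l2_add(1)[OF l2_diff(1)[OF l2_shift(1)[OF f(1)] f(1), of y] l] l2_shift(1)[OF l, of y]]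
       l2_add(2)[OF l2_diff(1)[OF l2_shift(1)[OF f(1)] f(1), of y] l] by linarith
    also have "... <= e" using d(2)[OF that] f(3) l2_shift(2)[OF l, of y] by simp
    finally show ?thesis by (simp add: algebra_simps)
  qed
  then show "EX d>0. ALL y. norm y < d --> n2 (%x. g (x + y) - g x) <= e" using d(1) by blast
qed

lemma tcont_scale:
  assumes "l2 f" "tcont f" shows "tcont (%x. c * f x)"
proof (cases "c = 0")
  case False
  show ?thesis unfolding tcont_def
  proof (intro allI impI)
    fix e :: real assume "e > 0"
    then obtain d where d: "d > 0" "!!y. norm y < d ==> n2 (%x. f (x + y) - f x) <= e/\<bar>c\<bar>"
      using assms(2)[unfolded tcont_def, rule_format, of "e/\<bar>c\<bar>"] False by auto
    have "n2 (%x. c * f (x + y) - c * f x) <= e" if "norm y < d" for y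
    proof -
      have "n2 (%x. c *R (f (x + y) - f x)) = \<bar>c\<bar> * n2 (%x. f (x + y) - f x)"
        by (intro l2_scaleR l2_diff l2_shift assms(1))
      also have "... <= e" using d(2)[OF that] False by (simp add: field_simps)
      finally show ?thesis by (simp add: algebra_simps)
    qed
    then show "EX d>0. ALL y. norm y < d --> n2 (%x. c * f (x + y) - c * f x) <= e" using d(1) by blast
  qed
qed (auto simp: tcont_def intro: exI[of _ 1])

text \<open>Enclose \<open>A\<close> between a compact \<open>K\<close> and an open
  \<open>U\<close>. A translation shorter than the distance from \<open>K\<close> to the complement
  of \<open>U\<close> changes the indicator only on U - K or on its translate.\<close>

lemma tcont_indicator:
  assumes A: "A \<in> sets borel" "emeasure lborel A < \<infinity>"
  shows "tcont (indicator A :: 'a::euclidean_space => real)"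
  unfolding tcont_def
proof (intro allI impI)
  fix e :: real assume e: "e > 0"
  \<comment> \<open>The set U - K is counted twice, once translated, and the norm is a square
    root.\<close>
  define \<eta> where "\<eta> = e^2 / 2"
  have \<eta>: "\<eta> > 0" using e by (simp add: \<eta>_def)
  obtain U where U: "open U" "A <= U" "emeasure lborel (U - A) < ennreal (\<eta>/2)"
    by (rule outer_regular_lborel[OF A(1), of "\<eta>/2"]) (use \<eta> in simp)
  have "A \<in> sets lebesgue" using A by auto
  then obtain C where C: "closed C" "C <= A" "emeasure lebesgue (A - C) < ennreal (\<eta>/2)"
    by (rule sets_lebesgue_inner_closed[of _ "\<eta>/2"]) (use \<eta> in simp)
  have Cb: "C \<in> sets borel" using C(1) by (rule borel_closed)
  have AC: "emeasure lborel (A - C) < ennreal (\<eta>/2)" using C(3) A Cb by simp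
  \<comment> \<open>Inner regularity yields a closed set only. Intersecting it with large balls
    makes it compact, and continuity from above keeps the error small.\<close>
  have "(%n. emeasure lborel (A - C \<inter> cball 0 (real n))) \<longlonglongrightarrow> emeasure lborel (\<Inter>n. A - C \<inter> cball 0 (real n))"
  proof (rule Lim_emeasure_decseq)
    show "range (%n. A - C \<inter> cball 0 (real n)) <= sets lborel" using A Cb by auto
    show "decseq (%n. A - C \<inter> cball 0 (real n))" by (auto simp: decseq_def)
    show "emeasure lborel (A - C \<inter> cball 0 (real n)) ~= \<infinity>" for n
      using A Cb emeasure_mono[of "A - C \<inter> cball 0 (real n)" A lborel] by (auto simp: top_unique)
  qed
  moreover have "(\<Inter>n. A - C \<inter> cball 0 (real n)) = A - C"
  proof -
    have "x \<notin> C" if x: "ALL n. x \<in> A - C \<inter> cball 0 (real n)" for x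
    proof -
      obtain n where "norm x <= real n" using real_arch_simple by blast
      then show ?thesis using x by (auto dest!: spec[of _ n])
    qed
    then show ?thesis using real_arch_simple by fast
  qed
  ultimately have "\<forall>\<^sub>F n in sequentially. emeasure lborel (A - C \<inter> cball 0 (real n)) < ennreal (\<eta>/2)"
    using AC by (simp add: order_tendstoD(2))
  then obtain n where n: "emeasure lborel (A - C \<inter> cball 0 (real n)) < ennreal (\<eta>/2)"
    by (meson eventually_sequentially le_refl)
  define K where "K = C \<inter> cball 0 (real n)"
  have K: "compact K" "K <= A" using C by (auto simp: K_def)
  have AK: "emeasure lborel (A - K) < ennreal (\<eta>/2)" using n by (simp add: K_def)
  have sb: "U \<in> sets borel" "K \<in> sets borel" using U K by (auto intro: borel_compact)
  have UK: "emeasure lborel (U - K) <= ennreal \<eta>"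
  proof -
    have "emeasure lborel (U - K) <= emeasure lborel ((U - A) \<union> (A - K))"
      using sb A by (intro emeasure_mono) auto
    also have "... <= emeasure lborel (U - A) + emeasure lborel (A - K)"
      using sb A by (intro emeasure_subadditive) auto
    also have "... <= ennreal (\<eta>/2) + ennreal (\<eta>/2)" using U(3) AK by (intro add_mono) auto
    finally show ?thesis using \<eta> by (simp flip: ennreal_plus)
  qed
  obtain d where d: "d > 0" "!!x y. x \<in> K ==> norm y < d ==> x + y \<in> U"
  proof (cases "K = {}")
    case False
    show ?thesis
    proof (cases "- U = {}")
      case True then show ?thesis using that[of 1] by auto
    next
      case False
      obtain d where "d > 0" and d: "!!x y. x \<in> K ==> y \<in> - U ==> d <= dist x y"
      proof -
        have "K \<inter> - U = {}" "closed (- U)" using K(2) U(1,2) by auto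
        from separate_compact_closed[OF K(1) this(2,1)] show ?thesis using that by blast
      qed
      show ?thesis
      proof (rule that[OF \<open>d > 0\<close>])
        fix x y :: 'a assume "x \<in> K" "norm y < d"
        then show "x + y \<in> U" using d[of x "x + y"] by (auto simp: dist_norm)
      qed
    qed
  qed (use that[of 1] in auto)
  have "n2 (%x. indicator A (x + y) - indicator A x :: real) <= e" if y: "norm y < d" for y
  proof (rule l2I_nn(2))
    have [measurable]: "A \<in> sets borel" "U - K \<in> sets borel" using A sb by auto
    show "bm (%x. indicator A (x + y) - indicator A x :: real)" by measurable
    have "(NNI x. ennreal ((norm (indicator A (x + y) - indicator A x :: real))^2))
        <= (NNI x. indicator (U - K) (x + y) + indicator (U - K) x)"
    proof (rule nn_integral_mono)
      fix x
      show "ennreal ((norm (indicator A (x + y) - indicator A x :: real))^2) <= indicator (U - K) (x + y) + indicator (U - K) x"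
      proof (cases "x \<in> A")
        case True
        show ?thesis
        proof (cases "x \<in> K")
          case True
          with y d have "x + y \<in> U" by auto
          then show ?thesis using \<open>x \<in> A\<close> K(2) by (auto simp: indicator_def)
        qed (use True U in \<open>auto simp: indicator_def\<close>)
      next
        case False
        show ?thesis
        proof (cases "x + y \<in> K")
          case True
          with y d(2)[of "x + y" "- y"] have "x \<in> U" by auto
          then show ?thesis using False K(2) by (auto simp: indicator_def)
        qed (use False U in \<open>auto simp: indicator_def\<close>)
      qed
    qed
    also have "... = emeasure lborel (U - K) + emeasure lborel (U - K)"
      by (subst nn_integral_add) (auto simp: nn_integral_shift[of "indicator (U - K)"])
    also have "... <= ennreal \<eta> + ennreal \<eta>" using UK by (intro add_mono)
    also have "... = ennreal (e^2)" using \<eta> by (simp add: \<eta>_def flip: ennreal_plus)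
    finally show "(NNI x. ennreal ((norm (indicator A (x + y) - indicator A x :: real))^2)) <= ennreal (e^2)" .
  qed (use e in auto)
  then show "EX d>0. ALL y. norm y < d --> n2 (%x. indicator A (x + y) - indicator A x :: real) <= e"
    using d(1) by blast
qed

text \<open>Simple functions with |s| <= 2 |g| converge to \<open>g\<close> in L2 by dominated
  convergence, where 9 is (2 + 1)^2; each of them is a finite combination of indicators of its level
  sets.\<close>

lemma l2_tcont:
  fixes g :: "'a::euclidean_space => real"
  assumes g: "l2 g" shows "tcont g"
proof (rule tcont_lim[OF g])
  fix e :: real assume e: "e > 0"
  have gm[measurable]: "bm g" using g by auto
  have gi: "integrable lborel (%x. (norm (g x))\<^sup>2)" using g by (simp add: l2_def)
  have "g \<in> borel_measurable lborel" by simp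
  from borel_measurable_implies_sequence_metric[OF this, of 0] obtain s where
    s: "!!i. simple_function lborel (s i)" "!!x. (%i. s i x) \<longlonglongrightarrow> g x" 
       "!!i x. dist (s i x) 0 <= 2 * dist (g x) 0" by auto
  have sm[measurable]: "bm (s i)" for i
    using borel_measurable_simple_function[OF s(1)[of i]] by simp
  have sl: "l2 (s i)" for i
    by (rule l2_cmp(1)[OF g, where C=2]) (use s(3) in auto)
  have "(%i. LBINT x. (norm (s i x - g x))\<^sup>2) \<longlonglongrightarrow> (\<integral>x. 0 \<partial>(lborel :: 'a measure))"
  proof (rule Bochner_Integration.integral_dominated_convergence[where w="%x. 9 * (norm (g x))^2"])
    show "AE x in lborel. (%i. (norm (s i x - g x))\<^sup>2) \<longlonglongrightarrow> 0"
    proof (rule AE_I2)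
      fix x show "(%i. (norm (s i x - g x))\<^sup>2) \<longlonglongrightarrow> 0"
        using tendsto_power[OF tendsto_norm[OF tendsto_diff[OF s(2)[of x] tendsto_const[of "g x"]]], of 2] by simp
    qed
    show "AE x in lborel. norm ((norm (s i x - g x))^2) <= 9 * (norm (g x))^2" for i
    proof (rule AE_I2)
      fix x have "norm (s i x - g x) <= 3 * norm (g x)"
        using norm_triangle_ineq4[of "s i x" "g x"] s(3)[of i x] by simp
      then have "(norm (s i x - g x))^2 <= (3 * norm (g x))^2" by (intro power_mono) auto
      then show "norm ((norm (s i x - g x))^2) <= 9 * (norm (g x))^2" by (simp add: power_mult_distrib)
    qed
    show "integrable lborel (%x. 9 * (norm (g x))^2)" using gi by auto
  qed auto
  then have "(%i. n2 (%x. s i x - g x)) \<longlonglongrightarrow> 0"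
    unfolding n2_def using tendsto_real_sqrt by fastforce
  then obtain i where i: "n2 (%x. s i x - g x) <= e"
    using order_tendstoD(2)[OF _ e] eventually_happens' by (force intro: less_imp_le)
  have fin: "finite (range (s i))" using s(1)[of i] by (auto simp: simple_function_def)
  have tC: "tcont (%x. \<Sum>c\<in>C. c * indicator (s i -` {c}) x) & l2 (%x. \<Sum>c\<in>C. c * indicator (s i -` {c}) x)"
    if "C <= range (s i)" "finite C" for C
    using that(2,1)
  proof (induction C rule: finite_induct)
    case empty show ?case by (auto simp: tcont_def intro: exI[of _ 1])
  next
    case (insert c C)
    have meas: "s i -` {c} \<in> sets borel"
      using measurable_sets_borel[OF sm, of "{c}" i] by simp
    have l: "l2 (%x. c * indicator (s i -` {c}) x)"
      by (rule l2_cmp(1)[OF sl[of i], where C=1]) (use meas in \<open>auto simp: indicator_def\<close>)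
    have t: "tcont (%x. c * indicator (s i -` {c}) x)"
    \<comment> \<open>The level set of a nonzero value has finite measure because the simple
      function is square integrable; the level set of 0 contributes nothing.\<close>
    proof (cases "c = 0")
      case False
      have "l2 (%x. (1/c) *R (c * indicator (s i -` {c}) x))" by (rule l2_scaleR(1)[OF l])
      then have l': "l2 (indicator (s i -` {c}) :: 'a => real)" using False by simp
      have "emeasure lborel (s i -` {c}) = (NNI x. ennreal ((norm (indicator (s i -` {c}) x :: real))^2))"
      proof -
        have "(NNI x. ennreal ((norm (indicator (s i -` {c}) x :: real))^2))
          = (NNI x. indicator (s i -` {c}) x)"
          by (intro nn_integral_cong) (simp add: indicator_def)
        also have "... = emeasure lborel (s i -` {c})" using meas by (intro nn_integral_indicator) simp
        finally show ?thesis by (rule sym)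
      qed
      also have "... < \<infinity>" using nn_integral_l2[OF l'] by simp
      finally show ?thesis
        by (intro tcont_scale[OF l'] tcont_indicator meas)
    qed (auto simp: tcont_def intro: exI[of _ 1])
    from insert.prems have "C <= range (s i)" by simp
    note IH = insert.IH[OF this]
    show ?case unfolding sum.insert[OF insert.hyps]
      using tcont_add[OF l conjunct2[OF IH] t conjunct1[OF IH]] l2_add(1)[OF l conjunct2[OF IH]] by (rule conjI)
  qed
  have eq: "(%x. \<Sum>c\<in>range (s i). c * indicator (s i -` {c}) x) = s i"
  proof
    fix x
    have "(\<Sum>c\<in>range (s i). c * indicator (s i -` {c}) x) = (\<Sum>c\<in>{s i x}. c * indicator (s i -` {c}) x)"
      using fin by (intro sum.mono_neutral_right) (auto simp: indicator_def)
    then show "(\<Sum>c\<in>range (s i). c * indicator (s i -` {c}) x) = s i x" by simp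
  qed
  have "tcont (s i)" using tC[OF subset_refl fin] unfolding eq by (rule conjunct1)
  then show "EX f. l2 f & tcont f & n2 (%x. f x - g x) <= e" using sl i by blast
qed

lemma pair_integrable_snd:
  fixes F :: "'a::euclidean_space \<times> 'b::euclidean_space => real"
  assumes "F \<in> borel_measurable (lborel \<Otimes>\<^sub>M lborel)"
    and "(NNI y. (NNI x. ennreal \<bar>F (x, y)\<bar>)) < \<infinity>"
  shows "integrable (lborel \<Otimes>\<^sub>M lborel) F"
proof (rule integrableI_bounded)
  have "(\<integral>\<^sup>+x. ennreal (norm (F x)) \<partial>(lborel \<Otimes>\<^sub>M lborel)) = (NNI y. (NNI x. ennreal \<bar>F (x, y)\<bar>))"
    using assms(1) by (subst lborel_pair.nn_integral_snd[symmetric]) auto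
  then show "(\<integral>\<^sup>+x. ennreal (norm (F x)) \<partial>(lborel \<Otimes>\<^sub>M lborel)) < \<infinity>" using assms(2) by simp
qed (rule assms)

lemma nn_integral_l2_mult:
  fixes p q :: "'a::euclidean_space => real"
  assumes "l2 p" "l2 q"
  shows "(NNI x. ennreal \<bar>p x * q x\<bar>) <= ennreal (n2 p * n2 q)"
proof -
  have [measurable]: "bm p" "bm q" using assms by auto
  have i: "integrable lborel (%x. \<bar>p x * q x\<bar>)" "\<bar>LBINT x. \<bar>p x * q x\<bar>\<bar> <= n2 p * n2 q"
    by (rule l2_cs[OF assms]; auto simp: abs_mult)+
  have "(NNI x. ennreal \<bar>p x * q x\<bar>) = ennreal (LBINT x. \<bar>p x * q x\<bar>)"
    using i(1) by (intro nn_integral_eq_integral) auto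
  then show ?thesis using i(2) by (simp add: ennreal_leI)
qed

lemma l2_mult_integrable:
  fixes p q :: "'a::euclidean_space => real"
  assumes "l2 p" "l2 q"
  shows "integrable lborel (%x. p x * q x)" "\<bar>LBINT x. p x * q x\<bar> <= n2 p * n2 q"
  using l2_inner[OF assms] by simp_all

lemma borel_measurable_vec_nth [measurable (raw)]:
  fixes f :: "'a => 'b::euclidean_space^'n::finite"
  assumes "f \<in> borel_measurable M" shows "(%x. f x $ i) \<in> borel_measurable M"
  by (rule measurable_compose[OF assms borel_measurable_continuous_onI])
     (intro linear_continuous_on bounded_linear_vec_nth)

lemma l2_component:
  fixes v :: "'a::euclidean_space => real^'m::finite"
  assumes "l2 v" shows "l2 (%x. v x $ \<beta>)"
  by (rule l2_cmp(1)[OF assms, where C=1]) (use assms in \<open>auto intro: component_le_norm_cart\<close>)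

lemma norm_matrix_entry_le: "\<bar>A $ \<beta> $ i\<bar> <= norm (A :: real^'d::finite^'m::finite)"
proof -
  have "\<bar>A $ \<beta> $ i\<bar> <= norm (A $ \<beta>)" by (rule component_le_norm_cart)
  also have "... <= norm A" by (rule Finite_Cartesian_Product.norm_nth_le)
  finally show ?thesis .
qed

lemma l2_entry:
  fixes V :: "'a::euclidean_space => real^'d::finite^'m::finite"
  assumes "l2 V" shows "l2 (%x. V x $ \<beta> $ i)"
  by (rule l2_cmp(1)[OF assms, where C=1]) (use assms in \<open>auto intro: norm_matrix_entry_le\<close>)

lemma test_l2:
  assumes "test_fun \<Omega> \<phi>" shows "l2 \<phi>"
proof -
  obtain B where B: "B >= 0" "!!x. \<bar>\<phi> x\<bar> <= B" using test_fun_bounded[OF assms] by blast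
  have [measurable]: "bm \<phi>" using assms by auto
  have "integrable lborel (%x. (norm (\<phi> x))\<^sup>2)"
  proof (rule Bochner_Integration.integrable_bound[of _ "%x. B * \<phi> x"])
    show "integrable lborel (%x. B * \<phi> x)" using test_fun_integrable[OF assms] by simp
    have "(norm (\<phi> x))^2 <= norm (B * \<phi> x)" for x
      using B mult_right_mono[OF B(2)[of x], of "\<bar>\<phi> x\<bar>"] by (simp add: power2_eq_square abs_mult)
    then show "AE x in lborel. norm ((norm (\<phi> x))^2) <= norm (B * \<phi> x)" by simp
  qed measurable
  then show ?thesis by (simp add: l2_def)
qed

lemma conv_alt:
  assumes [measurable]: "bm g" "bm \<phi>"
  shows "conv g \<phi> x = (LBINT y. g (x + y) * \<phi> (- y))"
  unfolding conv_def using integral_shift[of "%y. g y * \<phi> (x - y)" x] by (simp add: add.commute)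

lemma integrable_reflect:
  fixes \<phi> :: "'a::euclidean_space => real"
  assumes "integrable lborel \<phi>"
  shows "integrable lborel (%y. \<phi> (- y))" "(LBINT y. \<phi> (- y)) = (LBINT y. \<phi> y)"
proof -
  have d: "distr lborel borel (uminus :: 'a => 'a) = lborel"
  proof -
    have "(%x::'a. 0 + (- 1) *R x) = uminus" by auto
    then show ?thesis using lborel_affine[of "-1" "0::'a"] by (simp add: density_1)
  qed
  have [measurable]: "bm \<phi>" using assms by auto
  have "integrable (distr lborel borel uminus) \<phi>" using assms by (simp add: d)
  then show "integrable lborel (%y. \<phi> (- y))" by (subst (asm) integrable_distr_eq) auto
  have "(LBINT y. \<phi> y) = (\<integral>y. \<phi> y \<partial>(distr lborel borel uminus))" by (simp add: d)
  then show "(LBINT y. \<phi> (- y)) = (LBINT y. \<phi> y)" by (subst (asm) integral_distr) auto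
qed

text \<open>Paired with \<open>p\<close>, the mollification is an average over small y of
  \<theta>(y), the integral of p(x) g(x + y), and \<theta> is continuous at 0 by continuity of
  translations. This weak convergence is all that the extension of the weak form uses. The threshold
  \<open>d\<close> is the same for all mollifiers.\<close>

lemma mollify_weak:
  fixes p g :: "real^'d::finite => real"
  assumes p: "l2 p" and g: "l2 g" and e: "e > 0"
  obtains d where "d > 0" "!!\<phi>. test_fun UNIV \<phi> ==> (!!x. \<phi> x >= 0) ==> (!!x. norm x >= d ==> \<phi> x = 0) ==>
     (LBINT x. \<phi> x) = 1 ==> \<bar>(LBINT x. p x * conv g \<phi> x) - (LBINT x. p x * g x)\<bar> <= e"
proof -
  have [measurable]: "bm p" "bm g" using p g by auto
  \<comment> \<open>The summand 1 covers the case that \<open>p\<close> has norm 0.\<close>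
  define e' where "e' = e / (n2 p + 1)"
  have e': "e' > 0" using e by (auto simp: e'_def intro!: divide_pos_pos add_nonneg_pos)
  obtain d where d: "d > 0" "!!y. norm y < d ==> n2 (%x. g (x + y) - g x) <= e'"
    using l2_tcont[OF g] e' unfolding tcont_def by blast
  have "\<bar>(LBINT x. p x * conv g \<phi> x) - (LBINT x. p x * g x)\<bar> <= e"
    if \<phi>: "test_fun UNIV \<phi>" "!!x. \<phi> x >= 0" "!!x. norm x >= d ==> \<phi> x = 0" "(LBINT x. \<phi> x) = 1" for \<phi>
  proof -
    have [measurable]: "bm \<phi>" using \<phi>(1) by auto
    note ref = integrable_reflect[OF test_fun_integrable[OF \<phi>(1)]]
    define \<theta> where "\<theta> y = (LBINT x. p x * g (x + y))" for y
    let ?F = "%x y. p x * (g (x + y) * \<phi> (- y))"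
    have int: "integrable (lborel \<Otimes>\<^sub>M lborel) (case_prod ?F)"
    proof (rule pair_integrable_snd)
      have "(NNI x. ennreal \<bar>case (x, y) of (x, y) => ?F x y\<bar>) <= ennreal (n2 p * n2 g) * ennreal (\<phi> (- y))" for y
      proof -
        have "(NNI x. ennreal \<bar>?F x y\<bar>) = (NNI x. ennreal \<bar>p x * g (x + y)\<bar> * ennreal (\<phi> (- y)))"
          using \<phi>(2) by (intro nn_integral_cong) (simp add: abs_mult mult.assoc flip: ennreal_mult)
        also have "... = (NNI x. ennreal \<bar>p x * g (x + y)\<bar>) * ennreal (\<phi> (- y))"
          by (rule nn_integral_multc) measurable
        also have "... <= ennreal (n2 p * n2 g) * ennreal (\<phi> (- y))"
          using nn_integral_l2_mult[OF p l2_shift(1)[OF g, of y]] by (intro mult_right_mono) (auto simp: l2_shift(2)[OF g])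
        finally show ?thesis by simp
      qed
      then have "(NNI y. (NNI x. ennreal \<bar>case (x, y) of (x, y) => ?F x y\<bar>))
         <= (NNI y. ennreal (n2 p * n2 g) * ennreal (\<phi> (- y)))"
        by (intro nn_integral_mono) auto
      also have "... = ennreal (n2 p * n2 g) * (NNI y. ennreal (\<phi> (- y)))"
        by (rule nn_integral_cmult) measurable
      also have "(NNI y. ennreal (\<phi> (- y))) = ennreal (LBINT y. \<phi> (- y))"
        using ref(1) \<phi>(2) by (intro nn_integral_eq_integral) auto
      also have "ennreal (n2 p * n2 g) * ... < \<infinity>" by (simp flip: ennreal_mult'' add: ennreal_mult_less_top)
      finally show "(NNI y. (NNI x. ennreal \<bar>case (x, y) of (x, y) => ?F x y\<bar>)) < \<infinity>" .
    qed measurable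
    have "(LBINT x. p x * conv g \<phi> x) = (\<integral>x. (LBINT y. ?F x y) \<partial>lborel)"
      by (intro lebesgue_cong) (simp_all add: conv_alt)
    also have "... = (\<integral>y. (LBINT x. ?F x y) \<partial>lborel)"
      by (rule lborel_pair.Fubini_integral[OF int, symmetric])
    also have "... = (LBINT y. \<theta> y * \<phi> (- y))"
      by (simp add: \<theta>_def mult.assoc[symmetric])
    finally have 1: "(LBINT x. p x * conv g \<phi> x) = (LBINT y. \<theta> y * \<phi> (- y))" .
    have int2: "integrable lborel (%y. \<theta> y * \<phi> (- y))"
      using lborel_pair.integrable_snd[OF int] by (simp add: \<theta>_def mult.assoc[symmetric])
    have 2: "(LBINT x. p x * g x) = (LBINT y. \<theta> 0 * \<phi> (- y))"
      using ref \<phi>(4) by (simp add: \<theta>_def)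
    have "\<bar>(LBINT x. p x * conv g \<phi> x) - (LBINT x. p x * g x)\<bar> = \<bar>LBINT y. \<theta> y * \<phi> (- y) - \<theta> 0 * \<phi> (- y)\<bar>"
      unfolding 1 2 using int2 ref(1) by (subst Bochner_Integration.integral_diff) auto
    also have "... <= (LBINT y. e * \<phi> (- y))"
    proof (rule Bochner_Integration.integral_norm_bound_integral[where f="%y. \<theta> y * \<phi> (- y) - \<theta> 0 * \<phi> (- y)", simplified real_norm_def])
      show "integrable lborel (%y. \<theta> y * \<phi> (- y) - \<theta> 0 * \<phi> (- y))" using int2 ref(1) by auto
      show "integrable lborel (%y. e * \<phi> (- y))" using ref(1) by auto
      show "\<bar>\<theta> y * \<phi> (- y) - \<theta> 0 * \<phi> (- y)\<bar> <= e * \<phi> (- y)" for y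
      proof (cases "norm y < d")
        case True
        have "\<theta> y - \<theta> 0 = (LBINT x. p x * (g (x + y) - g x))"
          unfolding \<theta>_def using l2_mult_integrable(1)[OF p g] l2_mult_integrable(1)[OF p l2_shift(1)[OF g]]
          by (simp add: right_diff_distrib)
        then have "\<bar>\<theta> y - \<theta> 0\<bar> <= n2 p * n2 (%x. g (x + y) - g x)"
          using l2_mult_integrable(2)[OF p l2_diff(1)[OF l2_shift(1)[OF g] g]] by simp
        also have "... <= (n2 p + 1) * e'"
          using d(2)[OF True] by (intro mult_mono) (auto intro: add_nonneg_nonneg)
        also have "... = e" by (simp add: e'_def add_nonneg_eq_0_iff)
        finally have "\<bar>\<theta> y - \<theta> 0\<bar> * \<phi> (- y) <= e * \<phi> (- y)" using \<phi>(2) by (intro mult_right_mono)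
        then show ?thesis using \<phi>(2)[of "- y"] by (simp add: abs_mult flip: left_diff_distrib)
      qed (use \<phi>(3)[of "- y"] in simp)
    qed
    also have "... = e" using ref \<phi>(4) by simp
    finally show ?thesis .
  qed
  with d(1) show ?thesis by (rule that)
qed

text \<open>A convolution at \<open>x\<close> is the pairing with a reflected and translated test
  function, hence 0. Shrinking the mollifier gives that the integral of g^2 is 0.\<close>

lemma l2_zero_of_test:
  fixes g :: "real^'d::finite => real"
  assumes g: "l2 g" and z: "!!\<phi>. test_fun UNIV \<phi> ==> (LBINT x. g x * \<phi> x) = 0"
  shows "AE x in lborel. g x = 0"
proof -
  have "\<bar>LBINT x. g x * g x\<bar> <= e" if e: "e > 0" for e
  proof -
    obtain d where d: "d > 0" "!!\<phi>. test_fun UNIV \<phi> ==> (!!x. \<phi> x >= 0) ==> (!!x. norm x >= d ==> \<phi> x = 0) ==>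
     (LBINT x. \<phi> x) = 1 ==> \<bar>(LBINT x. g x * conv g \<phi> x) - (LBINT x. g x * g x)\<bar> <= e"
      using mollify_weak[OF g g e] by blast
    obtain \<phi> :: "real^'d => real" where \<phi>: "test_fun UNIV \<phi>" "!!x. \<phi> x >= 0"
    "!!x. norm x >= d ==> \<phi> x = 0" "(LBINT x. \<phi> x) = 1" using mollifier_exists[OF d(1)] by blast
    have "conv g \<phi> x = 0" for x
      unfolding conv_def using z[OF test_fun_affine(1)[OF \<phi>(1), of "-1" x]] by simp
    then show ?thesis using d(2)[OF \<phi>] by simp
  qed
  then have "(LBINT x. g x * g x) = 0" by (metis abs_le_zero_iff dense_ge)
  then have "n2 g = 0" by (simp add: n2_def power2_eq_square)
  then show ?thesis by (rule n2_eq_0_AE[OF g])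
qed

section \<open>Averages along a segment\<close>

definition av :: "'a::euclidean_space => ('a => 'b::euclidean_space) => 'a => 'b" where
  "av z g x = (LBINT s. indicator {0..1::real} s *R g (x + s *R z))"

lemma av_measurable [measurable]:
  assumes [measurable]: "bm g"
  shows "bm (av z g)"
  unfolding av_def[abs_def] by measurable

lemma av_shift: "av z (%x. g (x + y)) x = av z g (x + y)"
  by (simp add: av_def add_ac)

lemma av_eq_0: "(!!s. 0 <= s ==> s <= 1 ==> g (x + s *R z) = 0) ==> av z g x = 0"
  unfolding av_def by (rule integral_eq_zero_AE) (auto simp: indicator_def)

lemma av_cong: "(!!s. 0 <= s ==> s <= 1 ==> g (x + s *R z) = h (x + s *R z)) ==> av z g x = av z h x"
  unfolding av_def by (intro lebesgue_cong) (auto simp: indicator_def)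

lemma nn_integral_av_sq:
  fixes g :: "'a::euclidean_space => 'b::euclidean_space"
  assumes [measurable]: "bm g"
  shows "(NNI x. (NNI s. indicator {0..1::real} s * ennreal ((norm (g (x + s *R z)))^2)))
    = (NNI x. ennreal ((norm (g x))^2))"
proof -
  have "(NNI x. (NNI s. indicator {0..1::real} s * ennreal ((norm (g (x + s *R z)))^2)))
    = (NNI s. (NNI x. indicator {0..1::real} s * ennreal ((norm (g (x + s *R z)))^2)))"
    by (rule lborel_pair.Fubini') measurable
  also have "... = (NNI s. indicator {0..1::real} s * (NNI x. ennreal ((norm (g x))^2)))"
  proof (intro nn_integral_cong)
    fix s :: real
    have "(NNI x. indicator {0..1::real} s * ennreal ((norm (g (x + s *R z)))^2))
       = indicator {0..1::real} s * (NNI x. ennreal ((norm (g (x + s *R z)))^2))"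
      by (rule nn_integral_cmult) measurable
    then show "(NNI x. indicator {0..1::real} s * ennreal ((norm (g (x + s *R z)))^2))
       = indicator {0..1::real} s * (NNI x. ennreal ((norm (g x))^2))"
      using nn_integral_shift[of "%x. ennreal ((norm (g x))^2)" "s *R z"] by simp
  qed
  also have "... = (NNI x. ennreal ((norm (g x))^2))"
    by (subst nn_integral_multc) auto
  finally show ?thesis .
qed

text \<open>Cauchy-Schwarz only over the part of the segment where \<open>g\<close> does not vanish.
  If this part has length at most c < 1, averaging gains a factor; this is where the later factor
  sqrt(\<rho> / r) comes from.\<close>

lemma av_jensen_pointwise:
  fixes g :: "'a::euclidean_space => 'b::euclidean_space"
  assumes [measurable]: "bm g"
    and w: "emeasure lborel {s\<in>{0..1::real}. g (x + s *R z) ~= 0} <= ennreal c"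
  shows "ennreal ((norm (av z g x))^2) <= ennreal c * (NNI s. indicator {0..1::real} s * ennreal ((norm (g (x + s *R z)))^2))"
proof -
  let ?h = "%s::real. indicator {0..1::real} s *R g (x + s *R z)"
  define J where "J = {s\<in>{0..1::real}. g (x + s *R z) ~= 0}"
  have Jm[measurable]: "J \<in> sets borel" unfolding J_def by measurable
  \<comment> \<open>If the segment integral diverges, \<open>av\<close> has the default value 0 and
    the bound is trivial.\<close>
  have "ennreal (norm (av z g x)) <= (NNI s. ennreal (norm (?h s)))"
  proof (cases "integrable lborel ?h")
    case True then show ?thesis unfolding av_def by (rule integral_norm_bound_ennreal)
  qed (simp add: av_def not_integrable_integral_eq)
  also have "... = (NNI s. indicator J s * ennreal (norm (?h s)))"
    by (intro nn_integral_cong) (auto simp: J_def indicator_def)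
  finally have "(ennreal (norm (av z g x)))^2 <= (NNI s. indicator J s * ennreal (norm (?h s)))^2"
    by (rule power_mono) simp
  also have "... <= (NNI s. (indicator J s)\<^sup>2) * (NNI s. (ennreal (norm (?h s)))\<^sup>2)"
    by (rule Cauchy_Schwarz_nn_integral) measurable
  also have "(NNI s. (indicator J s)\<^sup>2) = emeasure lborel J"
  proof -
    have "(NNI s. (indicator J s)\<^sup>2) = (NNI s. indicator J s)"
      by (intro nn_integral_cong) (simp add: indicator_def)
    also have "... = emeasure lborel J" by (rule nn_integral_indicator) simp
    finally show ?thesis .
  qed
  also have "(NNI s. (ennreal (norm (?h s)))\<^sup>2)
      = (NNI s. indicator {0..1::real} s * ennreal ((norm (g (x + s *R z)))^2))"
    by (intro nn_integral_cong) (auto simp: indicator_def ennreal_power)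
  also have "emeasure lborel J * ... <= ennreal c * ..."
    using w by (intro mult_right_mono) (auto simp: J_def)
  finally show ?thesis by (simp add: ennreal_power)
qed

lemma av_l2_window:
  fixes g :: "'a::euclidean_space => 'b::euclidean_space"
  assumes g: "l2 g" and c: "0 <= c"
    and w: "!!x. emeasure lborel {s\<in>{0..1::real}. g (x + s *R z) ~= 0} <= ennreal c"
  shows "l2 (av z g)" "n2 (av z g) <= sqrt c * n2 g"
proof -
  have [measurable]: "bm g" using g by auto
  have "(NNI x. ennreal ((norm (av z g x))^2))
    <= (NNI x. ennreal c * (NNI s. indicator {0..1::real} s * ennreal ((norm (g (x + s *R z)))^2)))"
    by (intro nn_integral_mono av_jensen_pointwise w) measurable
  also have "... = ennreal c * (NNI x. (NNI s. indicator {0..1::real} s * ennreal ((norm (g (x + s *R z)))^2)))"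
    by (rule nn_integral_cmult) measurable
  also have "... = ennreal c * ennreal ((n2 g)^2)"
    by (simp add: nn_integral_av_sq nn_integral_l2[OF g])
  also have "... = ennreal ((sqrt c * n2 g)^2)"
    using c by (simp add: power_mult_distrib flip: ennreal_mult)
  finally have *: "(NNI x. ennreal ((norm (av z g x))^2)) <= ennreal ((sqrt c * n2 g)^2)" .
  show "l2 (av z g)" "n2 (av z g) <= sqrt c * n2 g" by (rule l2I_nn[OF _ *]; use c in simp)+
qed

lemma av_l2:
  assumes "l2 g" shows "l2 (av z g)" "n2 (av z g) <= n2 g"
proof -
  have [measurable]: "bm g" using assms by auto
  have "emeasure lborel {s\<in>{0..1::real}. g (x + s *R z) ~= 0} <= ennreal 1" for x
  proof -
    have "emeasure lborel {s\<in>{0..1::real}. g (x + s *R z) ~= 0} <= emeasure lborel {0..1::real}"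
      by (intro emeasure_mono) auto
    then show ?thesis by simp
  qed
  from av_l2_window[OF assms _ this] show "l2 (av z g)" "n2 (av z g) <= n2 g" by auto
qed

text \<open>By Tonelli and translation invariance the square of \<open>g\<close> is integrable along
  almost every segment; |y| <= 1 + |y|^2 then suffices on a segment of finite length.\<close>

lemma av_AE_integrable:
  fixes g :: "'a::euclidean_space => 'b::euclidean_space"
  assumes g: "l2 g"
  shows "AE x in lborel. integrable lborel (%s. indicator {0..1::real} s *R g (x + s *R z))"
proof -
  have [measurable]: "bm g" using g by auto
  let ?I = "%x. (NNI s. indicator {0..1::real} s * ennreal ((norm (g (x + s *R z)))^2))"
  have "AE x in lborel. ?I x ~= \<infinity>"
    by (rule nn_integral_PInf_AE) (auto simp: nn_integral_av_sq nn_integral_l2[OF g])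
  then show ?thesis
  proof eventually_elim
    fix x assume I: "?I x ~= \<infinity>"
    show "integrable lborel (%s. indicator {0..1::real} s *R g (x + s *R z))"
    proof (rule integrableI_bounded)
      have "(NNI s. ennreal (norm (indicator {0..1::real} s *R g (x + s *R z))))
        <= (NNI s. indicator {0..1::real} s + indicator {0..1::real} s * ennreal ((norm (g (x + s *R z)))^2))"
      proof (rule nn_integral_mono)
        fix s :: real
        have "norm y <= 1 + (norm y)^2" for y :: 'b
          using sum_squares_bound[of 1 "norm y"] norm_ge_zero[of y] by (simp del: norm_ge_zero)
        then have "ennreal (norm (g (x + s *R z))) <= 1 + ennreal ((norm (g (x + s *R z)))^2)"
          by (metis ennreal_1 ennreal_leI ennreal_plus zero_le_one zero_le_power2)
        then show "ennreal (norm (indicator {0..1::real} s *R g (x + s *R z)))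
           <= indicator {0..1::real} s + indicator {0..1::real} s * ennreal ((norm (g (x + s *R z)))^2)"
          by (simp add: indicator_def)
      qed
      also have "... = (NNI s. indicator {0..1::real} s) + ?I x"
        by (rule nn_integral_add) measurable
      also have "... < \<infinity>" using I by (simp add: less_top)
      finally show "(NNI s. ennreal (norm (indicator {0..1::real} s *R g (x + s *R z)))) < \<infinity>" .
    qed measurable
  qed
qed

text \<open>Where a segment integral diverges, its default value 0 can destroy additivity; hence the
  statement holds only almost everywhere.\<close>

lemma av_add_AE:
  assumes "l2 g" "l2 h" shows "AE x in lborel. av z (%x. g x + h x) x = av z g x + av z h x"
  using av_AE_integrable[OF assms(1), of z] av_AE_integrable[OF assms(2), of z]
  by eventually_elim (simp add: av_def scaleR_add_right)

lemma av_diff_AE: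
  assumes "l2 g" "l2 h" shows "AE x in lborel. av z (%x. g x - h x) x = av z g x - av z h x"
  using av_AE_integrable[OF assms(1), of z] av_AE_integrable[OF assms(2), of z]
  by eventually_elim (simp add: av_def scaleR_diff_right)

lemma av_linear_AE:
  assumes "l2 g" "bounded_linear T" shows "AE x in lborel. av z (%x. T (g x)) x = T (av z g x)"
  using av_AE_integrable[OF assms(1), of z]
proof eventually_elim
  fix x assume "integrable lborel (%s. indicator {0..1::real} s *R g (x + s *R z))"
  from integral_bounded_linear[OF assms(2) this]
  show "av z (%x. T (g x)) x = T (av z g x)"
    by (simp add: av_def linear_scale[OF bounded_linear.linear[OF assms(2)]])
qed

lemma av_test:
  fixes g p :: "'a::euclidean_space => real"
  assumes g: "l2 g" and p: "l2 p"
  shows "(LBINT x. p x * av z g x) = (\<integral>s. indicator {0..1::real} s * (LBINT x. p x * g (x + s *R z)) \<partial>lborel)"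
proof -
  have [measurable]: "bm g" "bm p" using g p by auto
  let ?F = "%x s. p x * (indicator {0..1::real} s * g (x + s *R z))"
  have int: "integrable (lborel \<Otimes>\<^sub>M lborel) (case_prod ?F)"
  proof (rule pair_integrable_snd)
    have "(NNI x. ennreal \<bar>case (x, s) of (x, s) => ?F x s\<bar>) <= ennreal (n2 p * n2 g) * indicator {0..1} s" for s
    proof (cases "s \<in> {0..1}")
      case True
      then show ?thesis
        using nn_integral_l2_mult[OF p l2_shift(1)[OF g, of "s *R z"]] by (simp add: l2_shift(2)[OF g])
    qed simp
    then have "(NNI s. (NNI x. ennreal \<bar>case (x, s) of (x, s) => ?F x s\<bar>))
       <= (NNI s. ennreal (n2 p * n2 g) * indicator {0..1::real} s)"
      by (intro nn_integral_mono) auto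
    also have "... < \<infinity>" by (subst nn_integral_cmult) auto
    finally show "(NNI s. (NNI x. ennreal \<bar>case (x, s) of (x, s) => ?F x s\<bar>)) < \<infinity>" .
  qed measurable
  have "(LBINT x. p x * av z g x) = (\<integral>x. (LBINT s. ?F x s) \<partial>lborel)"
    by (simp add: av_def)
  also have "... = (\<integral>s. (LBINT x. ?F x s) \<partial>lborel)"
    by (rule lborel_pair.Fubini_integral[OF int, symmetric])
  also have "... = (\<integral>s. indicator {0..1::real} s * (LBINT x. p x * g (x + s *R z)) \<partial>lborel)"
    by (simp add: mult.left_commute[of "p _"])
  finally show ?thesis .
qed

section \<open>Rank one matrices, Sobolev pairs and the product rule\<close>

definition outer :: "real^'m::finite => real^'d::finite => real^'d^'m" where
  "outer v p = (\<chi> \<beta> i. v $ \<beta> * p $ i)"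

lemma outer_nth [simp]: "outer v p $ \<beta> $ i = v $ \<beta> * p $ i"
  by (simp add: outer_def)

lemma inner_matrix: "(P::real^'d::finite^'m::finite) \<bullet> V = (\<Sum>\<beta>\<in>UNIV. \<Sum>i\<in>UNIV. P $ \<beta> $ i * V $ \<beta> $ i)"
  by (simp add: inner_vec_def)

lemma outer_inner: "outer v p \<bullet> V = v \<bullet> (V *v p)"
  by (simp add: inner_matrix inner_vec_def matrix_vector_mult_def sum_distrib_left mult_ac)

lemma inner_ou: "V \<bullet> outer v p = (V *v p) \<bullet> v"
  using outer_inner[of v p V] by (simp add: inner_commute)

lemma outer_mv: "outer v p *v z = (p \<bullet> z) *R v"
  by (simp add: vec_eq_iff matrix_vector_mult_def inner_vec_def sum_distrib_left sum_distrib_right mult_ac)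

lemma norm_ou: "norm (outer v p) = norm v * norm p"
proof -
  have "(norm (outer v p))^2 = (norm v * norm p)^2"
    by (simp add: power2_norm_eq_inner outer_inner outer_mv power_mult_distrib)
  then show ?thesis by (simp add: power2_eq_iff_nonneg)
qed

lemma norm_mv_le: "norm ((V::real^'d::finite^'m::finite) *v p) <= norm V * norm p"
proof (cases "V *v p = 0")
  case False
  have "(norm (V *v p))^2 = V \<bullet> outer (V *v p) p" by (simp add: inner_ou power2_norm_eq_inner)
  also have "... <= norm V * norm (outer (V *v p) p)" by (rule norm_cauchy_schwarz)
  finally have "norm (V *v p) * norm (V *v p) <= (norm V * norm p) * norm (V *v p)"
    by (simp add: norm_ou power2_eq_square mult_ac)
  then show ?thesis using False by (simp add: mult_le_cancel_right)
qed simp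

lemma bounded_linear_mv: "bounded_linear (%V::real^'d::finite^'m::finite. V *v p)"
  by (rule bounded_linear_intro[where K="norm p"])
     (auto simp: matrix_vector_mult_add_rdistrib scaleR_matrix_vector_assoc norm_mv_le)

lemma mv_measurable [measurable (raw)]:
  fixes V :: "'a => real^'d::finite^'m::finite"
  assumes "V \<in> borel_measurable M" shows "(%x. V x *v p) \<in> borel_measurable M"
  by (rule measurable_compose[OF assms borel_measurable_continuous_onI])
     (intro linear_continuous_on bounded_linear_mv)

lemma bounded_bilinear_ou: "bounded_bilinear (outer :: real^'m::finite => real^'d::finite => _)"
  by (rule bounded_bilinear.intro)
     (auto simp: vec_eq_iff distrib_left distrib_right mult_ac norm_ou intro!: exI[of _ 1])

lemma outer_measurable [measurable (raw)]:
  assumes "v \<in> borel_measurable M" "p \<in> borel_measurable M"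
  shows "(%x. outer (v x :: real^'m::finite) (p x :: real^'d::finite)) \<in> borel_measurable M"
proof -
  have "continuous_on UNIV (%z. outer (fst z :: real^'m) (snd z :: real^'d))"
    by (intro bounded_bilinear.continuous_on[OF bounded_bilinear_ou] continuous_intros)
  from borel_measurable_continuous_on[OF this, of "%x. (v x, p x)" M] show ?thesis using assms by simp
qed

lemma mv_l2:
  fixes V :: "'a::euclidean_space => real^'d::finite^'m::finite"
  assumes "l2 V" shows "l2 (%x. V x *v p)" "n2 (%x. V x *v p) <= norm p * n2 V"
proof -
  have [measurable]: "bm V" using assms by auto
  have *: "AE x in lborel. norm (V x *v p) <= norm p * norm (V x)"
    using norm_mv_le[of _ p] by (intro AE_I2) (simp add: mult.commute[of "norm p"])
  show "l2 (%x. V x *v p)" "n2 (%x. V x *v p) <= norm p * n2 V"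
    by (rule l2_cmp[OF assms _ *]; simp)+
qed

text \<open>The gradient is tested on the whole space, so a pair vanishing on one side of a hyperplane has zero trace on it.\<close>
definition H1 :: "(real^'d::finite => real^'m::finite) => (real^'d => real^'d^'m) => bool" where
  "H1 v V \<longleftrightarrow> l2 v & l2 V & (ALL \<phi>. test_fun UNIV \<phi> --> (ALL \<beta> i.
     (LBINT x. v x $ \<beta> * pd i \<phi> x) = - (LBINT x. V x $ \<beta> $ i * \<phi> x)))"

lemma H1D:
  assumes "H1 v V"
  shows "l2 v" "l2 V" "test_fun UNIV \<phi> ==>
    (LBINT x. v x $ \<beta> * pd i \<phi> x) = - (LBINT x. V x $ \<beta> $ i * \<phi> x)"
  using assms by (auto simp: H1_def)

lemma H1_int:
  assumes "H1 v V" "test_fun UNIV \<phi>"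
  shows "integrable lborel (%x. v x $ \<beta> * \<phi> x)" "integrable lborel (%x. V x $ \<beta> $ i * \<phi> x)"
  using l2_mult_integrable(1)[OF l2_component[OF H1D(1)[OF assms(1)]] test_l2[OF assms(2)]]
    l2_mult_integrable(1)[OF l2_entry[OF H1D(2)[OF assms(1)]] test_l2[OF assms(2)]] by auto

lemma H1_add:
  assumes "H1 v V" "H1 w W" shows "H1 (%x. v x + w x) (%x. V x + W x)"
  unfolding H1_def
proof (intro conjI allI impI)
  show "l2 (%x. v x + w x)" "l2 (%x. V x + W x)" using assms by (auto intro!: l2_add dest: H1D)
  fix \<phi> \<beta> i assume \<phi>: "test_fun UNIV (\<phi> :: real^'a => real)"
  note i = H1_int[OF assms(1) \<phi>] H1_int[OF assms(2) \<phi>] H1_int[OF assms(1) test_fun_pd[OF \<phi>]] H1_int[OF assms(2) test_fun_pd[OF \<phi>]]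
  show "(LBINT x. (v x + w x) $ \<beta> * pd i \<phi> x) = - (LBINT x. (V x + W x) $ \<beta> $ i * \<phi> x)"
    using i H1D(3)[OF assms(1) \<phi>] H1D(3)[OF assms(2) \<phi>] by (simp add: distrib_right)
qed

lemma H1_scale:
  assumes "H1 v V" shows "H1 (%x. c *R v x) (%x. c *R V x)"
  using assms unfolding H1_def by (auto intro!: l2_scaleR simp: mult.assoc)

lemma H1_diff:
  assumes "H1 v V" "H1 w W" shows "H1 (%x. v x - w x) (%x. V x - W x)"
  using H1_add[OF assms(1) H1_scale[OF assms(2), of "-1"]] by simp

lemma H1_shift:
  fixes v :: "real^'d::finite => real^'m::finite"
  assumes "H1 v V" shows "H1 (%x. v (x + z)) (%x. V (x + z))"
  unfolding H1_def
proof (intro conjI allI impI)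
  have [measurable]: "bm v" "bm V" using assms by (auto dest: H1D)
  show "l2 (%x. v (x + z))" "l2 (%x. V (x + z))" using assms by (auto intro!: l2_shift dest: H1D)
  fix \<phi> \<beta> i assume \<phi>: "test_fun UNIV (\<phi> :: real^'d => real)"
  have t: "test_fun UNIV (%y. \<phi> (- z + 1 *R y))" "pd i (%y. \<phi> (- z + 1 *R y)) = (%y. 1 * pd i \<phi> (- z + 1 *R y))"
    by (rule test_fun_affine[OF \<phi>]; simp)+
  have [measurable]: "bm \<phi>" "bm (pd i \<phi>)"
    using \<phi> test_fun_pd[OF \<phi>] by auto
  have "(LBINT x. v (x + z) $ \<beta> * pd i \<phi> x) = (LBINT x. v x $ \<beta> * pd i \<phi> (- z + x))"
    using integral_shift[of "%x. v x $ \<beta> * pd i \<phi> (- z + x)" z] by simp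
  also have "... = - (LBINT x. V x $ \<beta> $ i * \<phi> (- z + x))"
    using H1D(3)[OF assms t(1), of \<beta> i] unfolding t(2) by simp
  also have "(LBINT x. V x $ \<beta> $ i * \<phi> (- z + x)) = (LBINT x. V (x + z) $ \<beta> $ i * \<phi> x)"
    using integral_shift[of "%x. V x $ \<beta> $ i * \<phi> (- z + x)" z] by simp
  finally show "(LBINT x. v (x + z) $ \<beta> * pd i \<phi> x) = - (LBINT x. V (x + z) $ \<beta> $ i * \<phi> x)" .
qed

lemma H1_mult:
  fixes v :: "real^'d::finite => real^'m::finite"
  assumes h: "H1 v V" and z: "smooth_fun \<zeta>" "!!x i. pd i \<zeta> x = gz x $ i"
    and b: "!!x. \<bar>\<zeta> x\<bar> <= c" "!!x. norm (gz x) <= c" and [measurable]: "bm gz"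
  shows "H1 (%x. \<zeta> x *R v x) (%x. \<zeta> x *R V x + outer (v x) (gz x))"
  unfolding H1_def
proof (intro conjI allI impI)
  have [measurable]: "bm \<zeta>" using z(1) by (rule smooth_fun_measurable)
  have [measurable]: "bm v" "bm V" using h by (auto dest: H1D)
  have c: "0 <= c" using b(1)[of 0] by simp
  show l: "l2 (%x. \<zeta> x *R v x)"
    by (rule l2_cmp(1)[OF H1D(1)[OF h], where C=c]) (use b c in \<open>auto intro!: mult_right_mono AE_I2\<close>)
  have l1: "l2 (%x. \<zeta> x *R V x)"
    by (rule l2_cmp(1)[OF H1D(2)[OF h], where C=c]) (use b c in \<open>auto intro!: mult_right_mono AE_I2\<close>)
  have l2': "l2 (%x. outer (v x) (gz x))"
    by (rule l2_cmp(1)[OF H1D(1)[OF h], where C=c]) (use b c in \<open>auto simp: norm_ou mult.commute[of c] intro!: mult_left_mono AE_I2\<close>)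
  show "l2 (%x. \<zeta> x *R V x + outer (v x) (gz x))" using l1 l2' by (rule l2_add)
  fix \<phi> \<beta> i assume \<phi>: "test_fun UNIV (\<phi> :: real^'d => real)"
  have t: "test_fun UNIV (%x. \<zeta> x * \<phi> x)" by (rule test_fun_mult[OF z(1) \<phi>])
  have pdm: "pd i (%x. \<zeta> x * \<phi> x) x = \<zeta> x * pd i \<phi> x + gz x $ i * \<phi> x" for x
    using pd_mult[of \<zeta> x \<phi> i] z \<phi> by (auto simp: smooth_fun_differentiable test_fun_iff)
  have i1: "integrable lborel (%x. v x $ \<beta> * pd i (%x. \<zeta> x * \<phi> x) x)" by (rule H1_int[OF h test_fun_pd[OF t]])
  have i2: "integrable lborel (%x. outer (v x) (gz x) $ \<beta> $ i * \<phi> x)"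
    by (rule l2_mult_integrable(1)[OF l2_entry[OF l2'] test_l2[OF \<phi>]])
  have i3: "integrable lborel (%x. V x $ \<beta> $ i * (\<zeta> x * \<phi> x))" by (rule H1_int[OF h t])
  have "(LBINT x. (\<zeta> x *R v x) $ \<beta> * pd i \<phi> x)
     = (LBINT x. v x $ \<beta> * pd i (%x. \<zeta> x * \<phi> x) x - outer (v x) (gz x) $ \<beta> $ i * \<phi> x)"
    by (intro lebesgue_cong refl) (simp only: pdm, simp add: algebra_simps)
  also have "... = - (LBINT x. V x $ \<beta> $ i * (\<zeta> x * \<phi> x)) - (LBINT x. outer (v x) (gz x) $ \<beta> $ i * \<phi> x)"
    using i1 i2 H1D(3)[OF h t, of \<beta> i] by simp
  also have "... = - (LBINT x. V x $ \<beta> $ i * (\<zeta> x * \<phi> x) + outer (v x) (gz x) $ \<beta> $ i * \<phi> x)"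
    using i2 i3 by simp
  also have "... = - (LBINT x. (\<zeta> x *R V x + outer (v x) (gz x)) $ \<beta> $ i * \<phi> x)"
    by (simp add: algebra_simps)
  finally show "(LBINT x. (\<zeta> x *R v x) $ \<beta> * pd i \<phi> x)
    = - (LBINT x. (\<zeta> x *R V x + outer (v x) (gz x)) $ \<beta> $ i * \<phi> x)" .
qed

lemma av_component_AE:
  assumes "l2 (v :: 'a::euclidean_space => real^'m::finite)"
  shows "AE x in lborel. av z v x $ \<beta> = av z (%x. v x $ \<beta>) x"
  using av_linear_AE[OF assms bounded_linear_vec_nth[of \<beta>], of z] by eventually_elim simp

lemma av_entry_AE:
  assumes "l2 (V :: 'a::euclidean_space => real^'d::finite^'m::finite)"
  shows "AE x in lborel. av z V x $ \<beta> $ i = av z (%x. V x $ \<beta> $ i) x"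
  using av_linear_AE[OF assms bounded_linear_compose[OF bounded_linear_vec_nth[of i] bounded_linear_vec_nth[of \<beta>]], of z]
  by eventually_elim simp

lemma integral_mult_shift:
  fixes p g :: "'a::euclidean_space => real"
  assumes [measurable]: "bm p" "bm g"
  shows "(LBINT x. p x * g (x + z)) = (LBINT x. g x * p (x + - z))"
  using integral_shift[of "%x. g x * p (x + - z)" z] by (simp add: mult.commute)

lemma test_fun_shift:
  assumes "test_fun UNIV \<phi>"
  shows "test_fun UNIV (%y. \<phi> (y + z))" "pd i (%y. \<phi> (y + z)) = (%y. pd i \<phi> (y + z))"
  using test_fun_affine[OF assms, where c=1 and a=z] by (simp_all add: add.commute[of z])

text \<open>Pairing with a test function commutes with the average over translations, and every
  translate is a Sobolev pair.\<close>

lemma H1_av: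
  fixes v :: "real^'d::finite => real^'m::finite"
  assumes h: "H1 v V" shows "H1 (av z v) (av z V)"
  unfolding H1_def
proof (intro conjI allI impI)
  note l = H1D(1,2)[OF h]
  have [measurable]: "bm v" "bm V" using l by auto
  show "l2 (av z v)" "l2 (av z V)" using l by (auto intro: av_l2)
  fix \<phi> \<beta> i assume \<phi>: "test_fun UNIV (\<phi> :: real^'d => real)"
  have [measurable]: "bm \<phi>" "bm (pd i \<phi>)"
    using \<phi> test_fun_pd[OF \<phi>] by auto
  have "(LBINT x. av z v x $ \<beta> * pd i \<phi> x) = (LBINT x. pd i \<phi> x * av z (%x. v x $ \<beta>) x)"
  proof (rule integral_cong_AE)
    show "AE x in lborel. av z v x $ \<beta> * pd i \<phi> x = pd i \<phi> x * av z (%x. v x $ \<beta>) x"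
      using av_component_AE[OF l(1), of z \<beta>] by eventually_elim simp
  qed measurable
  also have "... = (\<integral>s. indicator {0..1::real} s * (LBINT x. pd i \<phi> x * v (x + s *R z) $ \<beta>) \<partial>lborel)"
    by (rule av_test[OF l2_component[OF l(1)] test_l2[OF test_fun_pd[OF \<phi>]]])
  also have "... = (\<integral>s. - (indicator {0..1::real} s * (LBINT x. \<phi> x * V (x + s *R z) $ \<beta> $ i)) \<partial>lborel)"
  proof (intro lebesgue_cong refl)
    fix s :: real
    have "(LBINT x. pd i \<phi> x * v (x + s *R z) $ \<beta>) = - (LBINT x. \<phi> x * V (x + s *R z) $ \<beta> $ i)"
      using H1D(3)[OF H1_shift[OF h, of "s *R z"] \<phi>, of \<beta> i] by (simp add: mult.commute)
    then show "indicator {0..1::real} s * (LBINT x. pd i \<phi> x * v (x + s *R z) $ \<beta>)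
      = - (indicator {0..1::real} s * (LBINT x. \<phi> x * V (x + s *R z) $ \<beta> $ i))" by simp
  qed
  also have "... = - (LBINT x. \<phi> x * av z (%x. V x $ \<beta> $ i) x)"
    by (simp add: av_test[OF l2_entry[OF l(2)] test_l2[OF \<phi>]])
  also have "(LBINT x. \<phi> x * av z (%x. V x $ \<beta> $ i) x) = (LBINT x. av z V x $ \<beta> $ i * \<phi> x)"
  proof (rule integral_cong_AE)
    show "AE x in lborel. \<phi> x * av z (%x. V x $ \<beta> $ i) x = av z V x $ \<beta> $ i * \<phi> x"
      using av_entry_AE[OF l(2), of z \<beta> i] by eventually_elim simp
  qed measurable
  finally show "(LBINT x. av z v x $ \<beta> * pd i \<phi> x) = - (LBINT x. av z V x $ \<beta> $ i * \<phi> x)" .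
qed

lemma test_fun_ftc:
  assumes \<phi>: "test_fun UNIV (\<phi> :: real^'d::finite => real)"
  shows "av z (%y. \<Sum>i\<in>UNIV. z $ i * pd i \<phi> y) y = \<phi> (y + z) - \<phi> y"
proof -
  let ?D = "%y. \<Sum>i\<in>UNIV. z $ i * pd i \<phi> y"
  have "((%s. \<phi> (y + s *R z)) has_real_derivative ?D (y + s *R z)) (at s)" for s
  proof -
    have d: "\<phi> differentiable at (y + s *R z)" using \<phi> by (auto simp: test_fun_iff smooth_fun_differentiable)
    have "((%s. y + s *R z) has_derivative (%h. h *R z)) (at s)" by (auto intro!: derivative_eq_intros)
    from has_derivative_compose[OF this has_derivative_sum_pd[OF d]]
    show ?thesis unfolding has_field_derivative_def
      by (rule has_derivative_eq_rhs) (simp add: sum_distrib_left mult_ac fun_eq_iff)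
  qed
  moreover have "isCont (%s. ?D (y + s *R z)) s" for s
  proof -
    have c: "continuous_on UNIV (pd i \<phi>)" for i
      using \<phi> test_fun_pd[OF \<phi>] by (auto simp: test_fun_iff intro: smooth_fun_continuous)
    have "continuous_on UNIV (%s. pd i \<phi> (y + s *R z))" for i
      by (rule continuous_on_compose2[OF c]) (auto intro!: continuous_intros)
    then have "continuous_on UNIV (%s. ?D (y + s *R z))"
      by (intro continuous_on_sum continuous_on_mult continuous_on_const)
    then show ?thesis by (simp add: continuous_on_eq_continuous_at)
  qed
  ultimately have "(LBINT s. ?D (y + s *R z) * indicator {0..1} s) = \<phi> (y + 1 *R z) - \<phi> (y + 0 *R z)"
    by (intro integral_FTC_Icc_real) auto
  then show ?thesis unfolding av_def by (simp add: mult.commute)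
qed

text \<open>By duality: the average is moved onto the test function, where it runs along -z and the
  classical fundamental theorem applies. Equality against all test functions is then equality almost
  everywhere, component by component.\<close>

lemma H1_ftc:
  fixes v :: "real^'d::finite => real^'m::finite"
  assumes h: "H1 v V"
  shows "AE x in lborel. v (x + z) - v x = av z (%x. V x *v z) x"
proof -
  note l = H1D(1,2)[OF h]
  have [measurable]: "bm v" "bm V" using l by auto
  have "AE x in lborel. (v (x + z) - v x) $ \<beta> - av z (%x. (V x *v z) $ \<beta>) x = 0" for \<beta>
  proof (rule l2_zero_of_test)
    have lz: "l2 (%x. (V x *v z) $ \<beta>)" by (intro l2_component mv_l2 l)
    have ld: "l2 (%x. (v (x + z) - v x) $ \<beta>)" by (intro l2_component l2_diff l2_shift l)
    show "l2 (%x. (v (x + z) - v x) $ \<beta> - av z (%x. (V x *v z) $ \<beta>) x)"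
      by (intro l2_diff av_l2 lz ld)
    fix \<phi> :: "real^'d => real" assume \<phi>: "test_fun UNIV \<phi>"
    note tl = test_l2[OF \<phi>]
    have pdm[measurable]: "bm \<phi>" "bm (pd i \<phi>)" for i
      using \<phi> test_fun_pd[OF \<phi>] by auto
    let ?d = "%y. \<Sum>i\<in>UNIV. (- z) $ i * pd i \<phi> y"
    have "l2 (%y. (- z) $ i * pd i \<phi> y)" for i
      using l2_scaleR(1)[OF test_l2[OF test_fun_pd[OF \<phi>]], of "(- z) $ i" i] by simp
    then have dl: "l2 ?d" by (intro l2_sum) simp_all
    have "(LBINT x. \<phi> x * av z (%x. (V x *v z) $ \<beta>) x)
      = (\<integral>s. indicator {0..1::real} s * (LBINT x. \<phi> x * (V (x + s *R z) *v z) $ \<beta>) \<partial>lborel)"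
      by (rule av_test[OF lz tl])
    also have "... = (\<integral>s. indicator {0..1::real} s * (LBINT x. v x $ \<beta> * ?d (x + s *R (- z))) \<partial>lborel)"
    proof (intro lebesgue_cong refl)
      fix s :: real
      note hs = H1_shift[OF h, of "s *R z"]
      have "(LBINT x. \<phi> x * (V (x + s *R z) *v z) $ \<beta>)
        = (LBINT x. (\<Sum>i\<in>UNIV. z $ i * (V (x + s *R z) $ \<beta> $ i * \<phi> x)))"
        by (simp add: matrix_vector_mult_def sum_distrib_left mult_ac)
      also have "... = (\<Sum>i\<in>UNIV. z $ i * (LBINT x. V (x + s *R z) $ \<beta> $ i * \<phi> x))"
        using H1_int(2)[OF hs \<phi>] by simp
      also have "... = (\<Sum>i\<in>UNIV. (- z) $ i * (LBINT x. v (x + s *R z) $ \<beta> * pd i \<phi> x))"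
        using H1D(3)[OF hs \<phi>, of \<beta>] by simp
      also have "... = (LBINT x. (\<Sum>i\<in>UNIV. (- z) $ i * (v (x + s *R z) $ \<beta> * pd i \<phi> x)))"
        using H1_int(1)[OF hs test_fun_pd[OF \<phi>]] by simp
      also have "... = (LBINT x. ?d x * v (x + s *R z) $ \<beta>)"
        by (simp only: sum_distrib_left sum_distrib_right mult_ac)
      also have "... = (LBINT x. v x $ \<beta> * ?d (x + - (s *R z)))"
        by (rule integral_mult_shift) measurable
      finally show "indicator {0..1::real} s * (LBINT x. \<phi> x * (V (x + s *R z) *v z) $ \<beta>)
        = indicator {0..1::real} s * (LBINT x. v x $ \<beta> * ?d (x + s *R (- z)))" by simp
    qed
    also have "... = (LBINT x. v x $ \<beta> * av (- z) ?d x)"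
      by (rule av_test[OF dl l2_component[OF l(1)], symmetric])
    also have "... = (LBINT x. v x $ \<beta> * (\<phi> (x + - z) - \<phi> x))"
      by (simp only: test_fun_ftc[OF \<phi>])
    also have "... = (LBINT x. v x $ \<beta> * \<phi> (x + - z)) - (LBINT x. v x $ \<beta> * \<phi> x)"
      using H1_int(1)[OF h \<phi>, of \<beta>] H1_int(1)[OF h test_fun_shift(1)[OF \<phi>, of "- z"], of \<beta>]
      by (simp only: right_diff_distrib Bochner_Integration.integral_diff)
    also have "(LBINT x. v x $ \<beta> * \<phi> (x + - z)) = (LBINT x. \<phi> x * v (x + z) $ \<beta>)"
      by (rule integral_mult_shift[symmetric]) measurable
    also have "... - (LBINT x. v x $ \<beta> * \<phi> x) = (LBINT x. (v (x + z) - v x) $ \<beta> * \<phi> x)"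
    proof -
      have i: "integrable lborel (%x. \<phi> x * v (x + z) $ \<beta>)" "integrable lborel (%x. v x $ \<beta> * \<phi> x)"
        using H1_int(1)[OF h \<phi>] H1_int(1)[OF H1_shift[OF h] \<phi>] by (simp_all add: mult.commute)
      show ?thesis unfolding Bochner_Integration.integral_diff[OF i, symmetric] by (simp add: algebra_simps)
    qed
    finally have *: "(LBINT x. av z (%x. (V x *v z) $ \<beta>) x * \<phi> x) = (LBINT x. (v (x + z) - v x) $ \<beta> * \<phi> x)"
      by (simp add: mult.commute)
    show "(LBINT x. ((v (x + z) - v x) $ \<beta> - av z (%x. (V x *v z) $ \<beta>) x) * \<phi> x) = 0"
      unfolding left_diff_distrib
      using l2_mult_integrable(1)[OF ld tl] l2_mult_integrable(1)[OF av_l2(1)[OF lz] tl] * by (subst Bochner_Integration.integral_diff) auto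
  qed
  then have "AE x in lborel. ALL \<beta>. (v (x + z) - v x) $ \<beta> - av z (%x. (V x *v z) $ \<beta>) x = 0"
    by (intro eventually_all_finite) 
  moreover have "AE x in lborel. ALL \<beta>. av z (%x. V x *v z) x $ \<beta> = av z (%x. (V x *v z) $ \<beta>) x"
    by (intro eventually_all_finite av_component_AE mv_l2 l)
  ultimately show ?thesis by eventually_elim (auto simp: vec_eq_iff)
qed

section \<open>Extension of the weak form to compactly supported Sobolev functions\<close>

definition gradv :: "(real^'d::finite => real^'m::finite) => real^'d => real^'d^'m" where
  "gradv \<phi> x = (\<chi> \<beta> i. pd i (%y. \<phi> y $ \<beta>) x)"

definition moll :: "real => (real^'d::finite => real) => bool" where
  "moll d \<phi> \<longleftrightarrow> test_fun UNIV \<phi> & (ALL x. \<phi> x >= 0) & (ALL x. norm x >= d --> \<phi> x = 0) & (LBINT x. \<phi> x) = 1"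

lemma conv_support:
  assumes "moll d \<phi>" "conv g \<phi> x ~= 0"
  shows "EX y. g y ~= 0 & norm (x - y) < d"
proof (rule ccontr)
  assume n: "~ ?thesis"
  have eq: "(%y. g y * \<phi> (x - y)) = (%y. 0)"
  proof
    fix y show "g y * \<phi> (x - y) = 0"
      using n assms(1) by (cases "norm (x - y) < d") (auto simp: moll_def)
  qed
  show False using assms(2) by (simp only: conv_def eq Bochner_Integration.integral_zero)
qed

lemma l2_bounded_integrable:
  fixes g :: "'a::euclidean_space => real"
  assumes "l2 g" "bounded {x. g x ~= 0}"
  shows "integrable lborel g"
proof -
  obtain N where N: "!!x. g x ~= 0 ==> norm x <= N" using assms(2) by (auto simp: bounded_iff)
  have "l2 (indicator (cball 0 N) :: 'a => real)"
  proof -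
    have "(%x. (norm (indicator (cball 0 N) x :: real))\<^sup>2) = (indicator (cball 0 N) :: 'a => real)"
      by (auto simp: indicator_def fun_eq_iff)
    moreover have "integrable lborel (indicator (cball 0 N) :: 'a => real)"
      using emeasure_lborel_cball_finite[of 0 N] by (intro integrable_real_indicator) (auto simp: less_top)
    ultimately show ?thesis by (simp add: l2_def)
  qed
  from l2_mult_integrable(1)[OF assms(1) this]
  show ?thesis
  proof (rule Bochner_Integration.integrable_cong[THEN iffD1, rotated -1])
    show "g x * indicator (cball 0 N) x = g x" for x using N[of x] by (auto simp: indicator_def)
  qed auto
qed

lemma uniform_choice_finite:
  assumes "finite I" "!!i. i \<in> I ==> EX d>0. ALL d'. 0 < d' --> d' <= d --> P i (d'::real)"
  shows "EX d>0. \<forall>i\<in>I. ALL d'. 0 < d' --> d' <= d --> P i d'"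
  using assms
proof (induction I rule: finite_induct)
  case (insert i I)
  obtain d1 where "d1 > 0" "ALL d'. 0 < d' --> d' <= d1 --> P i d'"
    using insert.prems[of i] by auto
  moreover obtain d2 where "d2 > 0" "\<forall>i\<in>I. ALL d'. 0 < d' --> d' <= d2 --> P i d'"
    using insert.IH insert.prems by auto
  ultimately show ?case by (intro exI[of _ "min d1 d2"]) auto
qed (auto intro: exI[of _ 1])

lemma mollify_weak':
  fixes p g :: "real^'d::finite => real"
  assumes p: "l2 p" and g: "l2 g" and e: "e > 0"
  shows "EX d>0. ALL d'. 0 < d' --> d' <= d --> (ALL \<phi>. moll d' \<phi> -->
     \<bar>(LBINT x. p x * conv g \<phi> x) - (LBINT x. p x * g x)\<bar> <= e)"
proof -
  obtain d where d: "d > 0" "!!\<phi>. test_fun UNIV \<phi> ==> (!!x. \<phi> x >= 0) ==> (!!x. norm x >= d ==> \<phi> x = 0) ==>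
     (LBINT x. \<phi> x) = 1 ==> \<bar>(LBINT x. p x * conv g \<phi> x) - (LBINT x. p x * g x)\<bar> <= e"
    using mollify_weak[OF assms] by blast
  show ?thesis
  proof (intro exI[of _ d] conjI d(1) allI impI)
    fix d' \<phi> assume "0 < d'" "d' <= d" and m: "moll d' (\<phi> :: real^'d => real)"
    show "\<bar>(LBINT x. p x * conv g \<phi> x) - (LBINT x. p x * g x)\<bar> <= e"
      using m \<open>d' <= d\<close> by (intro d(2)) (auto simp: moll_def)
  qed
qed

text \<open>The mollification of \<open>v\<close> is an admissible test function once its radius is
  at most half of \<delta>, and its gradient is the mollification of \<open>V\<close>. Finitely many
  scalar pairings have to converge, for which weak convergence is enough.\<close>

lemma weak_form_extend:
  fixes v :: "real^'d::finite => real^'m::finite" and P :: "real^'d => real^'d^'m"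
  assumes P: "l2 P" and q: "l2 q" and h: "H1 v V" and bd: "bounded {x. v x ~= 0}"
    and \<delta>: "\<delta> > 0" "!!x y. v x ~= 0 ==> dist x y <= \<delta> ==> y \<in> \<Omega>"
    and eq: "!!\<phi>. (!!\<beta>. test_fun \<Omega> (%y. \<phi> y $ \<beta>)) ==>
        (LBINT x. P x \<bullet> gradv \<phi> x) = (LBINT x. q x \<bullet> \<phi> x)"
  shows "(LBINT x. P x \<bullet> V x) = (LBINT x. q x \<bullet> v x)"
proof -
  note l = H1D(1,2)[OF h]
  have [measurable]: "bm v" "bm V" using l by auto
  \<comment> \<open>Number of scalar pairings: one for each entry of \<open>P\<close> and one for
    each component of \<open>q\<close>.\<close>
  let ?N = "real (CARD('m) * CARD('d) + CARD('m))"
  have key: "\<bar>(LBINT x. P x \<bullet> V x) - (LBINT x. q x \<bullet> v x)\<bar> <= ?N * e" if e: "e > 0" for e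
  proof -
    have "EX d>0. \<forall>b\<in>UNIV. ALL d'. 0 < d' --> d' <= d --> (ALL \<phi>. moll d' \<phi> -->
       \<bar>(LBINT x. P x $ fst b $ snd b * conv (%x. V x $ fst b $ snd b) \<phi> x) - (LBINT x. P x $ fst b $ snd b * V x $ fst b $ snd b)\<bar> <= e)"
      by (intro uniform_choice_finite mollify_weak' l2_entry P l e) simp
    then obtain d1 where d1: "d1 > 0" "!!b i d' \<phi>. 0 < d' ==> d' <= d1 ==> moll d' \<phi> ==>
       \<bar>(LBINT x. P x $ b $ i * conv (%x. V x $ b $ i) \<phi> x) - (LBINT x. P x $ b $ i * V x $ b $ i)\<bar> <= e"
      by auto
    have "EX d>0. \<forall>b\<in>UNIV. ALL d'. 0 < d' --> d' <= d --> (ALL \<phi>. moll d' \<phi> -->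
       \<bar>(LBINT x. q x $ b * conv (%x. v x $ b) \<phi> x) - (LBINT x. q x $ b * v x $ b)\<bar> <= e)"
      by (intro uniform_choice_finite mollify_weak' l2_component q l e) simp
    then obtain d2 where d2: "d2 > 0" "!!b d' \<phi>. 0 < d' ==> d' <= d2 ==> moll d' \<phi> ==>
       \<bar>(LBINT x. q x $ b * conv (%x. v x $ b) \<phi> x) - (LBINT x. q x $ b * v x $ b)\<bar> <= e"
      by auto
    \<comment> \<open>The other half of \<delta> is kept for passing to the closure of the
      support.\<close>
    define d where "d = min (min d1 d2) (\<delta> / 2)"
    have d: "d > 0" "d <= d1" "d <= d2" "d <= \<delta>/2" using d1 d2 \<delta> by (auto simp: d_def)
    obtain \<phi> :: "real^'d => real" where \<phi>: "test_fun UNIV \<phi>" "!!x. \<phi> x >= 0"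
      "!!x. norm x >= d ==> \<phi> x = 0" "(LBINT x. \<phi> x) = 1" using mollifier_exists[OF d(1)] by blast
    have m: "moll d \<phi>" using \<phi> by (auto simp: moll_def)
    define \<Phi> :: "real^'d => real^'m" where "\<Phi> x = (\<chi> \<beta>. conv (%x. v x $ \<beta>) \<phi> x)" for x
    have bd\<beta>: "bounded {x. v x $ \<beta> ~= 0}" for \<beta>
      by (rule bounded_subset[OF bd]) auto
    have vint: "integrable lborel (%x. v x $ \<beta>)" for \<beta>
      by (rule l2_bounded_integrable[OF l2_component[OF l(1)] bd\<beta>])
    have test: "test_fun \<Omega> (%y. \<Phi> y $ \<beta>)" for \<beta>
    proof -
      let ?S = "{x. conv (%x. v x $ \<beta>) \<phi> x ~= 0}"
      have S: "EX y. v y ~= 0 & dist x y < d" if "x \<in> ?S" for x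
      proof -
        from that have "conv (%x. v x $ \<beta>) \<phi> x ~= 0" by simp
        then obtain y where "v y $ \<beta> ~= 0" "norm (x - y) < d" using conv_support[OF m] by blast
        then show ?thesis by (intro exI[of _ y]) (auto simp: dist_norm)
      qed
      obtain N where N: "!!x. v x ~= 0 ==> norm x <= N" using bd by (auto simp: bounded_iff)
      have "bounded ?S"
      proof (rule boundedI)
        fix x assume "x \<in> ?S"
        then obtain y where "v y ~= 0" "dist x y < d" using S by blast
        then show "norm x <= N + d" using N[of y] norm_triangle_sub[of x y] by (simp add: dist_norm)
      qed
      moreover have "closure ?S <= \<Omega>"
      proof
        fix z assume "z \<in> closure ?S"
        then obtain x where x: "x \<in> ?S" "dist x z < \<delta>/2"
          using \<delta>(1) by (meson closure_approachable half_gt_zero)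
        then obtain y where y: "v y ~= 0" "dist x y < d" using S by blast
        have "dist y z <= \<delta>" using x(2) y(2) d(4) dist_triangle[of y z x] by (simp add: dist_commute)
        then show "z \<in> \<Omega>" using \<delta>(2) y(1) by blast
      qed
      ultimately show ?thesis unfolding test_fun_iff \<Phi>_def
        using smooth_conv[OF vint \<phi>(1)] by simp
    qed
    \<comment> \<open>The weak derivative is tested with y |-> \<phi>(x - y); the sign of the
      reflection cancels the sign of the integration by parts.\<close>
    have grad: "gradv \<Phi> x $ \<beta> $ i = conv (%x. V x $ \<beta> $ i) \<phi> x" for x \<beta> i
    proof -
      have t: "test_fun UNIV (%y. \<phi> (x + (-1) *R y))" "pd i (%y. \<phi> (x + (-1) *R y)) = (%y. (-1) * pd i \<phi> (x + (-1) *R y))"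
        by (rule test_fun_affine[OF \<phi>(1)]; simp)+
      have "gradv \<Phi> x $ \<beta> $ i = conv (%x. v x $ \<beta>) (pd i \<phi>) x"
        using pd_conv[OF vint \<phi>(1), of i \<beta>] by (simp add: gradv_def \<Phi>_def)
      also have "... = conv (%x. V x $ \<beta> $ i) \<phi> x"
        using H1D(3)[OF h t(1), of \<beta> i] unfolding t(2) conv_def by simp
      finally show ?thesis .
    qed
    have conv_l2: "l2 (conv g \<phi>)" if g: "l2 g" "bounded {x. g x ~= 0}" for g :: "real^'d => real"
    proof -
      obtain N where N: "!!x. g x ~= 0 ==> norm x <= N" using g(2) by (auto simp: bounded_iff)
      have "bounded {x. conv g \<phi> x ~= 0}"
      proof (rule boundedI)
        fix x assume "x \<in> {x. conv g \<phi> x ~= 0}"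
        then have "conv g \<phi> x ~= 0" by simp
        then obtain y where "g y ~= 0" "norm (x - y) < d" using conv_support[OF m] by blast
        then show "norm x <= N + d" using N[of y] norm_triangle_sub[of x y] by (simp add: dist_norm)
      qed
      then have "test_fun UNIV (conv g \<phi>)"
        using smooth_conv[OF l2_bounded_integrable[OF g] \<phi>(1)] by (simp add: test_fun_iff)
      then show ?thesis by (rule test_l2)
    qed
    have \<Phi>l: "l2 (conv (%x. v x $ \<beta>) \<phi>)" for \<beta> by (rule conv_l2[OF l2_component[OF l(1)] bd\<beta>])
    have Gl: "l2 (conv (%x. V x $ \<beta> $ i) \<phi>)" for \<beta> i
    proof -
      have "conv (%x. V x $ \<beta> $ i) \<phi> = pd i (%y. \<Phi> y $ \<beta>)"
        using grad[of _ \<beta> i] by (auto simp: gradv_def fun_eq_iff)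
      then show ?thesis using test_l2[OF test_fun_pd[OF test]] by simp
    qed
    have e1: "(LBINT x. P x \<bullet> gradv \<Phi> x) = (\<Sum>\<beta>\<in>UNIV. \<Sum>i\<in>UNIV. (LBINT x. P x $ \<beta> $ i * conv (%x. V x $ \<beta> $ i) \<phi> x))"
      using l2_mult_integrable(1)[OF l2_entry[OF P] Gl] by (simp add: inner_matrix grad)
    have e2: "(LBINT x. P x \<bullet> V x) = (\<Sum>\<beta>\<in>UNIV. \<Sum>i\<in>UNIV. (LBINT x. P x $ \<beta> $ i * V x $ \<beta> $ i))"
      using l2_mult_integrable(1)[OF l2_entry[OF P] l2_entry[OF l(2)]] by (simp add: inner_matrix)
    have e3: "(LBINT x. q x \<bullet> \<Phi> x) = (\<Sum>\<beta>\<in>UNIV. (LBINT x. q x $ \<beta> * conv (%x. v x $ \<beta>) \<phi> x))"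
      using l2_mult_integrable(1)[OF l2_component[OF q] \<Phi>l] by (simp add: inner_vec_def \<Phi>_def)
    have e4: "(LBINT x. q x \<bullet> v x) = (\<Sum>\<beta>\<in>UNIV. (LBINT x. q x $ \<beta> * v x $ \<beta>))"
      using l2_mult_integrable(1)[OF l2_component[OF q] l2_component[OF l(1)]] by (simp add: inner_vec_def)
    have "\<bar>(LBINT x. P x \<bullet> gradv \<Phi> x) - (LBINT x. P x \<bullet> V x)\<bar> <= (\<Sum>\<beta>\<in>(UNIV::'m set). \<Sum>i\<in>(UNIV::'d set). e)"
      unfolding e1 e2 sum_subtractf[symmetric] 
      by (intro order_trans[OF sum_abs] sum_mono d1(2)[OF d(1,2) m])
    moreover have "\<bar>(LBINT x. q x \<bullet> \<Phi> x) - (LBINT x. q x \<bullet> v x)\<bar> <= (\<Sum>\<beta>\<in>(UNIV::'m set). e)"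
      unfolding e3 e4 sum_subtractf[symmetric] 
      by (intro order_trans[OF sum_abs] sum_mono d2(2)[OF d(1,3) m])
    moreover have "(LBINT x. P x \<bullet> gradv \<Phi> x) = (LBINT x. q x \<bullet> \<Phi> x)" by (rule eq[OF test])
    ultimately show ?thesis by (simp add: algebra_simps)
  qed
  have N: "?N > 0" unfolding of_nat_0_less_iff by simp
  have "\<bar>(LBINT x. P x \<bullet> V x) - (LBINT x. q x \<bullet> v x)\<bar> <= e" if "e > 0" for e
    using key[of "e / ?N"] that N by simp
  then have "\<bar>(LBINT x. P x \<bullet> V x) - (LBINT x. q x \<bullet> v x)\<bar> <= 0" by (rule dense_ge)
  then show ?thesis by simp
qed

lemma smooth_affine_comp:
  fixes \<nu> :: "real^'d::finite"
  assumes "!!n. dn n g" "!!x. (g has_real_derivative g' x) (at x)"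
  shows "smooth_fun (%x. g (x \<bullet> \<nu> - a))" "pd i (%x. g (x \<bullet> \<nu> - a)) x = (g' (x \<bullet> \<nu> - a) *R \<nu>) $ i"
proof -
  have "sm n (%x. x \<bullet> \<nu> + (- a))" for n by (intro sm_add sm_inner_const sm_const)
  from sm_comp[OF assms(1) this] show "smooth_fun (%x. g (x \<bullet> \<nu> - a))"
    by (simp add: smooth_fun_iff_sm)
  have "((%x. x \<bullet> \<nu> - a) has_derivative (%h. h \<bullet> \<nu>)) (at x)"
    by (auto intro!: derivative_eq_intros)
  from has_derivative_compose[OF this assms(2)[unfolded has_field_derivative_def]]
  have "((%x. g (x \<bullet> \<nu> - a)) has_derivative (%h. g' (x \<bullet> \<nu> - a) * (h \<bullet> \<nu>))) (at x)" .
  from pd_eq[OF this, of i] show "pd i (%x. g (x \<bullet> \<nu> - a)) x = (g' (x \<bullet> \<nu> - a) *R \<nu>) $ i"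
    by (simp add: inner_axis inner_commute[of _ \<nu>])
qed

text \<open>The product rule for cut-offs that depend on the height alone: the extra term is a rank
  one matrix with normal second factor, so it only affects the normal derivative.\<close>

lemma H1_cut:
  fixes v :: "real^'d::finite => real^'m::finite"
  assumes h: "H1 v V" and g: "!!n. dn n g" "!!x. (g has_real_derivative g' x) (at x)"
    and b: "!!x. \<bar>g x\<bar> <= c" "!!x. \<bar>g' x\<bar> <= c"
  shows "H1 (%x. g (x \<bullet> \<nu> - a) *R v x)
    (%x. g (x \<bullet> \<nu> - a) *R V x + g' (x \<bullet> \<nu> - a) *R outer (v x) \<nu>)"
proof -
  have c: "0 <= c" using b(1)[of 0] by simp
  \<comment> \<open>\<open>g'\<close> is given pointwise only. By uniqueness it is the derivative
    supplied by \<open>dn\<close> of order 2, which is differentiable and therefore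
    continuous.\<close>
  have g'm: "bm g'"
  proof -
    from g(1)[of "Suc (Suc 0)"] obtain g1 g2 where *: "!!x. (g has_real_derivative g1 x) (at x)" "!!x. (g1 has_real_derivative g2 x) (at x)"
      by auto
    have "g1 = g'" using DERIV_unique[OF *(1) g(2)] by auto
    then have "continuous_on UNIV g'" using * by (intro continuous_at_imp_continuous_on ballI DERIV_isCont[of _ "g2 _"]) simp
    then show ?thesis by (rule borel_measurable_continuous_onI)
  qed
  have "H1 (%x. g (x \<bullet> \<nu> - a) *R v x) (%x. g (x \<bullet> \<nu> - a) *R V x + outer (v x) (g' (x \<bullet> \<nu> - a) *R \<nu>))"
  proof (rule H1_mult[OF h smooth_affine_comp[OF g], where c="c * max 1 (norm \<nu>)"])
    have "c <= c * max 1 (norm \<nu>)" using c by (simp add: mult_le_cancel_left1)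
    then show "\<bar>g (x \<bullet> \<nu> - a)\<bar> <= c * max 1 (norm \<nu>)" for x using b(1) order_trans by blast
    show "norm (g' (x \<bullet> \<nu> - a) *R \<nu>) <= c * max 1 (norm \<nu>)" for x
      using b(2)[of "x \<bullet> \<nu> - a"] c by (auto intro!: mult_mono)
    show "bm (%x. g' (x \<bullet> \<nu> - a) *R \<nu>)" using g'm by measurable
  qed
  moreover have "outer u (k *R \<nu>) = k *R outer u \<nu>" for u :: "real^'m" and k by (simp add: vec_eq_iff)
  ultimately show ?thesis by simp
qed

section \<open>Strips and Hardy's inequality\<close>

definition rs :: "'a set => ('a::euclidean_space => 'b::euclidean_space) => 'a => 'b" where
  "rs S g x = indicator S x *R g x"

definition nS :: "'a set => ('a::euclidean_space => 'b::euclidean_space) => real" where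
  "nS S g = n2 (rs S g)"

lemma rs_measurable [measurable]:
  assumes [measurable]: "S \<in> sets borel" "bm g"
  shows "bm (rs S g)"
  unfolding rs_def[abs_def] by measurable

lemma rs_l2: "l2 g ==> S \<in> sets borel ==> l2 (rs S g)"
  by (rule l2_cmp(1)[where C=1]) (auto simp: rs_def indicator_def)

lemma nS_nonneg [simp]: "0 <= nS S g" by (simp add: nS_def)

text \<open>The comparison is asked for only where \<open>p\<close> does not vanish, so
  \<open>S\<close> need not be contained in \<open>S'\<close>.\<close>

lemma nS_cmp:
  assumes "l2 (rs S' q)" "S \<in> sets borel" "bm p" "0 <= C"
    and "!!x. x \<in> S ==> p x ~= 0 ==> x \<in> S' & norm (p x) <= C * norm (q x)"
  shows "l2 (rs S p)" "nS S p <= C * nS S' q"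
proof -
  have "AE x in lborel. norm (rs S p x) <= C * norm (rs S' q x)"
  proof (rule AE_I2)
    fix x show "norm (rs S p x) <= C * norm (rs S' q x)"
      using assms(4) assms(5)[of x] by (cases "x \<in> S & p x ~= 0") (auto simp: rs_def indicator_def)
  qed
  note * = l2_cmp[OF assms(1) rs_measurable[OF assms(2,3)] this assms(4)]
  show "l2 (rs S p)" "nS S p <= C * nS S' q" using * by (auto simp: nS_def)
qed

lemma nS_mono:
  assumes "l2 (rs S' g)" "bm g" "S \<in> sets borel" "S <= S'"
  shows "nS S g <= nS S' g"
  using nS_cmp(2)[OF assms(1,3,2), of 1] assms(4) by auto

lemma nS_le_n2: "l2 g ==> S \<in> sets borel ==> nS S g <= n2 g"
  unfolding nS_def using l2_cmp(2)[of g "rs S g" 1] by (auto simp: rs_def indicator_def)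

lemma nS_add:
  assumes "l2 (rs S p)" "l2 (rs S q)"
  shows "l2 (rs S (%x. p x + q x))" "nS S (%x. p x + q x) <= nS S p + nS S q"
  using l2_add[OF assms] by (simp_all add: nS_def rs_def[abs_def] scaleR_add_right)

lemma nS_diff:
  assumes "l2 (rs S p)" "l2 (rs S q)"
  shows "l2 (rs S (%x. p x - q x))" "nS S (%x. p x - q x) <= nS S p + nS S q"
  using l2_diff[OF assms] by (simp_all add: nS_def rs_def[abs_def] scaleR_diff_right)

lemma nS_power2_nn:
  assumes "l2 (rs S g)" "S \<in> sets borel"
  shows "(NNI x. indicator S x * ennreal ((norm (g x))^2)) = ennreal ((nS S g)^2)"
  unfolding nS_def nn_integral_l2[OF assms(1), symmetric]
  by (intro nn_integral_cong) (auto simp: rs_def indicator_def)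

lemma nS_pythagoras:
  assumes "l2 g" "S \<in> sets borel" "S' \<in> sets borel" "S \<inter> S' = {}"
  shows "(nS (S \<union> S') g)^2 = (nS S g)^2 + (nS S' g)^2"
proof -
  have "integrable lborel (%x. (norm (rs S g x))\<^sup>2)" "integrable lborel (%x. (norm (rs S' g x))\<^sup>2)"
    using rs_l2[OF assms(1,2)] rs_l2[OF assms(1,3)] by (auto simp: l2_def)
  moreover have "(norm (rs (S \<union> S') g x))^2 = (norm (rs S g x))^2 + (norm (rs S' g x))^2" for x
    using assms(4) by (auto simp: rs_def indicator_def)
  ultimately show ?thesis unfolding nS_def n2_power2 by simp
qed

lemma nS_cs:
  assumes p: "l2 (rs S p)" and q: "l2 (rs S' q)" and [measurable]: "bm F"
    and le: "AE x in lborel. F x ~= 0 --> x \<in> S & x \<in> S' & \<bar>F x\<bar> <= norm (p x) * norm (q x)"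
  shows "integrable lborel F" "\<bar>LBINT x. F x\<bar> <= nS S p * nS S' q"
proof -
  have "AE x in lborel. \<bar>F x\<bar> <= norm (rs S p x) * norm (rs S' q x)"
    using le by eventually_elim (auto simp: rs_def indicator_def)
  from l2_cs[OF p q _ this] show "integrable lborel F" "\<bar>LBINT x. F x\<bar> <= nS S p * nS S' q"
    by (auto simp: nS_def)
qed

text \<open>The difference is the average of W z over a segment, and the segments that start in
  \<open>S\<close> stay in \<open>S'\<close>.\<close>

lemma shift_estimate:
  fixes w :: "real^'d::finite => real^'m::finite"
  assumes h: "H1 w W" and [measurable]: "S \<in> sets borel" "S' \<in> sets borel"
    and seg: "!!x s. x \<in> S ==> 0 <= s ==> s <= 1 ==> x + s *R z \<in> S'"
  shows "nS S (%x. w (x + z) - w x) <= norm z * nS S' W"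
proof -
  note l = H1D(1,2)[OF h]
  have [measurable]: "bm w" "bm W" using l by auto
  have lz: "l2 (rs S' (%x. W x *v z))" by (intro rs_l2 mv_l2 l) simp
  have "AE x in lborel. norm (rs S (%x. w (x + z) - w x) x) <= 1 * norm (av z (rs S' (%x. W x *v z)) x)"
    using H1_ftc[OF h, of z]
  proof eventually_elim
    fix x assume "w (x + z) - w x = av z (%x. W x *v z) x"
    moreover have "av z (%x. W x *v z) x = av z (rs S' (%x. W x *v z)) x" if "x \<in> S"
      using seg[OF that] by (intro av_cong) (auto simp: rs_def)
    ultimately show "norm (rs S (%x. w (x + z) - w x) x) <= 1 * norm (av z (rs S' (%x. W x *v z)) x)"
      by (auto simp: rs_def indicator_def)
  qed
  then have "nS S (%x. w (x + z) - w x) <= 1 * n2 (av z (rs S' (%x. W x *v z)))"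
    unfolding nS_def by (intro l2_cmp(2)[OF av_l2(1)[OF lz]]) (auto)
  also have "... <= n2 (rs S' (%x. W x *v z))" using av_l2(2)[OF lz] by simp
  also have "... <= norm z * nS S' W"
    unfolding nS_def[symmetric]
    by (rule nS_cmp(2)[OF rs_l2[OF l(2)]]) (use norm_mv_le in \<open>auto simp: mult.commute[of "norm z"]\<close>)
  finally show ?thesis .
qed

text \<open>Jensen's inequality inside the average and Tonelli reduce the claim to single
  translations by s z with s <= 1.\<close>

lemma n2_av_diff:
  fixes w :: "real^'d::finite => real^'m::finite"
  assumes h: "H1 w W" shows "n2 (%x. av z w x - w x) <= norm z * n2 W"
proof -
  note l = H1D(1,2)[OF h]
  have [measurable]: "bm w" "bm W" using l by auto
  have sh: "(NNI x. ennreal ((norm (w (x + s *R z) - w x))^2)) <= ennreal ((norm z * n2 W)^2)" if "0 <= s" "s <= 1" for s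
  proof -
    have "n2 (%x. w (x + s *R z) - w x) <= norm (s *R z) * n2 W"
      using shift_estimate[OF h, of UNIV UNIV "s *R z"] by (simp add: nS_def rs_def[abs_def])
    also have "... <= norm z * n2 W" using that by (intro mult_right_mono) (auto simp: mult_left_le_one_le)
    finally have "(n2 (%x. w (x + s *R z) - w x))^2 <= (norm z * n2 W)^2" by (intro power_mono) auto
    then show ?thesis
      by (simp add: nn_integral_l2[OF l2_diff(1)[OF l2_shift(1)[OF l(1)] l(1)]] ennreal_leI)
  qed
  let ?I = "%x. (NNI s. indicator {0..1::real} s * ennreal ((norm (w (x + s *R z) - w x))^2))"
  have "AE x in lborel. ennreal ((norm (av z w x - w x))^2) <= ?I x"
    using av_AE_integrable[OF l(1), of z]
  proof eventually_elim
    fix x assume i: "integrable lborel (%s. indicator {0..1::real} s *R w (x + s *R z))"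
    have "av z w x - w x = av z (%y. w y - w x) x"
    proof -
      have "(LBINT s. indicator {0..1::real} s *R w x) = w x"
        by (simp add: integral_scaleR_left)
      moreover have "integrable lborel (%s. indicator {0..1::real} s *R w x)" by auto
      ultimately show ?thesis using i by (simp add: av_def scaleR_diff_right)
    qed
    moreover have "ennreal ((norm (av z (%y. w y - w x) x))^2) <= ennreal 1 * ?I x"
    proof (rule av_jensen_pointwise)
      have "emeasure lborel {s\<in>{0..1::real}. w (x + s *R z) - w x ~= 0} <= emeasure lborel {0..1::real}"
        by (intro emeasure_mono) auto
      then show "emeasure lborel {s\<in>{0..1::real}. w (x + s *R z) - w x ~= 0} <= ennreal 1" by simp
    qed measurable
    ultimately show "ennreal ((norm (av z w x - w x))^2) <= ?I x" by simp
  qed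
  then have "(NNI x. ennreal ((norm (av z w x - w x))^2)) <= (NNI x. ?I x)"
    by (rule nn_integral_mono_AE)
  also have "... = (NNI s. (NNI x. indicator {0..1::real} s * ennreal ((norm (w (x + s *R z) - w x))^2)))"
    by (rule lborel_pair.Fubini') measurable
  also have "... <= (NNI s. ennreal ((norm z * n2 W)^2) * indicator {0..1::real} s)"
    using sh by (intro nn_integral_mono) (auto simp: indicator_def)
  also have "... = ennreal ((norm z * n2 W)^2)" by (subst nn_integral_cmult) auto
  finally show ?thesis by (intro l2I_nn(2)) auto
qed

section \<open>Hardy's inequality\<close>

lemma nn_integral_inverse_sqrt:
  assumes "0 < t" "t <= b"
  shows "(NNI s. indicator {0..1::real} s * ennreal (if s * b < t then 1 / sqrt (t - s * b) else 0)) <= ennreal (2 * sqrt t / b)"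
proof -
  have b: "b > 0" using assms by simp
  let ?F = "%s. - (2 / b) * sqrt (t - s * b)"
  let ?f = "%s. if s \<in> {0..t / b} then 1 / sqrt (t - s * b) else 0"
  have "((%s. 1 / sqrt (t - s * b)) has_integral (?F (t / b) - ?F 0)) {0..t / b}"
  proof (rule fundamental_theorem_of_calculus_interior)
    show "0 <= t / b" using assms by simp
    show "continuous_on {0..t / b} ?F" by (intro continuous_intros)
    fix s assume s: "s \<in> {0<..<t / b}"
    then have "t - s * b > 0" using b by (simp add: field_simps)
    then show "(?F has_vector_derivative 1 / sqrt (t - s * b)) (at s)"
      unfolding has_real_derivative_iff_has_vector_derivative[symmetric] using b
      by (auto intro!: derivative_eq_intros simp: field_simps)
  qed
  then have "(?f has_integral (?F (t / b) - ?F 0)) UNIV"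
    by (simp only: has_integral_restrict_UNIV)
  then have "(?f has_integral 2 * sqrt t / b) UNIV" using b by simp
  then have "(NNI s. ennreal (?f s)) = ennreal (2 * sqrt t / b)"
    using b by (intro nn_integral_has_integral_lborel) (auto intro!: divide_nonneg_nonneg simp: pos_le_divide_eq)
  moreover have "(NNI s. indicator {0..1::real} s * ennreal (if s * b < t then 1 / sqrt (t - s * b) else 0))
     <= (NNI s. ennreal (?f s))"
    by (intro nn_integral_mono) (auto simp: indicator_def pos_le_divide_eq b field_simps)
  ultimately show ?thesis by simp
qed

lemma nn_integral_power_minus_three_halves:
  assumes "0 < t" "0 < b"
  shows "(NNI s. indicator {0..1::real} s * ennreal (b / ((t + s * b) * sqrt (t + s * b)))) <= ennreal (2 / sqrt t)"
proof -
  let ?F = "%s. - 2 / sqrt (t + s * b)"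
  let ?f = "%s. b / ((t + s * b) * sqrt (t + s * b))"
  have pos: "t + s * b > 0" if "0 <= s" for s using that assms by (intro add_pos_nonneg) auto
  have "(NNI s. ennreal (?f s) * indicator {0..1} s) = ennreal (?F 1 - ?F 0)"
  proof (rule nn_integral_FTC_Icc)
    fix s :: real assume "s \<in> {0..1}"
    then have s: "0 <= s" "s <= 1" by auto
    show "DERIV ?F s :> ?f s"
      using pos[OF s(1)] by (auto intro!: derivative_eq_intros simp: field_simps power2_eq_square)
    show "0 <= ?f s" using pos[OF s(1)] assms by simp
  qed auto
  also have "... <= ennreal (2 / sqrt t)" using assms by (intro ennreal_leI) simp
  finally show ?thesis by (simp add: mult.commute)
qed

text \<open>At height t, \<open>w\<close> is the integral of \<open>W\<close> along the normal from
  the boundary, where it vanishes. Cauchy-Schwarz with the weight \<tau>^(1/4) split between the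
  factors bounds |w|^2 by 2 sqrt(t) times the integral of sqrt(\<tau>) |W|^2. After division by t^2
  the integrals are exchanged, and integrating 2 t^(-3/2) from \<tau> upwards gives 4 /
  sqrt(\<tau>); hence the constant 2 for the norms. The hypothesis \<open>star\<close> says that
  \<open>S\<close> contains the normal segment below each of its points, which holds for strips and
  for balls centred on the boundary.\<close>

lemma hardy:
  fixes w :: "real^'d::finite => real^'m::finite"
  assumes h: "H1 w W" and \<nu>: "norm \<nu> = 1" and [measurable]: "S \<in> sets borel"
    and w0: "!!x. x \<bullet> \<nu> - a <= 0 ==> w x = 0" and W0: "!!x. x \<bullet> \<nu> - a <= 0 ==> W x = 0"
    and b: "!!x. x \<in> S ==> x \<bullet> \<nu> - a <= b" "b > 0"
    and star: "!!x \<sigma>. x \<in> S ==> 0 <= \<sigma> ==> \<sigma> <= x \<bullet> \<nu> - a ==> x - \<sigma> *R \<nu> \<in> S"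
  shows "l2 (rs S (%x. (1 / (x \<bullet> \<nu> - a)) *R w x))" "nS S (%x. (1 / (x \<bullet> \<nu> - a)) *R w x) <= 2 * nS S W"
proof -
  note l = H1D(1,2)[OF h]
  have [measurable]: "bm w" "bm W" using l by auto
  define t where "t x = x \<bullet> \<nu> - a" for x
  have [measurable]: "bm t" unfolding t_def[abs_def] by measurable
  have tsh: "t (x + s *R (- b *R \<nu>)) = t x - s * b" for x s
    using \<nu> by (simp add: t_def inner_diff_left power2_norm_eq_inner[symmetric] flip: power2_norm_eq_inner)
  \<comment> \<open>One segment length \<open>b\<close> serves all points of \<open>S\<close>: from
    each of them the segment leaves the half space, so the almost everywhere identity is needed for
    a single vector only.\<close>
  let ?z = "- b *R \<nu>"
  let ?k = "%x s. indicator S x * (2 * b / (t x * sqrt (t x))) * (if s * b < t x then sqrt (t x - s * b) else 0) * (norm (W (x + s *R ?z)))^2"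
  let ?m = "%y s. indicator S y * 2 * sqrt (t y) * (norm (W y))^2 * (b / ((t y + s * b) * sqrt (t y + s * b)))"
  have pt: "AE x in lborel. ennreal ((norm (rs S (%x. (1 / t x) *R w x) x))^2)
     <= (NNI s. indicator {0..1::real} s * ennreal (?k x s))"
    using H1_ftc[OF h, of ?z] 
  proof eventually_elim
    fix x assume e: "w (x + ?z) - w x = av ?z (%x. W x *v ?z) x"
    show "ennreal ((norm (rs S (%x. (1 / t x) *R w x) x))^2) <= (NNI s. indicator {0..1::real} s * ennreal (?k x s))"
    proof (cases "x \<in> S & t x > 0")
      case False
      then have "rs S (%x. (1 / t x) *R w x) x = 0" using w0[of x] by (auto simp: rs_def t_def)
      then show ?thesis by simp
    next
      case True
      then have x: "x \<in> S" "t x > 0" "t x <= b" using b by (auto simp: t_def)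
      have "w (x + ?z) = 0" using w0[of "x + ?z"] tsh[of x 1] x(3) by (auto simp: t_def)
      then have wx: "norm (w x) = norm (av ?z (%x. W x *v ?z) x)" using e by (metis diff_0 norm_minus_cancel)
      \<comment> \<open>Fourth roots of the height distribute the weight over the two factors. Below
        the boundary both are set to 0, where \<open>W\<close> vanishes.\<close>
      let ?p = "%s. if s * b < t x then 1 / sqrt (sqrt (t x - s * b)) else 0"
      let ?q = "%s. (if s * b < t x then sqrt (sqrt (t x - s * b)) else 0) * norm (W (x + s *R ?z))"
      have W0': "W (x + s *R ?z) = 0" if "~ s * b < t x" for s
        using W0[of "x + s *R ?z"] tsh[of x s] that by (auto simp: t_def)
      define P where "P s = (indicator {0..1::real} s * ennreal (?p s))" for s
      define Q where "Q s = (indicator {0..1::real} s * ennreal (?q s))" for s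
      have [measurable]: "bm P" unfolding P_def[abs_def] by measurable
      have [measurable]: "bm Q" unfolding Q_def[abs_def] by measurable
      have "ennreal (norm (w x)) <= (NNI s. ennreal (norm (indicator {0..1::real} s *R (W (x + s *R ?z) *v ?z))))"
      proof (cases "integrable lborel (%s. indicator {0..1::real} s *R (W (x + s *R ?z) *v ?z))")
        case True then show ?thesis unfolding wx av_def by (rule integral_norm_bound_ennreal)
      qed (simp add: wx av_def not_integrable_integral_eq)
      also have "... <= (NNI s. ennreal b * (P s * Q s))"
      proof (intro nn_integral_mono)
        fix s :: real
        show "ennreal (norm (indicator {0..1::real} s *R (W (x + s *R ?z) *v ?z)))
           <= ennreal b * (P s * Q s)"
        proof (cases "s \<in> {0..1} & s * b < t x")
          case True
          have "norm (W (x + s *R ?z) *v ?z) <= norm (W (x + s *R ?z)) * norm ?z" by (rule norm_mv_le)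
          also have "... = b * (?p s * ?q s)" using True \<nu> b(2) by simp
          finally have "ennreal (norm (W (x + s *R ?z) *v ?z)) <= ennreal (b * (?p s * ?q s))" by (rule ennreal_leI)
          also have "... = ennreal b * (ennreal (?p s) * ennreal (?q s))"
          proof -
            have "ennreal (b * (p * q)) = ennreal b * (ennreal p * ennreal q)" if "0 <= p" "0 <= q" for p q
              using b(2) that by (simp add: ennreal_mult)
            from this[of "?p s" "?q s"] show ?thesis by auto
          qed
          finally show ?thesis using True by (simp add: P_def Q_def)
        next
          case False
          have "s \<notin> {0..1} | W (x + s *R ?z) *v ?z = 0"
          proof (cases "s * b < t x")
            case True with False show ?thesis by auto
          next
            case False
            show ?thesis unfolding W0'[OF False] by (simp add: vec_eq_iff matrix_vector_mult_def)
          qed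
          then show ?thesis by (auto simp: indicator_def simp del: scaleR_minus_left)
        qed
      qed
      also have "... = ennreal b * (NNI s. P s * Q s)"
        by (rule nn_integral_cmult) measurable
      finally have "(ennreal (norm (w x)))^2 <= (ennreal b * (NNI s. P s * Q s))^2"
        by (rule power_mono) simp
      also have "... = (ennreal b)^2 * (NNI s. P s * Q s)^2"
        by (rule power_mult_distrib)
      also have "... <= (ennreal b)^2 * ((NNI s. (P s)\<^sup>2) * (NNI s. (Q s)\<^sup>2))"
        by (rule mult_left_mono[OF Cauchy_Schwarz_nn_integral]) simp_all
      also have "(NNI s. (P s)\<^sup>2)
         = (NNI s. indicator {0..1::real} s * ennreal (if s * b < t x then 1 / sqrt (t x - s * b) else 0))"
        by (intro nn_integral_cong) (auto simp: P_def indicator_def ennreal_power power_divide)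
      also have "(ennreal b)^2 * (... * (NNI s. (Q s)\<^sup>2))
         <= (ennreal b)^2 * (ennreal (2 * sqrt (t x) / b) * (NNI s. (Q s)\<^sup>2))"
        by (rule mult_left_mono[OF mult_right_mono[OF nn_integral_inverse_sqrt[OF x(2,3)]]]) simp_all
      also have "... = ennreal (2 * b * sqrt (t x)) * (NNI s. (Q s)\<^sup>2)"
      proof -
        have "(ennreal b)^2 * ennreal (2 * sqrt (t x) / b) = ennreal (b^2 * (2 * sqrt (t x) / b))"
          using b(2) x(2) by (simp add: ennreal_power flip: ennreal_mult)
        also have "b^2 * (2 * sqrt (t x) / b) = 2 * b * sqrt (t x)" using b(2) by (simp add: power2_eq_square)
        finally show ?thesis by (simp only: mult.assoc[symmetric])
      qed
      finally have main: "ennreal ((norm (w x))^2) <= ennreal (2 * b * sqrt (t x)) * (NNI s. (Q s)\<^sup>2)"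
        by (simp add: ennreal_power)
      have "ennreal ((norm (rs S (%x. (1 / t x) *R w x) x))^2) = ennreal ((1 / t x)^2) * ennreal ((norm (w x))^2)"
        using x by (simp add: rs_def power_mult_distrib power_divide flip: ennreal_mult)
      also have "... <= ennreal ((1 / t x)^2) * (ennreal (2 * b * sqrt (t x)) * (NNI s. (Q s)\<^sup>2))"
        by (rule mult_left_mono[OF main]) simp
      also have "... = ennreal (2 * b / (t x * sqrt (t x))) * (NNI s. (Q s)\<^sup>2)"
      proof -
        have "(1 / t x)^2 * (2 * b * sqrt (t x)) = 2 * b / (t x * sqrt (t x))"
          using x by (simp add: power2_eq_square field_simps)
        moreover have "ennreal ((1 / t x)^2) * ennreal (2 * b * sqrt (t x)) = ennreal ((1 / t x)^2 * (2 * b * sqrt (t x)))"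
          using b(2) x by (intro ennreal_mult[symmetric]) auto
        ultimately show ?thesis by (simp only: mult.assoc[symmetric])
      qed
      also have "... = (NNI s. ennreal (2 * b / (t x * sqrt (t x))) * (Q s)^2)"
        by (rule nn_integral_cmult[symmetric]) measurable
      also have "... = (NNI s. indicator {0..1::real} s * ennreal (?k x s))"
      proof (intro nn_integral_cong)
        fix s :: real
        have "(?q s)^2 = (if s * b < t x then sqrt (t x - s * b) else 0) * (norm (W (x + s *R ?z)))^2"
          by (simp add: power_mult_distrib)
        then have "ennreal (2 * b / (t x * sqrt (t x))) * (ennreal (?q s))^2 = ennreal (?k x s)"
          using x b(2) by (simp add: ennreal_power mult.assoc flip: ennreal_mult)
        then show "ennreal (2 * b / (t x * sqrt (t x))) * (Q s)^2 = indicator {0..1::real} s * ennreal (?k x s)"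
          unfolding Q_def by (auto simp: indicator_def)
      qed
      finally show ?thesis .
    qed
  qed
  have "(NNI x. ennreal ((norm (rs S (%x. (1 / t x) *R w x) x))^2))
      <= (NNI x. (NNI s. indicator {0..1::real} s * ennreal (?k x s)))"
    by (rule nn_integral_mono_AE[OF pt])
  also have "... = (NNI s. (NNI x. indicator {0..1::real} s * ennreal (?k x s)))"
    by (rule lborel_pair.Fubini') measurable
  also have "... <= (NNI s. (NNI y. indicator {0..1::real} s * ennreal (?m y s)))"
  proof (rule nn_integral_mono)
    fix s :: real
    \<comment> \<open>The substitution y = x - s b \<nu> turns t(x) into t(y) + s b, and
      \<open>star\<close> keeps y in \<open>S\<close>.\<close>
    have "(NNI x. indicator {0..1::real} s * ennreal (?k x s)) <= (NNI x. indicator {0..1::real} s * ennreal (?m (x + s *R ?z) s))"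
    proof (intro nn_integral_mono)
      fix x
      show "indicator {0..1::real} s * ennreal (?k x s) <= indicator {0..1::real} s * ennreal (?m (x + s *R ?z) s)"
      proof (cases "s \<in> {0..1} & x \<in> S & s * b < t x")
        case True
        then have "x - (s * b) *R \<nu> \<in> S" using b(2) by (intro star) (auto simp: t_def)
        then have "x + s *R ?z \<in> S" by simp
        then show ?thesis unfolding tsh[of x s] using True by (simp add: mult_ac)
      qed (auto simp: indicator_def)
    qed
    also have "... = (NNI x. indicator {0..1::real} s * ennreal (?m x s))"
      by (rule nn_integral_shift[of "%x. indicator {0..1::real} s * ennreal (?m x s)"]) measurable
    finally show "(NNI x. indicator {0..1::real} s * ennreal (?k x s)) <= (NNI y. indicator {0..1::real} s * ennreal (?m y s))" .
  qed
  also have "... = (NNI y. (NNI s. indicator {0..1::real} s * ennreal (?m y s)))"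
    by (rule lborel_pair.Fubini'[symmetric]) measurable
  also have "... <= (NNI y. ennreal 4 * ennreal ((norm (rs S W y))^2))"
  proof (intro nn_integral_mono)
    fix y
    show "(NNI s. indicator {0..1::real} s * ennreal (?m y s)) <= ennreal 4 * ennreal ((norm (rs S W y))^2)"
    proof (cases "y \<in> S & t y > 0")
      case True
      have "(NNI s. indicator {0..1::real} s * ennreal (?m y s))
        = (NNI s. ennreal (2 * sqrt (t y) * (norm (W y))^2) * (indicator {0..1::real} s * ennreal (b / ((t y + s * b) * sqrt (t y + s * b)))))"
        using True b(2) by (intro nn_integral_cong) (auto simp: indicator_def simp flip: ennreal_mult)
      also have "... = ennreal (2 * sqrt (t y) * (norm (W y))^2) * (NNI s. indicator {0..1::real} s * ennreal (b / ((t y + s * b) * sqrt (t y + s * b))))"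
        by (rule nn_integral_cmult) measurable
      also have "... <= ennreal (2 * sqrt (t y) * (norm (W y))^2) * ennreal (2 / sqrt (t y))"
        using True b(2) by (intro mult_left_mono nn_integral_power_minus_three_halves) auto
      also have "... = ennreal 4 * ennreal ((norm (rs S W y))^2)"
        using True by (simp add: rs_def flip: ennreal_mult) (simp add: ennreal_mult)
      finally show ?thesis .
    next
      case False
      then have "y \<notin> S | W y = 0" using W0[of y] by (auto simp: t_def)
      then show ?thesis by auto
    qed
  qed
  also have "... = ennreal 4 * (NNI y. ennreal ((norm (rs S W y))^2))"
    by (rule nn_integral_cmult) measurable
  also have "... = ennreal ((2 * nS S W)^2)"
    by (simp add: nn_integral_l2[OF rs_l2[OF l(2)]] nS_def power_mult_distrib flip: ennreal_mult)
       (simp add: ennreal_mult)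
  finally have *: "(NNI x. ennreal ((norm (rs S (%x. (1 / t x) *R w x) x))^2)) <= ennreal ((2 * nS S W)^2)" .
  show "l2 (rs S (%x. (1 / (x \<bullet> \<nu> - a)) *R w x))" "nS S (%x. (1 / (x \<bullet> \<nu> - a)) *R w x) <= 2 * nS S W"
    unfolding nS_def[of S "%x. (1 / (x \<bullet> \<nu> - a)) *R w x"]
    by (rule l2I_nn[OF _ *[unfolded t_def]]; simp)+
qed

lemma nS_scaleR:
  assumes "l2 (rs S p)" shows "l2 (rs S (%x. c *R p x))" "nS S (%x. c *R p x) = \<bar>c\<bar> * nS S p"
  using l2_scaleR[OF assms, of c] by (simp_all add: nS_def rs_def[abs_def] mult.commute)

lemma n2_eq_nS:
  assumes "!!x. x \<notin> S ==> g x = 0" shows "n2 g = nS S g"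
  unfolding nS_def using assms by (intro arg_cong[where f=n2]) (auto simp: rs_def indicator_def fun_eq_iff)

lemma bounded_support_shift:
  fixes v :: "'a::real_normed_vector => 'b::zero"
  assumes "bounded {x. v x ~= 0}" shows "bounded {x. v (x + z) ~= 0}"
proof -
  have "{x. v (x + z) ~= 0} <= (%x. - z + x) ` {x. v x ~= 0}" by (auto intro!: image_eqI[where x="_ + z"])
  then show ?thesis using bounded_subset[OF bounded_translation[OF assms]] by blast
qed

lemma young: "x * y <= \<epsilon> * x^2 + y^2 / (4 * \<epsilon>)" if "\<epsilon> > 0" for x y \<epsilon> :: real
proof -
  have "0 <= (2 * \<epsilon> * x - y)^2" by simp
  then have "4 * \<epsilon> * (x * y) <= 4 * \<epsilon> * (\<epsilon> * x^2) + y^2" by (simp add: power2_diff power_mult_distrib algebra_simps power2_eq_square)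
  also have "... = 4 * \<epsilon> * (\<epsilon> * x^2 + y^2 / (4 * \<epsilon>))" using that by (simp add: field_simps)
  finally show ?thesis using that by simp
qed

lemma quadratic_bound:
  fixes x a b :: real
  assumes "x^2 <= a * x + b^2" "0 <= a" "0 <= b" "0 <= x"
  shows "x <= a + b"
proof (rule ccontr)
  assume "~ ?thesis"
  then have x: "x > a + b" by simp
  have "x * (a + b) <= x * x" using x assms(4) by (intro mult_left_mono) auto
  moreover have "b * b <= b * x" using x assms by (intro mult_left_mono) auto
  moreover have "x * x > 0" using x assms by (intro mult_pos_pos) auto
  moreover have "x * (a + b) < x * x" using x assms by (intro mult_strict_left_mono) auto
  ultimately show False using assms(1) by (simp add: power2_eq_square algebra_simps)
qed

section \<open>Energy estimates for compactly supported solutions\<close>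

text \<open>
  \<open>B x\<close> is the coefficient tensor at \<open>x\<close> acting on gradients; \<open>(w, W)\<close> is a compactly supported solution and its
  gradient in the half space \<open>x \<bullet> \<nu> > a\<close>, extended by zero.
\<close>

locale core = smooth_step c0 s s1 s2 for c0 s s1 s2 +
  fixes \<mu> \<Lambda> :: real and \<nu> :: "real^'d::finite" and a :: real
    and B :: "real^'d => real^'d^'m::finite => real^'d^'m"
    and w :: "real^'d => real^'m" and W f :: "real^'d => real^'d^'m" and h :: "real^'d => real^'m"
  assumes mu: "0 < \<mu>" and Lam: "0 <= \<Lambda>"
    and nu: "norm \<nu> = 1"
    and coer: "\<mu> * (norm \<Xi>)^2 <= B y \<Xi> \<bullet> \<Xi>" and bnd: "norm (B y \<Xi>) <= \<Lambda> * norm \<Xi>"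
    and lin: "linear (B y)"
    and Bmeas [measurable (raw)]: "bm V ==> bm (%x. B (x + z) (V x))"
    and wW: "H1 w W" and w0: "y \<bullet> \<nu> - a <= 0 ==> w y = 0" and W0: "y \<bullet> \<nu> - a <= 0 ==> W y = 0"
    and wbd: "bounded {x. w x ~= 0}"
    and fl: "l2 f" and hm [measurable]: "bm h"
    and hl: "l2 (%x. (x \<bullet> \<nu> - a) *R h x)"
    and eq: "H1 v V ==> bounded {x. v x ~= 0} ==> (!!x. x \<bullet> \<nu> - a <= 0 ==> v x = 0) ==>
      (!!x. x \<bullet> \<nu> - a <= 0 ==> V x = 0) ==>
      (LBINT x. B x (W x) \<bullet> V x) = - (LBINT x. f x \<bullet> V x) + (LBINT x. h x \<bullet> v x)"
begin

definition t :: "real^'d => real" where "t x = x \<bullet> \<nu> - a"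
abbreviation over_t :: "(real^'d => 'b::real_vector) => real^'d => 'b" where "over_t v == %x. (1 / t x) *R v x"
definition St :: "real => (real^'d) set" where "St \<rho> = {x. t x < \<rho>}"
text \<open>A norm, not its square: the energy E(\<rho>) is \<open>(e \<rho>)^2\<close>.\<close>

definition e :: "real => real" where "e \<rho> = nS (St \<rho>) W"
text \<open>\<open>h\<close> carries the factor \<open>t\<close> because it meets a test function v
  through (t h)(v / t), and Hardy's inequality controls v / t.\<close>

definition tau :: "real => real" where "tau \<rho> = nS (St \<rho>) f + nS (St \<rho>) (%x. t x *R h x)"

lemma t_measurable [measurable]: "bm t"
  unfolding t_def[abs_def] by measurable

lemma St_measurable [measurable]: "St \<rho> \<in> sets borel"
  unfolding St_def by measurable

lemma w_measurable [measurable]: "bm w" using wW by (auto dest: H1D)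
lemma W_measurable [measurable]: "bm W" using wW by (auto dest: H1D)
lemma f_measurable [measurable]: "bm f" using fl by auto
lemma wl: "l2 w" and Wl: "l2 W" using wW by (auto dest: H1D)

lemma Bmeas0 [measurable (raw)]: "bm V ==> bm (%x. B x (V x))"
  using Bmeas[of V 0] by simp

lemma t_shift: "t (x + z) = t x + z \<bullet> \<nu>"
  by (simp add: t_def inner_add_left)

lemma tw0: "t x <= 0 ==> w x = 0" and tW0: "t x <= 0 ==> W x = 0"
  using w0 W0 by (auto simp: t_def)

lemma nu_inner [simp]: "\<nu> \<bullet> \<nu> = 1"
  using nu by (simp add: norm_eq_1)

lemma St_mono: "\<rho> <= \<rho>' ==> St \<rho> <= St \<rho>'" by (auto simp: St_def)

lemma e_nonneg [simp]: "0 <= e \<rho>" by (simp add: e_def)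
lemma tau_nonneg [simp]: "0 <= tau \<rho>" by (simp add: tau_def)

lemma e_mono: "\<rho> <= \<rho>' ==> e \<rho> <= e \<rho>'"
  unfolding e_def by (intro nS_mono rs_l2 Wl St_mono) auto

lemma thl: "l2 (%x. t x *R h x)" using hl by (simp add: t_def)

lemma tau_mono: "\<rho> <= \<rho>' ==> tau \<rho> <= tau \<rho>'"
  unfolding tau_def by (intro add_mono nS_mono rs_l2 fl thl St_mono) auto

lemma tau_f: "nS (St \<rho>) f <= tau \<rho>" and tau_h: "nS (St \<rho>) (%x. t x *R h x) <= tau \<rho>"
  by (simp_all add: tau_def)

lemma hardy_w:
  assumes "\<rho> > 0"
  shows "l2 (rs (St \<rho>) (over_t w))" "nS (St \<rho>) (over_t w) <= 2 * e \<rho>"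
proof -
  have st: "x - \<sigma> *R \<nu> \<in> St \<rho>" if "x \<in> St \<rho>" "0 <= \<sigma>" for x \<sigma>
    using that t_shift[of x "- \<sigma> *R \<nu>"] by (auto simp: St_def)
  show "l2 (rs (St \<rho>) (over_t w))" "nS (St \<rho>) (over_t w) <= 2 * e \<rho>"
    unfolding t_def[abs_def] e_def
    by (rule hardy[OF wW nu _ w0 W0, where b=\<rho>]; use assms st in \<open>auto simp: St_def t_def\<close>)+
qed

lemma w_bound:
  assumes "\<rho> > 0" shows "nS (St \<rho>) w <= 2 * \<rho> * e \<rho>"
proof -
  have "nS (St \<rho>) w <= \<rho> * nS (St \<rho>) (over_t w)"
  proof (rule nS_cmp(2)[OF hardy_w(1)[OF assms]])
    fix x assume x: "x \<in> St \<rho>" "w x ~= 0"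
    then have "0 < t x" "t x < \<rho>" using tw0[of x] by (auto simp: St_def not_le[symmetric])
    then have "1 * norm (w x) <= (\<rho> / t x) * norm (w x)" by (intro mult_right_mono) auto
    then show "x \<in> St \<rho> & norm (w x) <= \<rho> * norm ((1 / t x) *R w x)" using x \<open>0 < t x\<close> by simp
  qed (use assms in auto)
  also have "... <= \<rho> * (2 * e \<rho>)" using hardy_w(2)[OF assms] assms by (intro mult_left_mono) auto
  finally show ?thesis by simp
qed

text \<open>The divergence part is paired with \<open>V\<close>, the other part with v / t; since v
  vanishes where t <= 0, the factors t and 1 / t cancel wherever the product is not 0.\<close>

lemma rhs_bound:
  assumes vl: "l2 v" and Vl: "l2 V" and r: "!!x. x \<notin> St r ==> v x = 0" "!!x. x \<notin> St r ==> V x = 0"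
    and v0: "!!x. t x <= 0 ==> v x = 0"
    and ql: "l2 (rs (St r) (over_t v))"
  shows "\<bar>- (LBINT x. f x \<bullet> V x) + (LBINT x. h x \<bullet> v x)\<bar>
    <= tau r * n2 V + tau r * nS (St r) (over_t v)"
proof -
  have [measurable]: "bm v" "bm V" using vl Vl by auto
  have 1: "\<bar>LBINT x. f x \<bullet> V x\<bar> <= nS (St r) f * nS (St r) V"
  proof (rule nS_cs(2)[OF rs_l2[OF fl] rs_l2[OF Vl]])
    have "x \<in> St r" if "f x \<bullet> V x ~= 0" for x using that r(2)[of x] by (cases "x \<in> St r") auto
    then show "AE x in lborel. f x \<bullet> V x ~= 0 --> x \<in> St r & x \<in> St r & \<bar>f x \<bullet> V x\<bar> <= norm (f x) * norm (V x)"
      by (intro AE_I2) (simp add: Cauchy_Schwarz_ineq2)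
  qed auto
  have 2: "\<bar>LBINT x. h x \<bullet> v x\<bar> <= nS (St r) (%x. t x *R h x) * nS (St r) (over_t v)"
  proof (rule nS_cs(2)[OF rs_l2[OF thl] ql])
    show "AE x in lborel. h x \<bullet> v x ~= 0 --> x \<in> St r & x \<in> St r & \<bar>h x \<bullet> v x\<bar> <= norm (t x *R h x) * norm ((1 / t x) *R v x)"
    proof (intro AE_I2 impI)
      fix x assume "h x \<bullet> v x ~= 0"
      then have "v x ~= 0" by auto
      then have "x \<in> St r" "t x > 0" using r(1) v0[of x] by (auto simp: not_le[symmetric])
      then show "x \<in> St r & x \<in> St r & \<bar>h x \<bullet> v x\<bar> <= norm (t x *R h x) * norm ((1 / t x) *R v x)"
        using Cauchy_Schwarz_ineq2[of "h x" "v x"] by simp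
    qed
  qed auto
  have 3: "nS (St r) f * nS (St r) V <= tau r * n2 V"
    by (intro mult_mono tau_f nS_le_n2 Vl) auto
  have 4: "nS (St r) (%x. t x *R h x) * nS (St r) (over_t v) <= tau r * nS (St r) (over_t v)"
    by (intro mult_right_mono tau_h) auto
  show ?thesis using 1 2 3 4 by linarith
qed

text \<open>\<open>kf \<rho>\<close> is \<open>w\<close> times minus the normal derivative of the cut-off \<open>s (2 - t / \<rho>)\<close>, and \<open>J \<rho>\<close> the flux through its layer.\<close>

definition kf :: "real => real^'d => real^'m" where
  "kf \<rho> x = (1 / \<rho> * s1 (2 - t x / \<rho>)) *R w x"

definition J :: "real => real" where
  "J \<rho> = (LBINT x. (B x (W x) *v \<nu>) \<bullet> kf \<rho> x)"

lemma BW_l2: "l2 (%x. B x (W x))"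
  by (rule l2_cmp(1)[OF Wl, where C=\<Lambda>]) (use bnd Lam in auto)

lemma kf_measurable [measurable]: "bm (kf \<rho>)"
  unfolding kf_def[abs_def] by measurable

lemma kf_support:
  assumes "\<rho> > 0" "kf \<rho> x ~= 0" shows "\<rho> < t x" "t x < 2 * \<rho>"
proof -
  have "~ (2 - t x / \<rho> <= 0 | 2 - t x / \<rho> >= 1)" using assms s1_0 by (auto simp: kf_def)
  then have "0 < 2 - t x / \<rho>" "2 - t x / \<rho> < 1" by auto
  then show "\<rho> < t x" "t x < 2 * \<rho>" using assms(1) by (auto simp: field_simps)
qed

lemma kf_le: "\<rho> > 0 ==> norm (kf \<rho> x) <= c0 / \<rho> * norm (w x)"
  unfolding kf_def norm_scaleR using s1_le[of "2 - t x / \<rho>"]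
  by (intro mult_right_mono) (auto simp: abs_mult divide_right_mono)

section \<open>Energy inequality and hole filling\<close>

lemma energy:
  assumes \<rho>: "\<rho> > 0"
  shows "\<mu> * (e \<rho>)^2 <= \<bar>J \<rho>\<bar> + (3 + 4 * c0) * tau (2 * \<rho>) * e (2 * \<rho>)"
proof -
  \<comment> \<open>Equal to 1 up to height \<rho> and to 0 from 2 \<rho> on, so that the term
    containing its derivative is exactly minus the flux \<open>J \<rho>\<close>.\<close>
  define g where "g \<tau> = s (2 - \<tau> / \<rho>)" for \<tau>
  define g' where "g' \<tau> = - (1 / \<rho> * s1 (2 - \<tau> / \<rho>))" for \<tau>
  have gd: "dn n g" for n
    using dn_affine[OF s_dn, of n "- 1 / \<rho>" 2] by (simp add: g_def[abs_def] algebra_simps)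
  have gder: "(g has_real_derivative g' x) (at x)" for x
  proof -
    have "((%\<tau>. 2 - \<tau> / \<rho>) has_real_derivative - (1 / \<rho>)) (at x)"
      using \<rho> by (auto intro!: derivative_eq_intros)
    from DERIV_chain2[OF s_der this] show ?thesis unfolding g_def[abs_def] g'_def by (simp add: mult.commute)
  qed
  have g01: "0 <= g x" "g x <= 1" for x using s_nn s_le by (auto simp: g_def)
  have g1: "g x = 1" if "x <= \<rho>" for x using that \<rho> by (auto simp: g_def intro!: s_1 simp: field_simps)
  have g0: "g x = 0" if "x >= 2 * \<rho>" for x using that \<rho> by (auto simp: g_def intro!: s_0 simp: field_simps)
  have g'0: "g' x = 0" if "x >= 2 * \<rho>" for x using that \<rho> by (auto simp: g'_def intro!: s1_0 simp: field_simps)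
  have g'b: "\<bar>g' x\<bar> <= c0 / \<rho>" for x using s1_le[of "2 - x / \<rho>"] \<rho> by (simp add: g'_def abs_mult divide_right_mono)
  define v where "v x = g (t x) *R w x" for x
  define V where "V x = g (t x) *R W x + g' (t x) *R outer (w x) \<nu>" for x
  have vV: "H1 v V"
    unfolding v_def[abs_def] V_def[abs_def] t_def[abs_def]
    by (rule H1_cut[OF wW gd gder, where c="max 1 (c0 / \<rho>)"])
       (use g01 g'b in \<open>auto simp: abs_le_iff le_max_iff_disj intro: order_trans[OF _ g01(2)]\<close>)
  note vl = H1D(1)[OF vV] and Vl = H1D(2)[OF vV]
  have [measurable]: "bm v" "bm V" using vl Vl by auto
  have gm[measurable]: "bm g" unfolding g_def[abs_def] by measurable
  have g'm[measurable]: "bm g'" unfolding g'_def[abs_def] by measurable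
  have EQ: "(LBINT x. B x (W x) \<bullet> V x) = - (LBINT x. f x \<bullet> V x) + (LBINT x. h x \<bullet> v x)"
    by (rule eq[OF vV]) (auto simp: v_def V_def w0 W0 outer_def vec_eq_iff intro: bounded_subset[OF wbd])
  have ql: "l2 (rs (St (2 * \<rho>)) (over_t v))"
    and q: "nS (St (2 * \<rho>)) (over_t v) <= 1 * nS (St (2 * \<rho>)) (over_t w)"
  proof -
    have *: "norm ((1 / t x) *R v x) <= 1 * norm ((1 / t x) *R w x)" for x
      using g01[of "t x"] by (simp add: v_def divide_right_mono mult_left_le_one_le)
    show "l2 (rs (St (2 * \<rho>)) (over_t v))"
      "nS (St (2 * \<rho>)) (over_t v) <= 1 * nS (St (2 * \<rho>)) (over_t w)"
      by (rule nS_cmp[OF hardy_w(1), where C=1]; use \<rho> * in auto)+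
  qed
  have g'w: "norm (g' (t x) *R outer (w x) \<nu>) <= c0 / \<rho> * norm (w x)" for x
    using mult_right_mono[OF g'b[of "t x"], of "norm (w x)"] by (simp add: norm_ou nu)
  \<comment> \<open>The derivative of the cut-off costs c0 / \<rho> times 4 \<rho> e(2 \<rho>),
    hence 1 + 4 c0; Hardy's inequality in the pairing with \<open>h\<close> adds 2, which makes the
    3 + 4 c0 of the claim.\<close>
  have "n2 V = nS (St (2 * \<rho>)) V"
    by (rule n2_eq_nS) (auto simp: V_def St_def g0 g'0)
  also have "... <= nS (St (2 * \<rho>)) (%x. g (t x) *R W x) + nS (St (2 * \<rho>)) (%x. g' (t x) *R outer (w x) \<nu>)"
    unfolding V_def[abs_def]
  proof (rule nS_add(2))
    show "l2 (rs (St (2 * \<rho>)) (%x. g (t x) *R W x))"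
      by (rule nS_cmp(1)[OF rs_l2[OF Wl St_measurable], where C=1]) (use g01 in \<open>auto simp: mult_left_le_one_le\<close>)
    show "l2 (rs (St (2 * \<rho>)) (%x. g' (t x) *R outer (w x) \<nu>))"
      by (rule nS_cmp(1)[OF rs_l2[OF wl St_measurable], where C="c0 / \<rho>"])
         (use g'w c0 \<rho> in auto)
  qed
  also have "... <= 1 * e (2 * \<rho>) + c0 / \<rho> * nS (St (2 * \<rho>)) w"
  proof (rule add_mono)
    show "nS (St (2 * \<rho>)) (%x. g (t x) *R W x) <= 1 * e (2 * \<rho>)"
      unfolding e_def by (rule nS_cmp(2)[OF rs_l2[OF Wl St_measurable], where C=1]) (use g01 in \<open>auto simp: mult_left_le_one_le\<close>)
    show "nS (St (2 * \<rho>)) (%x. g' (t x) *R outer (w x) \<nu>) <= c0 / \<rho> * nS (St (2 * \<rho>)) w"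
      by (rule nS_cmp(2)[OF rs_l2[OF wl St_measurable]])
         (use g'w c0 \<rho> in auto)
  qed
  also have "... <= 1 * e (2 * \<rho>) + c0 / \<rho> * (2 * (2 * \<rho>) * e (2 * \<rho>))"
    using \<rho> c0 by (intro add_left_mono mult_left_mono w_bound) auto
  also have "... = (1 + 4 * c0) * e (2 * \<rho>)" using \<rho> by (simp add: field_simps)
  finally have nV: "n2 V <= (1 + 4 * c0) * e (2 * \<rho>)" .
  have "\<bar>- (LBINT x. f x \<bullet> V x) + (LBINT x. h x \<bullet> v x)\<bar>
    <= tau (2 * \<rho>) * n2 V + tau (2 * \<rho>) * nS (St (2 * \<rho>)) (over_t v)"
    by (rule rhs_bound[OF vl Vl _ _ _ ql]) (auto simp: v_def V_def St_def g0 g'0 tw0)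
  also have "... <= tau (2 * \<rho>) * ((1 + 4 * c0) * e (2 * \<rho>)) + tau (2 * \<rho>) * (2 * e (2 * \<rho>))"
    using nV order_trans[OF q, of "2 * e (2 * \<rho>)"] hardy_w(2)[of "2 * \<rho>"] \<rho> by (intro add_mono mult_left_mono) auto
  also have "... = (3 + 4 * c0) * tau (2 * \<rho>) * e (2 * \<rho>)" by (simp add: algebra_simps)
  finally have R: "\<bar>LBINT x. B x (W x) \<bullet> V x\<bar> <= (3 + 4 * c0) * tau (2 * \<rho>) * e (2 * \<rho>)" unfolding EQ .
  have i1: "integrable lborel (%x. g (t x) * (B x (W x) \<bullet> W x))"
    by (rule l2_cs(1)[OF BW_l2 Wl])
       (use g01 in \<open>auto intro!: AE_I2 simp: abs_mult intro: order_trans[OF mult_left_le_one_le Cauchy_Schwarz_ineq2]\<close>)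
  have kl: "l2 (kf \<rho>)"
    by (rule l2_cmp(1)[OF wl, where C="c0 / \<rho>"]) (use kf_le[OF \<rho>] c0 \<rho> in auto)
  have i2: "integrable lborel (%x. (B x (W x) *v \<nu>) \<bullet> kf \<rho> x)"
    by (rule l2_inner(1)[OF mv_l2(1)[OF BW_l2] kl])
  have "(LBINT x. B x (W x) \<bullet> V x) = (LBINT x. g (t x) * (B x (W x) \<bullet> W x) - (B x (W x) *v \<nu>) \<bullet> kf \<rho> x)"
    by (intro lebesgue_cong) (auto simp: V_def kf_def g'_def inner_add_right inner_diff_right inner_ou)
  also have "... = (LBINT x. g (t x) * (B x (W x) \<bullet> W x)) - J \<rho>"
    using i1 i2 by (simp add: J_def)
  finally have split: "(LBINT x. B x (W x) \<bullet> V x) = (LBINT x. g (t x) * (B x (W x) \<bullet> W x)) - J \<rho>" .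
  have "\<mu> * (e \<rho>)^2 = (LBINT x. \<mu> * (norm (rs (St \<rho>) W x))^2)"
    by (simp add: e_def nS_def n2_power2)
  also have "... <= (LBINT x. g (t x) * (B x (W x) \<bullet> W x))"
  proof (rule integral_mono)
    show "integrable lborel (%x. \<mu> * (norm (rs (St \<rho>) W x))^2)"
      using rs_l2[OF Wl St_measurable, of \<rho>] by (auto simp: l2_def)
    show "\<mu> * (norm (rs (St \<rho>) W x))^2 <= g (t x) * (B x (W x) \<bullet> W x)" for x
    proof (cases "x \<in> St \<rho>")
      case True then show ?thesis using coer[of "W x" x] g1[of "t x"] by (simp add: rs_def St_def)
    next
      case False
      have "0 <= \<mu> * (norm (W x))^2" using mu by simp
      also have "... <= B x (W x) \<bullet> W x" by (rule coer)
      finally show ?thesis using False g01 by (simp add: rs_def)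
    qed
  qed (rule i1)
  finally show ?thesis using split R by linarith
qed

text \<open>The flux lives in the layer between \<rho> and 2 \<rho>, whose energy is the difference
  of two strip energies.\<close>

lemma J_annulus:
  assumes \<rho>: "\<rho> > 0"
  shows "\<bar>J \<rho>\<bar> <= 4 * c0 * \<Lambda> * sqrt ((e (2 * \<rho>))^2 - (e \<rho>)^2) * e (2 * \<rho>)"
proof -
  define A where "A = {x. \<rho> <= t x & t x < 2 * \<rho>}"
  have Am[measurable]: "A \<in> sets borel" unfolding A_def by measurable
  have "(e (2 * \<rho>))^2 = (e \<rho>)^2 + (nS A W)^2"
  proof -
    have "St (2 * \<rho>) = St \<rho> \<union> A" using \<rho> by (auto simp: St_def A_def)
    moreover have "St \<rho> \<inter> A = {}" by (auto simp: St_def A_def)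
    ultimately show ?thesis unfolding e_def using nS_pythagoras[OF Wl St_measurable Am, of \<rho>] by simp
  qed
  then have nA: "nS A W = sqrt ((e (2 * \<rho>))^2 - (e \<rho>)^2)" by simp
  have "\<bar>J \<rho>\<bar> <= nS A (%x. (\<Lambda> * c0 / \<rho>) *R W x) * nS (St (2 * \<rho>)) w"
    unfolding J_def
  proof (rule nS_cs(2))
    show "l2 (rs A (%x. (\<Lambda> * c0 / \<rho>) *R W x))" by (intro nS_scaleR rs_l2 Wl) simp
    show "l2 (rs (St (2 * \<rho>)) w)" by (intro rs_l2 wl) simp
    show "AE x in lborel. (B x (W x) *v \<nu>) \<bullet> kf \<rho> x ~= 0 --> x \<in> A & x \<in> St (2 * \<rho>) &
       \<bar>(B x (W x) *v \<nu>) \<bullet> kf \<rho> x\<bar> <= norm ((\<Lambda> * c0 / \<rho>) *R W x) * norm (w x)"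
    proof (intro AE_I2 impI conjI)
      fix x assume "(B x (W x) *v \<nu>) \<bullet> kf \<rho> x ~= 0"
      then have "kf \<rho> x ~= 0" by auto
      from kf_support[OF \<rho> this] show "x \<in> A" "x \<in> St (2 * \<rho>)" by (auto simp: A_def St_def)
      have "\<bar>(B x (W x) *v \<nu>) \<bullet> kf \<rho> x\<bar> <= norm (B x (W x) *v \<nu>) * norm (kf \<rho> x)" by (rule Cauchy_Schwarz_ineq2)
      also have "... <= (\<Lambda> * norm (W x)) * (c0 / \<rho> * norm (w x))"
        using norm_mv_le[of "B x (W x)" \<nu>] bnd[of x "W x"] nu kf_le[OF \<rho>, of x] Lam by (intro mult_mono) auto
      also have "... = norm ((\<Lambda> * c0 / \<rho>) *R W x) * norm (w x)" using Lam c0 \<rho> by simp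
      finally show "\<bar>(B x (W x) *v \<nu>) \<bullet> kf \<rho> x\<bar> <= norm ((\<Lambda> * c0 / \<rho>) *R W x) * norm (w x)" .
    qed
  qed measurable
  also have "nS A (%x. (\<Lambda> * c0 / \<rho>) *R W x) = \<Lambda> * c0 / \<rho> * nS A W"
    using Lam c0 \<rho> by (subst nS_scaleR(2)[OF rs_l2[OF Wl Am]]) simp
  also have "... * nS (St (2 * \<rho>)) w <= \<Lambda> * c0 / \<rho> * nS A W * (2 * (2 * \<rho>) * e (2 * \<rho>))"
    using \<rho> c0 Lam by (intro mult_left_mono w_bound) auto
  also have "... = 4 * c0 * \<Lambda> * nS A W * e (2 * \<rho>)" using \<rho> by simp
  finally show ?thesis unfolding nA .
qed

text \<open>The contraction ratio of hole filling: with K = 4 c0 \<Lambda>, the energy inequality in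
  which K^2 / \<mu> times the inner energy has been added to both sides has this quotient of
  coefficients.\<close>

definition lam :: real where "lam = (\<mu> / 2 + (4 * c0 * \<Lambda>)^2 / \<mu>) / (\<mu> + (4 * c0 * \<Lambda>)^2 / \<mu>)"

lemma lam: "0 < lam" "lam < 1"
proof -
  define K where "K = (4 * c0 * \<Lambda>)^2 / \<mu>"
  have K: "K >= 0" using mu by (simp add: K_def)
  then show "0 < lam" "lam < 1" unfolding lam_def K_def[symmetric] using mu by (auto intro!: divide_pos_pos add_pos_nonneg simp: divide_less_eq_1)
qed

text \<open>Widman's hole filling. Young's inequality splits the flux bound into a small multiple of
  the whole energy and a multiple of the layer energy e(2 \<rho>)^2 - e(\<rho>)^2, whose negative
  part is moved to the left.\<close>

lemma hole_filling:
  assumes \<rho>: "\<rho> > 0"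
  shows "(e \<rho>)^2 <= lam * (e (2 * \<rho>))^2 + ((3 + 4 * c0) / \<mu>)^2 * (tau (2 * \<rho>))^2"
proof -
  define K where "K = 4 * c0 * \<Lambda>"
  define C where "C = 3 + 4 * c0"
  define D where "D = (e (2 * \<rho>))^2 - (e \<rho>)^2"
  have D: "0 <= D" using e_mono[of \<rho> "2 * \<rho>"] \<rho> by (simp add: D_def power_mono)
  have "\<mu> * (e \<rho>)^2 <= (K * sqrt D) * e (2 * \<rho>) + (C * tau (2 * \<rho>)) * e (2 * \<rho>)"
    using energy[OF \<rho>] J_annulus[OF \<rho>] by (simp add: K_def C_def D_def mult.assoc)
  also have "... <= (\<mu> / 4 * (e (2 * \<rho>))^2 + (K * sqrt D)^2 / (4 * (\<mu> / 4)))
      + (\<mu> / 4 * (e (2 * \<rho>))^2 + (C * tau (2 * \<rho>))^2 / (4 * (\<mu> / 4)))"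
    using mu young[of "\<mu> / 4" "e (2 * \<rho>)" "K * sqrt D"] young[of "\<mu> / 4" "e (2 * \<rho>)" "C * tau (2 * \<rho>)"]
    by (intro add_mono) (simp_all add: mult.commute)
  also have "... = \<mu> / 2 * (e (2 * \<rho>))^2 + K^2 / \<mu> * D + (C * tau (2 * \<rho>))^2 / \<mu>"
    using mu D by (simp add: power_mult_distrib)
  finally have *: "(\<mu> + K^2 / \<mu>) * (e \<rho>)^2 <= (\<mu> / 2 + K^2 / \<mu>) * (e (2 * \<rho>))^2 + (C * tau (2 * \<rho>))^2 / \<mu>"
    by (simp add: D_def algebra_simps)
  have P: "\<mu> + K^2 / \<mu> > 0" using mu by (intro add_pos_nonneg) auto
  have "(e \<rho>)^2 <= ((\<mu> / 2 + K^2 / \<mu>) * (e (2 * \<rho>))^2 + (C * tau (2 * \<rho>))^2 / \<mu>) / (\<mu> + K^2 / \<mu>)"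
    using * P by (simp add: pos_le_divide_eq mult.commute)
  also have "... = lam * (e (2 * \<rho>))^2 + (C * tau (2 * \<rho>))^2 / \<mu> / (\<mu> + K^2 / \<mu>)"
    unfolding lam_def K_def[symmetric] by (subst add_divide_distrib) (simp only: times_divide_eq_left)
  also have "... <= lam * (e (2 * \<rho>))^2 + (C * tau (2 * \<rho>))^2 / \<mu> / \<mu>"
    using mu P by (intro add_left_mono divide_left_mono) auto
  also have "(C * tau (2 * \<rho>))^2 / \<mu> / \<mu> = (C / \<mu>)^2 * (tau (2 * \<rho>))^2"
    using mu by (simp add: power2_eq_square field_simps)
  finally show ?thesis by (simp add: C_def)
qed

text \<open>Repeated halving. The data of all intermediate strips are bounded by those at
  \<open>r\<close>, and the geometric weights sum to at most 1 / (1 - lam).\<close>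

lemma hole_filling_iter:
  assumes r: "r > 0"
  shows "(e (r / 2 ^ k))^2 <= lam ^ k * (e r)^2 + ((3 + 4 * c0) / \<mu>)^2 / (1 - lam) * (tau r)^2"
proof (induction k)
  case 0
  have "0 <= ((3 + 4 * c0) / \<mu>)^2 / (1 - lam) * (tau r)^2" using lam by simp
  then show ?case by simp
next
  case (Suc k)
  define C where "C = ((3 + 4 * c0) / \<mu>)^2"
  have C0: "0 <= C" by (simp add: C_def)
  have r': "r / 2 ^ Suc k > 0" "2 * (r / 2 ^ Suc k) = r / 2 ^ k" using r by auto
  have "(e (r / 2 ^ Suc k))^2 <= lam * (e (r / 2 ^ k))^2 + C * (tau (r / 2 ^ k))^2"
    using hole_filling[OF r'(1)] unfolding r'(2) C_def .
  also have "... <= lam * (lam ^ k * (e r)^2 + C / (1 - lam) * (tau r)^2) + C * (tau r)^2"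
    using Suc lam C0 tau_mono[of "r / 2 ^ k" r] r
    by (intro add_mono mult_left_mono power_mono) (auto simp: C_def field_simps)
  also have "... = lam ^ Suc k * (e r)^2 + C / (1 - lam) * (tau r)^2"
    using lam by (simp add: field_simps)
  finally show ?case by (simp add: C_def)
qed

section \<open>Caccioppoli inequality for differences along nearly tangential vectors\<close>

text \<open>The plateau cut-off vanishes near the boundary, where the difference quotient does not have zero trace.\<close>
definition pl :: "real => real => real => real" where
  "pl \<kappa> r \<tau> = s (\<tau> / \<kappa> - 2) * s (3 - 4 * \<tau> / r)"
definition pl' :: "real => real => real => real" where
  "pl' \<kappa> r \<tau> = s1 (\<tau> / \<kappa> - 2) / \<kappa> * s (3 - 4 * \<tau> / r) - 4 / r * s1 (3 - 4 * \<tau> / r) * s (\<tau> / \<kappa> - 2)"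

text \<open>Margins: a translation with normal component at most \<kappa> keeps the support of this
  cut-off between the heights \<kappa> and \<open>r\<close>, and 6 \<kappa> <= r leaves room for the
  plateau from 3 \<kappa> to r / 2.\<close>

lemma pl_props:
  assumes k: "0 < \<kappa>" "6 * \<kappa> <= r"
  shows "dn n (pl \<kappa> r)" "(pl \<kappa> r has_real_derivative pl' \<kappa> r x) (at x)"
    "0 <= pl \<kappa> r x" "pl \<kappa> r x <= 1"
    "x <= 2 * \<kappa> ==> pl \<kappa> r x = 0" "3 * r / 4 <= x ==> pl \<kappa> r x = 0"
    "3 * \<kappa> <= x ==> x <= r / 2 ==> pl \<kappa> r x = 1"
    "x <= 2 * \<kappa> ==> pl' \<kappa> r x = 0" "3 * r / 4 <= x ==> pl' \<kappa> r x = 0"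
    "\<bar>pl' \<kappa> r x\<bar> <= (if x < 3 * \<kappa> then c0 / \<kappa> else 0) + 4 * c0 / r"
    "\<bar>pl' \<kappa> r x\<bar> <= c0 / \<kappa> + 4 * c0 / r"
proof -
  have r: "r > 0" using k by linarith
  have "dn n (%\<tau>. s (1 / \<kappa> * \<tau> + (-2)))" "dn n (%\<tau>. s ((- 4 / r) * \<tau> + 3))" by (intro dn_affine s_dn)+
  from dn_mult[OF this] show "dn n (pl \<kappa> r)" by (simp add: pl_def[abs_def] algebra_simps)
  have d1: "((%\<tau>. s (\<tau> / \<kappa> - 2)) has_real_derivative s1 (x / \<kappa> - 2) / \<kappa>) (at x)"
  proof -
    have "((%\<tau>. \<tau> / \<kappa> - 2) has_real_derivative 1 / \<kappa>) (at x)" using k by (auto intro!: derivative_eq_intros)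
    from DERIV_chain2[OF s_der this] show ?thesis by simp
  qed
  have d2: "((%\<tau>. s (3 - 4 * \<tau> / r)) has_real_derivative - (4 / r * s1 (3 - 4 * x / r))) (at x)"
  proof -
    have "((%\<tau>. 3 - 4 * \<tau> / r) has_real_derivative - (4 / r)) (at x)" using r by (auto intro!: derivative_eq_intros)
    from DERIV_chain2[OF s_der this] show ?thesis by (simp add: mult.commute)
  qed
  show "(pl \<kappa> r has_real_derivative pl' \<kappa> r x) (at x)"
    unfolding pl_def[abs_def] pl'_def using DERIV_mult[OF d1 d2] by simp
  show "0 <= pl \<kappa> r x" "pl \<kappa> r x <= 1" using s_nn s_le by (auto simp: pl_def intro: mult_le_one)
  show "x <= 2 * \<kappa> ==> pl \<kappa> r x = 0" "x <= 2 * \<kappa> ==> pl' \<kappa> r x = 0"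
    using k by (auto simp: pl_def pl'_def s_0 s1_0 divide_le_eq)
  show "3 * r / 4 <= x ==> pl \<kappa> r x = 0" "3 * r / 4 <= x ==> pl' \<kappa> r x = 0"
    using r by (auto simp: pl_def pl'_def s_0 s1_0 le_divide_eq)
  show "3 * \<kappa> <= x ==> x <= r / 2 ==> pl \<kappa> r x = 1"
    using k r by (auto simp: pl_def s_1 le_divide_eq divide_le_eq)
  have b1: "\<bar>s1 (x / \<kappa> - 2) / \<kappa> * s (3 - 4 * x / r)\<bar> <= (if x < 3 * \<kappa> then c0 / \<kappa> else 0)"
  proof (cases "x < 3 * \<kappa>")
    case True
    have "\<bar>s1 (x / \<kappa> - 2)\<bar> / \<kappa> * s (3 - 4 * x / r) <= c0 / \<kappa> * 1"
      using k s1_le s_nn s_le c0 by (intro mult_mono divide_right_mono) auto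
    then show ?thesis using True k s_nn by (simp add: abs_mult)
  next
    case False
    then have "s1 (x / \<kappa> - 2) = 0" using k by (intro s1_0) (auto simp: le_divide_eq)
    then show ?thesis using False by simp
  qed
  have b2: "\<bar>4 / r * s1 (3 - 4 * x / r) * s (x / \<kappa> - 2)\<bar> <= 4 * c0 / r"
  proof -
    have "4 / r * \<bar>s1 (3 - 4 * x / r)\<bar> * s (x / \<kappa> - 2) <= 4 / r * c0 * 1"
      using r s1_le s_nn s_le c0 by (intro mult_mono mult_left_mono) auto
    then show ?thesis using r s_nn by (simp add: abs_mult)
  qed
  show B: "\<bar>pl' \<kappa> r x\<bar> <= (if x < 3 * \<kappa> then c0 / \<kappa> else 0) + 4 * c0 / r"
    unfolding pl'_def using b1 b2 by linarith
  have "0 <= c0 / \<kappa>" using c0 k by simp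
  then show "\<bar>pl' \<kappa> r x\<bar> <= c0 / \<kappa> + 4 * c0 / r" using B by (auto split: if_splits)
qed

text \<open>The equation is tested with g^2 d and with its translate by -z; subtraction gives an
  equation for the difference \<open>d\<close> with a coefficient error of size \<omega>. Near the
  boundary the cut-off has slope 1 / \<kappa>, and there \<open>d\<close> is bounded by the energy
  in the strip of width 4 \<kappa>; elsewhere the slope is 1 / r and \<open>d\<close> is bounded by
  |z| e(r). The parameter \<beta> balances the product of data and energy.\<close>

lemma difference_estimate:
  assumes k: "0 < \<kappa>" "6 * \<kappa> <= r" and z: "\<bar>z \<bullet> \<nu>\<bar> <= \<kappa>" and om: "0 <= \<omega>"
    and per: "!!x \<Xi>. norm (B (x + z) \<Xi> - B x \<Xi>) <= \<omega> * norm \<Xi>" and be: "0 < \<beta>" "\<beta> <= 1"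
  shows "nS (St (r / 2)) (%x. W (x + z) - W x)
    <= 20 * c0 * ((2 * \<Lambda> + 2) / \<mu> + 8 / sqrt \<mu> + 1) * ((norm z / r + \<omega> + \<beta>) * e r + e (4 * \<kappa>) + tau r / \<beta>)"
proof -
  have r: "r > 0" using k by linarith
  define d where "d x = w (x + z) - w x" for x
  define D where "D x = W (x + z) - W x" for x
  define g where "g x = pl \<kappa> r (t x)" for x
  define g' where "g' x = pl' \<kappa> r (t x)" for x
  note pp = pl_props[OF k]
  have gm[measurable]: "bm g"
    unfolding g_def[abs_def] pl_def by measurable
  have g'm[measurable]: "bm g'"
    unfolding g'_def[abs_def] pl'_def by measurable
  have dm[measurable]: "bm d" "bm D"
    unfolding d_def[abs_def] D_def[abs_def] by measurable
  have hd: "H1 d D" unfolding d_def[abs_def] D_def[abs_def] by (rule H1_diff[OF H1_shift[OF wW] wW])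
  note dl = H1D(1,2)[OF hd]
  define v where "v x = (g x)^2 *R d x" for x
  define V where "V x = (g x)^2 *R D x + (2 * g x * g' x) *R outer (d x) \<nu>" for x
  have g01: "0 <= g x" "g x <= 1" "(g x)^2 <= g x" for x
    using pp(3,4)[of "t x"] by (auto simp: g_def power2_eq_square mult_left_le)
  have vV: "H1 v V"
  proof -
    have bd: "\<bar>pl' \<kappa> r x\<bar> <= c0 / \<kappa> + 4 * c0 / r" for x by (rule pp(11))
    have p: "0 <= c0 / \<kappa> + 4 * c0 / r" using c0 k r by simp
    have "H1 (%x. (pl \<kappa> r (t x))\<^sup>2 *R d x) (%x. (pl \<kappa> r (t x))\<^sup>2 *R D x + (2 * pl \<kappa> r (t x) * pl' \<kappa> r (t x)) *R outer (d x) \<nu>)"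
      unfolding t_def
    proof (rule H1_cut[OF hd, where c="1 + 2 * (c0 / \<kappa> + 4 * c0 / r)"])
      show "dn n (%x. (pl \<kappa> r x)\<^sup>2)" for n unfolding power2_eq_square by (intro dn_mult pp(1))
      show "((%x. (pl \<kappa> r x)\<^sup>2) has_real_derivative 2 * pl \<kappa> r x * pl' \<kappa> r x) (at x)" for x
        using pp(2) by (auto intro!: derivative_eq_intros)
      show "\<bar>(pl \<kappa> r x)\<^sup>2\<bar> <= 1 + 2 * (c0 / \<kappa> + 4 * c0 / r)" for x
        using pp(3,4)[of x] p power_le_one[of "pl \<kappa> r x" 2] by simp
      show "\<bar>2 * pl \<kappa> r x * pl' \<kappa> r x\<bar> <= 1 + 2 * (c0 / \<kappa> + 4 * c0 / r)" for x
      proof -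
        have "pl \<kappa> r x * \<bar>pl' \<kappa> r x\<bar> <= 1 * (c0 / \<kappa> + 4 * c0 / r)"
          using pp(3,4)[of x] bd[of x] p by (intro mult_mono) auto
        then show ?thesis using pp(3)[of x] by (simp add: abs_mult)
      qed
    qed
    then show ?thesis by (simp add: v_def[abs_def] V_def[abs_def] g_def g'_def)
  qed
  note vl = H1D(1)[OF vV] and Vl = H1D(2)[OF vV]
  have [measurable]: "bm v" "bm V" using vl Vl by auto
  have g0: "g x = 0" "g' x = 0" if "t x <= 2 * \<kappa> | 3 * r / 4 <= t x" for x
    using that pp(5,6,8,9)[of "t x"] by (auto simp: g_def g'_def)
  have v0: "v x = 0" "V x = 0" if "t x <= 2 * \<kappa> | 3 * r / 4 <= t x" for x
    using g0[OF that] by (auto simp: v_def V_def)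
  have bdd: "bounded {x. d x ~= 0}"
    by (rule bounded_subset[OF bounded_Un[THEN iffD2, OF conjI[OF bounded_support_shift[OF wbd, of z] wbd]]])
       (auto simp: d_def)
  have bdv: "bounded {x. v x ~= 0}" by (rule bounded_subset[OF bdd]) (auto simp: v_def)
  have EQ1: "(LBINT x. B x (W x) \<bullet> V x) = - (LBINT x. f x \<bullet> V x) + (LBINT x. h x \<bullet> v x)"
    by (rule eq[OF vV bdv]) (use v0 k in \<open>auto simp: t_def[symmetric]\<close>)
  have tz: "t (x - z) = t x - z \<bullet> \<nu>" for x by (simp add: t_def inner_diff_left)
  have v0': "v (x - z) = 0" "V (x - z) = 0" if "t x <= \<kappa> | r <= t x" for x
  proof -
    have "t (x - z) <= 2 * \<kappa> | 3 * r / 4 <= t (x - z)"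
      using that z k r unfolding tz[of x] abs_le_iff by (elim disjE) linarith+
    from v0[OF this] show "v (x - z) = 0" "V (x - z) = 0" .
  qed
  have vVz: "H1 (%x. v (x - z)) (%x. V (x - z))" using H1_shift[OF vV, of "- z"] by simp
  have EQ2: "(LBINT x. B x (W x) \<bullet> V (x - z)) = - (LBINT x. f x \<bullet> V (x - z)) + (LBINT x. h x \<bullet> v (x - z))"
    by (rule eq[OF vVz]) (use v0' k bounded_support_shift[OF bdv, of "- z"] in \<open>auto simp: t_def[symmetric]\<close>)
  have hw: "l2 (rs (St r) (over_t w))" "nS (St r) (over_t w) <= 2 * e r"
    by (rule hardy_w[OF r])+
  \<comment> \<open>On the support of the cut-off t > 2 \<kappa>, so t(x) and t(x + z) are
    comparable and Hardy's inequality for \<open>w\<close> controls d / t. The constant 5 is 3/2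
    times 2, from the translate, plus 2.\<close>
  define Q where "Q x = (if 2 * \<kappa> < t x & t x < 3 * r / 4 then (1 / t x) *R d x else 0)" for x
  have Qm[measurable]: "bm Q" unfolding Q_def[abs_def] by measurable
  have Qb: "l2 Q" "n2 Q <= 5 * e r"
  proof -
    define q where "q x = rs (St r) (over_t w) x" for x
    have ql: "l2 q" "n2 q <= 2 * e r" using hw by (auto simp: q_def[abs_def] nS_def)
    define q1 where "q1 x = (if 2 * \<kappa> < t x & t x < 3 * r / 4 then (1 / t x) *R w (x + z) else 0)" for x
    define q2 where "q2 x = (if 2 * \<kappa> < t x & t x < 3 * r / 4 then (1 / t x) *R w x else 0)" for x
    have [measurable]: "bm q1" "bm q2"
      unfolding q1_def[abs_def] q2_def[abs_def] by measurable
    have a1: "norm (q1 x) <= (3/2) * norm (q (x + z))" for x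
    proof (cases "2 * \<kappa> < t x & t x < 3 * r / 4")
      case True
      have tt: "t (x + z) = t x + z \<bullet> \<nu>" by (rule t_shift)
      then have "t (x + z) > 0" "t (x + z) <= (3/2) * t x" "t (x + z) < r" using True z k by auto
      then have "1 / t x <= (3/2) * (1 / t (x + z))" using True k by (simp add: divide_simps)
      then have "1 / t x * norm (w (x + z)) <= (3/2) * (1 / t (x + z)) * norm (w (x + z))" by (intro mult_right_mono) auto
      then show ?thesis using True k \<open>t (x + z) > 0\<close> \<open>t (x + z) < r\<close> by (simp add: q1_def q_def rs_def St_def)
    qed (auto simp: q1_def)
    have a2: "norm (q2 x) <= 1 * norm (q x)" for x
      using r by (auto simp: q2_def q_def rs_def St_def)
    have l1: "l2 q1" "n2 q1 <= (3/2) * n2 (%x. q (x + z))"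
      by (rule l2_cmp[OF l2_shift(1)[OF ql(1), of z], where C="3/2"]; use a1 in auto)+
    have l2': "l2 q2" "n2 q2 <= 1 * n2 q" by (rule l2_cmp[OF ql(1), where C=1]; use a2 in auto)+
    have Qe: "Q = (%x. q1 x - q2 x)" by (auto simp: Q_def q1_def q2_def d_def scaleR_diff_right fun_eq_iff)
    show "l2 Q" unfolding Qe by (rule l2_diff(1)[OF l1(1) l2'(1)])
    have "n2 Q <= n2 q1 + n2 q2" unfolding Qe by (rule l2_diff(2)[OF l1(1) l2'(1)])
    then show "n2 Q <= 5 * e r" using l1(2) l2'(2) ql(2) l2_shift(2)[OF ql(1), of z] by simp
  qed
  have vQ: "norm ((1 / t x) *R v x) <= 1 * norm (Q x)" for x
  proof (cases "t x <= 2 * \<kappa> | 3 * r / 4 <= t x")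
    case False
    then have "t x > 0" using k by auto
    then show ?thesis using False g01[of x] by (simp add: v_def Q_def divide_right_mono mult_left_le_one_le power_le_one)
  qed (simp add: v0)
  have vQ': "norm ((1 / t x) *R v (x - z)) <= 2 * norm (Q (x - z))" for x
  proof (cases "t (x - z) <= 2 * \<kappa> | 3 * r / 4 <= t (x - z)")
    case False
    then have t1: "t (x - z) > 0" using k by auto
    have "t x = t (x - z) + z \<bullet> \<nu>" using tz[of x] by simp
    then have t2: "t x > 0" "t (x - z) <= 2 * t x" using False z k by auto
    then have "1 / t x <= 2 * (1 / t (x - z))" using t1 by (simp add: divide_simps)
    then have "1 / t x * norm (v (x - z)) <= 2 * (1 / t (x - z)) * norm (v (x - z))" by (intro mult_right_mono) auto
    also have "... = 2 * norm ((1 / t (x - z)) *R v (x - z))" using t1 by simp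
    also have "... <= 2 * norm (Q (x - z))" using vQ[of "x - z"] by simp
    finally show ?thesis using t2 by simp
  qed (simp add: v0)
  have R1: "\<bar>LBINT x. B x (W x) \<bullet> V x\<bar> <= tau r * n2 V + tau r * (5 * e r)"
  proof -
    have a: "l2 (rs (St r) (over_t v))" "nS (St r) (over_t v) <= 1 * nS (St r) Q"
      by (rule nS_cmp[OF rs_l2[OF Qb(1)], where C=1]; use vQ in auto)+
    have "nS (St r) (over_t v) <= 5 * e r" using a(2) nS_le_n2[OF Qb(1), of "St r"] Qb(2) by simp
    then have b: "tau r * nS (St r) (over_t v) <= tau r * (5 * e r)" by (intro mult_left_mono) auto
    have "\<bar>LBINT x. B x (W x) \<bullet> V x\<bar> <= tau r * n2 V + tau r * nS (St r) (over_t v)"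
      unfolding EQ1 by (rule rhs_bound[OF vl Vl _ _ _ a(1)]) (use v0 k r in \<open>auto simp: St_def\<close>)
    then show ?thesis using b by linarith
  qed
  \<comment> \<open>On the support of the translated test function t(x - z) <= 2 t(x), which doubles
    the constant 5.\<close>
  have R2: "\<bar>LBINT x. B x (W x) \<bullet> V (x - z)\<bar> <= tau r * n2 V + tau r * (10 * e r)"
  proof -
    have sl: "l2 (%x. Q (x - z))" "n2 (%x. Q (x - z)) = n2 Q" using l2_shift[OF Qb(1), of "- z"] by auto
    have a: "l2 (rs (St r) (%x. (1 / t x) *R v (x - z)))" "nS (St r) (%x. (1 / t x) *R v (x - z)) <= 2 * nS (St r) (%x. Q (x - z))"
      by (rule nS_cmp[OF rs_l2[OF sl(1)], where C=2]; use vQ' in auto)+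
    have "nS (St r) (%x. (1 / t x) *R v (x - z)) <= 10 * e r" using a(2) nS_le_n2[OF sl(1), of "St r"] Qb(2) sl(2) by simp
    then have b: "tau r * nS (St r) (%x. (1 / t x) *R v (x - z)) <= tau r * (10 * e r)" by (intro mult_left_mono) auto
    have nV: "n2 (%x. V (x - z)) = n2 V" using l2_shift(2)[OF Vl, of "- z"] by simp
    have "\<bar>LBINT x. B x (W x) \<bullet> V (x - z)\<bar> <= tau r * n2 (%x. V (x - z)) + tau r * nS (St r) (%x. (1 / t x) *R v (x - z))"
      unfolding EQ2 by (rule rhs_bound[OF H1D(1,2)[OF vVz] _ _ _ a(1)]) (use v0' k r in \<open>auto simp: St_def\<close>)
    then show ?thesis using b nV by simp
  qed
  define X where "X = n2 (%x. g x *R D x)"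
  define Y where "Y = n2 (%x. g' x *R d x)"
  have gDl: "l2 (%x. g x *R D x)" by (rule l2_cmp(1)[OF dl(2), where C=1]) (use g01 in \<open>auto simp: mult_left_le_one_le\<close>)
  define M where "M = c0 / \<kappa> + 4 * c0 / r"
  have g'b: "\<bar>g' x\<bar> <= M" for x using pp(11)[of "t x"] by (simp add: g'_def M_def)
  have M0: "0 <= M" using c0 k r by (simp add: M_def)
  have gdb: "norm (g' x *R d x) <= M * norm (d x)" for x using mult_right_mono[OF g'b[of x]] by simp
  have gdl: "l2 (%x. g' x *R d x)" by (rule l2_cmp(1)[OF dl(1), where C=M]) (use gdb M0 in auto)
  have ogd: "norm (outer (d x) \<nu>) = norm (d x)" for x by (simp add: norm_ou nu)
  have nV: "n2 V <= X + 2 * Y"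
  proof -
    have 1: "l2 (%x. (g x)\<^sup>2 *R D x)" "n2 (%x. (g x)\<^sup>2 *R D x) <= 1 * X"
      unfolding X_def by (rule l2_cmp[OF gDl, where C=1]; use g01 in \<open>auto intro!: AE_I2 mult_right_mono\<close>)+
    have *: "norm ((2 * g x * g' x) *R outer (d x) \<nu>) <= 2 * norm (g' x *R d x)" for x
    proof -
      have "g x * (\<bar>g' x\<bar> * norm (d x)) <= 1 * (\<bar>g' x\<bar> * norm (d x))" using g01 by (intro mult_right_mono) auto
      then show ?thesis using g01[of x] by (simp add: ogd abs_mult mult.assoc)
    qed
    have 2: "l2 (%x. (2 * g x * g' x) *R outer (d x) \<nu>)" "n2 (%x. (2 * g x * g' x) *R outer (d x) \<nu>) <= 2 * Y"
      unfolding Y_def by (rule l2_cmp[OF gdl, where C=2]; use * in \<open>auto intro!: AE_I2\<close>)+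
    show ?thesis using l2_add(2)[OF 1(1) 2(1)] 1(2) 2(2) by (simp add: V_def[abs_def])
  qed
  \<comment> \<open>Below height 3 \<kappa> both \<open>w\<close> and its translate have norm at
    most 8 \<kappa> e(4 \<kappa>), hence the 16; the second term is the translation estimate along
    z.\<close>
  have Yb: "Y <= 16 * c0 * e (4 * \<kappa>) + 4 * c0 * (norm z / r) * e r"
  proof -
    define y1 where "y1 x = (c0 / \<kappa>) *R rs (St (3 * \<kappa>)) d x" for x
    define y2 where "y2 x = (4 * c0 / r) *R rs (St (3 * r / 4)) d x" for x
    define G where "G x = norm (y1 x) + norm (y2 x)" for x
    have l1: "l2 (rs (St (3 * \<kappa>)) d)" "l2 (rs (St (3 * r / 4)) d)" by (intro rs_l2 dl; simp)+
    have n1: "l2 y1" "n2 y1 = c0 / \<kappa> * nS (St (3 * \<kappa>)) d"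
      using l2_scaleR[OF l1(1), of "c0 / \<kappa>"] c0 k by (auto simp: y1_def[abs_def] nS_def)
    have n2': "l2 y2" "n2 y2 = 4 * c0 / r * nS (St (3 * r / 4)) d"
      using l2_scaleR[OF l1(2), of "4 * c0 / r"] c0 r by (auto simp: y2_def[abs_def] nS_def)
    have nn: "l2 (%x. norm (y x))" "n2 (%x. norm (y x)) = n2 y" if "l2 y" for y :: "real^'d => real^'m"
      using that by (auto simp: l2_def n2_def)
    have Gl: "l2 G" "n2 G <= n2 y1 + n2 y2"
      using l2_add[OF nn(1)[OF n1(1)] nn(1)[OF n2'(1)]] nn(2)[OF n1(1)] nn(2)[OF n2'(1)] by (auto simp: G_def[abs_def])
    have gG: "norm (g' x *R d x) <= 1 * norm (G x)" for x
    proof -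
      have p: "0 <= c0 / \<kappa>" "0 <= 4 * c0 / r" using c0 k r by auto
      show ?thesis
      proof (cases "t x < 3 * r / 4")
        case False then show ?thesis using g0[of x] by simp
      next
        case True
        have "\<bar>g' x\<bar> * norm (d x) <= ((if t x < 3 * \<kappa> then c0 / \<kappa> else 0) + 4 * c0 / r) * norm (d x)"
          using pp(10)[of "t x"] by (intro mult_right_mono) (auto simp: g'_def)
        also have "... = G x" using True c0 k r by (simp add: G_def y1_def y2_def rs_def St_def distrib_right)
        also have "... <= norm (G x)" by simp
        finally show ?thesis by simp
      qed
    qed
    have "Y <= 1 * n2 G" unfolding Y_def by (rule l2_cmp(2)[OF Gl(1)]) (use gG in auto)
    also have "... <= c0 / \<kappa> * nS (St (3 * \<kappa>)) d + 4 * c0 / r * nS (St (3 * r / 4)) d" using Gl(2) n1 n2' by simp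
    also have "... <= c0 / \<kappa> * (16 * \<kappa> * e (4 * \<kappa>)) + 4 * c0 / r * (norm z * e r)"
    proof (intro add_mono mult_left_mono)
      have wsl: "l2 (%x. w (x + z))" by (rule l2_shift(1)[OF wl])
      have "nS (St (3 * \<kappa>)) d <= nS (St (3 * \<kappa>)) (%x. w (x + z)) + nS (St (3 * \<kappa>)) w"
        unfolding d_def[abs_def] by (intro nS_diff rs_l2 wl wsl) auto
      also have "nS (St (3 * \<kappa>)) (%x. w (x + z)) <= nS (St (4 * \<kappa>)) w"
      proof -
        have sl: "l2 (%x. rs (St (4 * \<kappa>)) w (x + z))" "n2 (%x. rs (St (4 * \<kappa>)) w (x + z)) = nS (St (4 * \<kappa>)) w"
          using l2_shift[OF rs_l2[OF wl St_measurable], of "4 * \<kappa>" z] by (auto simp: nS_def)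
        have "norm (rs (St (3 * \<kappa>)) (%x. w (x + z)) x) <= 1 * norm (rs (St (4 * \<kappa>)) w (x + z))" for x
          using z t_shift[of x z] by (auto simp: rs_def St_def indicator_def)
        then have "n2 (rs (St (3 * \<kappa>)) (%x. w (x + z))) <= 1 * n2 (%x. rs (St (4 * \<kappa>)) w (x + z))"
          by (intro l2_cmp(2)[OF sl(1)]) auto
        then show ?thesis using sl(2) by (simp add: nS_def)
      qed
      also have "nS (St (3 * \<kappa>)) w <= nS (St (4 * \<kappa>)) w"
        using k by (intro nS_mono rs_l2 wl St_mono) auto
      also have "nS (St (4 * \<kappa>)) w <= 2 * (4 * \<kappa>) * e (4 * \<kappa>)" using k by (intro w_bound) auto
      finally show "nS (St (3 * \<kappa>)) d <= 16 * \<kappa> * e (4 * \<kappa>)" by simp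
      show "nS (St (3 * r / 4)) d <= norm z * e r"
        unfolding d_def[abs_def] e_def
      proof (rule shift_estimate[OF wW])
        fix x \<sigma> assume x: "x \<in> St (3 * r / 4)" and \<sigma>: "0 <= \<sigma>" "\<sigma> <= (1::real)"
        have "\<sigma> * (z \<bullet> \<nu>) <= \<kappa>"
        proof -
          have "\<sigma> * (z \<bullet> \<nu>) <= \<sigma> * \<bar>z \<bullet> \<nu>\<bar>" using \<sigma> by (intro mult_left_mono) auto
          also have "... <= 1 * \<kappa>" using z \<sigma> by (intro mult_mono) auto
          finally show ?thesis by simp
        qed
        then show "x + \<sigma> *R z \<in> St r" using x k t_shift[of x "\<sigma> *R z"] by (auto simp: St_def)
      qed auto
    qed (use c0 k r in auto)
    also have "... = 16 * c0 * e (4 * \<kappa>) + 4 * c0 * (norm z / r) * e r" using k by simp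
    finally show ?thesis .
  qed
  have WzL: "l2 (%x. W (x + z))" by (rule l2_shift(1)[OF Wl])
  have BzL: "l2 (%x. B (x + z) (W (x + z)))" by (rule l2_shift(1)[OF BW_l2])
  have shiftB: "(LBINT x. B x (W x) \<bullet> V (x - z)) = (LBINT x. B (x + z) (W (x + z)) \<bullet> V x)"
    using integral_shift[of "%x. B x (W x) \<bullet> V (x - z)" z] by simp
  have BD: "B (x + z) (W (x + z)) - B x (W x) = B x (D x) + (B (x + z) (W (x + z)) - B x (W (x + z)))" for x
    using linear_diff[OF lin, of x "W (x + z)" "W x"] by (simp add: D_def)
  have BDl: "l2 (%x. B x (D x))" by (rule l2_cmp(1)[OF dl(2), where C=\<Lambda>]) (use bnd Lam in auto)
  define E where "E x = B (x + z) (W (x + z)) - B x (W (x + z))" for x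
  have El: "l2 E"
  proof -
    have "l2 (%x. B x (W (x + z)))" by (rule l2_cmp(1)[OF WzL, where C=\<Lambda>]) (use bnd Lam in auto)
    then show ?thesis unfolding E_def[abs_def] by (rule l2_diff(1)[OF BzL])
  qed
  \<comment> \<open>The translation is moved from the test function onto the flux; \<open>E\<close>
    collects the change of the coefficients along z.\<close>
  have main: "(LBINT x. B x (D x) \<bullet> V x) = (LBINT x. B x (W x) \<bullet> V (x - z)) - (LBINT x. B x (W x) \<bullet> V x) - (LBINT x. E x \<bullet> V x)"
  proof -
    have "(LBINT x. B (x + z) (W (x + z)) \<bullet> V x) - (LBINT x. B x (W x) \<bullet> V x)
       = (LBINT x. B (x + z) (W (x + z)) \<bullet> V x - B x (W x) \<bullet> V x)"
      using l2_inner(1)[OF BzL Vl] l2_inner(1)[OF BW_l2 Vl] by simp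
    also have "... = (LBINT x. B x (D x) \<bullet> V x + E x \<bullet> V x)"
      unfolding inner_diff_left[symmetric] BD E_def inner_add_left[symmetric] ..
    also have "... = (LBINT x. B x (D x) \<bullet> V x) + (LBINT x. E x \<bullet> V x)"
      using l2_inner(1)[OF BDl Vl] l2_inner(1)[OF El Vl] by simp
    finally show ?thesis unfolding shiftB by simp
  qed
  have Eb: "\<bar>LBINT x. E x \<bullet> V x\<bar> <= \<omega> * e r * n2 V"
  proof -
    define S where "S = St (3 * r / 4)"
    have Sm[measurable]: "S \<in> sets borel" by (simp add: S_def)
    have n: "nS S (%x. W (x + z)) <= e r"
    proof -
      have sl: "l2 (%x. rs (St r) W (x + z))" "n2 (%x. rs (St r) W (x + z)) = e r"
        using l2_shift[OF rs_l2[OF Wl St_measurable], of r z] by (auto simp: nS_def e_def)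
      have "norm (rs S (%x. W (x + z)) x) <= 1 * norm (rs (St r) W (x + z))" for x
        using z k t_shift[of x z] by (auto simp: rs_def St_def S_def indicator_def)
      then have "n2 (rs S (%x. W (x + z))) <= 1 * n2 (%x. rs (St r) W (x + z))"
        by (intro l2_cmp(2)[OF sl(1)]) auto
      then show ?thesis using sl(2) by (simp add: nS_def)
    qed
    have "\<bar>LBINT x. E x \<bullet> V x\<bar> <= nS S E * nS S V"
    proof (rule nS_cs(2)[OF rs_l2[OF El Sm] rs_l2[OF Vl Sm]])
      have "x \<in> S" if "E x \<bullet> V x ~= 0" for x using that v0(2)[of x] by (cases "t x < 3 * r / 4") (auto simp: S_def St_def)
      then show "AE x in lborel. E x \<bullet> V x ~= 0 --> x \<in> S & x \<in> S & \<bar>E x \<bullet> V x\<bar> <= norm (E x) * norm (V x)"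
        by (intro AE_I2) (simp add: Cauchy_Schwarz_ineq2)
    qed (use El in auto)
    also have "nS S E <= \<omega> * nS S (%x. W (x + z))"
      by (rule nS_cmp(2)[OF rs_l2[OF WzL Sm]]) (use per om El in \<open>auto simp: E_def\<close>)
    also have "\<omega> * nS S (%x. W (x + z)) * nS S V <= \<omega> * e r * n2 V"
      using n om nS_le_n2[OF Vl Sm] by (intro mult_mono mult_left_mono) auto
    finally show ?thesis by (simp add: mult_right_mono)
  qed
  have low: "\<mu> * X^2 <= (LBINT x. B x (D x) \<bullet> V x) + 2 * \<Lambda> * X * Y"
  proof -
    have i1: "integrable lborel (%x. (g x)\<^sup>2 * (B x (D x) \<bullet> D x))"
      by (rule l2_cs(1)[OF BDl dl(2)])
         (use g01 in \<open>auto intro!: AE_I2 simp: abs_mult power_le_one intro: order_trans[OF mult_left_le_one_le Cauchy_Schwarz_ineq2]\<close>)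
    have Bgl: "l2 (%x. g x *R B x (D x))" "n2 (%x. g x *R B x (D x)) <= \<Lambda> * X"
    proof -
      have "norm (g x *R B x (D x)) <= \<Lambda> * norm (g x *R D x)" for x
        using mult_left_mono[OF bnd[of x "D x"], of "g x"] g01 by (simp add: mult.left_commute)
      then show "l2 (%x. g x *R B x (D x))" "n2 (%x. g x *R B x (D x)) <= \<Lambda> * X"
        unfolding X_def using dm Lam by (intro l2_cmp[OF gDl, where C=\<Lambda>]; auto)+
    qed
    have i2: "integrable lborel (%x. (2 * g x * g' x) * ((B x (D x) *v \<nu>) \<bullet> d x))"
      and n2'': "\<bar>LBINT x. (2 * g x * g' x) * ((B x (D x) *v \<nu>) \<bullet> d x)\<bar> <= n2 (%x. 2 *R (g x *R B x (D x))) * Y"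
    proof -
      have *: "\<bar>(2 * g x * g' x) * ((B x (D x) *v \<nu>) \<bullet> d x)\<bar> <= norm (2 *R (g x *R B x (D x))) * norm (g' x *R d x)" for x
      proof -
        have "\<bar>(B x (D x) *v \<nu>) \<bullet> d x\<bar> <= norm (B x (D x) *v \<nu>) * norm (d x)" by (rule Cauchy_Schwarz_ineq2)
        also have "... <= norm (B x (D x)) * norm (d x)"
          using norm_mv_le[of "B x (D x)" \<nu>] nu by (intro mult_right_mono) auto
        finally have "(2 * g x * \<bar>g' x\<bar>) * \<bar>(B x (D x) *v \<nu>) \<bullet> d x\<bar> <= (2 * g x * \<bar>g' x\<bar>) * (norm (B x (D x)) * norm (d x))"
          using g01 by (intro mult_left_mono) auto
        then show ?thesis using g01[of x] by (simp add: abs_mult mult_ac)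
      qed
      show "integrable lborel (%x. (2 * g x * g' x) * ((B x (D x) *v \<nu>) \<bullet> d x))"
        "\<bar>LBINT x. (2 * g x * g' x) * ((B x (D x) *v \<nu>) \<bullet> d x)\<bar> <= n2 (%x. 2 *R (g x *R B x (D x))) * Y"
        unfolding Y_def by (rule l2_cs[OF l2_scaleR(1)[OF Bgl(1), of 2] gdl]; use * in auto)+
    qed
    have "n2 (%x. 2 *R (g x *R B x (D x))) * Y <= 2 * \<Lambda> * X * Y"
      using l2_scaleR(2)[OF Bgl(1), of 2] Bgl(2) by (intro mult_right_mono) (auto simp: Y_def)
    moreover have "(LBINT x. B x (D x) \<bullet> V x) = (LBINT x. (g x)\<^sup>2 * (B x (D x) \<bullet> D x) + (2 * g x * g' x) * ((B x (D x) *v \<nu>) \<bullet> d x))"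
      by (intro lebesgue_cong) (auto simp: V_def inner_add_right inner_ou)
    moreover have "... = (LBINT x. (g x)\<^sup>2 * (B x (D x) \<bullet> D x)) + (LBINT x. (2 * g x * g' x) * ((B x (D x) *v \<nu>) \<bullet> d x))"
      using i1 i2 by simp
    moreover have "\<mu> * X^2 <= (LBINT x. (g x)\<^sup>2 * (B x (D x) \<bullet> D x))"
    proof -
      have "\<mu> * X^2 = (LBINT x. \<mu> * (norm (g x *R D x))^2)" by (simp add: X_def n2_power2)
      also have "... <= (LBINT x. (g x)\<^sup>2 * (B x (D x) \<bullet> D x))"
      proof (rule integral_mono[OF _ i1])
        show "integrable lborel (%x. \<mu> * (norm (g x *R D x))^2)" using gDl by (auto simp: l2_def)
        show "\<mu> * (norm (g x *R D x))^2 <= (g x)^2 * (B x (D x) \<bullet> D x)" for x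
          using mult_left_mono[OF coer[of "D x" x], of "(g x)^2"] by (simp add: power_mult_distrib mult.left_commute)
      qed
      finally show ?thesis .
    qed
    ultimately show ?thesis using n2'' by linarith
  qed
  define T where "T = tau r"
  define m where "m = \<omega> * e r + 2 * T"
  have T0: "0 <= T" and X0: "0 <= X" and Y0: "0 <= Y" by (auto simp: T_def X_def Y_def)
  have m0: "0 <= m" using om T0 by (simp add: m_def)
  have ineq: "\<mu> * X^2 <= (2 * \<Lambda> * Y + m) * X + 2 * Y * m + 15 * (T * e r)"
  proof -
    have "(LBINT x. B x (D x) \<bullet> V x) <= m * n2 V + 15 * (T * e r)"
      unfolding main using R1 R2 Eb by (simp add: m_def T_def algebra_simps)
    also have "... <= m * (X + 2 * Y) + 15 * (T * e r)" using nV m0 by (intro add_right_mono mult_left_mono) auto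
    finally show ?thesis using low by (simp add: algebra_simps)
  qed
  \<comment> \<open>Chosen so that q^2 contains 2 T e(r): the mixed term of data and energy is
    thereby dominated by a square.\<close>
  define q where "q = \<beta> * e r + T / \<beta>"
  have q0: "0 <= q" using be T0 by (simp add: q_def)
  have Te: "T * e r <= q^2"
  proof -
    have "q^2 = (\<beta> * e r)^2 + (T / \<beta>)^2 + 2 * (e r * T)" using be by (simp add: q_def power2_sum)
    moreover have "0 <= e r * T" using T0 by simp
    ultimately show ?thesis using zero_le_power2[of "\<beta> * e r"] zero_le_power2[of "T / \<beta>"] by (simp only: mult.commute[of T])
  qed
  have YM: "2 * Y * m + 15 * (T * e r) <= (4 * (Y + m + q))^2"
  proof -
    have E: "(4 * (Y + m + q))^2 = 16 * Y^2 + 16 * m^2 + 16 * q^2 + 32 * (Y * m) + 32 * (Y * q) + 32 * (m * q)"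
      by (simp add: power2_eq_square algebra_simps)
    have "0 <= Y * m" "0 <= Y * q" "0 <= m * q" "0 <= Y^2" "0 <= m^2" "0 <= q^2" using Y0 m0 q0 by auto
    then show ?thesis unfolding E mult.assoc[of 2 Y m] using Te by linarith
  qed
  have Xb: "X <= (2 * \<Lambda> * Y + m) / \<mu> + 4 * (Y + m + q) / sqrt \<mu>"
  proof (rule quadratic_bound)
    have "X^2 <= ((2 * \<Lambda> * Y + m) * X + (4 * (Y + m + q))^2) / \<mu>"
      using ineq YM mu by (simp add: pos_le_divide_eq mult.commute)
    also have "... = (2 * \<Lambda> * Y + m) / \<mu> * X + (4 * (Y + m + q) / sqrt \<mu>)^2"
      by (subst add_divide_distrib) (simp only: power_divide real_sqrt_pow2[OF less_imp_le[OF mu]] times_divide_eq_left)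
    finally show "X^2 <= (2 * \<Lambda> * Y + m) / \<mu> * X + (4 * (Y + m + q) / sqrt \<mu>)^2" .
  qed (use mu Lam Y0 m0 q0 X0 in auto)
  define C1 where "C1 = (2 * \<Lambda> + 2) / \<mu> + 8 / sqrt \<mu>"
  have C1: "0 <= C1" using mu Lam by (simp add: C1_def)
  have XC: "X <= C1 * (Y + m + q)"
  proof -
    have "(2 * \<Lambda> * Y + m) / \<mu> <= (2 * \<Lambda> + 2) * (Y + m + q) / \<mu>"
    proof (intro divide_right_mono)
      have "0 <= \<Lambda> * m" "0 <= \<Lambda> * q" using Lam m0 q0 by auto
      then show "2 * \<Lambda> * Y + m <= (2 * \<Lambda> + 2) * (Y + m + q)" using Y0 m0 q0 by (simp add: algebra_simps)
    qed (use mu in auto)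
    moreover have "4 * (Y + m + q) / sqrt \<mu> <= 8 / sqrt \<mu> * (Y + m + q)"
      using mu Y0 m0 q0 by (simp add: divide_right_mono)
    ultimately show ?thesis using Xb by (simp add: C1_def algebra_simps)
  qed
  \<comment> \<open>Below 3 \<kappa> the cut-off need not be 1; there the gradient and its translate
    are each bounded by e(4 \<kappa>) outright.\<close>
  have near: "nS (St (r / 2)) D <= X + 2 * e (4 * \<kappa>)"
  proof -
    define y1 where "y1 x = rs (St (3 * \<kappa>)) D x" for x
    define G where "G x = norm (g x *R D x) + norm (y1 x)" for x
    have y1l: "l2 y1" unfolding y1_def[abs_def] by (intro rs_l2 dl) simp
    have nn: "l2 (%x. norm (y x))" "n2 (%x. norm (y x)) = n2 y" if "l2 y" for y :: "real^'d => real^'d^'m"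
      using that by (auto simp: l2_def n2_def)
    have Gl: "l2 G" "n2 G <= X + n2 y1"
      using l2_add[OF nn(1)[OF gDl] nn(1)[OF y1l]] nn(2)[OF gDl] nn(2)[OF y1l] by (auto simp: G_def[abs_def] X_def)
    have "norm (rs (St (r / 2)) D x) <= 1 * norm (G x)" for x
    proof (cases "t x < r / 2")
      case True
      show ?thesis
      proof (cases "t x < 3 * \<kappa>")
        case True then show ?thesis by (auto simp: G_def y1_def rs_def St_def indicator_def)
      next
        case False
        then have "g x = 1" using True pp(7)[of "t x"] by (simp add: g_def)
        then show ?thesis by (auto simp: G_def rs_def indicator_def)
      qed
    qed (simp add: rs_def St_def)
    then have "nS (St (r / 2)) D <= 1 * n2 G" unfolding nS_def by (intro l2_cmp(2)[OF Gl(1)]) auto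
    moreover have "n2 y1 <= 2 * e (4 * \<kappa>)"
    proof -
      have sl: "l2 (%x. rs (St (4 * \<kappa>)) W (x + z))" "n2 (%x. rs (St (4 * \<kappa>)) W (x + z)) = e (4 * \<kappa>)"
        using l2_shift[OF rs_l2[OF Wl St_measurable], of "4 * \<kappa>" z] by (auto simp: nS_def e_def)
      have "norm (rs (St (3 * \<kappa>)) (%x. W (x + z)) x) <= 1 * norm (rs (St (4 * \<kappa>)) W (x + z))" for x
        using z t_shift[of x z] by (auto simp: rs_def St_def indicator_def)
      then have "n2 (rs (St (3 * \<kappa>)) (%x. W (x + z))) <= 1 * n2 (%x. rs (St (4 * \<kappa>)) W (x + z))"
        by (intro l2_cmp(2)[OF sl(1)]) auto
      then have 1: "nS (St (3 * \<kappa>)) (%x. W (x + z)) <= e (4 * \<kappa>)" using sl(2) by (simp add: nS_def)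
      have 2: "nS (St (3 * \<kappa>)) W <= e (4 * \<kappa>)" using e_mono[of "3 * \<kappa>" "4 * \<kappa>"] k by (simp add: e_def)
      have "n2 y1 = nS (St (3 * \<kappa>)) D" by (simp add: y1_def[abs_def] nS_def)
      also have "... <= nS (St (3 * \<kappa>)) (%x. W (x + z)) + nS (St (3 * \<kappa>)) W"
        unfolding D_def[abs_def] by (intro nS_diff rs_l2 Wl WzL) auto
      finally show ?thesis using 1 2 by simp
    qed
    ultimately show ?thesis using Gl(2) by simp
  qed
  define Z where "Z = (norm z / r + \<omega> + \<beta>) * e r + e (4 * \<kappa>) + tau r / \<beta>"
  have nz: "0 <= norm z / r * e r" using r by simp
  have oz: "0 <= \<omega> * e r" using om by simp
  have bz: "0 <= \<beta> * e r" using be by simp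
  have Tb: "T <= tau r / \<beta>" using be T0 by (simp add: T_def pos_le_divide_eq mult_left_le)
  have YZ: "Y + m + q <= 20 * c0 * Z"
  proof -
    have "Y + m + q <= 16 * c0 * e (4 * \<kappa>) + 4 * c0 * (norm z / r * e r) + \<omega> * e r + \<beta> * e r + 3 * (tau r / \<beta>)"
      using Yb Tb by (simp add: m_def q_def T_def)
    also have "... <= 20 * c0 * e (4 * \<kappa>) + 20 * c0 * (norm z / r * e r) + 20 * c0 * (\<omega> * e r) + 20 * c0 * (\<beta> * e r) + 20 * c0 * (tau r / \<beta>)"
    proof -
      have "3 * (tau r / \<beta>) <= 20 * c0 * (tau r / \<beta>)" using c0 be by (intro mult_right_mono) auto
      moreover have "1 * (\<omega> * e r) <= 20 * c0 * (\<omega> * e r)" using c0 oz by (intro mult_right_mono) auto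
      moreover have "1 * (\<beta> * e r) <= 20 * c0 * (\<beta> * e r)" using c0 bz by (intro mult_right_mono) auto
      moreover have "16 * c0 * e (4 * \<kappa>) <= 20 * c0 * e (4 * \<kappa>)" using c0 by (intro mult_right_mono) auto
      moreover have "4 * c0 * (norm z / r * e r) <= 20 * c0 * (norm z / r * e r)" using c0 nz by (intro mult_right_mono) auto
      ultimately show ?thesis by linarith
    qed
    also have "... = 20 * c0 * Z" by (simp add: Z_def algebra_simps)
    finally show ?thesis .
  qed
  have Z0: "e (4 * \<kappa>) <= Z" using nz oz bz be by (simp add: Z_def distrib_right)
  have "nS (St (r / 2)) D <= C1 * (20 * c0 * Z) + 2 * Z"
    using near XC mult_left_mono[OF YZ C1] Z0 by linarith
  also have "... <= 20 * c0 * (C1 + 1) * Z"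
  proof -
    have "0 <= Z" using Z0 e_nonneg[of "4 * \<kappa>"] by linarith
    then have "2 * Z <= 20 * c0 * Z" using c0 by (intro mult_right_mono) auto
    then show ?thesis by (simp add: algebra_simps)
  qed
  finally show ?thesis by (simp add: D_def[abs_def] C1_def Z_def)
qed

end

section \<open>Averages along several vectors\<close>

fun avs :: "('a::euclidean_space) list => ('a => 'b::euclidean_space) => 'a => 'b" where
  "avs [] g = g"
| "avs (z # zs) g = av z (avs zs g)"

lemma avs_l2: "l2 g ==> l2 (avs zs g)"
  by (induction zs) (auto intro: av_l2)

lemma avs_n2: "l2 g ==> n2 (avs zs g) <= n2 g"
proof (induction zs)
  case (Cons z zs)
  then show ?case using av_l2(2)[OF avs_l2[OF Cons.prems], of z zs] by simp
qed simp

lemma avs_hh: "H1 v V ==> H1 (avs zs v) (avs zs V)"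
  by (induction zs) (auto intro: H1_av)

lemma av_nonzero: "av z g x ~= 0 ==> EX s. 0 <= s & s <= 1 & g (x + s *R z) ~= 0"
  using av_eq_0 by blast

text \<open>Each average moves a point by at most \<kappa> in the direction of \<nu>, so the range
  of heights grows by \<kappa> per vector at both ends.\<close>

lemma avs_support:
  fixes \<nu> :: "'a::euclidean_space"
  assumes z: "!!z. z \<in> set zs ==> \<bar>z \<bullet> \<nu>\<bar> <= \<kappa>" and k: "0 <= \<kappa>"
    and g: "!!x. g x ~= 0 ==> lo <= x \<bullet> \<nu> & x \<bullet> \<nu> <= hi"
    and x: "avs zs g x ~= 0"
  shows "lo - real (length zs) * \<kappa> <= x \<bullet> \<nu> & x \<bullet> \<nu> <= hi + real (length zs) * \<kappa>"
  using z x
proof (induction zs arbitrary: x)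
  case Nil then show ?case using g by simp
next
  case (Cons z zs)
  then obtain s where s: "0 <= s" "s <= 1" "avs zs g (x + s *R z) ~= 0" using av_nonzero by (metis avs.simps(2))
  have "s * \<bar>z \<bullet> \<nu>\<bar> <= 1 * \<kappa>" using s Cons.prems(1)[of z] k by (intro mult_mono) auto
  then have "\<bar>(s *R z) \<bullet> \<nu>\<bar> <= \<kappa>" using s by (simp add: abs_mult)
  moreover have "lo - real (length zs) * \<kappa> <= (x + s *R z) \<bullet> \<nu> & (x + s *R z) \<bullet> \<nu> <= hi + real (length zs) * \<kappa>"
    using Cons.prems(1) s(3) by (intro Cons.IH) auto
  ultimately show ?case unfolding inner_add_left abs_le_iff by (simp add: algebra_simps)
qed

lemma bounded_support_av:
  fixes g :: "'a::euclidean_space => 'b::euclidean_space"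
  assumes "bounded {x. g x ~= 0}" shows "bounded {x. av z g x ~= 0}"
proof -
  obtain N where N: "!!x. g x ~= 0 ==> norm x <= N" using assms by (auto simp: bounded_iff)
  show ?thesis
  proof (rule boundedI)
    fix x assume "x \<in> {x. av z g x ~= 0}"
    then obtain s where s: "0 <= s" "s <= 1" "g (x + s *R z) ~= 0" using av_nonzero[of z g x] by auto
    have "norm x <= norm (x + s *R z) + norm (s *R z)" using norm_triangle_ineq4[of "x + s *R z" "s *R z"] by simp
    also have "... <= N + norm z" using N[OF s(3)] s(1,2) by (intro add_mono) (auto simp: mult_left_le_one_le)
    finally show "norm x <= N + norm z" .
  qed
qed

lemma bounded_support_avs: "bounded {x. g x ~= 0} ==> bounded {x. avs zs g x ~= 0}"
  by (induction zs) (auto intro: bounded_support_av)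

text \<open>A segment can lie inside an exceptional null set, so equality almost everywhere passes
  to the averages only for almost every starting point; the L2 bound for the average of the
  difference shows this.\<close>

lemma av_cong_AE:
  fixes g h :: "'a::euclidean_space => 'b::euclidean_space"
  assumes g: "l2 g" and h: "l2 h" and eq: "AE x in lborel. g x = h x"
  shows "AE x in lborel. av z g x = av z h x"
proof -
  note l = l2_diff(1)[OF g h]
  have "n2 (%x. g x - h x) = n2 (%x::'a. 0 :: 'b)"
    using eq l by (intro n2_cong_AE) auto
  then have "n2 (av z (%x. g x - h x)) = 0" using av_l2(2)[OF l, of z] n2_nonneg[of "av z (%x. g x - h x)"] by simp
  from n2_eq_0_AE[OF av_l2(1)[OF l] this] av_diff_AE[OF g h, of z]
  show ?thesis by eventually_elim simp
qed

lemma avs_linear_AE: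
  assumes g: "l2 g" and T: "bounded_linear T"
  shows "AE x in lborel. avs zs (%x. T (g x)) x = T (avs zs g x)"
proof (induction zs)
  case (Cons z zs)
  have Tl: "l2 (%x. T (p x))" if "l2 p" for p :: "'a => 'b"
  proof -
    obtain K where K: "0 <= K" "!!x. norm (T x) <= norm x * K" using bounded_linear.nonneg_bounded[OF T] by auto
    have "bm T"
      using T by (intro borel_measurable_continuous_onI linear_continuous_on)
    then have "bm (%x. T (p x))" using that by (auto intro: measurable_compose[where N=borel])
    then show ?thesis by (rule l2_cmp(1)[OF that _ _ K(1)]) (use K in \<open>auto simp: mult.commute\<close>)
  qed
  from av_cong_AE[OF avs_l2[OF Tl[OF g]] Tl[OF avs_l2[OF g]] Cons, of z]
    av_linear_AE[OF avs_l2[OF g] T, of z zs]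
  show ?case by eventually_elim simp
qed simp

lemma avs_add_AE:
  assumes g: "l2 g" and h: "l2 h"
  shows "AE x in lborel. avs zs (%x. g x + h x) x = avs zs g x + avs zs h x"
proof (induction zs)
  case (Cons z zs)
  from av_cong_AE[OF avs_l2[OF l2_add(1)[OF g h]] l2_add(1)[OF avs_l2[OF g] avs_l2[OF h]] Cons, of z]
    av_add_AE[OF avs_l2[OF g] avs_l2[OF h], of z zs zs]
  show ?case by eventually_elim simp
qed simp

lemma avs_cong_AE:
  assumes g: "l2 g" and h: "l2 h" and "AE x in lborel. g x = h x"
  shows "AE x in lborel. avs zs g x = avs zs h x"
proof (induction zs)
  case (Cons z zs)
  from av_cong_AE[OF avs_l2[OF g] avs_l2[OF h] Cons, of z] show ?case by simp
qed (use assms in simp)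

text \<open>The average along z turns the derivative in direction z into a difference, by the
  fundamental theorem, and the averages outside of it commute with translations. So \<open>q\<close>
  is \<open>v\<close> averaged over all vectors of the list except the first occurrence of z, which
  is why its norm and support are under control.\<close>

lemma avs_difference:
  fixes v :: "real^'d::finite => real^'m::finite"
  assumes h: "H1 v V" and z: "z \<in> set zs" and zs: "!!z. z \<in> set zs ==> \<bar>z \<bullet> \<nu>\<bar> <= \<kappa>" and k: "0 <= \<kappa>"
    and g: "!!x. v x ~= 0 ==> lo <= x \<bullet> \<nu> & x \<bullet> \<nu> <= hi"
  shows "EX q. l2 q & n2 q <= n2 v & (AE x in lborel. avs zs V x *v z = q (x + z) - q x) &
     (ALL x. q x ~= 0 --> lo - real (length zs) * \<kappa> <= x \<bullet> \<nu> & x \<bullet> \<nu> <= hi + real (length zs) * \<kappa>)"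
  using z zs
proof (induction zs)
  case (Cons z' zs)
  note l = H1D(1,2)[OF h]
  note hz = avs_hh[OF h, of zs]
  have sup: "lo - real (length (z' # zs)) * \<kappa> <= y & y <= hi + real (length (z' # zs)) * \<kappa>"
    if "lo - real (length zs) * \<kappa> <= y & y <= hi + real (length zs) * \<kappa>" for y
    using that k by (auto simp: algebra_simps)
  show ?case
  proof (cases "z = z'")
    case True
    have "AE x in lborel. av z (avs zs V) x *v z = avs zs v (x + z) - avs zs v x"
      using H1_ftc[OF hz, of z] av_linear_AE[OF H1D(2)[OF hz] bounded_linear_mv[of z], of z]
      by eventually_elim simp
    moreover have "avs zs v x ~= 0 ==> lo - real (length zs) * \<kappa> <= x \<bullet> \<nu> & x \<bullet> \<nu> <= hi + real (length zs) * \<kappa>" for x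
      using Cons.prems(2) k g by (intro avs_support[where zs=zs]) auto
    ultimately show ?thesis
      using avs_l2[OF l(1)] avs_n2[OF l(1)] sup True by (intro exI[of _ "avs zs v"]) auto
  next
    case False
    then have "z \<in> set zs" using Cons.prems by simp
    from Cons.IH[OF this Cons.prems(2)] obtain q where q: "l2 q" "n2 q <= n2 v"
      "AE x in lborel. avs zs V x *v z = q (x + z) - q x"
      "!!x. q x ~= 0 ==> lo - real (length zs) * \<kappa> <= x \<bullet> \<nu> & x \<bullet> \<nu> <= hi + real (length zs) * \<kappa>" by auto
    have "AE x in lborel. av z' (avs zs V) x *v z = av z' q (x + z) - av z' q x"
      using av_linear_AE[OF H1D(2)[OF hz] bounded_linear_mv[of z], of z']
        av_cong_AE[OF mv_l2(1)[OF H1D(2)[OF hz]] l2_diff(1)[OF l2_shift(1)[OF q(1)] q(1)] q(3), of z']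
        av_diff_AE[OF l2_shift(1)[OF q(1), of z] q(1), of z']
      by eventually_elim (simp add: av_shift)
    moreover have "lo - real (length (z' # zs)) * \<kappa> <= x \<bullet> \<nu> & x \<bullet> \<nu> <= hi + real (length (z' # zs)) * \<kappa>" if "av z' q x ~= 0" for x
      using avs_support[of "[z']" \<nu> \<kappa> q "lo - real (length zs) * \<kappa>" "hi + real (length zs) * \<kappa>" x] Cons.prems(2) k q(4) that
      by (simp add: algebra_simps)
    ultimately show ?thesis
      using av_l2[OF q(1), of z'] q(2) by (intro exI[of _ "av z' q"]) auto
  qed
qed simp

lemma n2_triangle3: "l2 p ==> l2 q ==> (AE x in lborel. g x = p x + q x) ==> bm g ==> n2 g <= n2 p + n2 q"
  using l2_add[of p q] n2_cong_AE[of g "%x. p x + q x"] by (metis l2_measurable)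

lemma n2_avs_diff:
  fixes k :: "real^'d::finite => real^'m::finite"
  assumes h: "H1 k K" shows "n2 (%x. avs zs k x - k x) <= (\<Sum>z\<leftarrow>zs. norm z) * n2 K"
proof (induction zs)
  case (Cons z zs)
  note l = H1D(1,2)[OF h]
  note la = avs_l2[OF l(1), of zs]
  have "n2 (%x. av z (avs zs k) x - k x) <= n2 (av z (%x. avs zs k x - k x)) + n2 (%x. av z k x - k x)"
  proof (rule n2_triangle3)
    show "AE x in lborel. av z (avs zs k) x - k x = av z (%x. avs zs k x - k x) x + (av z k x - k x)"
      using av_diff_AE[OF la l(1), of z] by eventually_elim simp
    show "bm (%x. av z (avs zs k) x - k x)"
      using l2_diff(1)[OF av_l2(1)[OF la, of z] l(1)] by auto
  qed (intro av_l2 l2_diff la l)+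
  also have "... <= (\<Sum>z\<leftarrow>zs. norm z) * n2 K + norm z * n2 K"
    using av_l2(2)[OF l2_diff(1)[OF la l(1)], of z] Cons n2_av_diff[OF h, of z] by simp
  finally show ?case by (simp add: algebra_simps)
qed (simp)

text \<open>The projected axes e_i - \<nu>_i \<nu> span the tangent plane redundantly; using all of
  them avoids the choice of an orthonormal basis adapted to \<nu>. The identity holds because the
  vectors \<nu>_i G e_i sum up to G \<nu>.\<close>

lemma matrix_axis_decomp:
  fixes G V :: "real^'d::finite^'m::finite"
  assumes "\<nu> \<bullet> \<nu> = 1"
  shows "G \<bullet> V = (G *v \<nu>) \<bullet> (V *v \<nu>) + (\<Sum>i\<in>UNIV. (G *v axis i 1) \<bullet> (V *v (axis i 1 - (\<nu> $ i) *R \<nu>)))"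
proof -
  have a: "(G *v axis i 1) \<bullet> (V *v axis i 1) = (\<Sum>\<beta>\<in>UNIV. G $ \<beta> $ i * V $ \<beta> $ i)" for i
    by (simp add: inner_vec_def matrix_vector_mult_basis column_def)
  have "(\<Sum>i\<in>UNIV. (G *v axis i 1) \<bullet> (V *v axis i 1)) = G \<bullet> V"
    unfolding a inner_matrix by (rule sum.swap)
  moreover have n: "(\<Sum>i\<in>UNIV. (\<nu> $ i) *R (G *v axis i 1)) = G *v \<nu>"
    by (simp add: vec_eq_iff matrix_vector_mult_basis column_def matrix_vector_mult_def[of G] mult.commute)
  moreover have "(G *v axis i 1) \<bullet> (V *v (axis i 1 - (\<nu> $ i) *R \<nu>))
     = (G *v axis i 1) \<bullet> (V *v axis i 1) - ((\<nu> $ i) *R (G *v axis i 1)) \<bullet> (V *v \<nu>)" for i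
    by (simp add: matrix_vector_mult_diff_distrib matrix_vector_mult_scaleR inner_diff_right)
  moreover have "(\<Sum>i\<in>UNIV. ((\<nu> $ i) *R (G *v axis i 1)) \<bullet> (V *v \<nu>)) = (G *v \<nu>) \<bullet> (V *v \<nu>)"
    by (simp only: inner_sum_left[symmetric] n)
  ultimately show ?thesis by (simp only: sum_subtractf)
qed

section \<open>Moving the flux from one layer to a higher one\<close>

context core
begin

definition tt :: "'d => real^'d" where "tt i = axis i 1 - (\<nu> $ i) *R \<nu>"

lemma tt: "tt i \<bullet> \<nu> = 0" "norm (tt i) <= 1"
proof -
  show z: "tt i \<bullet> \<nu> = 0" by (simp add: tt_def inner_diff_left inner_axis')
  have "tt i \<bullet> tt i = tt i \<bullet> axis i 1 - \<nu> $ i * (tt i \<bullet> \<nu>)"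
    by (subst (2) tt_def) (simp only: inner_diff_right inner_scaleR_right)
  also have "... = 1 - (\<nu> $ i)^2" unfolding z by (simp add: inner_axis tt_def power2_eq_square)
  finally have "(norm (tt i))^2 = 1 - (\<nu> $ i)^2" by (simp only: power2_norm_eq_inner)
  then have "(norm (tt i))^2 <= 1^2" by simp
  then show "norm (tt i) <= 1" by (rule power2_le_imp_le) simp
qed

text \<open>The weak gradient of \<open>kf \<rho>\<close> by the product rule; the second derivative
  of the step brings the factor 1 / \<rho>^2.\<close>

definition kK :: "real => real^'d => real^'d^'m" where
  "kK \<rho> x = (1 / \<rho> * s1 (2 - t x / \<rho>)) *R W x + (- (1 / \<rho>^2 * s2 (2 - t x / \<rho>))) *R outer (w x) \<nu>"

lemma kf_hh:
  assumes \<rho>: "\<rho> > 0" shows "H1 (kf \<rho>) (kK \<rho>)"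
proof -
  let ?g = "%\<tau>. 1 / \<rho> * s1 (2 - \<tau> / \<rho>)"
  let ?g' = "%\<tau>. - (1 / \<rho>^2 * s2 (2 - \<tau> / \<rho>))"
  have "dn n ?g" for n
    using dn_mult[OF dn_const[of n "1/\<rho>"] dn_affine[OF s1_dn, of n "- 1 / \<rho>" 2]] by (simp add: algebra_simps)
  moreover have "(?g has_real_derivative ?g' x) (at x)" for x
  proof -
    have "((%\<tau>. 2 - \<tau> / \<rho>) has_real_derivative - (1 / \<rho>)) (at x)" using \<rho> by (auto intro!: derivative_eq_intros)
    from DERIV_cmult[OF DERIV_chain2[OF s1_der this], of "1/\<rho>"] show ?thesis by (simp add: mult.commute power2_eq_square)
  qed
  moreover have "\<bar>?g x\<bar> <= max (c0 / \<rho>) (c0 / \<rho>^2)" for x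
    using divide_right_mono[OF s1_le[of "2 - x / \<rho>"], of \<rho>] \<rho> by (simp add: abs_mult le_max_iff_disj)
  moreover have "\<bar>?g' x\<bar> <= max (c0 / \<rho>) (c0 / \<rho>^2)" for x
    using divide_right_mono[OF s2_le[of "2 - x / \<rho>"], of "\<rho>^2"] \<rho> by (simp add: abs_mult le_max_iff_disj)
  ultimately show ?thesis
    unfolding kf_def[abs_def] kK_def[abs_def] t_def[abs_def] by (intro H1_cut[OF wW])
qed

text \<open>The strip inequality for \<open>w\<close> at height 2 \<rho> gives the 4; the 5 is 1 +
  4, from the two terms of the product rule.\<close>

lemma kf_bounds:
  assumes \<rho>: "\<rho> > 0"
  shows "n2 (kf \<rho>) <= 4 * c0 * e (2 * \<rho>)" "n2 (kK \<rho>) <= 5 * c0 / \<rho> * e (2 * \<rho>)"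
    "kK \<rho> x ~= 0 ==> \<rho> < t x & t x < 2 * \<rho>"
proof -
  note l = H1D(1,2)[OF kf_hh[OF \<rho>]]
  have wb: "nS (St (2 * \<rho>)) w <= 4 * \<rho> * e (2 * \<rho>)" using w_bound[of "2 * \<rho>"] \<rho> by simp
  have "n2 (kf \<rho>) = nS (St (2 * \<rho>)) (kf \<rho>)"
    using kf_support(2)[OF \<rho>] by (intro n2_eq_nS) (auto simp: St_def)
  also have "... <= c0 / \<rho> * nS (St (2 * \<rho>)) w"
    by (rule nS_cmp(2)[OF rs_l2[OF wl St_measurable]]) (use kf_le[OF \<rho>] c0 \<rho> in auto)
  also have "... <= c0 / \<rho> * (4 * \<rho> * e (2 * \<rho>))" using wb c0 \<rho> by (intro mult_left_mono) auto
  finally show "n2 (kf \<rho>) <= 4 * c0 * e (2 * \<rho>)" using \<rho> by simp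
  show sup: "\<rho> < t x & t x < 2 * \<rho>" if "kK \<rho> x ~= 0" for x
  proof -
    have "~ (2 - t x / \<rho> <= 0 | 2 - t x / \<rho> >= 1)" using that s1_0 s2_0 by (auto simp: kK_def)
    then have "0 < 2 - t x / \<rho>" "2 - t x / \<rho> < 1" by auto
    then show ?thesis using \<rho> by (auto simp: field_simps)
  qed
  define A where "A x = (1 / \<rho> * s1 (2 - t x / \<rho>)) *R W x" for x
  define A' where "A' x = (- (1 / \<rho>^2 * s2 (2 - t x / \<rho>))) *R outer (w x) \<nu>" for x
  have s2m[measurable]: "bm s2"
  proof -
    from s2_dn[of "Suc 0"] obtain s3 where "!!x. (s2 has_real_derivative s3 x) (at x)" by auto
    then have "continuous_on UNIV s2" by (intro continuous_at_imp_continuous_on ballI DERIV_isCont)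
    then show ?thesis by (rule borel_measurable_continuous_onI)
  qed
  have [measurable]: "bm A" "bm A'"
    unfolding A_def[abs_def] A'_def[abs_def] by measurable
  have a: "norm (A x) <= c0 / \<rho> * norm (W x)" for x
    using mult_right_mono[OF divide_right_mono[OF s1_le[of "2 - t x / \<rho>"], of \<rho>], of "norm (W x)"] \<rho> by (simp add: A_def abs_mult)
  have a': "norm (A' x) <= c0 / \<rho>^2 * norm (w x)" for x
    using mult_right_mono[OF divide_right_mono[OF s2_le[of "2 - t x / \<rho>"], of "\<rho>^2"], of "norm (w x)"] \<rho> by (simp add: A'_def abs_mult norm_ou nu)
  have 1: "l2 (rs (St (2 * \<rho>)) A)" "nS (St (2 * \<rho>)) A <= c0 / \<rho> * e (2 * \<rho>)"
    unfolding e_def by (rule nS_cmp[OF rs_l2[OF Wl St_measurable], where C="c0 / \<rho>"]; use a c0 \<rho> in auto)+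
  have 2: "l2 (rs (St (2 * \<rho>)) A')" "nS (St (2 * \<rho>)) A' <= c0 / \<rho>^2 * nS (St (2 * \<rho>)) w"
    by (rule nS_cmp[OF rs_l2[OF wl St_measurable], where C="c0 / \<rho>^2"]; use a' c0 \<rho> in auto)+
  have "c0 / \<rho>^2 * nS (St (2 * \<rho>)) w <= c0 / \<rho>^2 * (4 * \<rho> * e (2 * \<rho>))" using wb c0 \<rho> by (intro mult_left_mono) auto
  also have "... = 4 * (c0 / \<rho>) * e (2 * \<rho>)" using \<rho> by (simp add: power2_eq_square)
  finally have 3: "nS (St (2 * \<rho>)) A' <= 4 * (c0 / \<rho>) * e (2 * \<rho>)" using 2(2) by linarith
  have "n2 (kK \<rho>) = nS (St (2 * \<rho>)) (%x. A x + A' x)"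
    using sup by (subst n2_eq_nS[of "St (2 * \<rho>)"]) (auto simp: St_def A_def A'_def kK_def[abs_def])
  also have "... <= c0 / \<rho> * e (2 * \<rho>) + 4 * (c0 / \<rho>) * e (2 * \<rho>)" using nS_add(2)[OF 1(1) 2(1)] 1(2) 3 by linarith
  finally show "n2 (kK \<rho>) <= 5 * c0 / \<rho> * e (2 * \<rho>)" by (simp add: algebra_simps)
qed

text \<open>\<Phi>0 is the primitive of \<open>kf \<rho>\<close> along the normal over a segment of
  length r, so its normal derivative is kf(x) - kf(x - r \<nu>), and the second term vanishes at
  heights below r. Each normal line meets the layer in a part of relative length \<rho> / r, whence
  the factor sqrt(\<rho> / r). Cutting off between r / 4 and 3 r / 8 produces the error \<Phi>,
  which keeps this factor. Tangential derivatives gain nothing: the full gradient \<open>V0\<close>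
  is bounded with r / \<rho> only.\<close>

lemma flux_test_function:
  assumes \<rho>: "\<rho> > 0" "16 * \<rho> <= r"
  obtains v0 V0 \<Phi> where "H1 v0 V0" "l2 \<Phi>"
    "n2 v0 <= 4 * c0 * r * sqrt (\<rho> / r) * e (2 * \<rho>)"
    "n2 V0 <= 37 * c0^2 * (r / \<rho>) * e (2 * \<rho>)"
    "n2 \<Phi> <= 32 * c0^2 * sqrt (\<rho> / r) * e (2 * \<rho>)"
    "AE x in lborel. V0 x *v \<nu> = kf \<rho> x + \<Phi> x"
    "!!x. v0 x ~= 0 ==> \<rho> <= t x & t x <= 3 * r / 8" "!!x. V0 x ~= 0 ==> \<rho> <= t x & t x <= 3 * r / 8"
    "!!x. \<Phi> x ~= 0 ==> \<rho> <= t x & t x <= 3 * r / 8" "bounded {x. v0 x ~= 0}"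
proof -
  have r: "r > 0" using \<rho> by linarith
  define \<theta> where "\<theta> = sqrt (\<rho> / r)"
  have th: "0 <= \<theta>" "\<theta> <= 1" "1 <= r / \<rho>" using \<rho> r by (auto simp: \<theta>_def)
  note hk = kf_hh[OF \<rho>(1)] and kb = kf_bounds[OF \<rho>(1)]
  note kl = H1D(1,2)[OF hk]
  define z where "z = - r *R \<nu>"
  have tz: "t (x + \<sigma> *R z) = t x - \<sigma> * r" for x \<sigma> using t_shift[of x "\<sigma> *R z"] by (simp add: z_def)
  define \<Phi>0 where "\<Phi>0 x = r *R av z (kf \<rho>) x" for x
  define D\<Phi> where "D\<Phi> x = r *R av z (kK \<rho>) x" for x
  have h\<Phi>: "H1 \<Phi>0 D\<Phi>" unfolding \<Phi>0_def[abs_def] D\<Phi>_def[abs_def] by (intro H1_scale H1_av hk)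
  note \<Phi>l = H1D(1,2)[OF h\<Phi>]
  \<comment> \<open>Along the segment the height decreases at rate r, and the layer has thickness
    \<rho>.\<close>
  have win: "emeasure lborel {\<sigma>\<in>{0..1::real}. kf \<rho> (x + \<sigma> *R z) ~= 0} <= ennreal (\<rho> / r)" for x
  proof -
    have "{\<sigma>\<in>{0..1::real}. kf \<rho> (x + \<sigma> *R z) ~= 0} <= {(t x - 2 * \<rho>) / r..(t x - \<rho>) / r}"
    proof
      fix \<sigma> assume "\<sigma> \<in> {\<sigma>\<in>{0..1::real}. kf \<rho> (x + \<sigma> *R z) ~= 0}"
      then have "kf \<rho> (x + \<sigma> *R z) ~= 0" by simp
      from kf_support[OF \<rho>(1) this] have "\<rho> < t x - \<sigma> * r" "t x - \<sigma> * r < 2 * \<rho>" by (simp_all only: tz)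
      then show "\<sigma> \<in> {(t x - 2 * \<rho>) / r..(t x - \<rho>) / r}" using r by (auto simp: divide_le_eq le_divide_eq)
    qed
    then have "emeasure lborel {\<sigma>\<in>{0..1::real}. kf \<rho> (x + \<sigma> *R z) ~= 0} <= emeasure lborel {(t x - 2 * \<rho>) / r..(t x - \<rho>) / r}"
      by (intro emeasure_mono) auto
    also have "... = ennreal ((t x - \<rho>) / r - (t x - 2 * \<rho>) / r)"
      using r \<rho> by (intro emeasure_lborel_Icc divide_right_mono) auto
    also have "(t x - \<rho>) / r - (t x - 2 * \<rho>) / r = \<rho> / r" by (simp add: diff_divide_distrib)
    finally show ?thesis .
  qed
  have n\<Phi>: "n2 \<Phi>0 <= 4 * c0 * r * \<theta> * e (2 * \<rho>)"
  proof -
    have "n2 (av z (kf \<rho>)) <= sqrt (\<rho> / r) * n2 (kf \<rho>)"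
      by (rule av_l2_window(2)[OF kl(1) _ win]) (use \<rho> r in auto)
    also have "... <= \<theta> * (4 * c0 * e (2 * \<rho>))" unfolding \<theta>_def[symmetric] using th by (intro mult_left_mono kb) auto
    finally have "r * n2 (av z (kf \<rho>)) <= r * (\<theta> * (4 * c0 * e (2 * \<rho>)))" using r by (intro mult_left_mono) auto
    moreover have "n2 \<Phi>0 = r * n2 (av z (kf \<rho>))" unfolding \<Phi>0_def[abs_def] using l2_scaleR(2)[OF av_l2(1)[OF kl(1)], of r z] r by simp
    ultimately show ?thesis by (simp add: mult_ac)
  qed
  have nD: "n2 D\<Phi> <= 5 * c0 * (r / \<rho>) * e (2 * \<rho>)"
  proof -
    have "n2 D\<Phi> = r * n2 (av z (kK \<rho>))" unfolding D\<Phi>_def[abs_def] using l2_scaleR(2)[OF av_l2(1)[OF kl(2)], of r z] r by simp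
    also have "... <= r * (5 * c0 / \<rho> * e (2 * \<rho>))" using av_l2(2)[OF kl(2), of z] kb(2) r by (intro mult_left_mono) auto
    finally show ?thesis by (simp add: mult_ac)
  qed
  have \<Phi>s: "\<rho> < t x" if "\<Phi>0 x ~= 0 | D\<Phi> x ~= 0" for x
  proof -
    have "EX \<sigma>. 0 <= \<sigma> & (kf \<rho> (x + \<sigma> *R z) ~= 0 | kK \<rho> (x + \<sigma> *R z) ~= 0)"
      using that av_nonzero[of z "kf \<rho>" x] av_nonzero[of z "kK \<rho>" x] by (auto simp: \<Phi>0_def D\<Phi>_def)
    then obtain \<sigma> where "0 <= \<sigma>" "\<rho> < t (x + \<sigma> *R z)" using kf_support(1)[OF \<rho>(1)] kb(3) by blast
    moreover from \<open>0 <= \<sigma>\<close> r have "0 <= \<sigma> * r" by simp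
    ultimately show ?thesis using tz[of x \<sigma>] by linarith
  qed
  \<comment> \<open>The support ends at height 3 r / 8, which leaves room below r / 2 for the later
    averages.\<close>
  define g where "g \<tau> = s (3 - 8 * \<tau> / r)" for \<tau>
  define g' where "g' \<tau> = - (8 / r * s1 (3 - 8 * \<tau> / r))" for \<tau>
  have gd: "dn n g" for n
    using dn_affine[OF s_dn, of n "- 8 / r" 3] by (simp add: g_def[abs_def] algebra_simps)
  have gder: "(g has_real_derivative g' x) (at x)" for x
  proof -
    have "((%\<tau>. 3 - 8 * \<tau> / r) has_real_derivative - (8 / r)) (at x)" using r by (auto intro!: derivative_eq_intros)
    from DERIV_chain2[OF s_der this] show ?thesis unfolding g_def[abs_def] g'_def by (simp add: mult.commute)
  qed
  have g01: "0 <= g x" "g x <= 1" for x using s_nn s_le by (auto simp: g_def)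
  have g1: "g x = 1" if "x <= r / 4" for x using that r by (auto simp: g_def divide_le_eq intro!: s_1)
  have g0: "g x = 0" "g' x = 0" if "3 * r / 8 <= x" for x
    using that r by (auto simp: g_def g'_def le_divide_eq intro!: s_0 s1_0)
  have g'b: "\<bar>g' x\<bar> <= 8 * c0 / r" for x
    using mult_left_mono[OF s1_le[of "3 - 8 * x / r"], of "8 / r"] r by (simp add: g'_def abs_mult)
  have [measurable]: "bm g" "bm g'" unfolding g_def[abs_def] g'_def[abs_def] by measurable
  define v0 where "v0 x = g (t x) *R \<Phi>0 x" for x
  define V0 where "V0 x = g (t x) *R D\<Phi> x + g' (t x) *R outer (\<Phi>0 x) \<nu>" for x
  define \<Phi> where "\<Phi> x = g' (t x) *R \<Phi>0 x" for x
  have hv: "H1 v0 V0"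
    unfolding v0_def[abs_def] V0_def[abs_def] t_def[abs_def]
  proof (rule H1_cut[OF h\<Phi> gd gder, where c="max 1 (8 * c0 / r)"])
    show "\<bar>g x\<bar> <= max 1 (8 * c0 / r)" for x using g01[of x] by (simp add: le_max_iff_disj)
    show "\<bar>g' x\<bar> <= max 1 (8 * c0 / r)" for x using g'b[of x] by (simp add: le_max_iff_disj)
  qed
  have [measurable]: "bm \<Phi>0" "bm D\<Phi>" using \<Phi>l by auto
  have [measurable]: "bm v0" "bm V0" using H1D(1,2)[OF hv] by auto
  have [measurable]: "bm \<Phi>" unfolding \<Phi>_def[abs_def] by measurable
  have b1: "norm (\<Phi> x) <= 8 * c0 / r * norm (\<Phi>0 x)" for x
    using mult_right_mono[OF g'b[of "t x"], of "norm (\<Phi>0 x)"] by (simp add: \<Phi>_def)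
  have pr: "0 <= 8 * c0 / r" using c0 r by simp
  have \<Phi>2: "l2 \<Phi>" "n2 \<Phi> <= 8 * c0 / r * n2 \<Phi>0"
    by (rule l2_cmp[OF \<Phi>l(1), where C="8 * c0 / r"]; use b1 pr in auto)+
  have n\<Phi>2: "n2 \<Phi> <= 32 * c0^2 * \<theta> * e (2 * \<rho>)"
  proof -
    have "8 * c0 / r * n2 \<Phi>0 <= 8 * c0 / r * (4 * c0 * r * \<theta> * e (2 * \<rho>))" using n\<Phi> pr by (intro mult_left_mono)
    also have "... = 32 * c0^2 * \<theta> * e (2 * \<rho>)" using r by (simp add: power2_eq_square)
    finally show ?thesis using \<Phi>2(2) by linarith
  qed
  have nv0: "n2 v0 <= 4 * c0 * r * \<theta> * e (2 * \<rho>)"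
  proof -
    have "n2 v0 <= 1 * n2 \<Phi>0"
      by (rule l2_cmp(2)[OF \<Phi>l(1)]) (use g01 in \<open>auto simp: v0_def mult_left_le_one_le\<close>)
    then show ?thesis using n\<Phi> by simp
  qed
  have nV0: "n2 V0 <= 37 * c0^2 * (r / \<rho>) * e (2 * \<rho>)"
  proof -
    have 1: "l2 (%x. g (t x) *R D\<Phi> x)" "n2 (%x. g (t x) *R D\<Phi> x) <= 1 * n2 D\<Phi>"
      by (rule l2_cmp[OF \<Phi>l(2), where C=1]; use g01 in \<open>auto simp: mult_left_le_one_le\<close>)+
    have 2: "l2 (%x. g' (t x) *R outer (\<Phi>0 x) \<nu>)" "n2 (%x. g' (t x) *R outer (\<Phi>0 x) \<nu>) <= 1 * n2 \<Phi>"
      by (rule l2_cmp[OF \<Phi>2(1), where C=1]; simp add: \<Phi>_def norm_ou nu)+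
    have "n2 V0 <= n2 D\<Phi> + n2 \<Phi>" using l2_add(2)[OF 1(1) 2(1)] 1(2) 2(2) by (simp add: V0_def[abs_def])
    also have "... <= 5 * c0 * (r / \<rho>) * e (2 * \<rho>) + 32 * c0^2 * \<theta> * e (2 * \<rho>)" using nD n\<Phi>2 by linarith
    also have "... <= 5 * c0^2 * (r / \<rho>) * e (2 * \<rho>) + 32 * c0^2 * (r / \<rho>) * e (2 * \<rho>)"
    proof (intro add_mono mult_right_mono mult_left_mono)
      show "c0 <= c0^2" using c0 by (simp add: power2_eq_square mult_left_le)
      show "\<theta> <= r / \<rho>" using th by linarith
    qed (use c0 \<rho> r in auto)
    finally show ?thesis by (simp add: algebra_simps)
  qed
  have AEV: "AE x in lborel. V0 x *v \<nu> = kf \<rho> x + \<Phi> x"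
    using H1_ftc[OF hk, of z] av_linear_AE[OF kl(2) bounded_linear_mv[of z], of z]
  proof eventually_elim
    fix x assume "kf \<rho> (x + z) - kf \<rho> x = av z (%x. kK \<rho> x *v z) x" "av z (%x. kK \<rho> x *v z) x = av z (kK \<rho>) x *v z"
    then have e1: "av z (kK \<rho>) x *v z = kf \<rho> (x + z) - kf \<rho> x" by simp
    have "D\<Phi> x *v \<nu> = - (av z (kK \<rho>) x *v z)"
      by (simp add: D\<Phi>_def z_def matrix_vector_mult_scaleR scaleR_matrix_vector_assoc[symmetric] vec.neg)
    then have e2: "D\<Phi> x *v \<nu> = kf \<rho> x - kf \<rho> (x + z)" using e1 by simp
    \<comment> \<open>Below 3 r / 8 the translated point is under the boundary, where
      \<open>kf\<close> vanishes, and on the layer itself \<open>g\<close> is 1; from 3 r / 8 on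
      both \<open>g\<close> and \<open>kf\<close> at x vanish.\<close>
    have e3: "g (t x) *R (kf \<rho> x - kf \<rho> (x + z)) = kf \<rho> x"
    proof (cases "t x < 3 * r / 8")
      case True
      have "kf \<rho> (x + z) = 0" using kf_support(1)[OF \<rho>(1), of "x + z"] tz[of x 1] True \<rho> r by force
      moreover have "kf \<rho> x = 0 | g (t x) = 1" using kf_support(2)[OF \<rho>(1), of x] g1[of "t x"] \<rho> by fastforce
      ultimately show ?thesis by auto
    next
      case False
      then show ?thesis using kf_support(2)[OF \<rho>(1), of x] g0(1)[of "t x"] \<rho> by force
    qed
    have "V0 x *v \<nu> = g (t x) *R (D\<Phi> x *v \<nu>) + \<Phi> x"
      by (simp add: V0_def \<Phi>_def matrix_vector_mult_add_rdistrib scaleR_matrix_vector_assoc[symmetric] outer_mv)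
    then show "V0 x *v \<nu> = kf \<rho> x + \<Phi> x" using e2 e3 by simp
  qed
  have bk: "bounded {x. kf \<rho> x ~= 0}" by (rule bounded_subset[OF wbd]) (auto simp: kf_def)
  have "bounded {x. v0 x ~= 0}"
    by (rule bounded_subset[OF bounded_support_av[OF bk, of z]]) (auto simp: v0_def \<Phi>0_def)
  moreover have "\<rho> <= t x & t x <= 3 * r / 8" if "v0 x ~= 0 | V0 x ~= 0 | \<Phi> x ~= 0" for x
  proof -
    have "\<Phi>0 x ~= 0 | D\<Phi> x ~= 0" using that by (auto simp: v0_def V0_def \<Phi>_def outer_def vec_eq_iff)
    moreover have "~ 3 * r / 8 <= t x" using that g0[of "t x"] by (auto simp: v0_def V0_def \<Phi>_def)
    ultimately show ?thesis using \<Phi>s[of x] by auto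
  qed
  ultimately show ?thesis
    using that[OF hv \<Phi>2(1) nv0[unfolded \<theta>_def] nV0 n\<Phi>2[unfolded \<theta>_def] AEV] by blast
qed

lemma Bl: "l2 V ==> l2 (%x. B (x + z) (V x))"
  by (rule l2_cmp(1)[where C=\<Lambda>]) (use bnd Lam in auto)

text \<open>Summation by parts: the translation passes from \<open>q\<close> to the flux, and the
  difference of the flux splits into one from the difference of \<open>W\<close> and one from the
  change of the coefficients.\<close>

lemma flux_tangential:
  assumes q: "l2 q" and r: "r > 0" and sup: "!!x. q x ~= 0 ==> x \<in> St (r / 2)"
    and om: "0 <= \<omega>" and per: "!!x \<Xi>. norm (B (x - z) \<Xi> - B x \<Xi>) <= \<omega> * norm \<Xi>"
    and \<Delta>: "nS (St (r / 2)) (%x. W (x - z) - W x) <= \<Delta>" and p: "norm p = 1"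
  shows "\<bar>LBINT x. (B x (W x) *v p) \<bullet> (q (x + z) - q x)\<bar> <= (\<Lambda> * \<Delta> + \<omega> * e r) * n2 q"
proof -
  have [measurable]: "bm q" using q by auto
  define S where "S = St (r / 2)"
  have Sm[measurable]: "S \<in> sets borel" by (simp add: S_def)
  have Wz: "l2 (%x. W (x - z))" using l2_shift(1)[OF Wl, of "- z"] by simp
  define D where "D x = W (x - z) - W x" for x
  have Dl: "l2 D" unfolding D_def[abs_def] by (rule l2_diff(1)[OF Wz Wl])
  define E1 where "E1 x = B (x - z) (D x)" for x
  define E2 where "E2 x = B (x - z) (W x) - B x (W x)" for x
  have E1l: "l2 E1" unfolding E1_def[abs_def] using Bl[OF Dl, of "- z"] by simp
  have E2l: "l2 E2" unfolding E2_def[abs_def] using l2_diff(1)[OF Bl[OF Wl, of "- z"] BW_l2] by simp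
  have BWz: "l2 (%x. B (x - z) (W (x - z)))" using l2_shift(1)[OF BW_l2, of "- z"] by simp
  have EE: "B (x - z) (W (x - z)) - B x (W x) = E1 x + E2 x" for x
    using linear_diff[OF lin, of "x - z" "W (x - z)" "W x"] by (simp add: E1_def E2_def D_def)
  have qz: "l2 (%x. q (x + z))" by (rule l2_shift(1)[OF q])
  have m: "l2 (%x. B x (W x) *v p)" by (rule mv_l2(1)[OF BW_l2])
  have mz: "l2 (%x. B (x - z) (W (x - z)) *v p)" by (rule mv_l2(1)[OF BWz])
  have "(LBINT x. (B x (W x) *v p) \<bullet> (q (x + z) - q x))
    = (LBINT x. (B x (W x) *v p) \<bullet> q (x + z)) - (LBINT x. (B x (W x) *v p) \<bullet> q x)"
    using l2_inner(1)[OF m qz] l2_inner(1)[OF m q] by (simp add: inner_diff_right)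
  also have "(LBINT x. (B x (W x) *v p) \<bullet> q (x + z)) = (LBINT x. (B (x - z) (W (x - z)) *v p) \<bullet> q x)"
    using integral_shift[of "%x. (B (x - z) (W (x - z)) *v p) \<bullet> q x" z] Bmeas[of "%x. W (x - z)" "- z"] by simp
  also have "... - (LBINT x. (B x (W x) *v p) \<bullet> q x) = (LBINT x. (B (x - z) (W (x - z)) *v p) \<bullet> q x - (B x (W x) *v p) \<bullet> q x)"
    using l2_inner(1)[OF mz q] l2_inner(1)[OF m q] by simp
  also have "... = (LBINT x. ((E1 x + E2 x) *v p) \<bullet> q x)"
    unfolding inner_diff_left[symmetric] matrix_vector_mult_diff_rdistrib[symmetric] EE ..
  finally have eq1: "(LBINT x. (B x (W x) *v p) \<bullet> (q (x + z) - q x)) = (LBINT x. ((E1 x + E2 x) *v p) \<bullet> q x)" .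
  have El: "l2 (%x. E1 x + E2 x)" by (rule l2_add(1)[OF E1l E2l])
  have [measurable]: "bm E1" "bm E2" using E1l E2l by auto
  have "\<bar>LBINT x. ((E1 x + E2 x) *v p) \<bullet> q x\<bar> <= nS S (%x. E1 x + E2 x) * nS S q"
  proof (rule nS_cs(2)[OF rs_l2[OF El Sm] rs_l2[OF q Sm]])
    show "AE x in lborel. ((E1 x + E2 x) *v p) \<bullet> q x ~= 0 --> x \<in> S & x \<in> S &
       \<bar>((E1 x + E2 x) *v p) \<bullet> q x\<bar> <= norm (E1 x + E2 x) * norm (q x)"
    proof (intro AE_I2 impI)
      fix x assume "((E1 x + E2 x) *v p) \<bullet> q x ~= 0"
      then have "q x ~= 0" by auto
      have "\<bar>((E1 x + E2 x) *v p) \<bullet> q x\<bar> <= norm ((E1 x + E2 x) *v p) * norm (q x)" by (rule Cauchy_Schwarz_ineq2)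
      also have "... <= norm (E1 x + E2 x) * norm (q x)"
        using norm_mv_le[of "E1 x + E2 x" p] p by (intro mult_right_mono) auto
      finally show "x \<in> S & x \<in> S & \<bar>((E1 x + E2 x) *v p) \<bullet> q x\<bar> <= norm (E1 x + E2 x) * norm (q x)"
        using sup[OF \<open>q x ~= 0\<close>] by (simp add: S_def)
    qed
  qed auto
  also have "... <= (\<Lambda> * \<Delta> + \<omega> * e r) * n2 q"
  proof (rule mult_mono)
    have a: "nS S E1 <= \<Lambda> * nS S D"
      by (rule nS_cmp(2)[OF rs_l2[OF Dl Sm]]) (use bnd Lam in \<open>auto simp: E1_def\<close>)
    have b: "nS S E2 <= \<omega> * nS S W"
      by (rule nS_cmp(2)[OF rs_l2[OF Wl Sm]]) (use per om in \<open>auto simp: E2_def\<close>)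
    have c: "\<Lambda> * nS S D <= \<Lambda> * \<Delta>" using \<Delta> Lam by (intro mult_left_mono) (auto simp: S_def D_def[abs_def])
    have d: "\<omega> * nS S W <= \<omega> * e r" using e_mono[of "r/2" r] om r by (intro mult_left_mono) (auto simp: S_def e_def)
    show "nS S (%x. E1 x + E2 x) <= \<Lambda> * \<Delta> + \<omega> * e r"
      using nS_add(2)[OF rs_l2[OF E1l Sm] rs_l2[OF E2l Sm]] a b c d by linarith
    show "0 <= \<Lambda> * \<Delta> + \<omega> * e r" using order_trans[OF nS_nonneg \<Delta>] Lam om by simp
  qed (use nS_le_n2[OF q Sm] in auto)
  finally show ?thesis unfolding eq1 .
qed

lemma flux_le:
  assumes vl: "l2 v" and r: "!!x. v x ~= 0 ==> x \<in> St r" and p: "norm p <= 1"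
  shows "\<bar>LBINT x. (B x (W x) *v p) \<bullet> v x\<bar> <= \<Lambda> * e r * n2 v"
proof -
  have [measurable]: "bm v" using vl by auto
  have "\<bar>LBINT x. (B x (W x) *v p) \<bullet> v x\<bar> <= nS (St r) (%x. \<Lambda> *R W x) * nS (St r) v"
  proof (rule nS_cs(2)[OF nS_scaleR(1)[OF rs_l2[OF Wl St_measurable]] rs_l2[OF vl St_measurable]])
    show "AE x in lborel. (B x (W x) *v p) \<bullet> v x ~= 0 --> x \<in> St r & x \<in> St r &
       \<bar>(B x (W x) *v p) \<bullet> v x\<bar> <= norm (\<Lambda> *R W x) * norm (v x)"
    proof (intro AE_I2 impI)
      fix x assume "(B x (W x) *v p) \<bullet> v x ~= 0"
      then have "v x ~= 0" by auto
      have "norm (B x (W x) *v p) <= norm (B x (W x)) * norm p" by (rule norm_mv_le)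
      also have "... <= norm (B x (W x)) * 1" using p by (intro mult_left_mono) auto
      also have "... <= norm (\<Lambda> *R W x)" using bnd[of x "W x"] Lam by simp
      finally have "norm (B x (W x) *v p) * norm (v x) <= norm (\<Lambda> *R W x) * norm (v x)" by (rule mult_right_mono) simp
      then show "x \<in> St r & x \<in> St r & \<bar>(B x (W x) *v p) \<bullet> v x\<bar> <= norm (\<Lambda> *R W x) * norm (v x)"
        using r[OF \<open>v x ~= 0\<close>] Cauchy_Schwarz_ineq2[of "B x (W x) *v p" "v x"] by auto
    qed
  qed auto
  also have "... <= (\<Lambda> * e r) * n2 v"
    using nS_scaleR(2)[OF rs_l2[OF Wl St_measurable], of r \<Lambda>] Lam nS_le_n2[OF vl St_measurable, of r]
    by (intro mult_mono) (auto simp: e_def)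
  finally show ?thesis .
qed

text \<open>\<open>tt i\<close> has no normal component, so the normal component of z is that of its
  deviation from the multiple of \<open>tt i\<close>.\<close>

lemma near_tangent:
  assumes "0 < L" "norm (z - L *R tt i) <= \<kappa>" "\<kappa> <= L"
  shows "\<bar>z \<bullet> \<nu>\<bar> <= \<kappa>" "norm z <= 2 * L"
proof -
  have "z \<bullet> \<nu> = (z - L *R tt i) \<bullet> \<nu>" by (simp add: inner_diff_left tt(1))
  then show "\<bar>z \<bullet> \<nu>\<bar> <= \<kappa>" using Cauchy_Schwarz_ineq2[of "z - L *R tt i" \<nu>] assms nu by simp
  have "norm z <= norm (L *R tt i) + norm (z - L *R tt i)" using norm_triangle_ineq[of "L *R tt i" "z - L *R tt i"] by simp
  moreover have "norm (L *R tt i) <= L * 1" using assms tt(2)[of i] by simp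
  ultimately show "norm z <= 2 * L" using assms by linarith
qed

text \<open>
  The test function of \<open>flux_test_function\<close> has normal derivative \<open>kf \<rho>\<close> up to a small error. Averaging it along each
  \<open>z i\<close> turns its derivative in that direction into a difference, which is moved onto \<open>B W\<close>.
\<close>

lemma flux_estimate:
  fixes z :: "'d => real^'d"
  assumes \<rho>: "\<rho> > 0" "16 * \<rho> <= r" and L: "0 < L" and k: "0 < \<kappa>" "\<kappa> <= L" "real CARD('d) * \<kappa> <= \<rho> / 2"
    "\<kappa> / L * (r / \<rho>) <= sqrt (\<rho> / r)"
    and z: "!!i. norm (z i - L *R tt i) <= \<kappa>"
    and om: "0 <= \<omega>" and per: "!!i x \<Xi>. norm (B (x - z i) \<Xi> - B x \<Xi>) <= \<omega> * norm \<Xi>"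
    and \<Delta>: "!!i. nS (St (r / 2)) (%x. W (x - z i) - W x) <= \<Delta>"
  shows "\<bar>J \<rho>\<bar> <= 10 * real CARD('d) * c0 * \<Lambda> * (L / \<rho>) * (e (3 * \<rho>))^2
     + 69 * real CARD('d) * c0^2 * \<Lambda> * sqrt (\<rho> / r) * e r * e (3 * \<rho>)
     + real CARD('d) * (4 * c0 * r / L) * sqrt (\<rho> / r) * (\<Lambda> * \<Delta> + \<omega> * e r) * e (3 * \<rho>)
     + 45 * c0^2 * (r / \<rho>) * tau r * e (3 * \<rho>)"
proof -
  have r: "r > 0" using \<rho> by linarith
  define n where "n = real CARD('d)"
  have n1: "1 <= n" by (simp add: n_def Suc_leI)
  define \<theta> where "\<theta> = sqrt (\<rho> / r)"
  have th: "0 <= \<theta>" "\<theta> <= 1" "1 <= r / \<rho>" using \<rho> r by (auto simp: \<theta>_def)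
  define e2 where "e2 = e (2 * \<rho>)"
  define e3 where "e3 = e (3 * \<rho>)"
  have e23: "0 <= e2" "e2 <= e3" "0 <= e3" using e_mono[of "2 * \<rho>" "3 * \<rho>"] \<rho> by (auto simp: e2_def e3_def)
  have zn: "\<bar>z i \<bullet> \<nu>\<bar> <= \<kappa>" and zb: "norm (z i) <= 2 * L" for i
    using near_tangent[OF L z k(2)] by auto
  obtain v0 V0 \<Phi> where hv0: "H1 v0 V0" and \<Phi>l: "l2 \<Phi>"
    and nv0: "n2 v0 <= 4 * c0 * r * \<theta> * e2" and nV0: "n2 V0 <= 37 * c0^2 * (r / \<rho>) * e2"
    and n\<Phi>: "n2 \<Phi> <= 32 * c0^2 * \<theta> * e2"
    and AEV: "AE x in lborel. V0 x *v \<nu> = kf \<rho> x + \<Phi> x"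
    and s0: "!!x. v0 x ~= 0 ==> \<rho> <= t x & t x <= 3 * r / 8" "!!x. V0 x ~= 0 ==> \<rho> <= t x & t x <= 3 * r / 8"
    "!!x. \<Phi> x ~= 0 ==> \<rho> <= t x & t x <= 3 * r / 8" and bv0: "bounded {x. v0 x ~= 0}"
      proof (rule flux_test_function[OF \<rho>, folded \<theta>_def e2_def], goal_cases)
    case (1 v0 V0 \<Phi>)
    show ?case by (rule 1(1); fact 1)
  qed
  \<comment> \<open>One averaging vector for each projected axis, so that every tangential
    derivative in the decomposition becomes a difference.\<close>
  obtain es :: "'d list" where es: "set es = UNIV" "distinct es" using finite_distinct_list[of "UNIV :: 'd set"] by auto
  have len: "length es = CARD('d)" using distinct_card[OF es(2)] es(1) by simp
  define zs where "zs = map z es"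
  have zset: "z i \<in> set zs" for i using es(1) by (auto simp: zs_def)
  have zsn: "\<bar>y \<bullet> \<nu>\<bar> <= \<kappa>" if "y \<in> set zs" for y using that zn by (auto simp: zs_def)
  have lenz: "real (length zs) * \<kappa> <= \<rho> / 2" using k(3) by (simp add: zs_def len)
  define v where "v = avs zs v0"
  define V where "V = avs zs V0"
  have hv: "H1 v V" unfolding v_def V_def by (rule avs_hh[OF hv0])
  note vl = H1D(1,2)[OF hv]
  note l0 = H1D(1,2)[OF hv0]
  have kl: "l2 (kf \<rho>)" using kf_hh[OF \<rho>(1)] by (rule H1D)
  have [measurable]: "bm v" "bm V" using vl by auto
  \<comment> \<open>The averages change heights by at most d \<kappa> <= \<rho> / 2 <= r /
    32.\<close>
  have sup: "\<rho> / 2 <= t x & t x < r / 2" if "avs zs g x ~= 0"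
    and "!!x. g x ~= 0 ==> \<rho> <= t x & t x <= 3 * r / 8" for g :: "real^'d => 'b::euclidean_space" and x
  proof -
    have "(\<rho> + a) - real (length zs) * \<kappa> <= x \<bullet> \<nu> & x \<bullet> \<nu> <= (3 * r / 8 + a) + real (length zs) * \<kappa>"
      by (rule avs_support[OF zsn _ _ that(1)]) (use k that(2) in \<open>force simp: t_def\<close>)+
    then show ?thesis using lenz \<rho> by (auto simp: t_def)
  qed
  have vs: "\<rho> / 2 <= t x & t x < r / 2" if "v x ~= 0 | V x ~= 0" for x
    using that sup[of v0 x] sup[of V0 x] s0 by (auto simp: v_def V_def)
  have nv: "n2 v <= 4 * c0 * r * \<theta> * e2" using avs_n2[OF l0(1), of zs] nv0 by (simp add: v_def)
  have nV: "n2 V <= 37 * c0^2 * (r / \<rho>) * e2" using avs_n2[OF l0(2), of zs] nV0 by (simp add: V_def)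
  have bv: "bounded {x. v x ~= 0}" unfolding v_def by (rule bounded_support_avs[OF bv0])
  have v0': "v x = 0" "V x = 0" if "t x <= 0" for x using vs[of x] that \<rho> by auto
  have EQ: "(LBINT x. B x (W x) \<bullet> V x) = - (LBINT x. f x \<bullet> V x) + (LBINT x. h x \<bullet> v x)"
    by (rule eq[OF hv bv]) (use v0' in \<open>auto simp: t_def\<close>)
  have T1: "\<bar>LBINT x. B x (W x) \<bullet> V x\<bar> <= 45 * c0^2 * (r / \<rho>) * tau r * e3"
  proof -
    have c: "norm ((1 / t x) *R v x) <= 2 / \<rho> * norm (v x)" for x
    proof (cases "v x = 0")
      case False
      then have "\<rho> / 2 <= t x" using vs by blast
      then have "1 / t x * norm (v x) <= 2 / \<rho> * norm (v x)" using \<rho> by (intro mult_right_mono) (auto simp: field_simps)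
      then show ?thesis using \<open>\<rho> / 2 <= t x\<close> \<rho> by simp
    qed simp
    have ql: "l2 (rs (St r) (over_t v))" "nS (St r) (over_t v) <= 2 / \<rho> * nS (St r) v"
      by (rule nS_cmp[OF rs_l2[OF vl(1) St_measurable], where C="2 / \<rho>"]; use c \<rho> in auto)+
    have "nS (St r) (over_t v) <= 2 / \<rho> * (4 * c0 * r * \<theta> * e2)"
      using ql(2) nS_le_n2[OF vl(1), of "St r"] nv \<rho> by (intro order_trans[OF ql(2)] mult_left_mono) auto
    also have "... = 8 * c0 * (r / \<rho>) * \<theta> * e2" by simp
    also have "... <= 8 * c0^2 * (r / \<rho>) * 1 * e2"
    proof (intro mult_right_mono mult_mono)
      show "c0 <= c0^2" using c0 by (simp add: power2_eq_square)
    qed (use th c0 e23 \<rho> r in auto)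
    finally have qb: "nS (St r) (over_t v) <= 8 * c0^2 * (r / \<rho>) * e2" by simp
    have "\<bar>LBINT x. B x (W x) \<bullet> V x\<bar> <= tau r * n2 V + tau r * nS (St r) (over_t v)"
      unfolding EQ by (rule rhs_bound[OF vl _ _ _ ql(1)]) (use vs r v0' in \<open>force simp: St_def\<close>)+
    also have "... <= tau r * (37 * c0^2 * (r / \<rho>) * e2) + tau r * (8 * c0^2 * (r / \<rho>) * e2)"
      using nV qb by (intro add_mono mult_left_mono) auto
    also have "... = 45 * c0^2 * (r / \<rho>) * tau r * e2" by (simp add: algebra_simps)
    also have "... <= 45 * c0^2 * (r / \<rho>) * tau r * e3" using e23 \<rho> r by (intro mult_left_mono) auto
    finally show ?thesis .
  qed
  define N where "N = (LBINT x. (B x (W x) *v \<nu>) \<bullet> (V x *v \<nu>))"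
  have m: "l2 (%x. B x (W x) *v p)" for p by (rule mv_l2(1)[OF BW_l2])
  have Bm[measurable]: "bm (%x. B x (W x) *v p)" for p using m by auto
  have akl: "l2 (avs zs (kf \<rho>))" and apl: "l2 (avs zs \<Phi>)" by (intro avs_l2 kl \<Phi>l)+
  have AEN: "AE x in lborel. V x *v \<nu> = avs zs (kf \<rho>) x + avs zs \<Phi> x"
    using avs_linear_AE[OF l0(2) bounded_linear_mv[of \<nu>], of zs]
      avs_cong_AE[OF mv_l2(1)[OF l0(2)] l2_add(1)[OF kl \<Phi>l] AEV, of zs]
      avs_add_AE[OF kl \<Phi>l, of zs]
    by eventually_elim (simp add: V_def)
  have N1: "N = (LBINT x. (B x (W x) *v \<nu>) \<bullet> avs zs (kf \<rho>) x) + (LBINT x. (B x (W x) *v \<nu>) \<bullet> avs zs \<Phi> x)"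
  proof -
    have [measurable]: "bm (avs zs (kf \<rho>))" "bm (avs zs \<Phi>)" using akl apl by auto
    have "N = (LBINT x. (B x (W x) *v \<nu>) \<bullet> avs zs (kf \<rho>) x + (B x (W x) *v \<nu>) \<bullet> avs zs \<Phi> x)"
      unfolding N_def
    proof (rule integral_cong_AE)
      show "AE x in lborel. (B x (W x) *v \<nu>) \<bullet> (V x *v \<nu>) = (B x (W x) *v \<nu>) \<bullet> avs zs (kf \<rho>) x + (B x (W x) *v \<nu>) \<bullet> avs zs \<Phi> x"
        using AEN by eventually_elim (simp add: inner_add_right)
    qed measurable
    then show ?thesis using l2_inner(1)[OF m akl] l2_inner(1)[OF m apl] by simp
  qed
  have N2: "\<bar>LBINT x. (B x (W x) *v \<nu>) \<bullet> avs zs \<Phi> x\<bar> <= 32 * c0^2 * \<Lambda> * \<theta> * e r * e3"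
  proof -
    have "\<bar>LBINT x. (B x (W x) *v \<nu>) \<bullet> avs zs \<Phi> x\<bar> <= \<Lambda> * e r * n2 (avs zs \<Phi>)"
    proof (rule flux_le[OF apl])
      fix x assume "avs zs \<Phi> x ~= 0"
      then show "x \<in> St r" using sup[of \<Phi> x] s0(3) r by (auto simp: St_def)
    qed (simp add: nu)
    also have "... <= \<Lambda> * e r * (32 * c0^2 * \<theta> * e3)"
    proof (rule mult_left_mono)
      have "32 * c0^2 * \<theta> * e2 <= 32 * c0^2 * \<theta> * e3" using e23 th by (intro mult_left_mono) auto
      then show "n2 (avs zs \<Phi>) <= 32 * c0^2 * \<theta> * e3" using avs_n2[OF \<Phi>l, of zs] n\<Phi> by linarith
    qed (use Lam in auto)
    finally show ?thesis by (simp add: mult_ac)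
  qed
  \<comment> \<open>Replacing \<open>kf\<close> by its average costs the total length 2 L d of the
    vectors times the gradient bound 5 c0 / \<rho>. The averaged layer stays below 3 \<rho>, hence
    e(3 \<rho>) instead of e(2 \<rho>).\<close>
  have N3: "\<bar>J \<rho> - (LBINT x. (B x (W x) *v \<nu>) \<bullet> avs zs (kf \<rho>) x)\<bar> <= 10 * n * c0 * \<Lambda> * (L / \<rho>) * e3^2"
  proof -
    have dl: "l2 (%x. avs zs (kf \<rho>) x - kf \<rho> x)" by (rule l2_diff(1)[OF akl kl])
    have "(LBINT x. (B x (W x) *v \<nu>) \<bullet> avs zs (kf \<rho>) x) - J \<rho> = (LBINT x. (B x (W x) *v \<nu>) \<bullet> (avs zs (kf \<rho>) x - kf \<rho> x))"
      using l2_inner(1)[OF m akl] l2_inner(1)[OF m kl] by (simp add: inner_diff_right J_def)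
    moreover have "\<bar>LBINT x. (B x (W x) *v \<nu>) \<bullet> (avs zs (kf \<rho>) x - kf \<rho> x)\<bar> <= \<Lambda> * e (3 * \<rho>) * n2 (%x. avs zs (kf \<rho>) x - kf \<rho> x)"
    proof (rule flux_le[OF dl])
      fix x assume "avs zs (kf \<rho>) x - kf \<rho> x ~= 0"
      then have "avs zs (kf \<rho>) x ~= 0 | kf \<rho> x ~= 0" by auto
      then show "x \<in> St (3 * \<rho>)"
      proof
        assume "avs zs (kf \<rho>) x ~= 0"
        then have "(\<rho> + a) - real (length zs) * \<kappa> <= x \<bullet> \<nu> & x \<bullet> \<nu> <= (2 * \<rho> + a) + real (length zs) * \<kappa>"
          by (rule avs_support[rotated 3, OF _ zsn])
             (use k kf_support[OF \<rho>(1)] in \<open>auto simp: t_def less_imp_le algebra_simps\<close>)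
        then show ?thesis using lenz \<rho> by (auto simp: St_def t_def)
      next
        assume "kf \<rho> x ~= 0"
        from kf_support(2)[OF \<rho>(1) this] show ?thesis using \<rho> by (simp add: St_def)
      qed
    qed (simp add: nu)
    moreover have "\<Lambda> * e (3 * \<rho>) * n2 (%x. avs zs (kf \<rho>) x - kf \<rho> x) <= \<Lambda> * e3 * (n * (2 * L) * (5 * c0 / \<rho> * e3))"
    proof -
      have "(\<Sum>y\<leftarrow>zs. norm y) <= (\<Sum>i\<leftarrow>es. 2 * L)"
        unfolding zs_def using zb by (simp add: sum_list_mono comp_def)
      also have "... = n * (2 * L)" by (simp add: sum_list_triv len n_def)
      finally have a: "(\<Sum>y\<leftarrow>zs. norm y) <= n * (2 * L)" .
      have b: "n2 (kK \<rho>) <= 5 * c0 / \<rho> * e3"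
        using kf_bounds(2)[OF \<rho>(1)] mult_left_mono[OF e23(2), of "5 * c0 / \<rho>"] c0 \<rho> by (simp add: e2_def)
      have "n2 (%x. avs zs (kf \<rho>) x - kf \<rho> x) <= (\<Sum>y\<leftarrow>zs. norm y) * n2 (kK \<rho>)"
        by (rule n2_avs_diff[OF kf_hh[OF \<rho>(1)]])
      also have "... <= n * (2 * L) * (5 * c0 / \<rho> * e3)"
        using a b n1 L by (intro mult_mono) auto
      finally show ?thesis unfolding e3_def[symmetric] using Lam e23 by (intro mult_left_mono) auto
    qed
    moreover have "\<Lambda> * e3 * (n * (2 * L) * (5 * c0 / \<rho> * e3)) = 10 * n * c0 * \<Lambda> * (L / \<rho>) * e3^2"
      by (simp add: power2_eq_square mult_ac)
    ultimately show ?thesis by linarith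
  qed
  define I where "I i = (LBINT x. (B x (W x) *v axis i 1) \<bullet> (V x *v tt i))" for i
  define \<Gamma> where "\<Gamma> = \<Lambda> * \<Delta> + \<omega> * e r"
  have \<Gamma>0: "0 <= \<Gamma>" using order_trans[OF nS_nonneg \<Delta>] Lam om by (simp add: \<Gamma>_def)
  have I: "\<bar>I i\<bar> <= (4 * c0 * r / L) * \<theta> * \<Gamma> * e3 + 37 * c0^2 * \<Lambda> * \<theta> * e r * e3" for i
  proof -
    obtain q where q: "l2 q" "n2 q <= n2 v0" "AE x in lborel. V x *v z i = q (x + z i) - q x"
      "!!x. q x ~= 0 ==> (\<rho> + a) - real (length zs) * \<kappa> <= x \<bullet> \<nu> & x \<bullet> \<nu> <= (3 * r / 8 + a) + real (length zs) * \<kappa>"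
    proof -
      have "\<rho> + a <= x \<bullet> \<nu> & x \<bullet> \<nu> <= 3 * r / 8 + a" if "v0 x ~= 0" for x
        using s0(1)[OF that] by (auto simp: t_def)
      from avs_difference[OF hv0 zset[of i] zsn less_imp_le[OF k(1)] this] show ?thesis
        unfolding V_def[symmetric] using that by blast
    qed
    have qm[measurable]: "bm q" using q(1) by auto
    \<comment> \<open>The deviation of \<open>z i\<close> from the tangential vector of length scale
      L. It meets the full gradient of size r / \<rho>; the hypothesis on \<kappa> / L makes up for
      that.\<close>
    define y where "y = z i - L *R tt i"
    have yl: "l2 (%x. V x *v y)" "n2 (%x. V x *v y) <= norm y * n2 V" by (rule mv_l2[OF vl(2)])+
    have a1: "norm (axis i 1 :: real^'d) = 1" by simp
    have Vy: "V x *v tt i = (1 / L) *R (V x *v z i) - (1 / L) *R (V x *v y)" for x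
      using L by (simp add: y_def matrix_vector_mult_diff_distrib matrix_vector_mult_scaleR scaleR_diff_right)
    have l1: "l2 (%x. V x *v z i)" by (rule mv_l2(1)[OF vl(2)])
    have "I i = (LBINT x. (1 / L) * ((B x (W x) *v axis i 1) \<bullet> (V x *v z i)) - (1 / L) * ((B x (W x) *v axis i 1) \<bullet> (V x *v y)))"
      unfolding I_def Vy by (simp add: inner_diff_right)
    also have "... = (1 / L) * (LBINT x. (B x (W x) *v axis i 1) \<bullet> (V x *v z i)) - (1 / L) * (LBINT x. (B x (W x) *v axis i 1) \<bullet> (V x *v y))"
      using l2_inner(1)[OF m l1] l2_inner(1)[OF m yl(1)] by simp
    also have "(LBINT x. (B x (W x) *v axis i 1) \<bullet> (V x *v z i)) = (LBINT x. (B x (W x) *v axis i 1) \<bullet> (q (x + z i) - q x))"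
    proof (rule integral_cong_AE)
      show "AE x in lborel. (B x (W x) *v axis i 1) \<bullet> (V x *v z i) = (B x (W x) *v axis i 1) \<bullet> (q (x + z i) - q x)"
        using q(3) by eventually_elim simp
    qed measurable
    finally have Ieq: "I i = (1 / L) * (LBINT x. (B x (W x) *v axis i 1) \<bullet> (q (x + z i) - q x))
        - (1 / L) * (LBINT x. (B x (W x) *v axis i 1) \<bullet> (V x *v y))" .
    have A: "\<bar>LBINT x. (B x (W x) *v axis i 1) \<bullet> (q (x + z i) - q x)\<bar> <= \<Gamma> * (4 * c0 * r * \<theta> * e3)"
    proof -
      have "\<bar>LBINT x. (B x (W x) *v axis i 1) \<bullet> (q (x + z i) - q x)\<bar> <= \<Gamma> * n2 q"
        unfolding \<Gamma>_def
      proof (rule flux_tangential[OF q(1) r _ om per \<Delta> a1])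
        fix x assume "q x ~= 0"
        from q(4)[OF this] show "x \<in> St (r / 2)" using lenz \<rho> by (auto simp: St_def t_def)
      qed
      also have "... <= \<Gamma> * (4 * c0 * r * \<theta> * e3)"
      proof (rule mult_left_mono[OF _ \<Gamma>0])
        have "4 * c0 * r * \<theta> * e2 <= 4 * c0 * r * \<theta> * e3" using e23 th c0 r by (intro mult_left_mono) auto
        then show "n2 q <= 4 * c0 * r * \<theta> * e3" using q(2) nv0 by linarith
      qed
      finally show ?thesis .
    qed
    have Bb: "\<bar>LBINT x. (B x (W x) *v axis i 1) \<bullet> (V x *v y)\<bar> <= L * (37 * c0^2 * \<Lambda> * \<theta> * e r * e3)"
    proof -
      have "\<bar>LBINT x. (B x (W x) *v axis i 1) \<bullet> (V x *v y)\<bar> <= \<Lambda> * e r * n2 (%x. V x *v y)"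
      proof (rule flux_le[OF yl(1)])
        fix x assume "V x *v y ~= 0"
        then have "V x ~= 0" by (metis matrix_vector_mult_0)
        then show "x \<in> St r" using vs[of x] r by (auto simp: St_def)
      qed simp
      also have "... <= \<Lambda> * e r * (\<kappa> * (37 * c0^2 * (r / \<rho>) * e3))"
      proof (rule mult_left_mono)
        have "37 * c0^2 * (r / \<rho>) * e2 <= 37 * c0^2 * (r / \<rho>) * e3" using e23 \<rho> r by (intro mult_left_mono) auto
        then have "norm y * n2 V <= \<kappa> * (37 * c0^2 * (r / \<rho>) * e3)"
          using z[of i] nV k unfolding y_def by (intro mult_mono) auto
        then show "n2 (%x. V x *v y) <= \<kappa> * (37 * c0^2 * (r / \<rho>) * e3)" using yl(2) by linarith
      qed (use Lam in auto)
      also have "... = (L * (37 * c0^2 * \<Lambda> * e r * e3)) * (\<kappa> / L * (r / \<rho>))" using L by (simp add: mult_ac)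
      also have "... <= (L * (37 * c0^2 * \<Lambda> * e r * e3)) * \<theta>"
        using k(4) L Lam e23 by (intro mult_left_mono) (auto simp: \<theta>_def)
      finally show ?thesis by (simp add: mult_ac)
    qed
    have "\<bar>I i\<bar> <= (1 / L) * \<bar>LBINT x. (B x (W x) *v axis i 1) \<bullet> (q (x + z i) - q x)\<bar>
       + (1 / L) * \<bar>LBINT x. (B x (W x) *v axis i 1) \<bullet> (V x *v y)\<bar>"
      unfolding Ieq using L by (intro order_trans[OF abs_triangle_ineq4]) (simp add: abs_mult)
    also have "... <= (1 / L) * (\<Gamma> * (4 * c0 * r * \<theta> * e3)) + (1 / L) * (L * (37 * c0^2 * \<Lambda> * \<theta> * e r * e3))"
      using A Bb L by (intro add_mono mult_left_mono) auto
    also have "... = (4 * c0 * r / L) * \<theta> * \<Gamma> * e3 + 37 * c0^2 * \<Lambda> * \<theta> * e r * e3" using L by (simp add: mult_ac)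
    finally show ?thesis .
  qed
  have "(LBINT x. B x (W x) \<bullet> V x) = N + (\<Sum>i\<in>UNIV. I i)"
  proof -
    have "(LBINT x. B x (W x) \<bullet> V x) = (LBINT x. (B x (W x) *v \<nu>) \<bullet> (V x *v \<nu>) + (\<Sum>i\<in>UNIV. (B x (W x) *v axis i 1) \<bullet> (V x *v tt i)))"
      unfolding tt_def by (subst matrix_axis_decomp[OF nu_inner]) (rule refl)
    also have "... = N + (\<Sum>i\<in>UNIV. I i)"
      unfolding N_def I_def using l2_inner(1)[OF m mv_l2(1)[OF vl(2)]] by simp
    finally show ?thesis .
  qed
  then have "J \<rho> = (J \<rho> - (LBINT x. (B x (W x) *v \<nu>) \<bullet> avs zs (kf \<rho>) x)) + (LBINT x. B x (W x) \<bullet> V x)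
      - (\<Sum>i\<in>UNIV. I i) - (LBINT x. (B x (W x) *v \<nu>) \<bullet> avs zs \<Phi> x)"
    using N1 by simp
  then have "\<bar>J \<rho>\<bar> <= \<bar>J \<rho> - (LBINT x. (B x (W x) *v \<nu>) \<bullet> avs zs (kf \<rho>) x)\<bar> + \<bar>LBINT x. B x (W x) \<bullet> V x\<bar>
      + \<bar>\<Sum>i\<in>UNIV. I i\<bar> + \<bar>LBINT x. (B x (W x) *v \<nu>) \<bullet> avs zs \<Phi> x\<bar>" by linarith
  moreover have "\<bar>\<Sum>i\<in>UNIV. I i\<bar> <= n * ((4 * c0 * r / L) * \<theta> * \<Gamma> * e3 + 37 * c0^2 * \<Lambda> * \<theta> * e r * e3)"
  proof -
    have "\<bar>\<Sum>i\<in>UNIV. I i\<bar> <= (\<Sum>i\<in>(UNIV::'d set). (4 * c0 * r / L) * \<theta> * \<Gamma> * e3 + 37 * c0^2 * \<Lambda> * \<theta> * e r * e3)"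
      by (intro order_trans[OF sum_abs] sum_mono I)
    then show ?thesis by (simp add: n_def)
  qed
  ultimately have "\<bar>J \<rho>\<bar> <= 10 * n * c0 * \<Lambda> * (L / \<rho>) * e3^2 + 45 * c0^2 * (r / \<rho>) * tau r * e3
     + n * ((4 * c0 * r / L) * \<theta> * \<Gamma> * e3 + 37 * c0^2 * \<Lambda> * \<theta> * e r * e3) + 32 * c0^2 * \<Lambda> * \<theta> * e r * e3"
    using N2 N3 T1 by linarith
  \<comment> \<open>As d >= 1, the normal error term joins the tangential ones: 37 + 32 =
    69.\<close>
  moreover have "1 * (32 * c0^2 * \<Lambda> * \<theta> * e r * e3) <= n * (32 * c0^2 * \<Lambda> * \<theta> * e r * e3)"
    using n1 Lam th e23 by (intro mult_right_mono) auto
  ultimately have "\<bar>J \<rho>\<bar> <= 10 * n * c0 * \<Lambda> * (L / \<rho>) * e3^2 + 45 * c0^2 * (r / \<rho>) * tau r * e3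
     + n * ((4 * c0 * r / L) * \<theta> * \<Gamma> * e3) + n * (69 * c0^2 * \<Lambda> * \<theta> * e r * e3)"
    by (simp add: algebra_simps)
  then show ?thesis
    unfolding n_def[symmetric] \<theta>_def[symmetric] e3_def[symmetric] \<Gamma>_def[symmetric] by (simp add: mult.assoc add_ac)
qed

text \<open>All lengths are tied to r: \<rho> = r / 3^N, translation length L = c \<rho>, deviation
  \<kappa> = r / 2^k / 4. Hole filling bounds e(4 \<kappa>) by (L / r) e(r) and data, so every error
  in the difference estimate has the size L / r of its main term, and the factor r / L of the flux
  estimate cancels it. What remains is sqrt(\<rho> / r) e(r) e(3 \<rho>), a small multiple of e(3
  \<rho>)^2, and data.\<close>

lemma one_step:
  fixes z :: "'d => real^'d"
  defines "n == real CARD('d)"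
    and "K == 20 * c0 * ((2 * \<Lambda> + 2) / \<mu> + 8 / sqrt \<mu> + 1)"
    and "q == (3 + 4 * c0) / \<mu> / sqrt (1 - lam)"
  assumes r: "r > 0" and N: "3 <= N" and c: "0 < c" "c <= 1" "10 * n * c0 * \<Lambda> * c <= \<mu> / 36"
    and k1: "1 / 2 ^ k / 4 <= c / 3 ^ N" and k2: "n * (1 / 2 ^ k / 4) <= 1 / 3 ^ N / 2"
    and k3: "(1 / 2 ^ k / 4) * 3 ^ N * 3 ^ N / c <= sqrt (1 / 3 ^ N)"
    and k4: "lam ^ k <= (c / 3 ^ N)^2"
    and z: "!!i. norm (z i - (c * r / 3 ^ N) *R tt i) <= r / 2 ^ k / 4"
    and om: "0 <= \<omega>" "\<omega> <= c / 3 ^ N"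
    and per: "!!i x \<Xi>. norm (B (x - z i) \<Xi> - B x \<Xi>) <= \<omega> * norm \<Xi>"
  shows "(e (r / 3 ^ N))^2 <= (1 / 12) * (e (3 * (r / 3 ^ N)))^2
    + 9 * (69 * n * c0^2 * \<Lambda> + 4 * n * c0 * (6 * \<Lambda> * K + 1))^2 / \<mu>^2 * (1 / 3 ^ N) * (e r)^2
    + 9 * (4 * n * c0 * \<Lambda> * K * (3 ^ N / c) * (q + 3 ^ N / c) + 45 * c0^2 * 3 ^ N + 3 + 4 * c0)^2 / \<mu>^2 * (tau r)^2"
proof -
  define \<rho> where "\<rho> = r / 3 ^ N"
  define L where "L = c * r / 3 ^ N"
  define \<kappa> where "\<kappa> = r / 2 ^ k / 4"
  define \<theta> where "\<theta> = sqrt (1 / 3 ^ N)"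
  define p where "p = (3::real) ^ N / c"
  have \<rho>0: "\<rho> > 0" and L0: "L > 0" and \<kappa>0: "\<kappa> > 0" using r c by (auto simp: \<rho>_def L_def \<kappa>_def)
  have p1: "p > 0" using c by (simp add: p_def)
  have rL: "r / L = p" "L / \<rho> = c" "r / \<rho> = 3 ^ N" "\<rho> / r = 1 / 3 ^ N" "L / r = c / 3 ^ N"
    using r c by (auto simp: L_def \<rho>_def p_def)
  have N3: "(27::real) <= 3 ^ N" using power_increasing[OF N, of "3::real"] by simp
  have rho16: "16 * \<rho> <= r" using N3 r by (simp add: \<rho>_def field_simps)
  have \<theta>1: "0 <= \<theta>" "\<theta> <= 1" "\<theta>^2 = 1 / 3 ^ N" by (auto simp: \<theta>_def)
  have \<kappa>L: "\<kappa> <= L" using mult_left_mono[OF k1, of r] r by (simp add: \<kappa>_def L_def mult_ac)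
  have n\<kappa>: "real CARD('d) * \<kappa> <= \<rho> / 2" using mult_left_mono[OF k2, of r] r by (simp add: \<kappa>_def \<rho>_def n_def mult_ac)
  have n1: "1 <= n" by (simp add: n_def Suc_leI)
  have "\<kappa> / L = (1 / 2 ^ k / 4) * 3 ^ N / c" using r c by (simp add: \<kappa>_def L_def field_simps)
  then have k3': "\<kappa> / L * (r / \<rho>) <= sqrt (\<rho> / r)" using k3 unfolding rL by (simp add: mult_ac)
  have k6: "6 * \<kappa> <= r"
  proof -
    have "\<rho> <= r / 2" using rho16 \<rho>0 by simp
    moreover have "1 * \<kappa> <= n * \<kappa>" using n1 \<kappa>0 by (intro mult_right_mono) auto
    ultimately have "\<kappa> <= r / 32" using n\<kappa> rho16 by (simp add: n_def)
    then show ?thesis using r by simp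
  qed
  have zn: "\<bar>(- z i) \<bullet> \<nu>\<bar> <= \<kappa>" and zb: "norm (- z i) <= 2 * L" for i
    using near_tangent[OF L0 z[folded L_def \<kappa>_def] \<kappa>L] by auto
  define x where "x = e (3 * \<rho>)"
  define y where "y = e r"
  define T where "T = tau r"
  have pos: "0 <= x" "0 <= y" "0 <= T" by (auto simp: x_def y_def T_def)
  have q0: "q >= 0" using c0 mu lam by (simp add: q_def)
  have K0: "K >= 0" using c0 mu Lam by (simp add: K_def)
  \<comment> \<open>The factor 1/4 in \<kappa> makes 4 \<kappa> = r / 2^k one of the halved
    strips.\<close>
  have hole: "e (4 * \<kappa>) <= (L / r) * y + q * T"
  proof -
    have "(e (r / 2 ^ k))^2 <= lam ^ k * y^2 + ((3 + 4 * c0) / \<mu>)^2 / (1 - lam) * T^2"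
      using hole_filling_iter[OF r, of k] by (simp add: y_def T_def)
    also have "((3 + 4 * c0) / \<mu>)^2 / (1 - lam) = q^2" using lam by (simp add: q_def power_divide power_mult_distrib)
    also have "lam ^ k * y^2 + q^2 * T^2 <= (L / r)^2 * y^2 + q^2 * T^2"
      using k4 unfolding rL by (intro add_mono mult_right_mono) auto
    also have "... <= ((L / r) * y + q * T)^2"
    proof -
      have "0 <= 2 * ((L / r) * y) * (q * T)" using L0 r pos q0 by simp
      then show ?thesis unfolding power2_sum power_mult_distrib[symmetric] by linarith
    qed
    finally have "e (r / 2 ^ k) <= (L / r) * y + q * T" by (rule power2_le_imp_le) (use L0 r pos q0 in auto)
    then show ?thesis by (simp add: \<kappa>_def)
  qed
  \<comment> \<open>5 = 2 + 1 + 1 + 1: the length of \<open>z i\<close>, the coefficient error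
    \<omega>, the choice \<beta> = L / r, and hole filling.\<close>
  define \<Delta> where "\<Delta> = K * (5 * (L / r) * y + q * T + T * p)"
  have Lr1: "0 < L / r" "L / r <= 1"
  proof -
    show "0 < L / r" using L0 r by simp
    have "c <= 3 ^ N" using c N3 by linarith
    then show "L / r <= 1" unfolding rL by simp
  qed
  have \<Delta>: "nS (St (r / 2)) (%x. W (x - z i) - W x) <= \<Delta>" for i
  proof -
    have "nS (St (r / 2)) (%x. W (x + - z i) - W x) <= K * ((norm (- z i) / r + \<omega> + L / r) * y + e (4 * \<kappa>) + T / (L / r))"
      unfolding K_def y_def T_def
      by (rule difference_estimate[OF \<kappa>0 k6 zn om(1) _ Lr1]) (use per in simp)
    also have "... <= K * ((2 * L / r + L / r + L / r) * y + ((L / r) * y + q * T) + T * p)"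
    proof (intro mult_left_mono add_mono hole mult_right_mono)
      show "norm (- z i) / r <= 2 * L / r" using zb[of i] r by (simp add: divide_right_mono)
      show "\<omega> <= L / r" using om rL by simp
      show "T / (L / r) <= T * p" unfolding rL(1)[symmetric] by simp
    qed (use K0 pos in auto)
    also have "... = \<Delta>" by (simp add: \<Delta>_def algebra_simps)
    finally show ?thesis by simp
  qed
  have lin: "(4 * c0 * r / L) * \<theta> * (\<Lambda> * \<Delta> + \<omega> * y) * x
    <= 4 * c0 * (6 * \<Lambda> * K + 1) * \<theta> * y * x + 4 * c0 * \<Lambda> * K * p * (q + p) * T * x"
  proof -
    have a: "r / L * (L / r) = 1" using L0 r by simp
    have "(r / L) * (\<Lambda> * \<Delta> + \<omega> * y) <= (r / L) * (\<Lambda> * \<Delta> + (L / r) * y)"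
      using om rL L0 r pos by (intro mult_left_mono add_left_mono mult_right_mono) auto
    also have "... = \<Lambda> * K * (5 * ((r / L) * (L / r)) * y + (r / L) * (q * T + T * p)) + (r / L) * (L / r) * y"
      by (simp only: \<Delta>_def algebra_simps)
    also have "... = (5 * \<Lambda> * K + 1) * y + \<Lambda> * K * p * (q + p) * T"
      unfolding a unfolding rL by (simp add: algebra_simps)
    finally have "4 * c0 * \<theta> * x * ((r / L) * (\<Lambda> * \<Delta> + \<omega> * y)) <= 4 * c0 * \<theta> * x * ((5 * \<Lambda> * K + 1) * y + \<Lambda> * K * p * (q + p) * T)"
      using c0 \<theta>1 pos by (intro mult_left_mono) auto
    also have "... = 4 * c0 * (5 * \<Lambda> * K + 1) * \<theta> * y * x + \<theta> * (4 * c0 * \<Lambda> * K * p * (q + p) * T * x)"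
      by (simp add: algebra_simps)
    also have "... <= 4 * c0 * (6 * \<Lambda> * K + 1) * \<theta> * y * x + 1 * (4 * c0 * \<Lambda> * K * p * (q + p) * T * x)"
      using c0 \<theta>1 pos Lam K0 p1 q0 by (intro add_mono mult_right_mono mult_left_mono mult_nonneg_nonneg add_nonneg_nonneg) auto
    finally show ?thesis by (simp add: mult_ac)
  qed
  have fl: "\<bar>J \<rho>\<bar> <= 10 * n * c0 * \<Lambda> * c * x^2 + 69 * n * c0^2 * \<Lambda> * \<theta> * y * x
     + n * ((4 * c0 * r / L) * \<theta> * (\<Lambda> * \<Delta> + \<omega> * y) * x) + 45 * c0^2 * 3 ^ N * T * x"
    using flux_estimate[OF \<rho>0 rho16 L0 \<kappa>0 \<kappa>L n\<kappa> k3' z[folded L_def \<kappa>_def] om(1) per \<Delta>]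
    unfolding n_def[symmetric] rL x_def[symmetric] y_def[symmetric] T_def[symmetric] \<theta>_def[symmetric]
    by (simp add: mult.assoc)
  have "\<mu> * (e \<rho>)^2 <= \<bar>J \<rho>\<bar> + (3 + 4 * c0) * T * x"
  proof -
    have "tau (2 * \<rho>) * e (2 * \<rho>) <= T * x"
      unfolding T_def x_def using rho16 \<rho>0 by (intro mult_mono tau_mono e_mono) auto
    then have "(3 + 4 * c0) * (tau (2 * \<rho>) * e (2 * \<rho>)) <= (3 + 4 * c0) * (T * x)" using c0 by (intro mult_left_mono) auto
    then show ?thesis using energy[OF \<rho>0] by (simp add: mult.assoc)
  qed
  also have "... <= 10 * n * c0 * \<Lambda> * c * x^2 + 69 * n * c0^2 * \<Lambda> * \<theta> * y * x
     + n * (4 * c0 * (6 * \<Lambda> * K + 1) * \<theta> * y * x + 4 * c0 * \<Lambda> * K * p * (q + p) * T * x) + 45 * c0^2 * 3 ^ N * T * x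
     + (3 + 4 * c0) * T * x"
    using fl mult_left_mono[OF lin, of n] n1 by linarith
  also have "... = 10 * n * c0 * \<Lambda> * c * x^2 + x * ((69 * n * c0^2 * \<Lambda> + 4 * n * c0 * (6 * \<Lambda> * K + 1)) * (\<theta> * y))
     + x * ((4 * n * c0 * \<Lambda> * K * p * (q + p) + 45 * c0^2 * 3 ^ N + 3 + 4 * c0) * T)"
    by (simp add: algebra_simps)
  \<comment> \<open>Both products receive \<mu> / 36 from Young's inequality, and the first term is
    below \<mu> / 36 by the choice of c; together they make the 1 / 12 of the claim.\<close>
  also have "... <= \<mu> / 36 * x^2 + (\<mu> / 36 * x^2 + ((69 * n * c0^2 * \<Lambda> + 4 * n * c0 * (6 * \<Lambda> * K + 1)) * (\<theta> * y))^2 / (4 * (\<mu> / 36)))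
     + (\<mu> / 36 * x^2 + ((4 * n * c0 * \<Lambda> * K * p * (q + p) + 45 * c0^2 * 3 ^ N + 3 + 4 * c0) * T)^2 / (4 * (\<mu> / 36)))"
    using c(3) mu by (intro add_mono young mult_right_mono) auto
  also have "... = \<mu> * ((1 / 12) * x^2 + 9 * (69 * n * c0^2 * \<Lambda> + 4 * n * c0 * (6 * \<Lambda> * K + 1))^2 / \<mu>^2 * \<theta>^2 * y^2
     + 9 * (4 * n * c0 * \<Lambda> * K * p * (q + p) + 45 * c0^2 * 3 ^ N + 3 + 4 * c0)^2 / \<mu>^2 * T^2)"
  proof -
    have *: "(X * Y)^2 / (4 * (\<mu> / 36)) = \<mu> * (9 * X^2 / \<mu>^2 * Y^2)" for X Y :: real
      using mu by (simp add: field_simps power2_eq_square)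
    show ?thesis unfolding * power_mult_distrib[of \<theta> y] by (simp add: algebra_simps)
  qed
  finally show ?thesis using mu
    unfolding mult_le_cancel_left_pos[OF mu] \<theta>1 \<rho>_def[symmetric] x_def[symmetric] y_def[symmetric] T_def[symmetric] p_def by simp
qed

end

section \<open>Summation over geometric scales\<close>

text \<open>Above the window the two shifted tails are at most the tail itself, so half of it is
  absorbed; summability makes this legitimate. Inside the window each term is compared with
  \<open>a k1\<close>, which belongs to the upper tail. Below the window the shifted sums are
  bounded by the full sum, of which again half is absorbed. The 6 is 2 + 2 * 2, for the part below
  and the tail above.\<close>

lemma summation_absorb:
  fixes a b :: "nat => real"
  assumes a: "!!k. 0 <= a k" "summable a" and b: "!!k. 0 <= b k" "summable b"
    and k: "k0 <= k1" "k1 <= k0 + P" and D: "0 <= D"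
    and step: "!!k. k < k0 | k1 <= k ==> a k <= (1 / 4) * a (k + 1) + (1 / 4) * a (k + N) + b k"
    and win: "!!k. k0 <= k ==> k < k1 ==> a k <= D * a k1"
  shows "(\<Sum>k. a k) <= (6 + 4 * real P * D) * (\<Sum>k. b k)"
proof -
  define S1 where "S1 = (\<Sum>k. a (k + k1))"
  define Bt where "Bt = (\<Sum>k. b k)"
  have sh: "summable (%k. a (k + m))" for m using a(2) by (simp add: summable_iff_shift)
  have shb: "summable (%k. b (k + m))" for m using b(2) by (simp add: summable_iff_shift)
  have tail: "(\<Sum>k. a (k + (m + m'))) <= (\<Sum>k. a (k + m))" for m m'
  proof -
    have "(\<Sum>k. a (k + m)) = (\<Sum>k. a (k + m' + m)) + (\<Sum>k<m'. a (k + m))"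
      using suminf_split_initial_segment[OF sh[of m], of m'] by simp
    moreover have "0 <= (\<Sum>k<m'. a (k + m))" using a by (simp add: sum_nonneg)
    ultimately show ?thesis by (simp add: add_ac)
  qed
  have Btail: "(\<Sum>k. b (k + m)) <= Bt" for m
  proof -
    have "Bt = (\<Sum>k. b (k + m)) + (\<Sum>k<m. b k)"
      unfolding Bt_def using suminf_split_initial_segment[OF b(2), of m] by simp
    moreover have "0 <= (\<Sum>k<m. b k)" using b by (simp add: sum_nonneg)
    ultimately show ?thesis by simp
  qed
  have S1: "S1 <= 2 * Bt"
  proof -
    have "S1 <= (\<Sum>k. (1 / 4) * a (k + (k1 + 1)) + (1 / 4) * a (k + (k1 + N)) + b (k + k1))"
      unfolding S1_def
    proof (intro suminf_le sh summable_add summable_mult shb)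
      show "a (k + k1) <= (1 / 4) * a (k + (k1 + 1)) + (1 / 4) * a (k + (k1 + N)) + b (k + k1)" for k
        using step[of "k + k1"] by (simp add: add_ac)
    qed
    also have "... = (1 / 4) * (\<Sum>k. a (k + (k1 + 1))) + (1 / 4) * (\<Sum>k. a (k + (k1 + N))) + (\<Sum>k. b (k + k1))"
    proof -
      have "(%k. (1 / 4) * a (k + (k1 + 1)) + (1 / 4) * a (k + (k1 + N)) + b (k + k1)) sums
        ((1 / 4) * (\<Sum>k. a (k + (k1 + 1))) + (1 / 4) * (\<Sum>k. a (k + (k1 + N))) + (\<Sum>k. b (k + k1)))"
        by (intro sums_add sums_mult summable_sums sh shb)
      then show ?thesis by (rule sums_unique[symmetric])
    qed
    also have "... <= (1 / 4) * S1 + (1 / 4) * S1 + Bt"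
      using tail[of k1 1] tail[of k1 N] Btail[of k1] unfolding S1_def by linarith
    finally show ?thesis by simp
  qed
  define Sw where "Sw = (\<Sum>k\<in>{k0..<k1}. a k)"
  define S0 where "S0 = (\<Sum>k<k0. a k)"
  define T where "T = (\<Sum>k. a k)"
  have Bt0: "0 <= Bt" unfolding Bt_def by (rule suminf_nonneg[OF b(2,1)])
  have "a k1 <= S1" using sum_le_suminf[OF sh[of k1], of "{0}"] a by (simp add: S1_def)
  then have ak1: "a k1 <= 2 * Bt" using S1 by linarith
  have "Sw <= (\<Sum>k\<in>{k0..<k1}. D * (2 * Bt))"
    unfolding Sw_def
  proof (rule sum_mono)
    fix k assume "k \<in> {k0..<k1}"
    then show "a k <= D * (2 * Bt)" using win[of k] mult_left_mono[OF ak1 D] by auto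
  qed
  also have "... = real (k1 - k0) * (D * (2 * Bt))" by simp
  also have "... <= real P * (D * (2 * Bt))" using k D Bt0 by (intro mult_right_mono) auto
  finally have Sw: "Sw <= 2 * real P * D * Bt" by (simp add: mult_ac)
  have T: "T = S0 + Sw + S1"
  proof -
    have "T = S1 + (\<Sum>k<k1. a k)"
      unfolding T_def S1_def using suminf_split_initial_segment[OF a(2), of k1] by simp
    moreover have "(\<Sum>k<k1. a k) = S0 + Sw"
      unfolding S0_def Sw_def using sum.atLeastLessThan_concat[of 0 k0 k1 a] k by (simp add: lessThan_atLeast0)
    ultimately show ?thesis by simp
  qed
  have init: "(\<Sum>k<k0. a (k + m)) <= T" for m
  proof -
    have "(\<Sum>k<k0. a (k + m)) <= (\<Sum>k. a (k + m))" using a by (intro sum_le_suminf sh) auto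
    also have "... <= T" using tail[of 0 m] by (simp add: T_def)
    finally show ?thesis .
  qed
  have "S0 <= (\<Sum>k<k0. (1 / 4) * a (k + 1) + (1 / 4) * a (k + N) + b k)"
    unfolding S0_def using step by (intro sum_mono) auto
  also have "... = (1 / 4) * (\<Sum>k<k0. a (k + 1)) + (1 / 4) * (\<Sum>k<k0. a (k + N)) + (\<Sum>k<k0. b k)"
    by (simp add: sum.distrib sum_distrib_left)
  also have "... <= (1 / 4) * T + (1 / 4) * T + Bt"
    using init[of 1] init[of N] sum_le_suminf[OF b(2), of "{..<k0}"] b unfolding Bt_def[symmetric] by (simp add: algebra_simps)
  finally have "T <= 2 * Bt + 2 * Sw + 2 * S1" using T by linarith
  also have "... <= (6 + 4 * real P * D) * Bt" using Sw S1 by (simp add: algebra_simps)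
  finally show ?thesis by (simp add: T_def Bt_def)
qed

section \<open>The power weight as a sum over the scales 3^k\<close>

lemma geometric_weight_upper:
  fixes \<alpha> \<rho>0 x :: real
  assumes \<alpha>: "\<alpha> < 0" and \<rho>0: "0 < \<rho>0" and x: "0 < x"
  shows "(\<Sum>k. ennreal ((3 ^ k * \<rho>0) powr \<alpha>) * indicator {..<3 ^ k * \<rho>0} x) <= ennreal (x powr \<alpha> / (1 - 3 powr \<alpha>))"
proof -
  define \<rho> where "\<rho> k = 3 ^ k * \<rho>0" for k :: nat
  have \<rho>: "0 < \<rho> k" "\<rho> (Suc k) = 3 * \<rho> k" for k using \<rho>0 by (auto simp: \<rho>_def)
  have "3 powr \<alpha> < 3 powr 0" using \<alpha> by (intro powr_less_mono) auto
  then have q: "3 powr \<alpha> < 1" by simp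
  \<comment> \<open>Once \<rho>_k > x, the decrease of this truncated weight is (1 - 3^\<alpha>)
    \<rho>_k^\<alpha>, and before that it is nonnegative; so the sum telescopes.\<close>
  define g where "g k = min (x powr \<alpha>) (\<rho> k powr \<alpha>)" for k
  have trm: "\<rho> k powr \<alpha> * indicator {..<\<rho> k} x <= (g k - g (Suc k)) / (1 - 3 powr \<alpha>)" for k
  proof (cases "x < \<rho> k")
    case True
    have "\<rho> k powr \<alpha> <= x powr \<alpha>" "\<rho> (Suc k) powr \<alpha> <= x powr \<alpha>"
      using True x \<alpha> \<rho>[of k] by (auto intro!: powr_mono2')
    moreover have "\<rho> (Suc k) powr \<alpha> = 3 powr \<alpha> * \<rho> k powr \<alpha>" using \<rho>[of k] by (simp add: powr_mult)
    ultimately have "g k - g (Suc k) = \<rho> k powr \<alpha> * (1 - 3 powr \<alpha>)" by (simp add: g_def algebra_simps)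
    then show ?thesis using q True \<alpha> by simp
  next
    case False
    have "\<rho> (Suc k) powr \<alpha> <= \<rho> k powr \<alpha>" using \<alpha> \<rho>[of k] by (intro powr_mono2') auto
    then have "g (Suc k) <= g k" by (auto simp: g_def)
    then show ?thesis using q False by simp
  qed
  have "(\<Sum>k<n. ennreal (\<rho> k powr \<alpha>) * indicator {..<\<rho> k} x) <= ennreal (x powr \<alpha> / (1 - 3 powr \<alpha>))" for n
  proof -
    have "(\<Sum>k<n. ennreal (\<rho> k powr \<alpha>) * indicator {..<\<rho> k} x) = (\<Sum>k<n. ennreal (\<rho> k powr \<alpha> * indicator {..<\<rho> k} x))"
      by (intro sum.cong) (auto simp: indicator_def)
    also have "... = ennreal (\<Sum>k<n. \<rho> k powr \<alpha> * indicator {..<\<rho> k} x)"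
      by (rule sum_ennreal) simp
    also have "... <= ennreal (x powr \<alpha> / (1 - 3 powr \<alpha>))"
    proof (rule ennreal_leI)
      have "(\<Sum>k<n. \<rho> k powr \<alpha> * indicator {..<\<rho> k} x) <= (\<Sum>k<n. (g k - g (Suc k)) / (1 - 3 powr \<alpha>))"
        by (intro sum_mono trm)
      also have "... = (g 0 - g n) / (1 - 3 powr \<alpha>)"
        by (simp add: sum_divide_distrib[symmetric] sum_lessThan_telescope')
      also have "... <= x powr \<alpha> / (1 - 3 powr \<alpha>)"
      proof (rule divide_right_mono)
        have "g 0 <= x powr \<alpha>" "0 <= g n" by (auto simp: g_def)
        then show "g 0 - g n <= x powr \<alpha>" by linarith
      qed (use q in simp)
      finally show "(\<Sum>k<n. \<rho> k powr \<alpha> * indicator {..<\<rho> k} x) <= x powr \<alpha> / (1 - 3 powr \<alpha>)" .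
    qed
    finally show ?thesis .
  qed
  then show ?thesis unfolding \<rho>_def by (intro suminf_le_const) auto
qed

lemma geometric_bracket:
  fixes \<rho>0 x :: real
  assumes "0 < \<rho>0" "\<rho>0 <= x"
  obtains k where "3 ^ k * \<rho>0 <= x" "x < 3 ^ Suc k * \<rho>0"
proof -
  define k where "k = (LEAST k. x < 3 ^ k * \<rho>0)"
  obtain m where "x / \<rho>0 < 3 ^ m" using real_arch_pow[of 3 "x / \<rho>0"] by auto
  then have ex: "EX k. x < 3 ^ k * \<rho>0" using assms by (auto simp: divide_less_eq)
  have "x < 3 ^ k * \<rho>0" unfolding k_def by (rule LeastI_ex[OF ex])
  moreover have "k ~= 0" using calculation assms by (cases k) auto
  then obtain j where j: "k = Suc j" by (cases k) auto
  have "~ x < 3 ^ j * \<rho>0" using not_less_Least[of j "%k. x < 3 ^ k * \<rho>0"] j by (simp add: k_def)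
  ultimately show ?thesis using that[of j] j by simp
qed

text \<open>One term suffices, the one whose scale satisfies \<rho>_k <= x < \<rho>_(k+1).\<close>

lemma geometric_weight_lower:
  fixes \<alpha> \<rho>0 x :: real
  assumes \<alpha>: "\<alpha> < 0" and \<rho>0: "0 < \<rho>0" and x: "\<rho>0 <= x"
  shows "ennreal (x powr \<alpha>) <= (\<Sum>k. ennreal ((3 ^ k * \<rho>0) powr \<alpha>) * indicator {..<3 ^ Suc k * \<rho>0} x)"
proof -
  obtain k where k: "3 ^ k * \<rho>0 <= x" "x < 3 ^ Suc k * \<rho>0" using geometric_bracket[OF \<rho>0 x] .
  define F :: "nat => ennreal" where "F k = ennreal ((3 ^ k * \<rho>0) powr \<alpha>) * indicator {..<3 ^ Suc k * \<rho>0} x" for k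
  have "ennreal (x powr \<alpha>) <= F k"
    using k \<rho>0 \<alpha> by (auto simp: F_def intro!: ennreal_leI powr_mono2')
  also have "... <= (\<Sum>k. F k)" using sum_le_suminf[of F "{k}"] by simp
  finally show ?thesis unfolding F_def .
qed

context core
begin

text \<open>The sequence to be summed is \<rho>_k^\<alpha> e(\<rho>_k)^2, with the one-step
  inequality at r = 3^N \<rho>_k. It is summable since \<open>e\<close> is bounded by the finite
  norm of \<open>W\<close> and \<alpha> < 0. The factor 1/12 becomes 1/4 because 3^(-\<alpha>) <= 3,
  and the window contains at most P indices.\<close>

lemma weighted_sum:
  assumes \<alpha>: "-1 < \<alpha>" "\<alpha> < 0" and r0: "0 < r0" and P: "R0 <= 3 ^ P * r0" and C3: "0 <= C3"
    and C2: "C2 * (1 / 3 ^ N) * (3 ^ N) powr (- \<alpha>) <= 1 / 4"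
    and step: "!!r. 0 < r ==> r <= r0 | R0 <= r ==> (e (r / 3 ^ N))\<^sup>2 <= (1 / 12) * (e (3 * (r / 3 ^ N)))^2
      + C2 * (1 / 3 ^ N) * (e r)^2 + C3 * (tau r)^2"
    and \<rho>0: "0 < \<rho>0" and sb: "summable (%k. (3 ^ k * \<rho>0) powr \<alpha> * (C3 * (tau (3 ^ N * (3 ^ k * \<rho>0)))^2))"
  shows "summable (%k. (3 ^ k * \<rho>0) powr \<alpha> * (e (3 ^ k * \<rho>0))^2)"
    "(\<Sum>k. (3 ^ k * \<rho>0) powr \<alpha> * (e (3 ^ k * \<rho>0))^2)
      <= (6 + 4 * real P * 3 ^ P) * (\<Sum>k. (3 ^ k * \<rho>0) powr \<alpha> * (C3 * (tau (3 ^ N * (3 ^ k * \<rho>0)))^2))"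
proof -
  define \<rho> where "\<rho> k = 3 ^ k * \<rho>0" for k :: nat
  have \<rho>: "0 < \<rho> k" "\<rho> (Suc k) = 3 * \<rho> k" "\<rho> (k + j) = 3 ^ j * \<rho> k" for k j
    using \<rho>0 by (auto simp: \<rho>_def power_add)
  define a' where "a' k = \<rho> k powr \<alpha> * (e (\<rho> k))^2" for k
  define b where "b k = \<rho> k powr \<alpha> * (C3 * (tau (3 ^ N * \<rho> k))^2)" for k
  have sa: "summable a'"
  proof (rule summable_comparison_test')
    have "3 powr \<alpha> < 3 powr 0" using \<alpha> by (intro powr_less_mono) auto
    then show "summable (%k. (3 powr \<alpha>) ^ k * (\<rho>0 powr \<alpha> * (n2 W)^2))" by (intro summable_mult2 summable_geometric) simp
    show "norm (a' k) <= (3 powr \<alpha>) ^ k * (\<rho>0 powr \<alpha> * (n2 W)^2)" if "k >= 0" for k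
    proof -
      have "(e (\<rho> k))^2 <= (n2 W)^2" unfolding e_def by (intro power_mono nS_le_n2 Wl) auto
      moreover have "\<rho> k powr \<alpha> = (3 powr \<alpha>) ^ k * \<rho>0 powr \<alpha>"
      proof (induction k)
        case (Suc k)
        then show ?case using \<rho>[of k] by (simp add: powr_mult)
      qed (simp add: \<rho>_def)
      ultimately show ?thesis by (simp add: a'_def mult.assoc mult_left_mono)
    qed
  qed
  \<comment> \<open>The first index whose outer scale 3^N \<rho>_k exceeds r0; \<open>k1\<close> is
    the first whose outer scale also reaches R0. The one-step inequality is available outside [k0,
    k1).\<close>
  define k0 where "k0 = (LEAST k. r0 < 3 ^ N * \<rho> k)"
  define k1 where "k1 = (LEAST k. R0 <= 3 ^ N * \<rho> k & r0 < 3 ^ N * \<rho> k)"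
  have unb: "EX k. M < 3 ^ N * \<rho> k" for M
  proof -
    obtain k where "M / (3 ^ N * \<rho>0) < 3 ^ k" using real_arch_pow[of 3 "M / (3 ^ N * \<rho>0)"] by auto
    then show ?thesis using \<rho>0 by (auto simp: \<rho>_def divide_less_eq mult_ac intro!: exI[of _ k])
  qed
  have mono: "3 ^ N * \<rho> k <= 3 ^ N * \<rho> k'" if "k <= k'" for k k'
    using that \<rho>0 by (simp add: \<rho>_def)
  have k0: "r0 < 3 ^ N * \<rho> k0" unfolding k0_def by (rule LeastI_ex[OF unb])
  have ex1: "EX k. R0 <= 3 ^ N * \<rho> k & r0 < 3 ^ N * \<rho> k" 
  proof -
    obtain k where "max R0 r0 < 3 ^ N * \<rho> k" using unb by blast
    then show ?thesis by (intro exI[of _ k]) simp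
  qed
  have k1: "R0 <= 3 ^ N * \<rho> k1" "r0 < 3 ^ N * \<rho> k1" using LeastI_ex[OF ex1] by (auto simp: k1_def)
  have k01: "k0 <= k1" unfolding k0_def by (rule Least_le) (rule k1)
  have k1P: "k1 <= k0 + P"
    unfolding k1_def
  proof (rule Least_le)
    have "3 ^ P * r0 <= 3 ^ P * (3 ^ N * \<rho> k0)" using k0 by simp
    moreover have "3 ^ N * \<rho> (k0 + P) = 3 ^ P * (3 ^ N * \<rho> k0)" by (simp add: \<rho>)
    ultimately show "R0 <= 3 ^ N * \<rho> (k0 + P) & r0 < 3 ^ N * \<rho> (k0 + P)"
      using P k0 mono[of k0 "k0 + P"] by linarith
  qed
  have step': "a' k <= (1 / 4) * a' (k + 1) + (1 / 4) * a' (k + N) + b k" if "k < k0 | k1 <= k" for k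
  proof -
    define r where "r = 3 ^ N * \<rho> k"
    have rr: "r / 3 ^ N = \<rho> k" "0 < r" using \<rho>[of k] by (auto simp: r_def)
    have "r <= r0 | R0 <= r" using that
    proof
      assume "k < k0"
      then show ?thesis using not_less_Least[of k "%k. r0 < 3 ^ N * \<rho> k"] by (auto simp: k0_def r_def)
    next
      assume "k1 <= k"
      from mono[OF this] show ?thesis using k1(1) unfolding r_def by linarith
    qed
    from step[OF rr(2) this] have "(e (\<rho> k))^2 <= (1 / 12) * (e (\<rho> (k + 1)))^2 + C2 * (1 / 3 ^ N) * (e (\<rho> (k + N)))^2 + C3 * (tau r)^2"
      unfolding rr \<rho> r_def by simp
    then have "a' k <= \<rho> k powr \<alpha> * ((1 / 12) * (e (\<rho> (k + 1)))^2 + C2 * (1 / 3 ^ N) * (e (\<rho> (k + N)))^2 + C3 * (tau r)^2)"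
      unfolding a'_def by (intro mult_left_mono) auto
    also have "... = (1 / 12) * (\<rho> k powr \<alpha>) * (e (\<rho> (k + 1)))^2 + C2 * (1 / 3 ^ N) * (\<rho> k powr \<alpha>) * (e (\<rho> (k + N)))^2 + b k"
      by (simp add: b_def r_def algebra_simps)
    also have "... <= (1 / 4) * a' (k + 1) + (1 / 4) * a' (k + N) + b k"
    proof (intro add_mono order_refl)
      have pj: "\<rho> k powr \<alpha> = (3 ^ j) powr (- \<alpha>) * \<rho> (k + j) powr \<alpha>" for j
        using \<rho>[of k] by (simp add: powr_mult powr_minus)
      have "\<rho> k powr \<alpha> = 3 powr (- \<alpha>) * \<rho> (k + 1) powr \<alpha>" using pj[of 1] by simp
      also have "... <= 3 * \<rho> (k + 1) powr \<alpha>"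
        using powr_mono[of "- \<alpha>" 1 3] \<alpha> by (intro mult_right_mono) auto
      finally have "\<rho> k powr \<alpha> * (e (\<rho> (k + 1)))^2 <= 3 * \<rho> (k + 1) powr \<alpha> * (e (\<rho> (k + 1)))^2"
        by (rule mult_right_mono) simp
      then show "(1 / 12) * (\<rho> k powr \<alpha>) * (e (\<rho> (k + 1)))^2 <= (1 / 4) * a' (k + 1)"
        unfolding a'_def by simp
      have "C2 * (1 / 3 ^ N) * (\<rho> k powr \<alpha>) = (C2 * (1 / 3 ^ N) * (3 ^ N) powr (- \<alpha>)) * \<rho> (k + N) powr \<alpha>"
        unfolding pj[of N] by (simp only: mult.assoc)
      also have "... <= (1 / 4) * \<rho> (k + N) powr \<alpha>" using C2 by (intro mult_right_mono) auto
      finally show "C2 * (1 / 3 ^ N) * (\<rho> k powr \<alpha>) * (e (\<rho> (k + N)))^2 <= (1 / 4) * a' (k + N)"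
        unfolding a'_def mult.assoc[symmetric] by (rule mult_right_mono) simp
    qed
    finally show ?thesis .
  qed
  \<comment> \<open>Since -\<alpha> < 1, the ratio of the weights is at most 3^P, and the energies
    increase with the scale.\<close>
  have win: "a' k <= 3 ^ P * a' k1" if "k0 <= k" "k < k1" for k
  proof -
    define j where "j = k1 - k"
    have j: "k1 = k + j" "j <= P" using that k1P by (auto simp: j_def)
    have "\<rho> k powr \<alpha> = (3 ^ j) powr (- \<alpha>) * \<rho> k1 powr \<alpha>" unfolding j(1) using \<rho>[of k] by (simp add: powr_mult powr_minus)
    also have "(3 ^ j) powr (- \<alpha>) <= (3 ^ j) powr 1" using \<alpha> by (intro powr_mono) auto
    also have "(3 ^ j) powr (1::real) <= 3 ^ P" using j(2) by simp
    finally have "\<rho> k powr \<alpha> <= 3 ^ P * \<rho> k1 powr \<alpha>" by (simp add: mult_right_mono)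
    moreover have "(e (\<rho> k))^2 <= (e (\<rho> k1))^2" using mono[of k k1] that by (intro power_mono e_mono) auto
    ultimately show ?thesis unfolding a'_def mult.assoc[symmetric] by (intro mult_mono) auto
  qed
  have "(\<Sum>k. a' k) <= (6 + 4 * real P * 3 ^ P) * (\<Sum>k. b k)"
  proof (rule summation_absorb[OF _ sa _ _ k01 k1P _ step' win])
    show "summable b" unfolding b_def[abs_def] \<rho>_def by (rule sb)
  qed (auto simp: a'_def b_def C3)
  with sa show "summable (%k. (3 ^ k * \<rho>0) powr \<alpha> * (e (3 ^ k * \<rho>0))^2)"
    "(\<Sum>k. (3 ^ k * \<rho>0) powr \<alpha> * (e (3 ^ k * \<rho>0))^2)
      <= (6 + 4 * real P * 3 ^ P) * (\<Sum>k. (3 ^ k * \<rho>0) powr \<alpha> * (C3 * (tau (3 ^ N * (3 ^ k * \<rho>0)))^2))"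
    unfolding a'_def[abs_def] b_def[abs_def] \<rho>_def by auto
qed

end

section \<open>Weighted norms and the estimate for compactly supported solutions\<close>

text \<open>The indicator is needed because \<open>powr\<close> has junk values at negative bases.\<close>

definition wnn :: "'a::euclidean_space => real => real => ('a => 'b::euclidean_space) => ennreal" where
  "wnn \<nu> a \<beta> g = (NNI x. indicator {0<..} (x \<bullet> \<nu> - a) * ennreal ((norm (g x))^2 * (x \<bullet> \<nu> - a) powr \<beta>))"

lemma wnn_add:
  fixes f :: "'a::euclidean_space => 'b::euclidean_space" and h :: "'a => 'c::euclidean_space"
  assumes [measurable]: "bm f" "bm h"
  shows "wnn \<nu> a \<alpha> f + wnn \<nu> a (\<alpha> + 2) h = (NNI x. indicator {0<..} (x \<bullet> \<nu> - a) *
    ennreal (((norm (f x))^2 + ((x \<bullet> \<nu> - a) * norm (h x))^2) * (x \<bullet> \<nu> - a) powr \<alpha>))"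
proof -
  define t where "t x = x \<bullet> \<nu> - a" for x
  have [measurable]: "bm t" unfolding t_def[abs_def] by measurable
  have "wnn \<nu> a \<alpha> f + wnn \<nu> a (\<alpha> + 2) h = (NNI x. indicator {0<..} (t x) * ennreal ((norm (f x))^2 * t x powr \<alpha>)
      + indicator {0<..} (t x) * ennreal ((norm (h x))^2 * t x powr (\<alpha> + 2)))"
    unfolding wnn_def t_def[symmetric] by (rule nn_integral_add[symmetric]) measurable
  also have "... = (NNI x. indicator {0<..} (t x) * ennreal (((norm (f x))^2 + (t x * norm (h x))^2) * t x powr \<alpha>))"
  proof (intro nn_integral_cong)
    fix x
    have "(norm (f x))^2 * t x powr \<alpha> + (norm (h x))^2 * t x powr (\<alpha> + 2) = ((norm (f x))^2 + (t x * norm (h x))^2) * t x powr \<alpha>" if "0 < t x"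
      using that by (simp add: powr_add power_mult_distrib algebra_simps)
    then show "indicator {0<..} (t x) * ennreal ((norm (f x))^2 * t x powr \<alpha>) + indicator {0<..} (t x) * ennreal ((norm (h x))^2 * t x powr (\<alpha> + 2))
      = indicator {0<..} (t x) * ennreal (((norm (f x))^2 + (t x * norm (h x))^2) * t x powr \<alpha>)"
      by (cases "0 < t x") (simp_all add: ennreal_plus[symmetric] del: ennreal_plus)
  qed
  finally show ?thesis by (simp only: t_def)
qed

context core
begin

text \<open>The factor 2 is that of (a + b)^2 <= 2 a^2 + 2 b^2. As the data vanish below the
  boundary, the strip t < r may be replaced by 0 < t < r.\<close>

lemma tau_power2_nn:
  assumes f0: "!!x. t x <= 0 ==> f x = 0" and h0: "!!x. t x <= 0 ==> h x = 0"
  shows "ennreal ((tau r)^2) <= 2 * (NNI x. indicator {..<r} (t x) * (indicator {0<..} (t x) * ennreal ((norm (f x))^2 + (t x * norm (h x))^2)))"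
proof -
  have [measurable]: "bm f" using fl by auto
  note [measurable] = hm
  have "(tau r)^2 <= 2 * ((nS (St r) f)^2 + (nS (St r) (%x. t x *R h x))^2)"
    using sum_squares_bound[of "nS (St r) f" "nS (St r) (%x. t x *R h x)"]
    by (simp add: tau_def power2_sum)
  then have "ennreal ((tau r)^2) <= ennreal (2 * ((nS (St r) f)^2 + (nS (St r) (%x. t x *R h x))^2))" by (rule ennreal_leI)
  also have "... = 2 * (ennreal ((nS (St r) f)^2) + ennreal ((nS (St r) (%x. t x *R h x))^2))"
    by (simp add: ennreal_mult)
  also have "... = 2 * (NNI x. indicator (St r) x * ennreal ((norm (f x))^2) + indicator (St r) x * ennreal ((norm (t x *R h x))^2))"
    using nS_power2_nn[OF rs_l2[OF fl St_measurable] St_measurable, of r] nS_power2_nn[OF rs_l2[OF thl St_measurable] St_measurable, of r]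
    by (subst nn_integral_add) simp_all
  also have "... = 2 * (NNI x. indicator {..<r} (t x) * (indicator {0<..} (t x) * ennreal ((norm (f x))^2 + (t x * norm (h x))^2)))"
    using f0 h0 by (intro arg_cong[where f="%x. 2 * x"] nn_integral_cong)
      (auto simp: indicator_def St_def power_mult_distrib not_less)
  finally show ?thesis .
qed

text \<open>The scales start at some \<rho>0 > 0, because the sum over arbitrarily small scales is
  not known to be finite beforehand. The bound is independent of \<rho>0, and monotone convergence
  lets \<rho>0 tend to 0. The factor 3 bounds the ratio of weights of neighbouring scales: heights
  between \<rho>_k and \<rho>_(k+1) are covered by e(\<rho>_(k+1)).\<close>

lemma weighted_estimate:
  assumes \<alpha>: "-1 < \<alpha>" "\<alpha> < 0" and r0: "0 < r0" and P: "R0 <= 3 ^ P * r0" and C3: "0 < C3"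
    and C2: "C2 * (1 / 3 ^ N) * (3 ^ N) powr (- \<alpha>) <= 1 / 4"
    and step: "!!r. 0 < r ==> r <= r0 | R0 <= r ==> (e (r / 3 ^ N))\<^sup>2 <= (1 / 12) * (e (3 * (r / 3 ^ N)))^2
      + C2 * (1 / 3 ^ N) * (e r)^2 + C3 * (tau r)^2"
    and f0: "!!x. t x <= 0 ==> f x = 0" and h0: "!!x. t x <= 0 ==> h x = 0"
  shows "wnn \<nu> a \<alpha> W <= ennreal (3 * (6 + 4 * real P * 3 ^ P) * (2 * C3 * (3 ^ N) powr (- \<alpha>) / (1 - 3 powr \<alpha>)))
      * (wnn \<nu> a \<alpha> f + wnn \<nu> a (\<alpha> + 2) h)"
proof -
  have [measurable]: "bm f" using fl by auto
  note [measurable] = hm W_measurable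
  define FF where "FF x = (norm (f x))^2 + (t x * norm (h x))^2" for x
  have [measurable]: "bm FF" unfolding FF_def[abs_def] by measurable
  have FF0: "0 <= FF x" for x by (simp add: FF_def)
  define R where "R = (NNI x. indicator {0<..} (t x) * ennreal (FF x * t x powr \<alpha>))"
  have "3 powr \<alpha> < 3 powr 0" using \<alpha> by (intro powr_less_mono) auto
  then have q: "3 powr \<alpha> < 1" by simp
  define K where "K = 2 * C3 * (3 ^ N) powr (- \<alpha>) / (1 - 3 powr \<alpha>)"
  have K: "0 < K" using q C3 by (simp add: K_def)
  define P' where "P' = 6 + 4 * real P * 3 ^ P"
  have P': "6 <= P'" by (simp add: P'_def)
  define X where "X x = ennreal (2 * C3) * (indicator {0<..} (t x) * ennreal (FF x))" for x
  have [measurable]: "bm X" unfolding X_def[abs_def] by measurable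
  have main: "(NNI x. indicator {\<rho>0..} (t x) * ennreal ((norm (W x))^2 * t x powr \<alpha>)) <= ennreal (3 * P' * K) * R"
    if \<rho>0: "0 < \<rho>0" for \<rho>0
  proof (cases "R = \<infinity>")
    case True
    then show ?thesis using K P' by (simp add: ennreal_mult_top)
  next
    case False
    define \<rho> where "\<rho> k = 3 ^ k * \<rho>0" for k :: nat
    have \<rho>: "0 < \<rho> k" for k using \<rho>0 by (simp add: \<rho>_def)
    define a' where "a' k = \<rho> k powr \<alpha> * (e (\<rho> k))^2" for k
    define b where "b k = \<rho> k powr \<alpha> * (C3 * (tau (3 ^ N * \<rho> k))^2)" for k
    have a0: "0 <= a' k" and b0: "0 <= b k" for k using C3 by (auto simp: a'_def b_def)
    \<comment> \<open>The data at index k live in t < 3^N \<rho>_k; summing the weights at a fixed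
      point gives the factor 3^(-N \<alpha>) / (1 - 3^\<alpha>) contained in
      \<open>K\<close>.\<close>
    have sumb: "(\<Sum>k. ennreal (b k)) <= ennreal K * R"
    proof -
      have "ennreal (b k) <= (NNI x. X x
          * (ennreal (\<rho> k powr \<alpha>) * indicator {..<\<rho> k} (t x / 3 ^ N)))" for k
      proof -
        have "ennreal (b k) = ennreal (\<rho> k powr \<alpha>) * ennreal C3 * ennreal ((tau (3 ^ N * \<rho> k))^2)"
          using C3 by (simp add: b_def ennreal_mult mult.assoc)
        also have "... <= ennreal (\<rho> k powr \<alpha>) * ennreal C3 * (2 * (NNI x. indicator {..<3 ^ N * \<rho> k} (t x) * (indicator {0<..} (t x) * ennreal (FF x))))"
          unfolding FF_def by (intro mult_left_mono tau_power2_nn f0 h0) auto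
        also have "... = ennreal (\<rho> k powr \<alpha>) * ennreal (2 * C3) * (NNI x. indicator {..<3 ^ N * \<rho> k} (t x) * (indicator {0<..} (t x) * ennreal (FF x)))"
          using C3 by (simp add: ennreal_mult mult_ac)
        also have "... = (NNI x. (ennreal (\<rho> k powr \<alpha>) * ennreal (2 * C3)) * (indicator {..<3 ^ N * \<rho> k} (t x) * (indicator {0<..} (t x) * ennreal (FF x))))"
          by (rule nn_integral_cmult[symmetric]) measurable
        also have "... = (NNI x. X x
          * (ennreal (\<rho> k powr \<alpha>) * indicator {..<\<rho> k} (t x / 3 ^ N)))"
          by (intro nn_integral_cong) (auto simp: X_def indicator_def divide_less_eq mult_ac)
        finally show ?thesis .
      qed
      then have "(\<Sum>k. ennreal (b k)) <= (\<Sum>k. (NNI x. X x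
          * (ennreal (\<rho> k powr \<alpha>) * indicator {..<\<rho> k} (t x / 3 ^ N))))"
        by (intro suminf_le) auto
      also have "... = (NNI x. (\<Sum>k. X x
          * (ennreal (\<rho> k powr \<alpha>) * indicator {..<\<rho> k} (t x / 3 ^ N))))"
        by (rule nn_integral_suminf[symmetric]) measurable
      also have "... <= (NNI x. ennreal K * (indicator {0<..} (t x) * ennreal (FF x * t x powr \<alpha>)))"
      proof (intro nn_integral_mono)
        fix x
        have "(\<Sum>k. X x * (ennreal (\<rho> k powr \<alpha>) * indicator {..<\<rho> k} (t x / 3 ^ N)))
          = X x * (\<Sum>k. ennreal (\<rho> k powr \<alpha>) * indicator {..<\<rho> k} (t x / 3 ^ N))"
          by (rule ennreal_suminf_cmult)
        also have "... <= ennreal K * (indicator {0<..} (t x) * ennreal (FF x * t x powr \<alpha>))"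
        proof (cases "0 < t x")
          case True
          have "(\<Sum>k. ennreal (\<rho> k powr \<alpha>) * indicator {..<\<rho> k} (t x / 3 ^ N)) <= ennreal ((t x / 3 ^ N) powr \<alpha> / (1 - 3 powr \<alpha>))"
            unfolding \<rho>_def by (rule geometric_weight_upper[OF \<alpha>(2) \<rho>0]) (use True in simp)
          then have "X x * (\<Sum>k. ennreal (\<rho> k powr \<alpha>) * indicator {..<\<rho> k} (t x / 3 ^ N))
            <= X x * ennreal ((t x / 3 ^ N) powr \<alpha> / (1 - 3 powr \<alpha>))"
            by (rule mult_left_mono) simp
          also have "... = ennreal (2 * C3 * FF x * ((t x / 3 ^ N) powr \<alpha> / (1 - 3 powr \<alpha>)))"
          proof -
            have 1: "0 <= 2 * C3" "0 <= 2 * C3 * FF x" "0 <= (t x / 3 ^ N) powr \<alpha> / (1 - 3 powr \<alpha>)" using C3 q FF0[of x] by auto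
            have "X x = ennreal (2 * C3) * ennreal (FF x)" using True by (simp add: X_def)
            then show ?thesis unfolding ennreal_mult[OF 1(1) FF0] ennreal_mult[OF 1(2,3)] by simp
          qed
          also have "2 * C3 * FF x * ((t x / 3 ^ N) powr \<alpha> / (1 - 3 powr \<alpha>)) = K * (FF x * t x powr \<alpha>)"
            using True by (simp add: K_def powr_divide powr_minus field_simps)
          also have "ennreal (K * (FF x * t x powr \<alpha>)) = ennreal K * ennreal (FF x * t x powr \<alpha>)"
            using K FF0 by (simp add: ennreal_mult)
          finally show ?thesis using True by simp
        qed (simp add: X_def)
        finally show "(\<Sum>k. X x * (ennreal (\<rho> k powr \<alpha>) * indicator {..<\<rho> k} (t x / 3 ^ N)))
          <= ennreal K * (indicator {0<..} (t x) * ennreal (FF x * t x powr \<alpha>))" .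
      qed
      also have "... = ennreal K * R" unfolding R_def by (rule nn_integral_cmult) measurable
      finally show ?thesis .
    qed
    have fin: "(\<Sum>k. ennreal (b k)) ~= \<infinity>"
    proof -
      have "ennreal K * R < \<infinity>" using False by (simp add: ennreal_mult_less_top less_top)
      then show ?thesis using sumb by (metis not_le infinity_ennreal_def)
    qed
    have sb: "summable b" by (rule summable_suminf_not_top[OF b0]) (use fin in simp)
    have ba: "summable a'" "(\<Sum>k. a' k) <= P' * (\<Sum>k. b k)"
      using weighted_sum[OF \<alpha> r0 P less_imp_le[OF C3] C2 step \<rho>0] sb
      unfolding a'_def[abs_def] b_def[abs_def] \<rho>_def P'_def by blast+
    have "(NNI x. indicator {\<rho>0..} (t x) * ennreal ((norm (W x))^2 * t x powr \<alpha>))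
      <= (NNI x. (\<Sum>k. ennreal ((norm (W x))^2) * (ennreal (\<rho> k powr \<alpha>) * indicator {..<\<rho> (Suc k)} (t x))))"
    proof (intro nn_integral_mono)
      fix x
      show "indicator {\<rho>0..} (t x) * ennreal ((norm (W x))^2 * t x powr \<alpha>)
        <= (\<Sum>k. ennreal ((norm (W x))^2) * (ennreal (\<rho> k powr \<alpha>) * indicator {..<\<rho> (Suc k)} (t x)))"
      proof (cases "\<rho>0 <= t x")
        case True
        then have "ennreal ((norm (W x))^2) * ennreal (t x powr \<alpha>) <= ennreal ((norm (W x))^2) * (\<Sum>k. ennreal (\<rho> k powr \<alpha>) * indicator {..<\<rho> (Suc k)} (t x))"
          unfolding \<rho>_def by (intro mult_left_mono geometric_weight_lower \<alpha> \<rho>0) auto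
        then show ?thesis using True by (simp add: ennreal_suminf_cmult ennreal_mult)
      qed simp
    qed
    also have "... = (\<Sum>k. (NNI x. ennreal ((norm (W x))^2) * (ennreal (\<rho> k powr \<alpha>) * indicator {..<\<rho> (Suc k)} (t x))))"
      by (rule nn_integral_suminf) measurable
    also have "... <= (\<Sum>k. ennreal (3 * a' (Suc k)))"
    proof (intro suminf_le)
      fix k
      have "(NNI x. ennreal ((norm (W x))^2) * (ennreal (\<rho> k powr \<alpha>) * indicator {..<\<rho> (Suc k)} (t x)))
        = (NNI x. ennreal (\<rho> k powr \<alpha>) * (indicator (St (\<rho> (Suc k))) x * ennreal ((norm (W x))^2)))"
        by (intro nn_integral_cong) (auto simp: indicator_def St_def mult.commute)
      also have "... = ennreal (\<rho> k powr \<alpha>) * ennreal ((e (\<rho> (Suc k)))^2)"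
        unfolding e_def nS_power2_nn[OF rs_l2[OF Wl St_measurable] St_measurable, symmetric] by (rule nn_integral_cmult) measurable
      also have "... = ennreal (\<rho> k powr \<alpha> * (e (\<rho> (Suc k)))^2)" by (simp add: ennreal_mult)
      also have "... <= ennreal (3 * a' (Suc k))"
      proof (rule ennreal_leI)
        have "\<rho> k powr \<alpha> = 3 powr (- \<alpha>) * \<rho> (Suc k) powr \<alpha>" using \<rho>0 by (simp add: \<rho>_def powr_mult powr_minus)
        also have "... <= 3 * \<rho> (Suc k) powr \<alpha>"
          using powr_mono[of "- \<alpha>" 1 3] \<alpha> by (intro mult_right_mono) auto
        finally have "\<rho> k powr \<alpha> * (e (\<rho> (Suc k)))^2 <= 3 * \<rho> (Suc k) powr \<alpha> * (e (\<rho> (Suc k)))^2"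
          by (rule mult_right_mono) simp
        then show "\<rho> k powr \<alpha> * (e (\<rho> (Suc k)))^2 <= 3 * a' (Suc k)" by (simp add: a'_def)
      qed
      finally show "(NNI x. ennreal ((norm (W x))^2) * (ennreal (\<rho> k powr \<alpha>) * indicator {..<\<rho> (Suc k)} (t x))) <= ennreal (3 * a' (Suc k))" .
    qed auto
    also have "... = ennreal (\<Sum>k. 3 * a' (Suc k))"
      using ba(1) a0 by (intro suminf_ennreal2) (auto simp: summable_Suc_iff intro: summable_mult)
    also have "... <= ennreal (3 * P' * (\<Sum>k. b k))"
    proof (rule ennreal_leI)
      have "(\<Sum>k. 3 * a' (Suc k)) = 3 * (\<Sum>k. a' (Suc k))" using ba(1) by (intro suminf_mult) (simp add: summable_Suc_iff)
      also have "(\<Sum>k. a' (Suc k)) <= (\<Sum>k. a' k)" using suminf_split_head[OF ba(1)] a0[of 0] by simp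
      finally show "(\<Sum>k. 3 * a' (Suc k)) <= 3 * P' * (\<Sum>k. b k)" using ba(2) by simp
    qed
    also have "... = ennreal (3 * P') * (\<Sum>k. ennreal (b k))"
      using P' suminf_nonneg[OF sb b0] by (simp add: ennreal_mult suminf_ennreal2[OF b0 sb])
    also have "... <= ennreal (3 * P') * (ennreal K * R)" by (intro mult_left_mono sumb) simp
    also have "... = ennreal (3 * P' * K) * R" using P' K by (simp add: ennreal_mult mult.assoc)
    finally show ?thesis .
  qed
  have "(NNI x. indicator {0<..} (t x) * ennreal ((norm (W x))^2 * t x powr \<alpha>))
    = (NNI x. (SUP n. indicator {1 / real (Suc n)..} (t x) * ennreal ((norm (W x))^2 * t x powr \<alpha>)))"
  proof (intro nn_integral_cong)
    fix x
    have "(SUP n. indicator {1 / real (Suc n)..} (t x) * ennreal ((norm (W x))^2 * t x powr \<alpha>))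
      = indicator {0<..} (t x) * ennreal ((norm (W x))^2 * t x powr \<alpha>)" (is "(SUP n. ?g n) = ?l")
    proof (rule antisym)
      show "(SUP n. ?g n) <= ?l"
      proof (rule SUP_least)
        fix n
        have "0 < 1 / real (Suc n)" by simp
        then have "0 < t x" if "1 / real (Suc n) <= t x" using that by linarith
        then show "?g n <= ?l" by (auto simp: indicator_def simp del: of_nat_Suc)
      qed
      show "?l <= (SUP n. ?g n)"
      proof (cases "0 < t x")
        case True
        then obtain n where "1 / real (Suc n) < t x" using nat_approx_posE by blast
        then have "?l <= ?g n" using True by (auto simp: indicator_def)
        also have "... <= (SUP n. ?g n)" by (rule SUP_upper) simp
        finally show ?thesis .
      qed simp
    qed
    then show "indicator {0<..} (t x) * ennreal ((norm (W x))^2 * t x powr \<alpha>) = (SUP n. ?g n)" by simp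
  qed
  also have "... = (SUP n. (NNI x. indicator {1 / real (Suc n)..} (t x) * ennreal ((norm (W x))^2 * t x powr \<alpha>)))"
  proof (rule nn_integral_monotone_convergence_SUP)
    show "incseq (%n x. indicator {1 / real (Suc n)..} (t x) * ennreal ((norm (W x))^2 * t x powr \<alpha>))"
    proof (intro incseq_SucI le_funI mult_right_mono)
      fix n x
      have "1 / real (Suc (Suc n)) <= 1 / real (Suc n)" by (intro divide_left_mono) auto
      then show "(indicator {1 / real (Suc n)..} (t x) :: ennreal) <= indicator {1 / real (Suc (Suc n))..} (t x)"
        by (auto simp: indicator_def simp del: of_nat_Suc)
    qed simp
  qed measurable
  also have "... <= ennreal (3 * P' * K) * R" by (intro SUP_least main) simp
  finally show ?thesis unfolding P'_def K_def R_def FF_def wnn_def[of _ _ _ W] wnn_add[OF f_measurable hm] t_def .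
qed

end

section \<open>Choice of the constants, at small and at large scales\<close>

lemma round_vec_dist: "norm ((\<chi> j. of_int (round (y $ j))) - y) <= real CARD('d)" for y :: "real^'d::finite"
proof -
  have "norm ((\<chi> j. of_int (round (y $ j))) - y) <= (\<Sum>j\<in>UNIV. \<bar>((\<chi> j. of_int (round (y $ j))) - y) $ j\<bar>)" by (rule norm_le_l1_cart)
  also have "... <= (\<Sum>j\<in>(UNIV::'d set). 1)"
  proof (rule sum_mono)
    fix j
    show "\<bar>((\<chi> j. of_int (round (y $ j))) - y) $ j\<bar> <= 1"
      using of_int_round_abs_le[of "y $ j"] by simp
  qed
  finally show ?thesis by simp
qed

definition regular_periodic :: "real => real => (real^'d::finite => 'a::real_normed_vector => 'b::real_normed_vector) => bool" where
  "regular_periodic K \<sigma> B \<longleftrightarrow> (ALL x z \<Xi>. (ALL k. z $ k \<in> \<int>) --> B (x + z) \<Xi> = B x \<Xi>) &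
    (ALL x z \<Xi>. norm (B (x + z) \<Xi> - B x \<Xi>) <= K * norm z powr \<sigma> * norm \<Xi>)"

text \<open>Every parameter is fixed before \<nu>, \<open>a\<close> and the solution: c by
  ellipticity, N by \<alpha>, k by N and c, then the thresholds r0 and R0, and finally the number P
  of scales between them.\<close>

lemma core_estimate:
  fixes \<mu> \<Lambda> c0 \<alpha> \<sigma> H :: real
  assumes mu: "0 < \<mu>" and Lam: "0 <= \<Lambda>" and step: "smooth_step c0 s s1 s2" and \<alpha>: "-1 < \<alpha>" "\<alpha> < 0" and \<sigma>: "0 < \<sigma>" and H: "0 <= H"
  shows "EX C>0. ALL (\<nu>::real^'d::finite) a (B::real^'d => real^'d^'m::finite => real^'d^'m) w W f h.
    core c0 s s1 s2 \<mu> \<Lambda> \<nu> a B w W f h & regular_periodic H \<sigma> B &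
    (ALL x. x \<bullet> \<nu> - a <= 0 --> f x = 0 & h x = 0) -->
    wnn \<nu> a \<alpha> W <= ennreal C * (wnn \<nu> a \<alpha> f + wnn \<nu> a (\<alpha> + 2) h)"
proof -
  have c0: "1 <= c0" using step by (rule smooth_step.c0)
  define n where "n = real CARD('d)"
  have n1: "1 <= n" by (simp add: n_def Suc_leI)
  define la where "la = (\<mu> / 2 + (4 * c0 * \<Lambda>)^2 / \<mu>) / (\<mu> + (4 * c0 * \<Lambda>)^2 / \<mu>)"
  have la: "0 < la" "la < 1"
  proof -
    have "0 <= (4 * c0 * \<Lambda>)^2 / \<mu>" using mu by simp
    then show "0 < la" "la < 1" unfolding la_def using mu by (auto intro!: divide_pos_pos add_pos_nonneg simp: divide_less_eq_1)
  qed
  define K where "K = 20 * c0 * ((2 * \<Lambda> + 2) / \<mu> + 8 / sqrt \<mu> + 1)"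
  define q where "q = (3 + 4 * c0) / \<mu> / sqrt (1 - la)"
  \<comment> \<open>360 = 10 * 36 makes the averaging error at most \<mu> / 36; \<Lambda> + 1 avoids
    a division by 0.\<close>
  define c where "c = min 1 (\<mu> / (360 * n * c0 * (\<Lambda> + 1)))"
  have c: "0 < c" "c <= 1" using mu Lam c0 n1 by (auto simp: c_def)
  have c3: "10 * n * c0 * \<Lambda> * c <= \<mu> / 36"
  proof -
    have "10 * n * c0 * \<Lambda> * c <= 10 * n * c0 * (\<Lambda> + 1) * (\<mu> / (360 * n * c0 * (\<Lambda> + 1)))"
      using Lam c0 n1 c by (intro mult_mono) (auto simp: c_def)
    also have "... = 10 * (n * c0 * (\<Lambda> + 1)) * (\<mu> / (360 * (n * c0 * (\<Lambda> + 1))))" by (simp only: mult.assoc)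
    also have "... = \<mu> / 36" 
    proof -
      have "10 * X * (\<mu> / (360 * X)) = \<mu> / 36" if "0 < X" for X using that by (simp add: field_simps)
      moreover have "0 < n * c0 * (\<Lambda> + 1)" using Lam c0 n1 by simp
      ultimately show ?thesis .
    qed
    finally show ?thesis .
  qed
  define C2 where "C2 = 9 * (69 * n * c0^2 * \<Lambda> + 4 * n * c0 * (6 * \<Lambda> * K + 1))^2 / \<mu>^2"
  obtain N where N: "3 <= N" "C2 * (1 / 3 ^ N) * (3 ^ N) powr (- \<alpha>) <= 1 / 4"
  proof -
    \<comment> \<open>This is where \<alpha> > -1 enters: the expression decays like 3^(-N (1 +
      \<alpha>)).\<close>
    have "(%N. C2 * (1 / 3 ^ N) * (3 ^ N) powr (- \<alpha>)) \<longlonglongrightarrow> 0" using \<alpha> by real_asymp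
    then have "\<forall>\<^sub>F N in sequentially. C2 * (1 / 3 ^ N) * (3 ^ N) powr (- \<alpha>) < 1 / 4" by (rule order_tendstoD) simp
    then have "\<forall>\<^sub>F N in sequentially. 3 <= N & C2 * (1 / 3 ^ N) * (3 ^ N) powr (- \<alpha>) <= 1 / 4"
      using eventually_ge_at_top[of 3] by eventually_elim auto
    then show ?thesis using that by (auto dest: eventually_happens)
  qed
  obtain k where k: "1 <= k" "1 / 2 ^ k / 4 <= c / 3 ^ N" "n * (1 / 2 ^ k / 4) <= 1 / 3 ^ N / 2"
    "(1 / 2 ^ k / 4) * 3 ^ N * 3 ^ N / c <= sqrt (1 / 3 ^ N)" "la ^ k <= (c / 3 ^ N)^2"
  proof -
    have l: "(%k. 1 / 2 ^ k / 4) \<longlonglongrightarrow> (0::real)" by real_asymp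
    have l1: "\<forall>\<^sub>F k in sequentially. 1 / 2 ^ k / 4 < c / 3 ^ N" by (rule order_tendstoD[OF l]) (use c in simp)
    have l2: "\<forall>\<^sub>F k in sequentially. n * (1 / 2 ^ k / 4) < 1 / 3 ^ N / 2"
      by (rule order_tendstoD(2)[OF tendsto_mult_right_zero[OF l]]) simp
    have l3: "\<forall>\<^sub>F k in sequentially. (3 ^ N * 3 ^ N / c) * (1 / 2 ^ k / 4) < sqrt (1 / 3 ^ N)"
      by (rule order_tendstoD(2)[OF tendsto_mult_right_zero[OF l]]) simp
    have l4: "\<forall>\<^sub>F k in sequentially. la ^ k < (c / 3 ^ N)^2"
      by (rule order_tendstoD(2)[OF LIMSEQ_realpow_zero]) (use la c in auto)
    have "\<forall>\<^sub>F k in sequentially. 1 <= k & 1 / 2 ^ k / 4 <= c / 3 ^ N & n * (1 / 2 ^ k / 4) <= 1 / 3 ^ N / 2 &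
      (1 / 2 ^ k / 4) * 3 ^ N * 3 ^ N / c <= sqrt (1 / 3 ^ N) & la ^ k <= (c / 3 ^ N)^2"
      using eventually_ge_at_top[of 1] l1 l2 l3 l4 by eventually_elim (simp add: mult_ac)
    then show ?thesis using that by (auto dest: eventually_happens)
  qed
  define C3 where "C3 = 9 * (4 * n * c0 * \<Lambda> * K * (3 ^ N / c) * (q + 3 ^ N / c) + 45 * c0^2 * 3 ^ N + 3 + 4 * c0)^2 / \<mu>^2"
  have C3: "0 < C3"
  proof -
    have "0 <= K" "0 <= q" using mu Lam c0 la by (auto simp: K_def q_def)
    then have "0 < 4 * n * c0 * \<Lambda> * K * (3 ^ N / c) * (q + 3 ^ N / c) + 45 * c0^2 * 3 ^ N + 3 + 4 * c0"
      using n1 c0 Lam c by (intro add_nonneg_pos add_nonneg_nonneg mult_nonneg_nonneg) auto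
    then show ?thesis unfolding C3_def using mu by simp
  qed
  \<comment> \<open>If |z|^\<sigma> <= D, the coefficients change by at most c / 3^N along z; H + 1
    avoids a division by 0.\<close>
  define D where "D = (c / 3 ^ N) / (H + 1)"
  have D: "0 < D" "H * D <= c / 3 ^ N"
  proof -
    show "0 < D" using c H by (simp add: D_def)
    have "H * D <= (H + 1) * D" using \<open>0 < D\<close> by (intro mult_right_mono) auto
    also have "... = c / 3 ^ N" using H by (simp add: D_def)
    finally show "H * D <= c / 3 ^ N" .
  qed
  \<comment> \<open>For r <= r0 the translation length c r / 3^N is at most D^(1/\<sigma>), so
    exactly tangential vectors can be used.\<close>
  define r0 where "r0 = D powr (1 / \<sigma>) / (c / 3 ^ N)"
  have r0: "0 < r0" using D c by (simp add: r0_def)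
  \<comment> \<open>Rounding to a lattice vector moves a point by at most n, and this must not
    exceed \<kappa> = r / 2^k / 4.\<close>
  define R0 where "R0 = 4 * 2 ^ k * n"
  obtain P where "R0 / r0 < 3 ^ P" using real_arch_pow[of 3 "R0 / r0"] by auto
  then have P: "R0 <= 3 ^ P * r0" using r0 by (simp add: divide_less_eq)
  define C where "C = 3 * (6 + 4 * real P * 3 ^ P) * (2 * C3 * (3 ^ N) powr (- \<alpha>) / (1 - 3 powr \<alpha>))"
  have "3 powr \<alpha> < 3 powr 0" using \<alpha> by (intro powr_less_mono) auto
  then have C: "0 < C" using C3 by (auto simp: C_def intro!: mult_pos_pos divide_pos_pos add_pos_nonneg)
  show ?thesis
  proof (intro exI[of _ C] conjI C allI impI)
    fix \<nu> :: "real^'d" and a and B :: "real^'d => real^'d^'m => real^'d^'m" and w W f h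
    assume asm: "core c0 s s1 s2 \<mu> \<Lambda> \<nu> a B w W f h & regular_periodic H \<sigma> B &
      (ALL x. x \<bullet> \<nu> - a <= 0 --> f x = 0 & h x = 0)"
    then interpret core c0 s s1 s2 \<mu> \<Lambda> \<nu> a B w W f h by blast
    have per: "B (x + z) \<Xi> = B x \<Xi>" if "ALL k. z $ k \<in> \<int>" for x z \<Xi>
      using asm that unfolding regular_periodic_def by blast
    have hol: "norm (B (x + z) \<Xi> - B x \<Xi>) <= H * norm z powr \<sigma> * norm \<Xi>" for x z \<Xi>
      using asm unfolding regular_periodic_def by blast
    have f0: "f x = 0" and h0: "h x = 0" if "t x <= 0" for x using asm that by (auto simp: t_def)
    have lam: "lam = la" by (simp add: lam_def la_def)
    note os = one_step[of _ N c k, unfolded lam, folded n_def K_def q_def, folded C2_def C3_def]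
    have step: "(e (r / 3 ^ N))^2 <= (1 / 12) * (e (3 * (r / 3 ^ N)))^2 + C2 * (1 / 3 ^ N) * (e r)^2 + C3 * (tau r)^2"
      if r: "0 < r" and "r <= r0 | R0 <= r" for r
      using that(2)
    proof
      assume rr: "r <= r0"
      show ?thesis
      proof (rule os[OF r N(1) c c3 k(2,3,4,5), where z="%i. (c * r / 3 ^ N) *R tt i" and \<omega>="H * D"])
        fix i and x :: "real^'d" and \<Xi> :: "real^'d^'m"
        have "norm ((c * r / 3 ^ N) *R tt i) <= c * r / 3 ^ N * 1"
          unfolding norm_scaleR using c r tt(2)[of i] by (intro mult_mono) auto
        also have "... <= D powr (1 / \<sigma>)"
          using mult_left_mono[OF rr, of "c / 3 ^ N"] c by (simp add: r0_def)
        finally have "norm (- ((c * r / 3 ^ N) *R tt i)) powr \<sigma> <= (D powr (1 / \<sigma>)) powr \<sigma>"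
          using \<sigma> by (intro powr_mono2) auto
        also have "... = D" using D \<sigma> by (simp add: powr_powr)
        finally have "H * norm (- ((c * r / 3 ^ N) *R tt i)) powr \<sigma> * norm \<Xi> <= H * D * norm \<Xi>"
          using H by (intro mult_right_mono mult_left_mono) auto
        then show "norm (B (x - (c * r / 3 ^ N) *R tt i) \<Xi> - B x \<Xi>) <= H * D * norm \<Xi>"
          using hol[of x "- ((c * r / 3 ^ N) *R tt i)" \<Xi>] by simp
      qed (use D H r in auto)
    next
      assume rr: "R0 <= r"
      define z where "z i = (\<chi> j. of_int (round (((c * r / 3 ^ N) *R tt i) $ j)) :: real^'d)" for i
      show ?thesis
      proof (rule os[OF r N(1) c c3 k(2,3,4,5), where z=z and \<omega>=0])
        fix i
        have "norm (z i - (c * r / 3 ^ N) *R tt i) <= n" unfolding z_def n_def by (rule round_vec_dist)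
        also have "n <= r / 2 ^ k / 4" using rr by (simp add: R0_def field_simps)
        finally show "norm (z i - (c * r / 3 ^ N) *R tt i) <= r / 2 ^ k / 4" .
        fix x :: "real^'d" and \<Xi> :: "real^'d^'m"
        show "norm (B (x - z i) \<Xi> - B x \<Xi>) <= 0 * norm \<Xi>" using per[of "- z i" x \<Xi>] by (simp add: z_def)
      qed (use c in auto)
    qed
    show "wnn \<nu> a \<alpha> W <= ennreal C * (wnn \<nu> a \<alpha> f + wnn \<nu> a (\<alpha> + 2) h)"
      using weighted_estimate[OF \<alpha> r0 P C3 N(2) step f0 h0] unfolding C_def by simp
  qed
qed

section \<open>Cut-off at infinity\<close>

definition grad :: "(real^'d::finite => real) => real^'d => real^'d" where
  "grad \<zeta> x = (\<chi> i. pd i \<zeta> x)"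

lemma grad_test_fun:
  assumes "test_fun \<Omega> \<zeta>"
  shows "bm (grad \<zeta>)" "EX c. ALL x. norm (grad \<zeta> x) <= c"
    "x \<notin> closure {x. \<zeta> x ~= 0} ==> grad \<zeta> x = 0"
proof -
  have t: "test_fun \<Omega> (pd i \<zeta>)" for i by (rule test_fun_pd[OF assms])
  have "bm (%x. grad \<zeta> x \<bullet> b)" if "b \<in> Basis" for b
    using that test_fun_measurable[OF t] by (auto simp: Basis_vec_def inner_axis grad_def)
  then show "bm (grad \<zeta>)" by (simp add: borel_measurable_euclidean_space[of "grad \<zeta>"])
  have "EX c. ALL x. \<bar>pd i \<zeta> x\<bar> <= c" for i using test_fun_bounded[OF t[of i]] by blast
  then obtain c where c: "!!i x. \<bar>pd i \<zeta> x\<bar> <= c i" by metis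
  have "norm (grad \<zeta> x) <= sum c UNIV" for x
    
  proof -
    have "(\<Sum>i\<in>UNIV. \<bar>grad \<zeta> x $ i\<bar>) <= sum c UNIV" by (intro sum_mono) (simp add: grad_def c)
    then show ?thesis using norm_le_l1_cart[of "grad \<zeta> x"] by linarith
  qed
  then show "EX c. ALL x. norm (grad \<zeta> x) <= c" by blast
  show "grad \<zeta> x = 0" if "x \<notin> closure {x. \<zeta> x ~= 0}" using pd_eq_0_outside[OF that] by (simp add: grad_def vec_eq_iff)
qed

lemma outer_0 [simp]: "outer 0 p = 0"
  by (simp add: vec_eq_iff)

lemma test_fun_subset: "test_fun \<Omega> \<phi> ==> \<Omega> <= \<Omega>' ==> test_fun \<Omega>' \<phi>"
  unfolding test_fun_iff by blast

lemma l2_bounded_mult: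
  fixes U :: "real^'d::finite => 'b::euclidean_space" and g :: "real^'d => real"
  assumes Ul: "l2 (rs S U)" and [measurable]: "bm U" "bm g"
    and b: "!!x. \<bar>g x\<bar> <= c" and s: "!!x. g x ~= 0 ==> x \<in> S"
  shows "l2 (%x. g x *R U x)"
proof (rule l2_cmp(1)[OF Ul, where C="\<bar>c\<bar>"])
  show "AE x in lborel. norm (g x *R U x) <= \<bar>c\<bar> * norm (rs S U x)"
  proof (intro AE_I2)
    fix x
    show "norm (g x *R U x) <= \<bar>c\<bar> * norm (rs S U x)"
    proof (cases "g x = 0")
      case False
      have "\<bar>g x\<bar> <= \<bar>c\<bar>" using b[of x] by linarith
      then show ?thesis using s[OF False] by (simp add: rs_def mult_right_mono)
    qed simp
  qed
qed auto

text \<open>The weak gradient of the uncut pair is tested with the product \<zeta> \<phi>. Square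
  integrability on balls is enough because \<zeta> has compact support.\<close>

lemma H1_test_cut:
  fixes U :: "real^'d::finite => real^'m::finite" and \<Gamma> :: "real^'d => real^'d^'m"
  assumes \<zeta>: "test_fun UNIV \<zeta>" and [measurable]: "bm U" "bm \<Gamma>"
    and U: "!!r. l2 (rs (cball x0 r) U)" and \<Gamma>: "!!r. l2 (rs (cball x0 r) \<Gamma>)"
    and weak: "!!\<phi> \<beta> i. test_fun UNIV \<phi> ==> (LBINT x. U x $ \<beta> * pd i \<phi> x) = - (LBINT x. \<Gamma> x $ \<beta> $ i * \<phi> x)"
  shows "H1 (%x. \<zeta> x *R U x) (%x. \<zeta> x *R \<Gamma> x + outer (U x) (grad \<zeta> x))"
proof -
  note gm[measurable] = grad_test_fun(1)[OF \<zeta>] and zm[measurable] = test_fun_measurable[OF \<zeta>]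
  obtain r where r: "closure {x. \<zeta> x ~= 0} <= cball x0 r"
    using \<zeta> bounded_subset_ballD[of "closure {x. \<zeta> x ~= 0}" x0] ball_subset_cball unfolding test_fun_iff
    by (metis bounded_closure subset_trans)
  obtain c1 where c1: "!!x. \<bar>\<zeta> x\<bar> <= c1" using test_fun_bounded[OF \<zeta>] by blast
  obtain c2 where c2: "!!x. norm (grad \<zeta> x) <= c2" using grad_test_fun(2)[OF \<zeta>] by blast
  have \<zeta>s: "x \<in> cball x0 r" if "\<zeta> x ~= 0" for x using r closure_subset[of "{x. \<zeta> x ~= 0}"] that by blast
  have gs: "x \<in> cball x0 r" if "grad \<zeta> x ~= 0" for x using r grad_test_fun(3)[OF \<zeta>, of x] that by blast
  have l: "l2 (%x. \<zeta> x *R U x)" "l2 (%x. \<zeta> x *R \<Gamma> x)"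
    using l2_bounded_mult[OF U _ _ c1 \<zeta>s] l2_bounded_mult[OF \<Gamma> _ _ c1 \<zeta>s] by auto
  have lg: "l2 (%x. norm (grad \<zeta> x) *R U x)"
    by (rule l2_bounded_mult[OF U, where c=c2]) (use c2 gs in auto)
  have lou: "l2 (%x. outer (U x) (grad \<zeta> x))"
    by (rule l2_cmp(1)[OF lg, where C=1]) (auto simp: norm_ou mult.commute)
  show ?thesis
    unfolding H1_def
  proof (intro conjI allI impI l l2_add(1)[OF l(2) lou])
    fix \<phi> :: "real^'d => real" and \<beta> i assume \<phi>: "test_fun UNIV \<phi>"
    have tp: "test_fun UNIV (%x. \<zeta> x * \<phi> x)" using \<zeta> by (intro test_fun_mult \<phi>) (simp add: test_fun_iff)
    have pp: "pd i (%x. \<zeta> x * \<phi> x) x = \<zeta> x * pd i \<phi> x + pd i \<zeta> x * \<phi> x" for x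
      using \<zeta> \<phi> by (intro pd_mult smooth_fun_differentiable) (auto simp: test_fun_iff)
    have i1: "integrable lborel (%x. (\<zeta> x *R U x) $ \<beta> * pd i \<phi> x)"
      by (rule l2_mult_integrable(1)[OF l2_component[OF l(1)] test_l2[OF test_fun_pd[OF \<phi>]]])
    have i2: "integrable lborel (%x. (\<zeta> x *R \<Gamma> x) $ \<beta> $ i * \<phi> x)"
      by (rule l2_mult_integrable(1)[OF l2_entry[OF l(2)] test_l2[OF \<phi>]])
    have i3: "integrable lborel (%x. outer (U x) (grad \<zeta> x) $ \<beta> $ i * \<phi> x)"
      by (rule l2_mult_integrable(1)[OF l2_entry[OF lou] test_l2[OF \<phi>]])
    have "(LBINT x. (\<zeta> x *R U x) $ \<beta> * pd i \<phi> x) + (LBINT x. outer (U x) (grad \<zeta> x) $ \<beta> $ i * \<phi> x)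
      = (LBINT x. U x $ \<beta> * pd i (%x. \<zeta> x * \<phi> x) x)"
      unfolding pp by (subst Bochner_Integration.integral_add[OF i1 i3, symmetric])
        (auto intro!: lebesgue_cong simp: grad_def algebra_simps)
    also have "... = - (LBINT x. (\<zeta> x *R \<Gamma> x) $ \<beta> $ i * \<phi> x)"
      unfolding weak[OF tp] by (simp add: mult_ac)
    finally show "(LBINT x. (\<zeta> x *R U x) $ \<beta> * pd i \<phi> x)
      = - (LBINT x. (\<zeta> x *R \<Gamma> x + outer (U x) (grad \<zeta> x)) $ \<beta> $ i * \<phi> x)"
      using Bochner_Integration.integral_add[OF i2 i3] by (simp add: distrib_right)
  qed
qed

text \<open>Hardy's inequality controls the commutator with the cut-off \<open>s (t / \<epsilon> - 1)\<close> as \<open>\<epsilon> \<rightarrow> 0\<close>.\<close>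

lemma weak_form_boundary:
  fixes v q :: "real^'d::finite => real^'m::finite" and P :: "real^'d => real^'d^'m" and \<nu> :: "real^'d"
  assumes P: "l2 P" and [measurable]: "bm q" and q: "l2 (%x. (x \<bullet> \<nu> - a) *R q x)"
    and \<nu>: "norm \<nu> = 1" and h: "H1 v V" and bd: "bounded {x. v x ~= 0}"
    and v0: "!!x. x \<bullet> \<nu> - a <= 0 ==> v x = 0" and V0: "!!x. x \<bullet> \<nu> - a <= 0 ==> V x = 0"
    and eq: "!!\<phi>. (!!\<beta>. test_fun {x. 0 < x \<bullet> \<nu> - a} (%y. \<phi> y $ \<beta>)) ==>
        (LBINT x. P x \<bullet> gradv \<phi> x) = (LBINT x. q x \<bullet> \<phi> x)"
  shows "(LBINT x. P x \<bullet> V x) = (LBINT x. q x \<bullet> v x)"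
proof -
  obtain c s s1 s2 where "smooth_step c s s1 s2" using smooth_step_exists by blast
  then interpret smooth_step c s s1 s2 .
  note s = s_dn s_der s1_dn s_0 s_1 s_nn s_le s1_le s1_0 and c = c0
  define t where "t x = x \<bullet> \<nu> - a" for x
  have [measurable]: "bm t" unfolding t_def[abs_def] by measurable
  note l = H1D(1,2)[OF h]
  have [measurable]: "bm v" "bm V" "bm P" using l P by auto
  obtain b where b: "b > 0" "!!x. v x ~= 0 ==> t x <= b"
  proof -
    obtain N where N: "!!x. v x ~= 0 ==> norm x <= N" using bd by (auto simp: bounded_iff)
    have "t x <= \<bar>N\<bar> + \<bar>a\<bar> + 1" if "v x ~= 0" for x
      using N[OF that] Cauchy_Schwarz_ineq2[of x \<nu>] \<nu> by (auto simp: t_def)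
    then show ?thesis using that[of "\<bar>N\<bar> + \<bar>a\<bar> + 1"] by auto
  qed
  define S where "S = {x. t x <= b}"
  have [measurable]: "S \<in> sets borel" unfolding S_def by measurable
  have ql: "l2 (%x. (1 / t x) *R v x)"
  proof -
    have "l2 (rs S (%x. (1 / t x) *R v x))"
      unfolding t_def
    proof (rule hardy(1)[OF h \<nu> _ v0 V0 _ b(1)])
      fix x and \<sigma> :: real assume "x \<in> S" "0 <= \<sigma>"
      then show "x - \<sigma> *R \<nu> \<in> S" using \<nu> by (simp add: S_def t_def inner_diff_left power2_norm_eq_inner[symmetric] flip: power2_norm_eq_inner)
    qed (auto simp: S_def t_def)
    moreover have "rs S (%x. (1 / t x) *R v x) = (%x. (1 / t x) *R v x)"
    proof
      fix x show "rs S (%x. (1 / t x) *R v x) x = (1 / t x) *R v x"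
        using b(2)[of x] by (cases "v x = 0") (auto simp: rs_def S_def)
    qed
    ultimately show ?thesis by simp
  qed
  define \<epsilon> where "\<epsilon> k = 1 / real (Suc k)" for k
  have \<epsilon>: "0 < \<epsilon> k" for k by (simp add: \<epsilon>_def)
  have \<epsilon>0: "\<epsilon> \<longlonglongrightarrow> 0" unfolding \<epsilon>_def[abs_def] by real_asymp
  define g where "g k \<tau> = s (\<tau> / \<epsilon> k - 1)" for k \<tau>
  define g' where "g' k \<tau> = s1 (\<tau> / \<epsilon> k - 1) / \<epsilon> k" for k \<tau>
  have [measurable]: "bm (g k)" "bm (g' k)" for k
    unfolding g_def[abs_def] g'_def[abs_def] by measurable
  have gd: "dn n (g k)" for n k using dn_affine[OF s(1), of n "1 / \<epsilon> k" "- 1"] by (simp add: g_def[abs_def])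
  have gder: "(g k has_real_derivative g' k x) (at x)" for k x
  proof -
    have "((%\<tau>. \<tau> / \<epsilon> k - 1) has_real_derivative 1 / \<epsilon> k) (at x)" using \<epsilon>[of k] by (auto intro!: derivative_eq_intros)
    from DERIV_chain2[OF s(2) this] show ?thesis unfolding g_def[abs_def] g'_def by simp
  qed
  have g01: "0 <= g k x" "g k x <= 1" for k x using s by (auto simp: g_def)
  have g0: "g k x = 0" "g' k x = 0" if "x <= \<epsilon> k" for k x using that \<epsilon>[of k] s(4,9) by (auto simp: g_def g'_def)
  have g1: "g k x = 1" "g' k x = 0" if "2 * \<epsilon> k <= x" for k x using that \<epsilon>[of k] by (auto simp: g_def g'_def le_divide_eq intro!: s)
  have g'b: "\<bar>g' k x\<bar> <= c / \<epsilon> k" for k x using s(8) \<epsilon>[of k] by (simp add: g'_def divide_right_mono)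
  \<comment> \<open>Below 2 \<epsilon> the bound c / \<epsilon> is at most 2 c / x. So the
    commutator is dominated by v / t, uniformly in k, and Hardy's inequality makes the dominating
    function integrable.\<close>
  have g't: "\<bar>g' k x\<bar> <= 2 * c / x" if "0 < x" for k x
  proof (cases "2 * \<epsilon> k <= x")
    case True then show ?thesis using g1 that c by simp
  next
    case False
    then have "c / \<epsilon> k <= 2 * c / x" using that \<epsilon>[of k] c by (auto simp: field_simps)
    then show ?thesis using g'b[of k x] by linarith
  qed
  define vk where "vk k x = g k (t x) *R v x" for k x
  define Vk where "Vk k x = g k (t x) *R V x + g' k (t x) *R outer (v x) \<nu>" for k x
  have [measurable]: "bm (vk k)" "bm (Vk k)" for k
    unfolding vk_def[abs_def] Vk_def[abs_def] by measurable
  have hk: "H1 (vk k) (Vk k)" for k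
    unfolding vk_def[abs_def] Vk_def[abs_def] t_def
  proof (rule H1_cut[OF h gd gder, where c="max 1 (c / \<epsilon> k)"])
    show "\<bar>g k x\<bar> <= max 1 (c / \<epsilon> k)" for x using g01[of k x] by (simp add: le_max_iff_disj)
    show "\<bar>g' k x\<bar> <= max 1 (c / \<epsilon> k)" for x using g'b[of k x] by (simp add: le_max_iff_disj)
  qed
  have vks: "\<epsilon> k < t x" if "vk k x ~= 0" for k x
  proof (rule ccontr)
    assume "~ ?thesis" then show False using that g0(1)[of "t x" k] by (simp add: vk_def)
  qed
  have key: "(LBINT x. P x \<bullet> Vk k x) = (LBINT x. q x \<bullet> vk k x)" for k
  proof -
    \<comment> \<open>Only t q is square integrable. Cut away from the boundary, \<open>q\<close>
      itself is, and the test functions in question do not see the change.\<close>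
    define q' where "q' x = indicator {\<epsilon> k / 2..} (t x) *R q x" for x
    have [measurable]: "bm q'" unfolding q'_def[abs_def] by measurable
    have q'l: "l2 q'"
    proof (rule l2_cmp(1)[OF q, where C="2 / \<epsilon> k"])
      show "AE x in lborel. norm (q' x) <= 2 / \<epsilon> k * norm ((x \<bullet> \<nu> - a) *R q x)"
      proof (intro AE_I2)
        fix x
        show "norm (q' x) <= 2 / \<epsilon> k * norm ((x \<bullet> \<nu> - a) *R q x)"
        proof (cases "\<epsilon> k / 2 <= t x")
          case True
          then have "1 <= 2 / \<epsilon> k * \<bar>t x\<bar>" using \<epsilon>[of k] by (simp add: field_simps)
          then have "1 * norm (q x) <= 2 / \<epsilon> k * \<bar>t x\<bar> * norm (q x)" by (rule mult_right_mono) simp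
          then show ?thesis using True by (simp add: q'_def t_def)
        qed (use \<epsilon>[of k] in \<open>simp add: q'_def\<close>)
      qed
    qed (use \<epsilon>[of k] in auto)
    have "(LBINT x. P x \<bullet> Vk k x) = (LBINT x. q' x \<bullet> vk k x)"
    proof (rule weak_form_extend[OF P q'l hk, where \<delta>="\<epsilon> k / 2" and \<Omega>="{x. \<epsilon> k / 2 <= t x}"])
      show "bounded {x. vk k x ~= 0}" by (rule bounded_subset[OF bd]) (auto simp: vk_def)
      show "y \<in> {x. \<epsilon> k / 2 <= t x}" if "vk k x ~= 0" "dist x y <= \<epsilon> k / 2" for x y
      proof -
        have "\<bar>(x - y) \<bullet> \<nu>\<bar> <= \<epsilon> k / 2" using Cauchy_Schwarz_ineq2[of "x - y" \<nu>] \<nu> that(2) by (simp add: dist_norm)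
        then show ?thesis using vks[OF that(1)] unfolding t_def inner_diff_left by (simp, linarith)
      qed
      fix \<phi> :: "real^'d => real^'m" assume \<phi>: "!!\<beta>. test_fun {x. \<epsilon> k / 2 <= t x} (%y. \<phi> y $ \<beta>)"
      have "test_fun {x. 0 < x \<bullet> \<nu> - a} (%y. \<phi> y $ \<beta>)" for \<beta>
        by (rule test_fun_subset[OF \<phi>]) (use \<epsilon>[of k] in \<open>auto simp: t_def\<close>)
      then have "(LBINT x. P x \<bullet> gradv \<phi> x) = (LBINT x. q x \<bullet> \<phi> x)" by (rule eq)
      also have "... = (LBINT x. q' x \<bullet> \<phi> x)"
      proof (intro lebesgue_cong refl)
        fix x
        have "\<phi> x = 0" if "~ \<epsilon> k / 2 <= t x"
        proof -
          have "\<phi> x $ \<beta> = 0" for \<beta>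
            using \<phi>[of \<beta>] closure_subset[of "{y. \<phi> y $ \<beta> ~= 0}"] that unfolding test_fun_iff by blast
          then show ?thesis by (simp add: vec_eq_iff)
        qed
        then show "q x \<bullet> \<phi> x = q' x \<bullet> \<phi> x" by (cases "\<epsilon> k / 2 <= t x") (auto simp: q'_def)
      qed
      finally show "(LBINT x. P x \<bullet> gradv \<phi> x) = (LBINT x. q' x \<bullet> \<phi> x)" .
    qed (use \<epsilon>[of k] in simp)
    also have "... = (LBINT x. q x \<bullet> vk k x)"
    proof (intro lebesgue_cong refl)
      fix x show "q' x \<bullet> vk k x = q x \<bullet> vk k x" using vks[of k x] \<epsilon>[of k] by (cases "vk k x = 0") (auto simp: q'_def)
    qed
    finally show ?thesis .
  qed
  have ev: "\<forall>\<^sub>F k in sequentially. 2 * \<epsilon> k < t x" if "0 < t x" for x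
    using order_tendstoD(2)[OF tendsto_mult_right_zero[OF \<epsilon>0, of 2] that] by simp
  have "(%k. LBINT x. P x \<bullet> Vk k x) \<longlonglongrightarrow> (LBINT x. P x \<bullet> V x)"
  proof (rule integral_dominated_convergence[where w="%x. norm (P x) * norm (V x) + 2 * c * (norm (P x) * norm ((1 / t x) *R v x))"])
    have nP: "l2 (%x. norm (P x))" by (rule l2_cmp(1)[OF P, where C=1]) auto
    have nV: "l2 (%x. norm (V x))" by (rule l2_cmp(1)[OF l(2), where C=1]) auto
    have nq: "l2 (%x. norm ((1 / t x) *R v x))" by (rule l2_cmp(1)[OF ql, where C=1]) auto
    show "integrable lborel (%x. norm (P x) * norm (V x) + 2 * c * (norm (P x) * norm ((1 / t x) *R v x)))"
      by (intro Bochner_Integration.integrable_add integrable_mult_right l2_mult_integrable(1)[OF nP nV] l2_mult_integrable(1)[OF nP nq])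
    show "AE x in lborel. (%k. P x \<bullet> Vk k x) \<longlonglongrightarrow> P x \<bullet> V x"
    proof (intro AE_I2 tendsto_eventually)
      fix x
      show "\<forall>\<^sub>F k in sequentially. P x \<bullet> Vk k x = P x \<bullet> V x"
      proof (cases "0 < t x")
        case True
        from ev[OF this] show ?thesis by eventually_elim (simp add: Vk_def g1)
      next
        case False
        then show ?thesis using v0[of x] V0[of x] by (simp add: Vk_def t_def)
      qed
    qed
    fix k
    show "AE x in lborel. norm (P x \<bullet> Vk k x) <= norm (P x) * norm (V x) + 2 * c * (norm (P x) * norm ((1 / t x) *R v x))"
    proof (intro AE_I2)
      fix x
      have "norm (Vk k x) <= norm (V x) + 2 * c * norm ((1 / t x) *R v x)"
      proof (cases "0 < t x")
        case True
        have "norm (g k (t x) *R V x) <= norm (V x)" using g01[of k "t x"] by (simp add: mult_left_le_one_le)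
        moreover have "norm (g' k (t x) *R outer (v x) \<nu>) <= 2 * c / t x * norm (v x)"
          using mult_right_mono[OF g't[OF True, of k], of "norm (v x)"] by (simp add: norm_ou \<nu>)
        ultimately show ?thesis
          using norm_triangle_ineq[of "g k (t x) *R V x" "g' k (t x) *R outer (v x) \<nu>"] True by (simp add: Vk_def)
      next
        case False
        then show ?thesis using v0[of x] V0[of x] by (simp add: Vk_def t_def)
      qed
      then have "norm (P x) * norm (Vk k x) <= norm (P x) * (norm (V x) + 2 * c * norm ((1 / t x) *R v x))"
        by (rule mult_left_mono) simp
      then show "norm (P x \<bullet> Vk k x) <= norm (P x) * norm (V x) + 2 * c * (norm (P x) * norm ((1 / t x) *R v x))"
        using Cauchy_Schwarz_ineq2[of "P x" "Vk k x"] by (simp add: algebra_simps)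
    qed
  qed measurable
  moreover have "(%k. LBINT x. q x \<bullet> vk k x) \<longlonglongrightarrow> (LBINT x. q x \<bullet> v x)"
  proof (rule integral_dominated_convergence[where w="%x. norm ((x \<bullet> \<nu> - a) *R q x) * norm ((1 / t x) *R v x)"])
    have nq: "l2 (%x. norm ((x \<bullet> \<nu> - a) *R q x))" by (rule l2_cmp(1)[OF q, where C=1]) auto
    have nv: "l2 (%x. norm ((1 / t x) *R v x))" by (rule l2_cmp(1)[OF ql, where C=1]) auto
    show "integrable lborel (%x. norm ((x \<bullet> \<nu> - a) *R q x) * norm ((1 / t x) *R v x))"
      by (rule l2_mult_integrable(1)[OF nq nv])
    show "AE x in lborel. (%k. q x \<bullet> vk k x) \<longlonglongrightarrow> q x \<bullet> v x"
    proof (intro AE_I2 tendsto_eventually)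
      fix x
      show "\<forall>\<^sub>F k in sequentially. q x \<bullet> vk k x = q x \<bullet> v x"
      proof (cases "0 < t x")
        case True
        from ev[OF this] show ?thesis by eventually_elim (simp add: vk_def g1)
      next
        case False
        then show ?thesis using v0[of x] by (simp add: vk_def t_def)
      qed
    qed
    fix k
    show "AE x in lborel. norm (q x \<bullet> vk k x) <= norm ((x \<bullet> \<nu> - a) *R q x) * norm ((1 / t x) *R v x)"
    proof (intro AE_I2)
      fix x
      show "norm (q x \<bullet> vk k x) <= norm ((x \<bullet> \<nu> - a) *R q x) * norm ((1 / t x) *R v x)"
      proof (cases "0 < t x")
        case True
        have "norm (q x \<bullet> vk k x) <= norm (q x) * norm (vk k x)" using Cauchy_Schwarz_ineq2[of "q x" "vk k x"] by simp
        also have "... <= norm (q x) * norm (v x)" using g01[of k "t x"] by (intro mult_left_mono) (auto simp: vk_def mult_left_le_one_le)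
        also have "... = norm ((x \<bullet> \<nu> - a) *R q x) * norm ((1 / t x) *R v x)" using True by (simp add: t_def)
        finally show ?thesis .
      next
        case False
        then show ?thesis using v0[of x] by (simp add: vk_def t_def)
      qed
    qed
  qed measurable
  ultimately show ?thesis unfolding key by (rule LIMSEQ_unique)
qed

lemma mv_measurable2:
  assumes "V \<in> borel_measurable M" "p \<in> borel_measurable M"
  shows "(%x. (V x :: real^'d::finite^'m::finite) *v p x) \<in> borel_measurable M"
proof -
  have "bounded_bilinear (%(V :: real^'d^'m) p. V *v p)"
    by (rule bounded_bilinear.intro)
       (auto simp: matrix_vector_mult_add_rdistrib matrix_vector_right_distrib scaleR_matrix_vector_assoc
         matrix_vector_mult_scaleR intro!: exI[of _ 1] norm_mv_le)
  from bounded_bilinear.continuous_on[OF this continuous_on_fst[OF continuous_on_id] continuous_on_snd[OF continuous_on_id]]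
  have "continuous_on UNIV (%z. (fst z :: real^'d^'m) *v snd z)" by simp
  from borel_measurable_continuous_on[OF this, of "%x. (V x, p x)" M] show ?thesis using assms by simp
qed

text \<open>The solution extended by zero across the boundary, in Borel representatives; zero trace
  is expressed by testing \<open>weak\<close> on the whole space. Here \<nu> is the inner normal,
  and norms are finite on balls around the boundary point \<open>x0\<close>, up to the boundary but
  not at infinity.\<close>

locale half_problem = smooth_step c0 s s1 s2 for c0 s s1 s2 +
  fixes \<mu> \<Lambda> :: real and \<nu> x0 :: "real^'d::finite" and a :: real
    and B :: "real^'d => real^'d^'m::finite => real^'d^'m"
    and U :: "real^'d => real^'m" and \<Gamma> F :: "real^'d => real^'d^'m" and H :: "real^'d => real^'m"
  assumes mu: "0 < \<mu>" and Lam: "0 <= \<Lambda>"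
    and nu: "norm \<nu> = 1" and x0: "x0 \<bullet> \<nu> - a = 0"
    and coer: "\<mu> * (norm \<Xi>)^2 <= B y \<Xi> \<bullet> \<Xi>" and bnd: "norm (B y \<Xi>) <= \<Lambda> * norm \<Xi>"
    and lin: "linear (B y)"
    and Bmeas: "bm V ==> bm (%x. B (x + z) (V x))"
    and meas[measurable]: "bm U" "bm \<Gamma>"
      "bm F" "bm H"
    and zero: "y \<bullet> \<nu> - a <= 0 ==> U y = 0" "y \<bullet> \<nu> - a <= 0 ==> \<Gamma> y = 0"
      "y \<bullet> \<nu> - a <= 0 ==> F y = 0" "y \<bullet> \<nu> - a <= 0 ==> H y = 0"
    and U: "l2 (rs (cball x0 r) U)" and \<Gamma>: "l2 (rs (cball x0 r) \<Gamma>)" and F: "l2 (rs (cball x0 r) F)"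
    and H: "l2 (rs (cball x0 r) (%x. (x \<bullet> \<nu> - a) *R H x))"
    and weak: "test_fun UNIV \<phi> ==> (LBINT x. U x $ \<beta> * pd i \<phi> x) = - (LBINT x. \<Gamma> x $ \<beta> $ i * \<phi> x)"
    and eqn: "(!!\<beta>. test_fun {x. 0 < x \<bullet> \<nu> - a} (%y. \<psi> y $ \<beta>)) ==>
        (LBINT x. (B x (\<Gamma> x) + F x) \<bullet> gradv \<psi> x) = (LBINT x. H x \<bullet> \<psi> x)"
begin

definition t :: "real^'d => real" where "t x = x \<bullet> \<nu> - a"
text \<open>A function of |x - x0|^2 / R^2, hence smooth at \<open>x0\<close> as well: 1 up to
  radius R and 0 from radius sqrt(2) R on, in particular from 2 R on.\<close>

definition \<eta> :: "real => real^'d => real" where "\<eta> R x = s (2 - ((x - x0) \<bullet> (x - x0)) / R^2)"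
definition wR where "wR R x = \<eta> R x *R U x"
definition WR where "WR R x = \<eta> R x *R \<Gamma> x + outer (U x) (grad (\<eta> R) x)"
text \<open>The data of the cut solution, determined by \<eta> (B \<Gamma> + F) = B WR + fR: the
  commutator with \<open>U\<close> enters the divergence term, the one with \<Gamma> and
  \<open>F\<close> enters \<open>hR\<close>.\<close>

definition fR where "fR R x = \<eta> R x *R F x - B x (outer (U x) (grad (\<eta> R) x))"
definition hR where "hR R x = \<eta> R x *R H x - (B x (\<Gamma> x) + F x) *v grad (\<eta> R) x"

lemma t_measurable [measurable]: "bm t"
  unfolding t_def[abs_def] by measurable

lemma t_le: "\<bar>t x\<bar> <= norm (x - x0)"
proof -
  have "t x = (x - x0) \<bullet> \<nu>" using x0 by (simp add: t_def inner_diff_left)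
  then show ?thesis using Cauchy_Schwarz_ineq2[of "x - x0" \<nu>] nu by simp
qed

lemma \<eta>01: "0 <= \<eta> R x" "\<eta> R x <= 1"
  using s_nn s_le by (auto simp: \<eta>_def)

lemma grad_\<eta>: "grad (\<eta> R) x = (- (2 / R^2) * s1 (2 - ((x - x0) \<bullet> (x - x0)) / R^2)) *R (x - x0)"
proof -
  have eq: "2 - y / R^2 = 2 + (- (1 / R^2)) * y" for y :: real by simp
  have "((%x. 2 + (- (1 / R^2)) * ((x - x0) \<bullet> (x - x0))) has_derivative (%h. (- (1 / R^2)) * (2 * ((x - x0) \<bullet> h)))) (at x)"
  proof -
    have "((%x. 2 + k * ((x - x0) \<bullet> (x - x0))) has_derivative (%h. k * (2 * ((x - x0) \<bullet> h)))) (at x)" for k :: real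
      by (auto intro!: derivative_eq_intros simp: inner_commute)
    then show ?thesis .
  qed
  from has_derivative_compose[OF this s_der[unfolded has_field_derivative_def]]
  have "(\<eta> R has_derivative (%h. s1 (2 + (- (1 / R^2)) * ((x - x0) \<bullet> (x - x0))) * ((- (1 / R^2)) * (2 * ((x - x0) \<bullet> h))))) (at x)"
    unfolding \<eta>_def[abs_def] eq .
  from pd_eq[OF this] show ?thesis by (simp add: grad_def vec_eq_iff inner_axis)
qed

lemma \<eta>_1:
  assumes "R > 0" "norm (x - x0) <= R" shows "\<eta> R x = 1" "grad (\<eta> R) x = 0"
proof -
  have "((x - x0) \<bullet> (x - x0)) / R^2 <= 1"
    using power_mono[OF assms(2), of 2] assms(1) by (simp add: power2_norm_eq_inner)
  then show "\<eta> R x = 1" "grad (\<eta> R) x = 0" unfolding grad_\<eta> by (auto simp: \<eta>_def intro!: s_1 s1_0)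
qed

lemma \<eta>_0:
  assumes "R > 0" "2 * R <= norm (x - x0)" shows "\<eta> R x = 0" "grad (\<eta> R) x = 0"
proof -
  have "(2 * R)^2 <= (norm (x - x0))^2" using assms by (intro power_mono) auto
  then have "4 * R^2 <= (x - x0) \<bullet> (x - x0)" by (simp add: power2_norm_eq_inner power_mult_distrib)
  then have "2 * R^2 <= (x - x0) \<bullet> (x - x0)" using zero_le_power2[of R] by linarith
  then have "2 <= ((x - x0) \<bullet> (x - x0)) / R^2" using assms(1) by (simp add: le_divide_eq)
  then show "\<eta> R x = 0" "grad (\<eta> R) x = 0" unfolding grad_\<eta> by (auto simp: \<eta>_def intro!: s_0 s1_0)
qed

lemma grad_\<eta>_le:
  assumes R: "R > 0" shows "norm (grad (\<eta> R) x) <= 4 * c0 / R"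
proof (cases "2 * R <= norm (x - x0)")
  case False
  have "norm (grad (\<eta> R) x) = 2 / R^2 * \<bar>s1 (2 - ((x - x0) \<bullet> (x - x0)) / R^2)\<bar> * norm (x - x0)" by (simp add: grad_\<eta> abs_mult)
  also have "... <= 2 / R^2 * c0 * (2 * R)" using False s1_le c0 by (intro mult_mono) auto
  also have "... = 4 * c0 / R" using R by (simp add: power2_eq_square)
  finally show ?thesis .
qed (use \<eta>_0[OF R, of x] R c0 in simp)

text \<open>The height is at most 2 R on the support, and the gradient at most 4 c0 / R. Hence the
  commutator in \<open>hR\<close>, multiplied by t, stays comparable to \<Gamma> and
  \<open>F\<close> uniformly in R.\<close>

lemma t_gr_le:
  assumes R: "R > 0" shows "\<bar>t x\<bar> * norm (grad (\<eta> R) x) <= 8 * c0"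
proof (cases "2 * R <= norm (x - x0)")
  case False
  then have "\<bar>t x\<bar> * norm (grad (\<eta> R) x) <= (2 * R) * (4 * c0 / R)" using t_le[of x] grad_\<eta>_le[OF R, of x] R by (intro mult_mono) auto
  then show ?thesis using R by simp
qed (use \<eta>_0[OF R, of x] c0 in simp)

lemma \<eta>_test: assumes R: "R > 0" shows "test_fun UNIV (\<eta> R)"
  unfolding test_fun_iff
proof (intro conjI)
  have "sm n (%x. (x - x0) \<bullet> (x - x0))" for n
  proof -
    have eq: "(%x. (x - x0) \<bullet> (x - x0)) = (%x. x \<bullet> x + ((- 2) * (x \<bullet> x0) + x0 \<bullet> x0))"
      by (auto simp: inner_diff_left inner_diff_right inner_commute)
    show ?thesis unfolding eq by (intro sm_add sm_mult sm_inner_self sm_inner_const sm_const)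
  qed
  then have "sm n (%x. 2 + (- (1 / R^2)) * ((x - x0) \<bullet> (x - x0)))" for n by (intro sm_add sm_mult sm_const)
  from sm_comp[OF s_dn this] show "smooth_fun (\<eta> R)" by (simp add: smooth_fun_iff_sm \<eta>_def[abs_def])
  show "bounded {x. \<eta> R x ~= 0}"
    by (rule bounded_subset[OF bounded_cball[of x0 "2 * R"]]) (use \<eta>_0[OF R] in \<open>force simp: dist_norm norm_minus_commute\<close>)
qed simp

lemma supp:
  assumes R: "R > 0" and "\<eta> R x ~= 0 | grad (\<eta> R) x ~= 0"
  shows "x \<in> ball x0 (2 * R)" "x \<in> cball x0 (2 * R)"
proof -
  have "norm (x - x0) < 2 * R" using assms(2) \<eta>_0[OF R, of x] by force
  then show "x \<in> ball x0 (2 * R)" "x \<in> cball x0 (2 * R)" by (auto simp: dist_norm norm_minus_commute)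
qed

lemma \<eta>_meas: "R > 0 ==> bm (\<eta> R)" "R > 0 ==> bm (grad (\<eta> R))"
  using test_fun_measurable[OF \<eta>_test] grad_test_fun(1)[OF \<eta>_test] by auto

lemma wWR: "R > 0 ==> H1 (wR R) (WR R)"
  unfolding wR_def[abs_def] WR_def[abs_def] using H1_test_cut[OF \<eta>_test meas(1,2) U \<Gamma> weak] .

lemma BM [measurable (raw)]: "bm V ==> bm (%x. B x (V x))"
  using Bmeas[of V 0] by simp

lemma l2_gr:
  fixes V :: "real^'d => 'b::euclidean_space"
  assumes R: "R > 0" and V: "l2 (rs (cball x0 (2 * R)) V)" and [measurable]: "bm V"
  shows "l2 (%x. norm (grad (\<eta> R) x) *R V x)" "l2 (%x. \<eta> R x *R V x)"
    "l2 (%x. (t x * norm (grad (\<eta> R) x)) *R V x)"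
proof -
  note [measurable] = \<eta>_meas[OF R]
  have sp: "x \<in> cball x0 (2 * R)" if "\<eta> R x ~= 0 | grad (\<eta> R) x ~= 0" for x using supp(2)[OF R that] .
  show "l2 (%x. norm (grad (\<eta> R) x) *R V x)"
  proof (rule l2_bounded_mult[OF V, where c="4 * c0 / R"])
    show "x \<in> cball x0 (2 * R)" if "norm (grad (\<eta> R) x) ~= 0" for x by (rule sp) (use that in simp)
  qed (simp_all add: grad_\<eta>_le[OF R])
  show "l2 (%x. \<eta> R x *R V x)"
  proof (rule l2_bounded_mult[OF V, where c=1])
    show "x \<in> cball x0 (2 * R)" if "\<eta> R x ~= 0" for x by (rule sp) (use that in simp)
  qed (simp_all add: \<eta>01)
  show "l2 (%x. (t x * norm (grad (\<eta> R) x)) *R V x)"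
  proof (rule l2_bounded_mult[OF V, where c="8 * c0"])
    show "x \<in> cball x0 (2 * R)" if "t x * norm (grad (\<eta> R) x) ~= 0" for x by (rule sp) (use that in auto)
  qed (simp_all add: abs_mult t_gr_le[OF R])
qed

lemma Ql: "l2 (rs (cball x0 r) (%x. B x (\<Gamma> x) + F x))"
proof (rule nS_add(1)[OF _ F])
  show "l2 (rs (cball x0 r) (%x. B x (\<Gamma> x)))"
    by (rule nS_cmp(1)[OF \<Gamma>, where C=\<Lambda>]) (use bnd Lam in auto)
qed

lemma fR_l2: assumes R: "R > 0" shows "l2 (fR R)"
  unfolding fR_def[abs_def]
proof (rule l2_diff(1)[OF l2_gr(2)[OF R F]])
  note [measurable] = \<eta>_meas[OF R]
  show "l2 (%x. B x (outer (U x) (grad (\<eta> R) x)))"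
    by (rule l2_cmp(1)[OF l2_gr(1)[OF R U], where C=\<Lambda>])
       (use bnd[of _ "outer (U _) (grad (\<eta> R) _)"] Lam in \<open>auto simp: norm_ou mult.commute mult.left_commute\<close>)
qed simp

lemma hR_l2: assumes R: "R > 0" shows "l2 (%x. t x *R hR R x)" "bm (hR R)"
proof -
  note [measurable] = \<eta>_meas[OF R]
  let ?q = "%x. (B x (\<Gamma> x) + F x) *v grad (\<eta> R) x"
  have qm[measurable]: "bm (?q)"
  proof -
    show ?thesis by (rule mv_measurable2) measurable
  qed
  show "bm (hR R)" unfolding hR_def[abs_def] by measurable
  have 1: "l2 (%x. \<eta> R x *R ((x \<bullet> \<nu> - a) *R H x))" by (rule l2_gr(2)[OF R H]) simp
  have 2: "l2 (%x. t x *R ?q x)"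
  proof (rule l2_cmp(1)[OF l2_gr(3)[OF R Ql], where C=1])
    show "AE x in lborel. norm (t x *R ?q x) <= 1 * norm ((t x * norm (grad (\<eta> R) x)) *R (B x (\<Gamma> x) + F x))"
    proof (intro AE_I2)
      fix x
      have "\<bar>t x\<bar> * norm (?q x) <= \<bar>t x\<bar> * (norm (B x (\<Gamma> x) + F x) * norm (grad (\<eta> R) x))"
        by (intro mult_left_mono norm_mv_le) simp
      then show "norm (t x *R ?q x) <= 1 * norm ((t x * norm (grad (\<eta> R) x)) *R (B x (\<Gamma> x) + F x))"
        by (simp add: abs_mult mult_ac)
    qed
  qed auto
  have "(%x. t x *R hR R x) = (%x. \<eta> R x *R ((x \<bullet> \<nu> - a) *R H x) - t x *R ?q x)"
    by (auto simp: hR_def t_def scaleR_diff_right)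
  then show "l2 (%x. t x *R hR R x)" using l2_diff(1)[OF 1 2] by simp
qed

text \<open>\<eta> \<psi> is again an admissible test function, and the product rule moves the
  gradient of \<eta> to the right side.\<close>

lemma cut_equation:
  fixes \<psi> :: "real^'d => real^'m"
  assumes R: "R > 0" and \<psi>: "!!\<beta>. test_fun {x. 0 < x \<bullet> \<nu> - a} (%y. \<psi> y $ \<beta>)"
  shows "(LBINT x. (\<eta> R x *R (B x (\<Gamma> x) + F x)) \<bullet> gradv \<psi> x) = (LBINT x. hR R x \<bullet> \<psi> x)"
proof -
  note [measurable] = \<eta>_meas[OF R]
  define Q where "Q x = B x (\<Gamma> x) + F x" for x
  have Qm[measurable]: "bm Q" unfolding Q_def[abs_def] by measurable
  have Ql': "l2 (rs (cball x0 r) Q)" for r using Ql by (simp add: Q_def[abs_def])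
  have sm: "smooth_fun (\<eta> R)" using \<eta>_test[OF R] by (simp add: test_fun_iff)
  have pp: "gradv (%y. \<eta> R y *R \<psi> y) x = \<eta> R x *R gradv \<psi> x + outer (\<psi> x) (grad (\<eta> R) x)" for x
  proof -
    have "pd i (%y. \<eta> R y * \<psi> y $ \<beta>) x = \<eta> R x * pd i (%y. \<psi> y $ \<beta>) x + pd i (\<eta> R) x * \<psi> x $ \<beta>" for i \<beta>
      using \<psi>[of \<beta>] sm by (intro pd_mult smooth_fun_differentiable) (auto simp: test_fun_iff)
    then show ?thesis by (simp add: vec_eq_iff gradv_def grad_def)
  qed
  have e1: "(LBINT x. Q x \<bullet> gradv (%y. \<eta> R y *R \<psi> y) x) = (LBINT x. H x \<bullet> (\<eta> R x *R \<psi> x))"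
    unfolding Q_def by (rule eqn) (use test_fun_mult[OF sm \<psi>] in simp)
  have l\<psi>: "l2 (%x. \<psi> x $ \<beta>)" for \<beta> by (rule test_l2[OF \<psi>])
  have lQ: "l2 (%x. \<eta> R x *R Q x)" "l2 (%x. norm (grad (\<eta> R) x) *R Q x)" using l2_gr[OF R Ql' Qm] by auto
  have lg: "l2 (%x. Q x *v grad (\<eta> R) x)"
  proof (rule l2_cmp(1)[OF lQ(2), where C=1])
    show "bm (%x. Q x *v grad (\<eta> R) x)" by (rule mv_measurable2) measurable
    show "AE x in lborel. norm (Q x *v grad (\<eta> R) x) <= 1 * norm (norm (grad (\<eta> R) x) *R Q x)"
      using norm_mv_le[of "Q _" "grad (\<eta> R) _"] by (intro AE_I2) (simp add: mult.commute)
  qed simp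
  have i1: "integrable lborel (%x. (\<eta> R x *R Q x) \<bullet> gradv \<psi> x)"
    unfolding inner_matrix gradv_def
    by (intro lebesgue_sum)
       (simp only: vec_lambda_beta, intro l2_mult_integrable(1)[OF l2_entry[OF lQ(1)]] test_l2[OF test_fun_pd[OF \<psi>]])
  have i2: "integrable lborel (%x. (Q x *v grad (\<eta> R) x) \<bullet> \<psi> x)"
    unfolding inner_vec_def inner_real_def
    by (intro lebesgue_sum l2_mult_integrable(1)[OF l2_component[OF lg]] l\<psi>)
  \<comment> \<open>Only t H is square integrable on balls. The component of \<psi> has compact
    support in the open half space, so t is bounded below there and 1 / t can be given to
    \<psi>.\<close>
  have i3: "integrable lborel (%x. (\<eta> R x *R H x) \<bullet> \<psi> x)"
    unfolding inner_vec_def inner_real_def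
  proof (intro lebesgue_sum)
    fix \<beta> :: 'm
    let ?K = "closure {x. \<psi> x $ \<beta> ~= 0}"
    have K: "compact ?K" "?K <= {x. 0 < x \<bullet> \<nu> - a}" using \<psi>[of \<beta>] by (auto simp: test_fun_def)
    obtain \<epsilon> where e: "\<epsilon> > 0" "!!x. x \<in> ?K ==> \<epsilon> <= t x"
    proof (cases "?K = {}")
      case False
      have "continuous_on ?K t" unfolding t_def by (intro continuous_intros)
      from continuous_attains_inf[OF K(1) False this] obtain y where "y \<in> ?K" "\<forall>x\<in>?K. t y <= t x" by blast
      then show ?thesis using that[of "t y"] K(2) by (auto simp: t_def)
    qed (use that[of 1] in auto)
    have tx: "\<epsilon> <= t x" if "\<psi> x $ \<beta> ~= 0" for x by (rule e(2)) (use closure_subset[of "{x. \<psi> x $ \<beta> ~= 0}"] that in auto)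
    have l1: "l2 (%x. \<psi> x $ \<beta> / t x)"
    proof (rule l2_cmp(1)[OF l\<psi>[of \<beta>], where C="1 / \<epsilon>"])
      have [measurable]: "bm (%x. \<psi> x $ \<beta>)" using l\<psi>[of \<beta>] by auto
      show "bm (%x. \<psi> x $ \<beta> / t x)" by measurable
      show "AE x in lborel. norm (\<psi> x $ \<beta> / t x) <= 1 / \<epsilon> * norm (\<psi> x $ \<beta>)"
      proof (intro AE_I2)
        fix x show "norm (\<psi> x $ \<beta> / t x) <= 1 / \<epsilon> * norm (\<psi> x $ \<beta>)"
        proof (cases "\<psi> x $ \<beta> = 0")
          case False
          from tx[OF this] e(1) show ?thesis by (auto simp: norm_divide intro!: divide_left_mono mult_pos_pos)
        qed simp
      qed
    qed (use e in auto)
    have l2: "l2 (%x. (\<eta> R x *R ((x \<bullet> \<nu> - a) *R H x)) $ \<beta>)"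
      by (rule l2_component[OF l2_gr(2)[OF R H]]) simp
    have "(\<eta> R x *R H x) $ \<beta> * \<psi> x $ \<beta> = (\<eta> R x *R ((x \<bullet> \<nu> - a) *R H x)) $ \<beta> * (\<psi> x $ \<beta> / t x)" for x
      using tx[of x] e(1) by (cases "\<psi> x $ \<beta> = 0") (auto simp: t_def)
    then show "integrable lborel (%x. (\<eta> R x *R H x) $ \<beta> * \<psi> x $ \<beta>)"
      using l2_mult_integrable(1)[OF l2 l1] by simp
  qed
  have "(LBINT x. (\<eta> R x *R Q x) \<bullet> gradv \<psi> x) + (LBINT x. (Q x *v grad (\<eta> R) x) \<bullet> \<psi> x)
    = (LBINT x. (\<eta> R x *R Q x) \<bullet> gradv \<psi> x + (Q x *v grad (\<eta> R) x) \<bullet> \<psi> x)"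
    by (rule Bochner_Integration.integral_add[OF i1 i2, symmetric])
  also have "... = (LBINT x. (\<eta> R x *R H x) \<bullet> \<psi> x)"
    using e1 unfolding pp by (simp add: inner_add_right inner_ou)
  finally have "(LBINT x. (\<eta> R x *R Q x) \<bullet> gradv \<psi> x)
    = (LBINT x. (\<eta> R x *R H x) \<bullet> \<psi> x) - (LBINT x. (Q x *v grad (\<eta> R) x) \<bullet> \<psi> x)" by simp
  also have "... = (LBINT x. (\<eta> R x *R H x) \<bullet> \<psi> x - (Q x *v grad (\<eta> R) x) \<bullet> \<psi> x)"
    by (rule Bochner_Integration.integral_diff[OF i3 i2, symmetric])
  finally show ?thesis unfolding hR_def Q_def by (simp add: inner_diff_left)
qed

lemma core_cut:
  assumes R: "R > 0" shows "core c0 s s1 s2 \<mu> \<Lambda> \<nu> a B (wR R) (WR R) (fR R) (hR R)"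
proof
  note l = H1D(1,2)[OF wWR[OF R]]
  show "bounded {x. wR R x ~= 0}"
    by (rule bounded_subset[OF bounded_cball[of x0 "2 * R"]]) (use supp(2)[OF R] in \<open>auto simp: wR_def\<close>)
  show "wR R y = 0" "WR R y = 0" if "y \<bullet> \<nu> - a <= 0" for y using zero(1,2)[OF that] by (simp_all add: wR_def WR_def)
  show "l2 (%x. (x \<bullet> \<nu> - a) *R hR R x)" using hR_l2(1)[OF R] by (simp add: t_def)
  fix v :: "real^'d => real^'m" and V assume hv: "H1 v V" and bd: "bounded {x. v x ~= 0}"
    and v0: "!!x. x \<bullet> \<nu> - a <= 0 ==> v x = 0" and V0: "!!x. x \<bullet> \<nu> - a <= 0 ==> V x = 0"
  define P where "P x = \<eta> R x *R (B x (\<Gamma> x) + F x)" for x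
  have Pl: "l2 P" unfolding P_def[abs_def] by (rule l2_gr(2)[OF R Ql]) simp
  have e: "(LBINT x. P x \<bullet> V x) = (LBINT x. hR R x \<bullet> v x)"
  proof (rule weak_form_boundary[OF Pl hR_l2(2)[OF R] _ nu hv bd v0 V0])
    show "l2 (%x. (x \<bullet> \<nu> - a) *R hR R x)" using hR_l2(1)[OF R] by (simp add: t_def)
  qed (simp_all only: P_def cut_equation[OF R])
  have Bl: "l2 (%x. B x (WR R x))"
    by (rule l2_cmp(1)[OF l(2), where C=\<Lambda>]) (use bnd Lam l in auto)
  have "P x = B x (WR R x) + fR R x" for x
    by (simp add: P_def WR_def fR_def linear_add[OF lin] linear_scale[OF lin] scaleR_add_right)
  then have "(LBINT x. P x \<bullet> V x) = (LBINT x. B x (WR R x) \<bullet> V x) + (LBINT x. fR R x \<bullet> V x)"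
    using l2_inner(1)[OF Bl H1D(2)[OF hv]] l2_inner(1)[OF fR_l2[OF R] H1D(2)[OF hv]] by (simp add: inner_add_left)
  then show "(LBINT x. B x (WR R x) \<bullet> V x) = - (LBINT x. fR R x \<bullet> V x) + (LBINT x. hR R x \<bullet> v x)"
    using e by simp
qed (use mu Lam c0 s_dn s_der s1_dn s1_der s_0 s_1 s_nn s_le s1_le s2_le s1_0 s2_0 s2_dn nu coer bnd linear_add[OF lin] linear_scale[OF lin] Bmeas
    wWR[OF R] fR_l2[OF R] hR_l2[OF R] in auto)

end

section \<open>The error of the cut-off and its limit\<close>

definition bnn :: "'a::euclidean_space => real => ('a => 'b::euclidean_space) => ennreal" where
  "bnn x0 R g = (NNI x. indicator (ball x0 R) x * ennreal ((norm (g x))^2))"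

context half_problem
begin

text \<open>Moving along the normal towards the boundary does not increase the distance to the
  boundary point \<open>x0\<close>, so balls around it satisfy the geometric hypothesis of Hardy's
  inequality.\<close>

lemma hardy_ball:
  assumes R: "R > 0"
  shows "bnn x0 R (%x. (1 / t x) *R U x) <= 4 * bnn x0 R \<Gamma>"
proof -
  define S where "S = ball x0 R"
  have S[measurable]: "S \<in> sets borel" by (simp add: S_def)
  have w0: "wR R x = 0" "WR R x = 0" if "x \<bullet> \<nu> - a <= 0" for x using zero(1,2)[OF that] by (simp_all add: wR_def WR_def)
  have star: "x - \<sigma> *R \<nu> \<in> S" if "x \<in> S" "0 <= \<sigma>" "\<sigma> <= x \<bullet> \<nu> - a" for x \<sigma>
  proof -
    have tx: "(x - x0) \<bullet> \<nu> = x \<bullet> \<nu> - a" using x0 by (simp add: inner_diff_left)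
    have "(norm (x - \<sigma> *R \<nu> - x0))^2 = (norm (x - x0))^2 - \<sigma> * (2 * ((x - x0) \<bullet> \<nu>) - \<sigma>)"
    proof -
      have "x - \<sigma> *R \<nu> - x0 = (x - x0) - \<sigma> *R \<nu>" by simp
      then show ?thesis using nu
        by (simp add: power2_norm_eq_inner inner_diff_left inner_diff_right inner_commute norm_eq_1 algebra_simps)
    qed
    moreover have "0 <= \<sigma> * (2 * ((x - x0) \<bullet> \<nu>) - \<sigma>)" using that(2,3) unfolding tx by (intro mult_nonneg_nonneg) auto
    ultimately have "(norm (x - \<sigma> *R \<nu> - x0))^2 <= (norm (x - x0))^2" by linarith
    then have "norm (x - \<sigma> *R \<nu> - x0) <= norm (x - x0)" by (rule power2_le_imp_le) simp
    then show ?thesis using that(1) by (simp add: S_def dist_norm norm_minus_commute)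
  qed
  have tb: "x \<bullet> \<nu> - a <= R" if "x \<in> S" for x
    using t_le[of x] that by (simp add: t_def S_def dist_norm norm_minus_commute)
  have h: "l2 (rs S (%x. (1 / (x \<bullet> \<nu> - a)) *R wR R x))" "nS S (%x. (1 / (x \<bullet> \<nu> - a)) *R wR R x) <= 2 * nS S (WR R)"
    by (rule hardy[OF wWR[OF R] nu S w0 tb R star]; assumption)+
  have c: "wR R x = U x" "WR R x = \<Gamma> x" if "x \<in> S" for x
    using \<eta>_1[OF R, of x] that by (auto simp: wR_def WR_def S_def dist_norm norm_minus_commute vec_eq_iff)
  have "(NNI x. indicator S x * ennreal ((norm ((1 / t x) *R U x))^2))
    = (NNI x. indicator S x * ennreal ((norm ((1 / (x \<bullet> \<nu> - a)) *R wR R x))^2))"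
    by (intro nn_integral_cong) (auto simp: indicator_def t_def c)
  also have "... = ennreal ((nS S (%x. (1 / (x \<bullet> \<nu> - a)) *R wR R x))^2)" by (rule nS_power2_nn[OF h(1) S])
  also have "... <= ennreal (4 * (nS S (WR R))^2)"
    using power_mono[OF h(2) nS_nonneg, of 2] by (intro ennreal_leI) (simp add: power_mult_distrib)
  also have "... = 4 * ennreal ((nS S (WR R))^2)" by (simp add: ennreal_mult)
  also have "ennreal ((nS S (WR R))^2) = (NNI x. indicator S x * ennreal ((norm (WR R x))^2))"
    by (rule nS_power2_nn[OF rs_l2[OF H1D(2)[OF wWR[OF R]] S] S, symmetric])
  also have "... = (NNI x. indicator S x * ennreal ((norm (\<Gamma> x))^2))"
    by (intro nn_integral_cong) (auto simp: indicator_def c)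
  finally show ?thesis unfolding S_def bnn_def .
qed

text \<open>Let k be t times the length of the gradient of \<eta>. The terms with \<open>F\<close>
  are absorbed by k <= 8 c0, with 192 = 3 * 64. The terms with U / t and \<Gamma> carry k^2
  t^\<alpha>, which is at most (4 c0 / R)^2 (2 R)^(2 + \<alpha>) because 2 + \<alpha> > 0; this is
  of order R^\<alpha>, the rate of the growth hypothesis.\<close>

lemma cut_error_pointwise:
  assumes R: "R > 0" and \<alpha>: "-1 < \<alpha>" "\<alpha> < 0" and tx: "0 < t x"
  shows "((norm (fR R x))^2 + (t x * norm (hR R x))^2) * t x powr \<alpha>
    <= (3 + 192 * c0^2) * (((norm (F x))^2 + (t x * norm (H x))^2) * t x powr \<alpha>)
     + 192 * \<Lambda>^2 * c0^2 * (2 * R) powr \<alpha> * (indicator (ball x0 (2 * R)) x * ((norm ((1 / t x) *R U x))^2 + (norm (\<Gamma> x))^2))"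
proof -
  define g where "g = norm (grad (\<eta> R) x)"
  define p where "p = norm (F x)"
  define q where "q = t x * norm (H x)"
  define y where "y = norm ((1 / t x) *R U x)"
  define z where "z = norm (\<Gamma> x)"
  define k where "k = t x * g"
  have pos: "0 <= g" "0 <= p" "0 <= q" "0 <= y" "0 <= z" "0 <= k" using tx by (auto simp: g_def p_def q_def y_def z_def k_def)
  have k8: "k <= 8 * c0" using t_gr_le[OF R, of x] tx by (simp add: k_def g_def)
  have fb: "norm (fR R x) <= p + \<Lambda> * k * y"
  proof -
    have "norm (\<eta> R x *R F x) <= p" using \<eta>01[of R x] by (simp add: p_def mult_left_le_one_le)
    moreover have "norm (B x (outer (U x) (grad (\<eta> R) x))) <= \<Lambda> * (norm (U x) * g)"
      using bnd[of x "outer (U x) (grad (\<eta> R) x)"] by (simp add: norm_ou g_def)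
    moreover have "norm (U x) * g = k * y" using tx by (simp add: k_def y_def)
    ultimately show ?thesis unfolding fR_def
      using norm_triangle_ineq4[of "\<eta> R x *R F x" "B x (outer (U x) (grad (\<eta> R) x))"] by (simp add: mult.assoc)
  qed
  have hb: "t x * norm (hR R x) <= q + k * p + \<Lambda> * k * z"
  proof -
    have "norm (\<eta> R x *R H x) <= norm (H x)" using \<eta>01[of R x] by (simp add: mult_left_le_one_le)
    moreover have "norm ((B x (\<Gamma> x) + F x) *v grad (\<eta> R) x) <= (\<Lambda> * z + p) * g"
    proof -
      have "norm ((B x (\<Gamma> x) + F x) *v grad (\<eta> R) x) <= norm (B x (\<Gamma> x) + F x) * g" unfolding g_def by (rule norm_mv_le)
      also have "... <= (\<Lambda> * z + p) * g"
        using norm_triangle_ineq[of "B x (\<Gamma> x)" "F x"] bnd[of x "\<Gamma> x"] pos unfolding z_def p_def by (intro mult_right_mono) auto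
      finally show ?thesis .
    qed
    ultimately have "norm (hR R x) <= norm (H x) + (\<Lambda> * z + p) * g" unfolding hR_def
      using norm_triangle_ineq4[of "\<eta> R x *R H x" "(B x (\<Gamma> x) + F x) *v grad (\<eta> R) x"] by linarith
    then have "t x * norm (hR R x) <= t x * (norm (H x) + (\<Lambda> * z + p) * g)" using tx by (intro mult_left_mono) auto
    then show ?thesis by (simp add: q_def k_def algebra_simps)
  qed
  have two: "(u + v)^2 <= 2 * u^2 + 2 * v^2" for u v :: real using sum_squares_bound[of u v] by (simp add: power2_sum)
  have three: "(u + v + w)^2 <= 3 * u^2 + 3 * v^2 + 3 * w^2" for u v w :: real
    using sum_squares_bound[of u v] sum_squares_bound[of u w] sum_squares_bound[of v w] by (simp add: power2_sum algebra_simps)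
  have "(norm (fR R x))^2 <= (p + \<Lambda> * k * y)^2" using fb by (intro power_mono) auto
  also have "... <= 2 * p^2 + 2 * (\<Lambda> * k * y)^2" by (rule two)
  finally have f2: "(norm (fR R x))^2 <= 2 * p^2 + 2 * (\<Lambda> * k * y)^2" .
  have "(t x * norm (hR R x))^2 <= (q + k * p + \<Lambda> * k * z)^2" using hb tx by (intro power_mono) auto
  also have "... <= 3 * q^2 + 3 * (k * p)^2 + 3 * (\<Lambda> * k * z)^2" by (rule three)
  finally have h2: "(t x * norm (hR R x))^2 <= 3 * q^2 + 3 * (k * p)^2 + 3 * (\<Lambda> * k * z)^2" .
  have "k^2 <= (8 * c0)^2" using k8 pos by (intro power_mono) auto
  then have "k^2 * p^2 <= (64 * c0^2) * p^2" by (intro mult_right_mono) (auto simp: power_mult_distrib)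
  then have "3 * (k * p)^2 <= 192 * c0^2 * p^2" by (simp add: power_mult_distrib)
  then have "(norm (fR R x))^2 + (t x * norm (hR R x))^2 <= (2 + 192 * c0^2) * p^2 + 3 * q^2 + (2 * (\<Lambda> * k * y)^2 + 3 * (\<Lambda> * k * z)^2)"
    using f2 h2 by (simp add: algebra_simps)
  also have "... <= (3 + 192 * c0^2) * (p^2 + q^2) + 3 * \<Lambda>^2 * k^2 * (y^2 + z^2)"
  proof -
    have "0 <= 192 * c0^2 * q^2" "0 <= (\<Lambda> * k * y)^2" "0 <= p^2" by auto
    then show ?thesis by (simp add: algebra_simps power_mult_distrib)
  qed
  finally have main: "(norm (fR R x))^2 + (t x * norm (hR R x))^2 <= (3 + 192 * c0^2) * (p^2 + q^2) + 3 * \<Lambda>^2 * k^2 * (y^2 + z^2)" .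
  have kt: "k^2 * t x powr \<alpha> <= 64 * c0^2 * (2 * R) powr \<alpha> * indicator (ball x0 (2 * R)) x"
  proof (cases "x \<in> ball x0 (2 * R)")
    case True
    have t2: "t x <= 2 * R" using t_le[of x] True by (simp add: dist_norm norm_minus_commute)
    have "g^2 <= (4 * c0 / R)^2" using grad_\<eta>_le[OF R, of x] pos unfolding g_def by (intro power_mono) auto
    moreover have "t x powr (2 + \<alpha>) <= (2 * R) powr (2 + \<alpha>)" using t2 tx \<alpha> by (intro powr_mono2) auto
    ultimately have "g^2 * t x powr (2 + \<alpha>) <= (4 * c0 / R)^2 * (2 * R) powr (2 + \<alpha>)" by (intro mult_mono) auto
    also have "... = 64 * c0^2 * (2 * R) powr \<alpha>" using R by (simp add: powr_add power_divide power_mult_distrib)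
    finally have "g^2 * t x powr (2 + \<alpha>) <= 64 * c0^2 * (2 * R) powr \<alpha>" .
    moreover have "k^2 * t x powr \<alpha> = g^2 * t x powr (2 + \<alpha>)" using tx by (simp add: k_def powr_add power_mult_distrib)
    ultimately show ?thesis using True by simp
  next
    case False
    then have "grad (\<eta> R) x = 0" using \<eta>_0(2)[OF R, of x] by (simp add: dist_norm norm_minus_commute)
    then show ?thesis using False by (simp add: k_def g_def)
  qed
  have "((norm (fR R x))^2 + (t x * norm (hR R x))^2) * t x powr \<alpha>
    <= ((3 + 192 * c0^2) * (p^2 + q^2) + 3 * \<Lambda>^2 * k^2 * (y^2 + z^2)) * t x powr \<alpha>"
    by (intro mult_right_mono main) simp
  also have "... = (3 + 192 * c0^2) * ((p^2 + q^2) * t x powr \<alpha>) + 3 * \<Lambda>^2 * (y^2 + z^2) * (k^2 * t x powr \<alpha>)"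
    by (simp add: algebra_simps)
  also have "... <= (3 + 192 * c0^2) * ((p^2 + q^2) * t x powr \<alpha>) + 3 * \<Lambda>^2 * (y^2 + z^2) * (64 * c0^2 * (2 * R) powr \<alpha> * indicator (ball x0 (2 * R)) x)"
    by (intro add_left_mono mult_left_mono kt) auto
  finally show ?thesis unfolding p_def q_def y_def z_def by (simp add: mult_ac)
qed

text \<open>960 = 192 * 5: Hardy's inequality bounds the term with U / t by 4 times the energy of
  \<Gamma>, and the term with \<Gamma> adds that energy once more.\<close>

lemma cut_error:
  assumes R: "R > 0" and \<alpha>: "-1 < \<alpha>" "\<alpha> < 0"
  shows "wnn \<nu> a \<alpha> (fR R) + wnn \<nu> a (\<alpha> + 2) (hR R) <= ennreal (3 + 192 * c0^2) * (wnn \<nu> a \<alpha> F + wnn \<nu> a (\<alpha> + 2) H)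
     + ennreal (960 * \<Lambda>^2 * c0^2) * (ennreal ((2 * R) powr \<alpha>) * bnn x0 (2 * R) \<Gamma>)"
proof -
  let ?D = "192 * \<Lambda>^2 * c0^2 * (2 * R) powr \<alpha>"
  let ?G = "bnn x0 (2 * R) \<Gamma>"
  define X where "X x = ((norm (F x))^2 + (t x * norm (H x))^2) * t x powr \<alpha>" for x
  define Y where "Y x = (norm ((1 / t x) *R U x))^2 + (norm (\<Gamma> x))^2" for x
  have [measurable]: "bm X" "bm Y" unfolding X_def[abs_def] Y_def[abs_def] by measurable
  have [measurable]: "ball x0 (2 * R) \<in> sets borel" by simp
  have pos: "0 <= X x" "0 <= Y x" for x by (auto simp: X_def Y_def)
  have "(NNI x. indicator {0<..} (t x) * ennreal (((norm (fR R x))^2 + (t x * norm (hR R x))^2) * t x powr \<alpha>))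
    <= (NNI x. ennreal (3 + 192 * c0^2) * (indicator {0<..} (t x) * ennreal (X x)) + ennreal ?D * (indicator (ball x0 (2 * R)) x * ennreal (Y x)))"
  proof (intro nn_integral_mono)
    fix x
    show "indicator {0<..} (t x) * ennreal (((norm (fR R x))^2 + (t x * norm (hR R x))^2) * t x powr \<alpha>)
      <= ennreal (3 + 192 * c0^2) * (indicator {0<..} (t x) * ennreal (X x)) + ennreal ?D * (indicator (ball x0 (2 * R)) x * ennreal (Y x))"
    proof (cases "0 < t x")
      case True
      have "ennreal (((norm (fR R x))^2 + (t x * norm (hR R x))^2) * t x powr \<alpha>)
        <= ennreal ((3 + 192 * c0^2) * X x + ?D * (indicator (ball x0 (2 * R)) x * Y x))"
        unfolding X_def Y_def by (intro ennreal_leI cut_error_pointwise R \<alpha> True)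
      also have "... = ennreal ((3 + 192 * c0^2) * X x) + ennreal (?D * (indicator (ball x0 (2 * R)) x * Y x))"
        using pos by (intro ennreal_plus) auto
      also have "ennreal ((3 + 192 * c0^2) * X x) = ennreal (3 + 192 * c0^2) * ennreal (X x)" by (rule ennreal_mult) (use pos in auto)
      also have "ennreal (?D * (indicator (ball x0 (2 * R)) x * Y x)) = ennreal ?D * (indicator (ball x0 (2 * R)) x * ennreal (Y x))"
        by (subst ennreal_mult) (use pos in \<open>auto simp: indicator_def\<close>)
      finally show ?thesis using True by simp
    qed simp
  qed
  also have "... = ennreal (3 + 192 * c0^2) * (NNI x. indicator {0<..} (t x) * ennreal (X x))
    + ennreal ?D * (NNI x. indicator (ball x0 (2 * R)) x * ennreal (Y x))"
  proof -
    have m: "(%x. indicator {0<..} (t x) * ennreal (X x)) \<in> borel_measurable lborel"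
      "(%x. indicator (ball x0 (2 * R)) x * ennreal (Y x)) \<in> borel_measurable lborel" by measurable
    show ?thesis
      unfolding nn_integral_cmult[OF m(1), symmetric] nn_integral_cmult[OF m(2), symmetric]
      by (rule nn_integral_add) (use m in measurable)
  qed
  also have "... <= ennreal (3 + 192 * c0^2) * (NNI x. indicator {0<..} (t x) * ennreal (X x)) + ennreal ?D * (ennreal 5 * ?G)"
  proof (intro add_left_mono mult_left_mono)
    have "(NNI x. indicator (ball x0 (2 * R)) x * ennreal (Y x))
      = (NNI x. indicator (ball x0 (2 * R)) x * ennreal ((norm ((1 / t x) *R U x))^2) + indicator (ball x0 (2 * R)) x * ennreal ((norm (\<Gamma> x))^2))"
      by (intro nn_integral_cong) (auto simp: indicator_def Y_def)
    also have "... = bnn x0 (2 * R) (%x. (1 / t x) *R U x) + ?G"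
      unfolding bnn_def by (rule nn_integral_add) measurable
    also have "... <= 4 * ?G + ?G" using hardy_ball[of "2 * R"] R by (intro add_right_mono) simp
    also have "... = ennreal 5 * ?G" using distrib_right[of 4 1 ?G] by simp
    finally show "(NNI x. indicator (ball x0 (2 * R)) x * ennreal (Y x)) <= ennreal 5 * ?G" .
  qed simp
  also have "ennreal ?D * (ennreal 5 * ?G) = ennreal (960 * \<Lambda>^2 * c0^2) * (ennreal ((2 * R) powr \<alpha>) * ?G)"
  proof -
    have "ennreal ?D * ennreal 5 = ennreal (?D * 5)" by (rule ennreal_mult[symmetric]) auto
    also have "?D * 5 = 960 * \<Lambda>^2 * c0^2 * (2 * R) powr \<alpha>" by simp
    also have "ennreal ... = ennreal (960 * \<Lambda>^2 * c0^2) * ennreal ((2 * R) powr \<alpha>)" by (rule ennreal_mult) auto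
    finally show ?thesis by (simp only: mult.assoc[symmetric])
  qed
  finally show ?thesis unfolding X_def wnn_add[OF meas(3,4)] wnn_add[OF l2_measurable[OF fR_l2[OF R]] hR_l2(2)[OF R]] t_def .
qed

text \<open>On a fixed ball the cut gradient equals \<Gamma> as soon as R exceeds the radius, and
  the error term tends to 0 by the growth hypothesis; the balls then exhaust the space.\<close>

lemma limit_estimate:
  assumes \<alpha>: "-1 < \<alpha>" "\<alpha> < 0" and C: "0 <= C"
    and est: "!!R. R > 0 ==> wnn \<nu> a \<alpha> (WR R) <= ennreal C * (wnn \<nu> a \<alpha> (fR R) + wnn \<nu> a (\<alpha> + 2) (hR R))"
    and growth: "((%R. ennreal (R powr \<alpha>) * bnn x0 R \<Gamma>) \<longlongrightarrow> 0) at_top"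
  shows "wnn \<nu> a \<alpha> \<Gamma> <= ennreal (C * (3 + 192 * c0^2)) * (wnn \<nu> a \<alpha> F + wnn \<nu> a (\<alpha> + 2) H)"
proof -
  define \<R> where "\<R> = wnn \<nu> a \<alpha> F + wnn \<nu> a (\<alpha> + 2) H"
  define \<Phi> where "\<Phi> R = ennreal (R powr \<alpha>) * bnn x0 R \<Gamma>" for R
  define g where "g x = indicator {0<..} (t x) * ennreal ((norm (\<Gamma> x))^2 * t x powr \<alpha>)" for x
  have [measurable]: "bm g" unfolding g_def[abs_def] by measurable
  let ?b = "%R. ennreal C * (ennreal (3 + 192 * c0^2) * \<R> + ennreal (960 * \<Lambda>^2 * c0^2) * \<Phi> (2 * R))"
  have le: "(NNI x. indicator (ball x0 R0) x * g x) <= ?b R" if "0 < R" "R0 <= R" for R R0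
  proof -
    have "(NNI x. indicator (ball x0 R0) x * g x) <= wnn \<nu> a \<alpha> (WR R)"
      unfolding wnn_def t_def[symmetric]
    proof (intro nn_integral_mono)
      fix x
      show "indicator (ball x0 R0) x * g x <= indicator {0<..} (t x) * ennreal ((norm (WR R x))^2 * t x powr \<alpha>)"
      proof (cases "x \<in> ball x0 R0")
        case True
        then have "norm (x - x0) <= R" using that by (simp add: dist_norm norm_minus_commute)
        then have "WR R x = \<Gamma> x" using \<eta>_1[OF that(1), of x] by (simp add: WR_def vec_eq_iff)
        then show ?thesis by (simp add: g_def indicator_def)
      qed simp
    qed
    also have "... <= ?b R"
      unfolding \<R>_def \<Phi>_def by (rule order_trans[OF est[OF that(1)]]) (intro mult_left_mono cut_error[OF that(1) \<alpha>], simp)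
    finally show ?thesis .
  qed
  have lim: "(?b \<longlongrightarrow> ennreal C * (ennreal (3 + 192 * c0^2) * \<R> + ennreal (960 * \<Lambda>^2 * c0^2) * 0)) at_top"
  proof (intro ennreal_tendsto_cmult tendsto_add tendsto_const)
    have "filterlim (%R. 2 * R) at_top (at_top :: real filter)" by real_asymp
    from filterlim_compose[OF growth[folded \<Phi>_def] this] show "((%R. \<Phi> (2 * R)) \<longlongrightarrow> 0) at_top" .
  qed simp_all
  have ball: "(NNI x. indicator (ball x0 R0) x * g x) <= ennreal C * (ennreal (3 + 192 * c0^2) * \<R>)" for R0
  proof -
    have "\<forall>\<^sub>F R in at_top. (NNI x. indicator (ball x0 R0) x * g x) <= ?b R"
      using eventually_ge_at_top[of "max 1 R0"] by eventually_elim (rule le, auto)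
    from tendsto_lowerbound[OF lim this] show ?thesis by simp
  qed
  have "(NNI x. g x) = (NNI x. (SUP k. indicator (ball x0 (real k)) x * g x))"
  proof (intro nn_integral_cong)
    fix x
    obtain k where "dist x0 x < real k" using reals_Archimedean2 by blast
    then have "g x <= (SUP k. indicator (ball x0 (real k)) x * g x)" by (intro SUP_upper2[of k]) auto
    moreover have "(SUP k. indicator (ball x0 (real k)) x * g x) <= g x" by (intro SUP_least) (auto simp: indicator_def)
    ultimately show "g x = (SUP k. indicator (ball x0 (real k)) x * g x)" by (rule antisym)
  qed
  also have "... = (SUP k. (NNI x. indicator (ball x0 (real k)) x * g x))"
  proof (rule nn_integral_monotone_convergence_SUP)
    show "incseq (%k x. indicator (ball x0 (real k)) x * g x)"
      by (intro incseq_SucI le_funI mult_right_mono) (auto simp: indicator_def)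
    have [measurable]: "ball x0 (real k) \<in> sets borel" for k by simp
    show "(%x. indicator (ball x0 (real k)) x * g x) \<in> borel_measurable lborel" for k by measurable
  qed
  also have "... <= ennreal C * (ennreal (3 + 192 * c0^2) * \<R>)" by (intro SUP_least ball)
  also have "... = ennreal (C * (3 + 192 * c0^2)) * \<R>" by (subst ennreal_mult) (use C in \<open>auto simp: mult.assoc\<close>)
  finally show ?thesis unfolding g_def \<R>_def wnn_def[of _ _ _ \<Gamma>] t_def .
qed

end

lemma half_space_estimate:
  fixes \<mu> \<Lambda> \<alpha> \<sigma> K :: real
  assumes mu: "0 < \<mu>" and Lam: "0 <= \<Lambda>" and step: "smooth_step c0 s s1 s2" and \<alpha>: "-1 < \<alpha>" "\<alpha> < 0"
    and \<sigma>: "0 < \<sigma>" and K: "0 <= K"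
  shows "EX C>0. ALL (\<nu>::real^'d::finite) x0 a (B::real^'d => real^'d^'m::finite => real^'d^'m) U \<Gamma> F H.
    half_problem c0 s s1 s2 \<mu> \<Lambda> \<nu> x0 a B U \<Gamma> F H & regular_periodic K \<sigma> B &
    ((%R. ennreal (R powr \<alpha>) * bnn x0 R \<Gamma>) \<longlongrightarrow> 0) at_top -->
    wnn \<nu> a \<alpha> \<Gamma> <= ennreal C * (wnn \<nu> a \<alpha> F + wnn \<nu> a (\<alpha> + 2) H)"
proof (rule exE[OF core_estimate[OF mu Lam step \<alpha> \<sigma> K, where 'd='d and 'm='m]], elim conjE)
  fix C assume C: "0 < C" and est: "ALL (\<nu>::real^'d) a (B::real^'d => real^'d^'m => real^'d^'m) w W f h.
    core c0 s s1 s2 \<mu> \<Lambda> \<nu> a B w W f h & regular_periodic K \<sigma> B &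
    (ALL x. x \<bullet> \<nu> - a <= 0 --> f x = 0 & h x = 0) -->
    wnn \<nu> a \<alpha> W <= ennreal C * (wnn \<nu> a \<alpha> f + wnn \<nu> a (\<alpha> + 2) h)"
  have pos: "0 < C * (3 + 192 * c0^2)" using C by (intro mult_pos_pos add_pos_nonneg) auto
  show ?thesis
  proof (rule exI, rule conjI[OF pos], intro allI impI, elim conjE)
    fix \<nu> x0 :: "real^'d" and a and B :: "real^'d => real^'d^'m => real^'d^'m" and U \<Gamma> F H
    assume "half_problem c0 s s1 s2 \<mu> \<Lambda> \<nu> x0 a B U \<Gamma> F H"
    then interpret half_problem c0 s s1 s2 \<mu> \<Lambda> \<nu> x0 a B U \<Gamma> F H .
    assume reg: "regular_periodic K \<sigma> B" and growth: "((%R. ennreal (R powr \<alpha>) * bnn x0 R \<Gamma>) \<longlongrightarrow> 0) at_top"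
    have z: "ALL x. x \<bullet> \<nu> - a <= 0 --> fR R x = 0 & hR R x = 0" for R
      using zero by (auto simp: fR_def hR_def linear_0[OF lin])
    show "wnn \<nu> a \<alpha> \<Gamma> <= ennreal (C * (3 + 192 * c0^2)) * (wnn \<nu> a \<alpha> F + wnn \<nu> a (\<alpha> + 2) H)"
    proof (rule limit_estimate[OF \<alpha> less_imp_le[OF C] _ growth])
      fix R :: real assume R: "0 < R"
      show "wnn \<nu> a \<alpha> (WR R) <= ennreal C * (wnn \<nu> a \<alpha> (fR R) + wnn \<nu> a (\<alpha> + 2) (hR R))"
        by (rule est[THEN spec[where x=\<nu>], THEN spec[where x=a], THEN spec[where x=B], THEN spec[where x="wR R"],
            THEN spec[where x="WR R"], THEN spec[where x="fR R"], THEN spec[where x="hR R"], THEN mp])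
           (intro conjI core_cut[OF R] reg z)
    qed
  qed
qed

section \<open>Weak solutions\<close>

text \<open>The flux A \<nabla>u at one point, with the solution index first and the space index
  second, as in the gradients.\<close>

definition tens :: "('d => 'd => 'm => 'm => real) => real^'d::finite^'m::finite => real^'d^'m" where
  "tens c \<Xi> = (\<chi> \<alpha> i. \<Sum>j\<in>UNIV. \<Sum>\<beta>\<in>UNIV. c i j \<alpha> \<beta> * \<Xi> $ \<beta> $ j)"

lemma tens_inner:
  "tens c \<Xi> \<bullet> \<Psi> = (\<Sum>i\<in>UNIV. \<Sum>j\<in>UNIV. \<Sum>\<alpha>\<in>UNIV. \<Sum>\<beta>\<in>UNIV. c i j \<alpha> \<beta> * \<Xi> $ \<beta> $ j * \<Psi> $ \<alpha> $ i)"
proof -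
  have "tens c \<Xi> \<bullet> \<Psi> = (\<Sum>\<alpha>\<in>UNIV. \<Sum>i\<in>UNIV. \<Sum>j\<in>UNIV. \<Sum>\<beta>\<in>UNIV. c i j \<alpha> \<beta> * \<Xi> $ \<beta> $ j * \<Psi> $ \<alpha> $ i)"
    by (simp add: inner_matrix tens_def sum_distrib_right)
  also have "... = (\<Sum>i\<in>UNIV. \<Sum>\<alpha>\<in>UNIV. \<Sum>j\<in>UNIV. \<Sum>\<beta>\<in>UNIV. c i j \<alpha> \<beta> * \<Xi> $ \<beta> $ j * \<Psi> $ \<alpha> $ i)"
    by (rule sum.swap)
  also have "... = (\<Sum>i\<in>UNIV. \<Sum>j\<in>UNIV. \<Sum>\<alpha>\<in>UNIV. \<Sum>\<beta>\<in>UNIV. c i j \<alpha> \<beta> * \<Xi> $ \<beta> $ j * \<Psi> $ \<alpha> $ i)"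
    by (intro sum.cong refl sum.swap)
  finally show ?thesis .
qed

lemma linear_tens: "linear (tens c)"
  by (rule linearI) (simp_all add: tens_def vec_eq_iff algebra_simps sum.distrib sum_distrib_left)

lemma tens_diff: "tens c \<Xi> - tens c' \<Xi> = tens (%i j \<alpha> \<beta>. c i j \<alpha> \<beta> - c' i j \<alpha> \<beta>) \<Xi>"
  by (simp add: tens_def vec_eq_iff algebra_simps sum_subtractf)

text \<open>Crude but explicit: every entry is a sum of d m terms, and the norm is bounded by the
  sum over the d m entries.\<close>

lemma norm_tens_le:
  fixes \<Xi> :: "real^'d::finite^'m::finite"
  assumes c: "!!i j \<alpha> \<beta>. \<bar>c i j \<alpha> \<beta>\<bar> <= k"
  shows "norm (tens c \<Xi>) <= k * (real CARD('d) * real CARD('m))^2 * norm \<Xi>"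
proof -
  have k: "0 <= k" using c[of undefined undefined undefined undefined] by linarith
  have entry: "\<bar>tens c \<Xi> $ \<alpha> $ i\<bar> <= real CARD('d) * (real CARD('m) * (k * norm \<Xi>))" for \<alpha> i
  proof -
    have "\<bar>tens c \<Xi> $ \<alpha> $ i\<bar> <= (\<Sum>j\<in>(UNIV::'d set). \<Sum>\<beta>\<in>(UNIV::'m set). k * norm \<Xi>)"
      unfolding tens_def vec_lambda_beta
      by (intro order_trans[OF sum_abs] sum_mono)
         (auto simp: abs_mult intro!: mult_mono c norm_matrix_entry_le k)
    then show ?thesis by simp
  qed
  have "norm (tens c \<Xi>) <= (\<Sum>\<alpha>\<in>UNIV. norm (tens c \<Xi> $ \<alpha>))" unfolding norm_vec_def by (rule L2_set_le_sum) simp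
  also have "... <= (\<Sum>\<alpha>\<in>(UNIV::'m set). \<Sum>i\<in>(UNIV::'d set). real CARD('d) * (real CARD('m) * (k * norm \<Xi>)))"
    by (intro sum_mono order_trans[OF norm_le_l1_cart] entry)
  also have "... = k * (real CARD('d) * real CARD('m))^2 * norm \<Xi>" by (simp add: power2_eq_square)
  finally show ?thesis .
qed

lemma borel_measurable_matrixI:
  fixes f :: "'a => real^'d::finite^'m::finite"
  assumes "!!\<alpha> i. (%x. f x $ \<alpha> $ i) \<in> borel_measurable M"
  shows "f \<in> borel_measurable M"
proof -
  have "(%x. f x \<bullet> b) \<in> borel_measurable M" if "b \<in> Basis" for b
    using that assms by (auto simp: Basis_vec_def inner_axis)
  then show ?thesis by (simp add: borel_measurable_euclidean_space[of f])
qed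

lemma tens_measurable:
  fixes A :: "'a => 'd::finite => 'd => 'm::finite => 'm => real"
  assumes [measurable]: "!!i j \<alpha> \<beta>. (%x. A x i j \<alpha> \<beta>) \<in> borel_measurable M" "V \<in> borel_measurable M"
  shows "(%x. tens (A x) (V x)) \<in> borel_measurable M"
  by (rule borel_measurable_matrixI) (simp add: tens_def)

lemma holder_continuous:
  fixes g :: "'a::metric_space => real"
  assumes \<sigma>: "0 < \<sigma>" and h: "!!x y. \<bar>g x - g y\<bar> <= k * dist x y powr \<sigma>"
  shows "continuous_on UNIV g"
proof (intro continuous_at_imp_continuous_on ballI)
  fix x :: 'a
  have "((%y. dist y x) \<longlongrightarrow> 0) (at x)" by (rule tendsto_dist_iff[THEN iffD1]) (rule tendsto_ident_at)
  then have "((%y. k * dist y x powr \<sigma>) \<longlongrightarrow> 0) (at x)"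
    by (intro tendsto_mult_right_zero tendsto_zero_powrI[OF _ tendsto_const _ \<sigma>]) auto
  from Lim_null_comparison[OF _ this, of "%y. g y - g x"] h[of _ x]
  have "((%y. g y - g x) \<longlongrightarrow> 0) (at x)" by auto
  then show "isCont g x" unfolding isCont_def by (rule LIM_zero_cancel)
qed

text \<open>Coordinates are replaced separately, and the result is multiplied by the indicator of
  \<open>S\<close>, so that it vanishes outside \<open>S\<close> at every point and not only almost
  everywhere.\<close>

lemma borel_version:
  fixes g :: "'a::euclidean_space => 'b::euclidean_space"
  assumes g: "g \<in> borel_measurable lebesgue" and S: "S \<in> sets borel" and 0: "!!x. x \<notin> S ==> g x = 0"
  obtains g' where "bm g'" "!!x. x \<notin> S ==> g' x = 0" "AE x in lborel. g x = g' x"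
proof -
  have "\<exists>p\<in>borel_measurable lborel. AE x in lborel. g x \<bullet> b = p x" for b
    by (rule completion_ex_borel_measurable_real) (use g in measurable)
  then obtain p where p: "!!b. p b \<in> borel_measurable lborel" "!!b. AE x in lborel. g x \<bullet> b = p b x" by metis
  have pm[measurable]: "bm (p b)" for b using p(1)[of b] by simp
  define g' where "g' x = indicator S x *R (\<Sum>b\<in>Basis. p b x *R b)" for x
  have "AE x in lborel. \<forall>b\<in>Basis. g x \<bullet> b = p b x" using p(2) by (intro AE_finite_allI) auto
  then have "AE x in lborel. g x = g' x"
  proof eventually_elim
    fix x assume *: "\<forall>b\<in>Basis. g x \<bullet> b = p b x"
    have "g x = (\<Sum>b\<in>Basis. p b x *R b)" using euclidean_representation[of "g x"] * by simp
    then show "g x = g' x" using 0[of x] by (cases "x \<in> S") (auto simp: g'_def)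
  qed
  moreover have "bm g'" unfolding g'_def[abs_def] using S by measurable
  ultimately show ?thesis using that[of g'] by (auto simp: g'_def)
qed

lemma lebesgue_integral_version:
  fixes f g :: "'a::euclidean_space => real"
  assumes g: "bm g" and ae: "AE x in lborel. f x = g x"
  shows "(\<integral>x. f x \<partial>lebesgue) = (LBINT x. g x)" "integrable lebesgue f ==> integrable lborel g"
proof -
  have gl: "g \<in> borel_measurable lborel" "g \<in> borel_measurable lebesgue" using g by (auto intro: measurable_completion)
  have ae': "AE x in lebesgue. g x = f x" "AE x in lebesgue. f x = g x" using ae by (auto simp: AE_completion_iff)
  have fm: "f \<in> borel_measurable lebesgue" by (rule borel_measurable_AE[OF gl(2) ae'(1)])
  show "(\<integral>x. f x \<partial>lebesgue) = (LBINT x. g x)"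
    using integral_cong_AE[OF fm gl(2) ae'(2)] integral_completion[OF gl(1)] by simp
  show "integrable lborel g" if "integrable lebesgue f"
    using integrable_cong_AE_imp[OF that gl(2) ae'(2)] integrable_completion[OF gl(1)] by simp
qed

lemma measurable_exhaustion:
  fixes g :: "'a::euclidean_space => 'b::euclidean_space"
  assumes "!!k. set_borel_measurable lebesgue (S k) g"
    and "!!x. \<forall>\<^sub>F k in sequentially. indicator (S k) x *R g x = g' x"
  shows "g' \<in> borel_measurable lebesgue"
proof (rule borel_measurable_LIMSEQ_metric)
  show "(%x. indicator (S k) x *R g x) \<in> borel_measurable lebesgue" for k
    using assms(1)[of k] by (simp add: set_borel_measurable_def)
  show "(%k. indicator (S k) x *R g x) \<longlonglongrightarrow> g' x" for x using assms(2)[of x] by (rule tendsto_eventually)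
qed

lemma L2loc_UNIV:
  fixes g g' :: "real^'d::finite => 'b::euclidean_space"
  assumes g: "L2loc UNIV g"
  shows "g \<in> borel_measurable lebesgue"
    "bm g' ==> AE x in lborel. g x = g' x ==> l2 (rs (cball x0 r) g')"
proof -
  show "g \<in> borel_measurable lebesgue"
  proof (rule measurable_exhaustion[where S="%k. cball 0 (real k)" and g=g])
    show "set_borel_measurable lebesgue (cball 0 (real k)) g" for k using g by (auto simp: L2loc_def)
    fix x :: "real^'d"
    obtain k where "norm x <= real k" using real_arch_simple by blast
    then show "\<forall>\<^sub>F k in sequentially. indicator (cball 0 (real k)) x *R g x = g x"
      by (intro eventually_sequentiallyI[of k]) auto
  qed
  assume [measurable]: "bm g'" and ae: "AE x in lborel. g x = g' x"
  have rm: "bm (rs (cball x0 r) g')" by (rule rs_measurable) auto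
  have i: "integrable lebesgue (%x. indicator (cball x0 r) x * (norm (g x))^2)"
    using g by (auto simp: L2loc_def set_integrable_def)
  have "integrable lborel (%x. (norm (rs (cball x0 r) g' x))\<^sup>2)"
  proof (rule lebesgue_integral_version(2)[OF _ _ i])
    show "bm (%x. (norm (rs (cball x0 r) g' x))\<^sup>2)" using rm by measurable
    show "AE x in lborel. indicator (cball x0 r) x * (norm (g x))^2 = (norm (rs (cball x0 r) g' x))^2"
      using ae by eventually_elim (auto simp: rs_def indicator_def)
  qed
  then show "l2 (rs (cball x0 r) g')" using rm by (simp add: l2_def)
qed

text \<open>Local integrability speaks of compact subsets of the open half space only; balls
  intersected with the heights t >= 1 / (k + 1) exhaust it.\<close>

lemma half_space_measurable:
  fixes g :: "real^'d::finite => 'b::euclidean_space"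
  assumes g: "L1loc {x. 0 < x \<bullet> \<nu> - a} g"
  shows "(%x. if 0 < x \<bullet> \<nu> - a then g x else 0) \<in> borel_measurable lebesgue"
proof (rule measurable_exhaustion[where S="%k. cball 0 (real k) \<inter> {x. 1 / real (Suc k) <= x \<bullet> \<nu> - a}" and g=g])
  fix k
  let ?K = "cball 0 (real k) \<inter> {x. 1 / real (Suc k) <= x \<bullet> \<nu> - a}"
  have "closed {x. 1 / real (Suc k) <= x \<bullet> \<nu> - a}" by (intro closed_Collect_le continuous_intros)
  then have "compact ?K" by (intro compact_Int_closed) auto
  moreover have "?K <= {x. 0 < x \<bullet> \<nu> - a}"
  proof
    fix x assume "x \<in> ?K"
    moreover have "0 < 1 / real (Suc k)" by simp
    ultimately show "x \<in> {x. 0 < x \<bullet> \<nu> - a}" by (simp only: Int_iff mem_Collect_eq) linarith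
  qed
  ultimately have "set_integrable lebesgue ?K g" using g unfolding L1loc_def by blast
  then show "set_borel_measurable lebesgue ?K g"
    unfolding set_integrable_def set_borel_measurable_def by (rule borel_measurable_integrable)
next
  fix x :: "real^'d"
  show "\<forall>\<^sub>F k in sequentially. indicator (cball 0 (real k) \<inter> {x. 1 / real (Suc k) <= x \<bullet> \<nu> - a}) x *R g x
    = (if 0 < x \<bullet> \<nu> - a then g x else 0)"
  proof (cases "0 < x \<bullet> \<nu> - a")
    case True
    have "\<forall>\<^sub>F k in sequentially. norm x <= real k" by real_asymp
    moreover have "(%k. 1 / real (Suc k)) \<longlonglongrightarrow> 0" by real_asymp
    from order_tendstoD(2)[OF this True] have "\<forall>\<^sub>F k in sequentially. 1 / real (Suc k) < x \<bullet> \<nu> - a" .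
    ultimately show ?thesis by eventually_elim (use True in auto)
  next
    case False
    have "~ 1 / real (Suc k) <= x \<bullet> \<nu> - a" for k
    proof -
      have "0 < 1 / real (Suc k)" by simp
      then show ?thesis using False by linarith
    qed
    then show ?thesis using False by (intro always_eventually allI) (simp add: indicator_def del: of_nat_Suc)
  qed
qed

text \<open>As \<alpha> < 0, the weight is bounded below where t <= b. A finite weighted norm
  therefore gives square integrability up to the boundary.\<close>

lemma l2_ball_of_weighted:
  fixes g :: "real^'d::finite => 'b::euclidean_space"
  assumes \<alpha>: "\<alpha> < 0" and \<nu>: "norm \<nu> = 1" and [measurable]: "bm g"
    and 0: "!!x. x \<bullet> \<nu> - a <= 0 ==> g x = 0"
    and fin: "wnn \<nu> a \<alpha> g < \<infinity>"
  shows "l2 (rs (cball x0 r) g)"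
proof -
  define b where "b = norm x0 + \<bar>r\<bar> + \<bar>a\<bar> + 1"
  have b: "b > 0" by (simp add: b_def add_nonneg_pos)
  have tb: "x \<bullet> \<nu> - a <= b" if "x \<in> cball x0 r" for x
  proof -
    have "norm x <= norm x0 + \<bar>r\<bar>" using that norm_triangle_sub[of x x0] by (auto simp: dist_norm norm_minus_commute)
    then show ?thesis using Cauchy_Schwarz_ineq2[of x \<nu>] \<nu> by (auto simp: b_def)
  qed
  have rm[measurable]: "bm (rs (cball x0 r) g)" by (rule rs_measurable) auto
  have "(NNI x. ennreal ((norm (rs (cball x0 r) g x))^2))
    <= (NNI x. ennreal (b powr (- \<alpha>)) * (indicator {0<..} (x \<bullet> \<nu> - a) * ennreal ((norm (g x))^2 * (x \<bullet> \<nu> - a) powr \<alpha>)))"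
  proof (intro nn_integral_mono)
    fix x
    show "ennreal ((norm (rs (cball x0 r) g x))^2)
      <= ennreal (b powr (- \<alpha>)) * (indicator {0<..} (x \<bullet> \<nu> - a) * ennreal ((norm (g x))^2 * (x \<bullet> \<nu> - a) powr \<alpha>))"
    proof (cases "x \<in> cball x0 r & 0 < x \<bullet> \<nu> - a")
      case True
      have "1 = b powr (- \<alpha>) * b powr \<alpha>" using b by (simp add: powr_minus)
      also have "... <= b powr (- \<alpha>) * (x \<bullet> \<nu> - a) powr \<alpha>"
        using True tb[of x] \<alpha> by (intro mult_left_mono powr_mono2') auto
      finally have "(norm (g x))^2 * 1 <= (norm (g x))^2 * (b powr (- \<alpha>) * (x \<bullet> \<nu> - a) powr \<alpha>)" by (rule mult_left_mono) simp
      then have "ennreal ((norm (g x))^2) <= ennreal (b powr (- \<alpha>) * ((norm (g x))^2 * (x \<bullet> \<nu> - a) powr \<alpha>))"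
        by (intro ennreal_leI) (simp add: mult_ac)
      also have "... = ennreal (b powr (- \<alpha>)) * ennreal ((norm (g x))^2 * (x \<bullet> \<nu> - a) powr \<alpha>)" by (rule ennreal_mult) auto
      finally show ?thesis using True by (simp add: rs_def)
    next
      case False
      then have "rs (cball x0 r) g x = 0" using 0[of x] by (auto simp: rs_def indicator_def)
      then show ?thesis by simp
    qed
  qed
  also have "... = ennreal (b powr (- \<alpha>)) * wnn \<nu> a \<alpha> g" unfolding wnn_def by (rule nn_integral_cmult) measurable
  also have "... < \<infinity>" using fin by (simp add: ennreal_mult_less_top)
  finally have "integrable lborel (%x. (norm (rs (cball x0 r) g x))\<^sup>2)" by (intro integrableI_bounded) auto
  then show ?thesis by (simp add: l2_def)
qed

lemma half_space_eq: "half_space n a = {x. 0 < x \<bullet> (- n) - a}"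
  by (auto simp: half_space_def)

lemma test_inner_integrable:
  fixes P :: "real^'d::finite => real^'d^'m::finite"
  assumes P: "!!r. l2 (rs (cball x0 r) P)" and \<psi>: "!!\<beta>. test_fun \<Omega> (%y. \<psi> y $ \<beta>)"
  shows "integrable lborel (%x. P x \<bullet> gradv \<psi> x)"
  unfolding inner_matrix
proof (intro lebesgue_sum)
  fix \<alpha> :: 'm and i :: 'd
  have t: "test_fun \<Omega> (pd i (%y. \<psi> y $ \<alpha>))" by (rule test_fun_pd[OF \<psi>])
  have "bounded {x. pd i (%y. \<psi> y $ \<alpha>) x ~= 0}" using t unfolding test_fun_iff by blast
  then obtain r where "{x. pd i (%y. \<psi> y $ \<alpha>) x ~= 0} <= ball x0 r" using bounded_subset_ballD by blast
  then have r: "x \<in> cball x0 r" if "pd i (%y. \<psi> y $ \<alpha>) x ~= 0" for x using that ball_subset_cball[of x0 r] by blast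
  have "P x $ \<alpha> $ i * gradv \<psi> x $ \<alpha> $ i = rs (cball x0 r) P x $ \<alpha> $ i * pd i (%y. \<psi> y $ \<alpha>) x" for x
    using r[of x] by (cases "pd i (%y. \<psi> y $ \<alpha>) x = 0") (auto simp: gradv_def rs_def)
  then show "integrable lborel (%x. P x $ \<alpha> $ i * gradv \<psi> x $ \<alpha> $ i)"
    using l2_mult_integrable(1)[OF l2_entry[OF P[of r], of \<alpha> i] test_l2[OF t]] by simp
qed

lemma weighted_integral_version:
  fixes g g' :: "real^'d::finite => 'b::euclidean_space"
  assumes ae: "AE x in lborel. x \<in> half_space n a --> g x = g' x"
  shows "(\<integral>\<^sup>+x\<in>half_space n a. ennreal ((norm (g x))^2 * \<bar>a + x \<bullet> n\<bar> powr \<beta>) \<partial>lebesgue)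
    = wnn (- n) a \<beta> g'"
  unfolding nn_integral_completion wnn_def
proof (rule nn_integral_cong_AE, use ae in eventually_elim)
  fix x assume *: "x \<in> half_space n a --> g x = g' x"
  show "ennreal ((norm (g x))^2 * \<bar>a + x \<bullet> n\<bar> powr \<beta>) * indicator (half_space n a) x
    = indicator {0<..} (x \<bullet> (- n) - a) * ennreal ((norm (g' x))^2 * (x \<bullet> (- n) - a) powr \<beta>)"
  proof (cases "x \<in> half_space n a")
    case True
    then have e: "\<bar>a + x \<bullet> n\<bar> = x \<bullet> (- n) - a" by (simp add: half_space_def)
    have "0 < x \<bullet> (- n) - a" using True by (simp add: half_space_eq)
    then show ?thesis unfolding e using * True by (simp del: inner_minus_right)
  qed (simp add: half_space_eq)
qed

text \<open>A weak solution has \<open>f\<close> and \<open>h\<close> merely locally integrable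
  inside the half space; the square integrability of f and t h up to the boundary is drawn from the
  finiteness of the weighted integrals. The operator bound for the coefficients comes from the bound
  |M| for their entries.\<close>

lemma weak_solution_half_problem:
  fixes A :: "('d::finite, 'm::finite) coeff" and n x0 :: "real^'d" and u :: "real^'d => real^'m"
    and G f :: "real^'d => real^'d^'m" and h :: "real^'d => real^'m"
  assumes \<mu>: "0 < \<mu>" and \<sigma>: "0 < \<sigma>" and \<alpha>: "\<alpha> < 0" and step: "smooth_step c0 s s1 s2"
    and ell: "elliptic \<mu> A" and hol: "holder_bound \<sigma> M A" and n: "norm n = 1"
    and ws: "weak_solution (half_space n a) A u G f h" and zb: "zero_bdry (half_space n a) u G"
    and x0: "x0 \<in> frontier (half_space n a)"
    and fin: "(\<integral>\<^sup>+x\<in>half_space n a. ennreal ((norm (f x))^2 * \<bar>a + x \<bullet> n\<bar> powr \<alpha>) \<partial>lebesgue) < \<infinity>"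
      "(\<integral>\<^sup>+x\<in>half_space n a. ennreal ((norm (h x))^2 * \<bar>a + x \<bullet> n\<bar> powr (\<alpha> + 2)) \<partial>lebesgue) < \<infinity>"
  obtains U \<Gamma> F H where
    "half_problem c0 s s1 s2 \<mu> (\<bar>M\<bar> * (real CARD('d) * real CARD('m))^2) (- n) x0 a (%x. tens (A x)) U \<Gamma> F H"
    "AE x in lborel. x \<in> half_space n a --> G x = \<Gamma> x" "AE x in lborel. x \<in> half_space n a --> f x = F x"
    "AE x in lborel. x \<in> half_space n a --> h x = H x"
proof -
  \<comment> \<open>The inner normal: the half space is x \<bullet> \<nu> > a.\<close>
  define \<nu> where "\<nu> = - n"
  define \<Omega> where "\<Omega> = {x. 0 < x \<bullet> \<nu> - a}"
  have \<Omega>: "half_space n a = \<Omega>" by (simp add: \<Omega>_def \<nu>_def half_space_eq)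
  have \<nu>: "norm \<nu> = 1" using n by (simp add: \<nu>_def)
  have \<Omega>m[measurable]: "\<Omega> \<in> sets borel" unfolding \<Omega>_def by measurable
  have n0: "- n ~= 0" using n by auto
  have "half_space n a = {x. (- n) \<bullet> x > a}" by (auto simp: half_space_def inner_commute)
  then have x0n: "x0 \<bullet> \<nu> - a = 0" using x0 frontier_halfspace_gt[OF disjI1[OF n0], of a] by (simp add: \<nu>_def inner_commute)
  have L: "L2loc UNIV (%x. if x \<in> \<Omega> then u x else 0)" "L2loc UNIV (%x. if x \<in> \<Omega> then G x else 0)"
    and wg: "weak_gradient UNIV (%x. if x \<in> \<Omega> then u x else 0) (%x. if x \<in> \<Omega> then G x else 0)"
    using zb by (auto simp: zero_bdry_def H1loc_def \<Omega>)
  have L1: "L1loc \<Omega> f" "L1loc \<Omega> h" using ws by (auto simp: weak_solution_def \<Omega>)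
  obtain U where U: "bm U" "!!x. x \<notin> \<Omega> ==> U x = 0" "AE x in lborel. (if x \<in> \<Omega> then u x else 0) = U x"
    by (rule borel_version[OF L2loc_UNIV(1)[OF L(1)] \<Omega>m]) auto
  obtain \<Gamma> where \<Gamma>: "bm \<Gamma>" "!!x. x \<notin> \<Omega> ==> \<Gamma> x = 0" "AE x in lborel. (if x \<in> \<Omega> then G x else 0) = \<Gamma> x"
    by (rule borel_version[OF L2loc_UNIV(1)[OF L(2)] \<Omega>m]) auto
  obtain F where F: "bm F" "!!x. x \<notin> \<Omega> ==> F x = 0" "AE x in lborel. (if 0 < x \<bullet> \<nu> - a then f x else 0) = F x"
    by (rule borel_version[OF half_space_measurable[OF L1(1)[unfolded \<Omega>_def]] \<Omega>m]) (auto simp: \<Omega>_def)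
  obtain H where H: "bm H" "!!x. x \<notin> \<Omega> ==> H x = 0" "AE x in lborel. (if 0 < x \<bullet> \<nu> - a then h x else 0) = H x"
    by (rule borel_version[OF half_space_measurable[OF L1(2)[unfolded \<Omega>_def]] \<Omega>m]) (auto simp: \<Omega>_def)
  note [measurable] = U(1) \<Gamma>(1) F(1) H(1)
  have ae\<Gamma>: "AE x in lborel. x \<in> \<Omega> --> G x = \<Gamma> x" using \<Gamma>(3) by eventually_elim auto
  have aeF: "AE x in lborel. x \<in> \<Omega> --> f x = F x" using F(3) by eventually_elim (auto simp: \<Omega>_def)
  have aeH: "AE x in lborel. x \<in> \<Omega> --> h x = H x" using H(3) by eventually_elim (auto simp: \<Omega>_def)
  define \<Lambda> where "\<Lambda> = \<bar>M\<bar> * (real CARD('d) * real CARD('m))^2"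
  have Aentry: "\<bar>A x i j \<alpha> \<beta>\<bar> <= \<bar>M\<bar>" for x i j \<alpha> \<beta>
    using hol unfolding holder_bound_def by (meson abs_ge_self order_trans)
  have Am: "bm (%x. A x i j \<alpha> \<beta>)" for i j \<alpha> \<beta>
    by (rule borel_measurable_continuous_onI[OF holder_continuous[OF \<sigma>, of _ M]]) (use hol in \<open>auto simp: holder_bound_def\<close>)
  have Ashift: "bm (%x. A (x + z) i j \<alpha> \<beta>)" for i j \<alpha> \<beta> z
    by (rule measurable_compose[OF _ Am]) measurable
  have Bm: "bm (%x. tens (A (x + z)) (V x))" if "bm V" for z V
    by (rule tens_measurable[OF Ashift that])
  have bnd: "norm (tens (A y) \<Xi>) <= \<Lambda> * norm \<Xi>" for y \<Xi>
    unfolding \<Lambda>_def by (rule norm_tens_le[OF Aentry])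
  have \<Lambda>0: "0 <= \<Lambda>" by (simp add: \<Lambda>_def)
  have Ul: "l2 (rs (cball x0 r) U)" and \<Gamma>l: "l2 (rs (cball x0 r) \<Gamma>)" for r
    using L2loc_UNIV(2)[OF L(1) U(1,3)] L2loc_UNIV(2)[OF L(2) \<Gamma>(1,3)] by auto
  have Fl: "l2 (rs (cball x0 r) F)" for r
  proof (rule l2_ball_of_weighted[OF \<alpha> \<nu> F(1)])
    show "F x = 0" if "x \<bullet> \<nu> - a <= 0" for x using F(2)[of x] that by (auto simp: \<Omega>_def)
    show "wnn \<nu> a \<alpha> F < \<infinity>"
      using fin(1) weighted_integral_version[of n a f F \<alpha>] aeF by (simp add: \<Omega> \<nu>_def)
  qed
  have Hl: "l2 (rs (cball x0 r) (%x. (x \<bullet> \<nu> - a) *R H x))" for r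
  proof (rule l2_ball_of_weighted[OF \<alpha> \<nu>])
    show "(x \<bullet> \<nu> - a) *R H x = 0" if "x \<bullet> \<nu> - a <= 0" for x using H(2)[of x] that by (auto simp: \<Omega>_def)
    \<comment> \<open>t^2 t^\<alpha> = t^(\<alpha> + 2), so the criterion with weight t^\<alpha>
      applies to t H.\<close>
    have "wnn \<nu> a \<alpha> (%x. (x \<bullet> \<nu> - a) *R H x) = wnn \<nu> a (\<alpha> + 2) H"
      unfolding wnn_def by (intro nn_integral_cong) (auto simp: indicator_def powr_add power_mult_distrib mult_ac)
    then show "wnn \<nu> a \<alpha> (%x. (x \<bullet> \<nu> - a) *R H x) < \<infinity>"
      using fin(2) weighted_integral_version[of n a h H "\<alpha> + 2"] aeH by (simp add: \<Omega> \<nu>_def)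
  qed measurable
  have weak: "(LBINT x. U x $ \<beta> * pd i \<phi> x) = - (LBINT x. \<Gamma> x $ \<beta> $ i * \<phi> x)" if \<phi>: "test_fun UNIV \<phi>" for \<phi> \<beta> i
  proof -
    have [measurable]: "bm \<phi>" "bm (pd i \<phi>)"
      using test_fun_measurable[OF \<phi>] test_fun_measurable[OF test_fun_pd[OF \<phi>]] by auto
    have "(\<integral>x. (if x \<in> \<Omega> then u x else 0) $ \<beta> * pd i \<phi> x \<partial>lebesgue) = (LBINT x. U x $ \<beta> * pd i \<phi> x)"
      by (rule lebesgue_integral_version(1)) (measurable, use U(3) in eventually_elim, simp)
    moreover have "(\<integral>x. (if x \<in> \<Omega> then G x else 0) $ \<beta> $ i * \<phi> x \<partial>lebesgue) = (LBINT x. \<Gamma> x $ \<beta> $ i * \<phi> x)"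
      by (rule lebesgue_integral_version(1)) (measurable, use \<Gamma>(3) in eventually_elim, simp)
    moreover have "(\<integral>x. (if x \<in> \<Omega> then u x else 0) $ \<beta> * pd i \<phi> x \<partial>lebesgue)
      = - (\<integral>x. (if x \<in> \<Omega> then G x else 0) $ \<beta> $ i * \<phi> x \<partial>lebesgue)"
      using wg \<phi> unfolding weak_gradient_def by blast
    ultimately show ?thesis by simp
  qed
  have eqn: "(LBINT x. (tens (A x) (\<Gamma> x) + F x) \<bullet> gradv \<psi> x) = (LBINT x. H x \<bullet> \<psi> x)"
    if \<psi>: "!!\<beta>. test_fun {x. 0 < x \<bullet> \<nu> - a} (%y. \<psi> y $ \<beta>)" for \<psi> :: "real^'d => real^'m"
  proof -
    have \<psi>\<Omega>: "test_fun \<Omega> (%y. \<psi> y $ \<beta>)" for \<beta> using \<psi> by (simp add: \<Omega>_def)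
    \<comment> \<open>The test function vanishes outside the half space, so the unspecified values
      of \<open>G\<close>, \<open>f\<close> and \<open>h\<close> there have no influence on the
      integrals.\<close>
    have out: "pd i (%y. \<psi> y $ \<beta>) x = 0" "\<psi> x $ \<beta> = 0" if "x \<notin> \<Omega>" for x i \<beta>
    proof -
      have "x \<notin> closure {x. \<psi> x $ \<beta> ~= 0}" using \<psi>\<Omega>[of \<beta>] that by (auto simp: test_fun_iff)
      then show "pd i (%y. \<psi> y $ \<beta>) x = 0" "\<psi> x $ \<beta> = 0"
        using pd_eq_0_outside[of x "%y. \<psi> y $ \<beta>"] closure_subset[of "{x. \<psi> x $ \<beta> ~= 0}"] by auto
    qed
    have gm[measurable]: "bm (gradv \<psi>)"
      by (rule borel_measurable_matrixI) (simp add: gradv_def test_fun_measurable[OF test_fun_pd[OF \<psi>\<Omega>]])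
    have pm: "bm \<psi>"
    proof -
      have "bm (%x. \<psi> x \<bullet> b)" if "b \<in> Basis" for b
        using that test_fun_measurable[OF \<psi>\<Omega>] by (auto simp: Basis_vec_def inner_axis)
      then show ?thesis by (simp add: borel_measurable_euclidean_space[of \<psi>])
    qed
    have Tm[measurable]: "bm (%x. tens (A x) (\<Gamma> x))" using Bm[OF \<Gamma>(1), of 0] by simp
    let ?L1 = "%x. \<Sum>i\<in>UNIV. \<Sum>j\<in>UNIV. \<Sum>\<alpha>\<in>UNIV. \<Sum>\<beta>\<in>UNIV. A x i j \<alpha> \<beta> * G x $ \<beta> $ j * pd i (%y. \<psi> y $ \<alpha>) x"
    let ?L2 = "%x. \<Sum>i\<in>UNIV. \<Sum>\<alpha>\<in>UNIV. f x $ \<alpha> $ i * pd i (%y. \<psi> y $ \<alpha>) x"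
    let ?L3 = "%x. \<Sum>\<alpha>\<in>UNIV. h x $ \<alpha> * \<psi> x $ \<alpha>"
    have 1: "(\<integral>x. ?L1 x \<partial>lebesgue)
      = (LBINT x. tens (A x) (\<Gamma> x) \<bullet> gradv \<psi> x)"
    proof (rule lebesgue_integral_version(1))
      show "bm (%x. tens (A x) (\<Gamma> x) \<bullet> gradv \<psi> x)" by measurable
      show "AE x in lborel. ?L1 x
        = tens (A x) (\<Gamma> x) \<bullet> gradv \<psi> x"
        using ae\<Gamma>
      proof eventually_elim
        fix x assume *: "x \<in> \<Omega> --> G x = \<Gamma> x"
        show "?L1 x
          = tens (A x) (\<Gamma> x) \<bullet> gradv \<psi> x"
          unfolding tens_inner using * out(1)[of x] by (cases "x \<in> \<Omega>") (simp_all add: gradv_def)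
      qed
    qed
    have 2: "(\<integral>x. ?L2 x \<partial>lebesgue) = (LBINT x. F x \<bullet> gradv \<psi> x)"
    proof (rule lebesgue_integral_version(1))
      show "bm (%x. F x \<bullet> gradv \<psi> x)" by measurable
      show "AE x in lborel. ?L2 x = F x \<bullet> gradv \<psi> x"
        using aeF
      proof eventually_elim
        fix x assume *: "x \<in> \<Omega> --> f x = F x"
        have "?L2 x = (\<Sum>\<alpha>\<in>UNIV. \<Sum>i\<in>UNIV. f x $ \<alpha> $ i * pd i (%y. \<psi> y $ \<alpha>) x)"
          by (rule sum.swap)
        then show "?L2 x = F x \<bullet> gradv \<psi> x"
          unfolding inner_matrix using * out(1)[of x] by (cases "x \<in> \<Omega>") (simp_all add: gradv_def)
      qed
    qed
    have 3: "(\<integral>x. ?L3 x \<partial>lebesgue) = (LBINT x. H x \<bullet> \<psi> x)"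
    proof (rule lebesgue_integral_version(1))
      show "bm (%x. H x \<bullet> \<psi> x)" using pm by measurable
      show "AE x in lborel. ?L3 x = H x \<bullet> \<psi> x"
        using aeH
      proof eventually_elim
        fix x assume *: "x \<in> \<Omega> --> h x = H x"
        then show "?L3 x = H x \<bullet> \<psi> x"
          unfolding inner_vec_def using out(2)[of x] by (cases "x \<in> \<Omega>") simp_all
      qed
    qed
    have "l2 (rs (cball x0 r) (%x. tens (A x) (\<Gamma> x)))" for r
      by (rule nS_cmp(1)[OF \<Gamma>l, where C=\<Lambda>]) (use bnd \<Lambda>0 in auto)
    then have i1: "integrable lborel (%x. tens (A x) (\<Gamma> x) \<bullet> gradv \<psi> x)" by (rule test_inner_integrable[OF _ \<psi>])
    have i2: "integrable lborel (%x. F x \<bullet> gradv \<psi> x)" by (rule test_inner_integrable[OF Fl \<psi>])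
    have "(LBINT x. tens (A x) (\<Gamma> x) \<bullet> gradv \<psi> x) = - (LBINT x. F x \<bullet> gradv \<psi> x) + (LBINT x. H x \<bullet> \<psi> x)"
      using ws \<psi>\<Omega> unfolding weak_solution_def \<Omega> 1[symmetric] 2[symmetric] 3[symmetric] by blast
    then show ?thesis using i1 i2 by (simp add: inner_add_left)
  qed
  have "half_problem c0 s s1 s2 \<mu> \<Lambda> \<nu> x0 a (%x. tens (A x)) U \<Gamma> F H"
  proof (intro half_problem.intro half_problem_axioms.intro step)
    show "\<mu> * (norm \<Xi>)^2 <= tens (A y) \<Xi> \<bullet> \<Xi>" for \<Xi> y
    proof -
      have "\<mu> * (norm \<Xi>)^2 <= (\<Sum>i\<in>UNIV. \<Sum>j\<in>UNIV. \<Sum>\<alpha>\<in>UNIV. \<Sum>\<beta>\<in>UNIV. A y i j \<alpha> \<beta> * \<Xi> $ \<alpha> $ i * \<Xi> $ \<beta> $ j)"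
        using ell by (simp add: elliptic_def)
      also have "... = tens (A y) \<Xi> \<bullet> \<Xi>" unfolding tens_inner by (simp add: mult_ac)
      finally show ?thesis .
    qed
    show "U y = 0" "\<Gamma> y = 0" "F y = 0" "H y = 0" if "y \<bullet> \<nu> - a <= 0" for y
      using that U(2)[of y] \<Gamma>(2)[of y] F(2)[of y] H(2)[of y] by (auto simp: \<Omega>_def)
  qed (use \<mu> \<Lambda>0 \<nu> x0n bnd linear_tens Bm Ul \<Gamma>l Fl Hl weak eqn in auto)
  then show ?thesis
    by (rule that[of U \<Gamma> F H, folded \<nu>_def \<Lambda>_def, unfolded \<Omega>]) (fact ae\<Gamma> aeF aeH)+
qed

theorem theorem4p6:
  fixes \<mu> \<sigma> \<alpha> M :: real
  assumes "0 < \<mu>" and "0 < \<sigma>" and "\<sigma> < 1" and "-1 < \<alpha>" and "\<alpha> < 0"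
  shows "\<exists>C>0. \<forall>(A::('d::finite, 'm::finite) coeff) (n::real^'d) (a::real)
            (u::real^'d \<Rightarrow> real^'m) (G::real^'d \<Rightarrow> real^'d^'m)
            (f::real^'d \<Rightarrow> real^'d^'m) (h::real^'d \<Rightarrow> real^'m) (x0::real^'d).
     elliptic \<mu> A \<and> periodic_coeff A \<and> holder_bound \<sigma> M A \<and> norm n = 1 \<and>
     weak_solution (half_space n a) A u G f h \<and> zero_bdry (half_space n a) u G \<and>
     x0 \<in> frontier (half_space n a) \<and>
     ((\<lambda>R. ennreal (R powr \<alpha>) *
          (\<integral>\<^sup>+x\<in>ball x0 R \<inter> half_space n a. ennreal ((norm (G x))\<^sup>2) \<partial>lebesgue)) \<longlongrightarrow> 0) at_top
     \<longrightarrow>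
     (\<integral>\<^sup>+x\<in>half_space n a. ennreal ((norm (G x))\<^sup>2 * \<bar>a + x \<bullet> n\<bar> powr \<alpha>) \<partial>lebesgue)
       \<le> ennreal C * (\<integral>\<^sup>+x\<in>half_space n a. ennreal ((norm (f x))\<^sup>2 * \<bar>a + x \<bullet> n\<bar> powr \<alpha>) \<partial>lebesgue)
        + ennreal C * (\<integral>\<^sup>+x\<in>half_space n a. ennreal ((norm (h x))\<^sup>2 * \<bar>a + x \<bullet> n\<bar> powr (\<alpha> + 2)) \<partial>lebesgue)"
proof -
  define N where "N = (real CARD('d) * real CARD('m))^2"
  \<comment> \<open>The step is chosen before all data, so its bound \<open>c0\<close> is an
    absolute constant.\<close>
  obtain c0 s s1 s2 where step: "smooth_step c0 s s1 s2" using smooth_step_exists by blast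
  have nonneg: "0 <= \<bar>M\<bar> * N" by (simp add: N_def)
  obtain C where C: "0 < C" and est: "ALL (\<nu>::real^'d) x0 a (B::real^'d => real^'d^'m => real^'d^'m) U \<Gamma> F H.
    half_problem c0 s s1 s2 \<mu> (\<bar>M\<bar> * N) \<nu> x0 a B U \<Gamma> F H & regular_periodic (\<bar>M\<bar> * N) \<sigma> B &
    ((%R. ennreal (R powr \<alpha>) * bnn x0 R \<Gamma>) \<longlongrightarrow> 0) at_top -->
    wnn \<nu> a \<alpha> \<Gamma> <= ennreal C * (wnn \<nu> a \<alpha> F + wnn \<nu> a (\<alpha> + 2) H)"
  proof (rule exE[OF half_space_estimate[OF assms(1) nonneg step assms(4,5,2) nonneg, where 'd='d and 'm='m]], goal_cases)
    case (1 C)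
    show ?case by (rule 1(1)[OF conjunct1[OF 1(2)] conjunct2[OF 1(2)]])
  qed
  show ?thesis
  proof (rule exI, rule conjI[OF C], intro allI impI, elim conjE)
    fix A :: "('d, 'm) coeff" and n :: "real^'d" and a u G f h x0
    assume ell: "elliptic \<mu> A" and per: "periodic_coeff A" and hol: "holder_bound \<sigma> M A" and n: "norm n = 1"
      and ws: "weak_solution (half_space n a) A u G f h" and zb: "zero_bdry (half_space n a) u G"
      and x0: "x0 \<in> frontier (half_space n a)"
      and growth: "((%R. ennreal (R powr \<alpha>) *
          (\<integral>\<^sup>+x\<in>ball x0 R \<inter> half_space n a. ennreal ((norm (G x))^2) \<partial>lebesgue)) \<longlongrightarrow> 0) at_top"
    let ?f = "\<integral>\<^sup>+x\<in>half_space n a. ennreal ((norm (f x))^2 * \<bar>a + x \<bullet> n\<bar> powr \<alpha>) \<partial>lebesgue"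
    let ?h = "\<integral>\<^sup>+x\<in>half_space n a. ennreal ((norm (h x))^2 * \<bar>a + x \<bullet> n\<bar> powr (\<alpha> + 2)) \<partial>lebesgue"
    show "(\<integral>\<^sup>+x\<in>half_space n a. ennreal ((norm (G x))^2 * \<bar>a + x \<bullet> n\<bar> powr \<alpha>) \<partial>lebesgue) <= ennreal C * ?f + ennreal C * ?h"
    \<comment> \<open>If one of the data integrals is infinite, so is the right side, since C > 0.
      Otherwise their finiteness is what the passage to \<open>half_problem\<close>
      requires.\<close>
    proof (cases "?f < \<infinity> & ?h < \<infinity>")
      case False
      then have "ennreal C * ?f + ennreal C * ?h = \<infinity>" using C by (auto simp: less_top[symmetric] ennreal_mult_top)
      then show ?thesis by (simp only: infinity_ennreal_def top_greatest)
    next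
      case True
      obtain U \<Gamma> F H where hp: "half_problem c0 s s1 s2 \<mu> (\<bar>M\<bar> * N) (- n) x0 a (%x. tens (A x)) U \<Gamma> F H"
        and ae\<Gamma>: "AE x in lborel. x \<in> half_space n a --> G x = \<Gamma> x"
        and aeF: "AE x in lborel. x \<in> half_space n a --> f x = F x"
        and aeH: "AE x in lborel. x \<in> half_space n a --> h x = H x"
      proof (rule weak_solution_half_problem[OF assms(1,2,5) step ell hol n ws zb x0 conjunct1[OF True] conjunct2[OF True], folded N_def], goal_cases)
        case (1 U \<Gamma> F H)
        show ?case by (rule 1(1); fact 1)
      qed
      interpret half_problem c0 s s1 s2 \<mu> "\<bar>M\<bar> * N" "- n" x0 a "%x. tens (A x)" U \<Gamma> F H by fact
      have hol': "norm (tens (A (x + z)) \<Xi> - tens (A x) \<Xi>) <= (\<bar>M\<bar> * N) * norm z powr \<sigma> * norm \<Xi>" for x z \<Xi>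
      proof -
        have "\<bar>A (x + z) i j \<alpha> \<beta> - A x i j \<alpha> \<beta>\<bar> <= \<bar>M\<bar> * norm z powr \<sigma>" for i j \<alpha> \<beta>
        proof -
          have "\<bar>A (x + z) i j \<alpha> \<beta> - A x i j \<alpha> \<beta>\<bar> <= M * dist (x + z) x powr \<sigma>" using hol unfolding holder_bound_def by blast
          also have "... <= \<bar>M\<bar> * norm z powr \<sigma>" by (simp add: dist_norm mult_right_mono)
          finally show ?thesis .
        qed
        from norm_tens_le[OF this, where \<Xi>=\<Xi>] show ?thesis unfolding tens_diff N_def by (simp add: mult_ac)
      qed
      \<comment> \<open>\<Gamma> vanishes outside the half space, so the integral over the half ball
        is the one over the ball.\<close>
      have growth': "((%R. ennreal (R powr \<alpha>) * bnn x0 R \<Gamma>) \<longlongrightarrow> 0) at_top"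
      proof -
        have "(\<integral>\<^sup>+x\<in>ball x0 R \<inter> half_space n a. ennreal ((norm (G x))^2) \<partial>lebesgue)
          = bnn x0 R \<Gamma>" for R
          unfolding nn_integral_completion bnn_def
        proof (rule nn_integral_cong_AE, use ae\<Gamma> in eventually_elim)
          fix x assume *: "x \<in> half_space n a --> G x = \<Gamma> x"
          have "\<Gamma> x = 0" if "x \<notin> half_space n a" using zero(2)[of x] that by (simp add: half_space_eq)
          then show "ennreal ((norm (G x))^2) * indicator (ball x0 R \<inter> half_space n a) x
            = indicator (ball x0 R) x * ennreal ((norm (\<Gamma> x))^2)"
            using * by (cases "x \<in> half_space n a") (auto simp: indicator_def)
        qed
        then show ?thesis using growth by simp
      qed
      have "wnn (- n) a \<alpha> \<Gamma> <= ennreal C * (wnn (- n) a \<alpha> F + wnn (- n) a (\<alpha> + 2) H)"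
        by (rule est[THEN spec[where x="- n"], THEN spec[where x=x0], THEN spec[where x=a], THEN spec[where x="%x. tens (A x)"],
              THEN spec[where x=U], THEN spec[where x=\<Gamma>], THEN spec[where x=F], THEN spec[where x=H], THEN mp])
           (use hp hol' growth' per in \<open>auto simp: periodic_coeff_def regular_periodic_def\<close>)
      then show ?thesis
        unfolding weighted_integral_version[OF ae\<Gamma>] weighted_integral_version[OF aeF] weighted_integral_version[OF aeH]
        by (simp only: distrib_left)
    qed
  qed
qed

end
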